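(* Let $\Omega\in\overline{\mathfrak D}(\mathbb R^3)$ be a polyhedral domain and let $\mathbf B\in C^0(\overline\Omega)$ be a continuous magnetic field. Let $\mathbf t$ be a stratum of $\overline\Omega$ which is not a vertex, and let $\Lambda_{\mathbf t}:\mathbf t\ni x\mapsto E(\mathbf B_x,\Pi_x)$. For $x\in\partial\mathbf t$ set $$\Lambda_{\mathbf t}(x)=E(\mathbf B_x,\Pi_{\mathbb X}),$$ where $\Pi_{\mathbb X}$ is the tangent cone to $\Pi_x$ at any point of the stratum $\tilde{\mathbf t}$ of $\Pi_x$ which corresponds to $\mathbf t$ through the local diffeomorphism $\mathrm U^x$, i.e. $\mathrm U^x(\mathbf t\cap\mathcal U_x)=\tilde{\mathbf t}\cap\mathcal V_x$. Then this formula defines a continuous extension of the function $\Lambda_{\mathbf t}$ to $\overline{\mathbf t}$.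
   Context: **Cones and corner domains.** A cone in $\mathbb R^n$ is an open set $\Pi$ with $\rho x\in\Pi$ for all $\rho>0$, $x\in\Pi$; its section is $\Pi\cap\mathbb S^{n-1}$ ($\mathbb S^0=\{-1,1\}$), and the cone with section $\mathbb S^{n-1}$ is understood to be $\mathbb R^n$. Classes $\mathfrak P_n$ (cones of $\mathbb R^n$) and $\mathfrak D(M)$ (open subsets of $M$) are defined recursively. $\mathfrak P_0=\{\{0\}\}$; $\mathfrak D(\mathbb S^0)$ consists of all (nonempty) subsets of $\mathbb S^0$, so $\mathfrak P_1=\{\mathbb R,\mathbb R_+,\mathbb R_-\}$. For $n\ge1$: (1) $\Pi\in\mathfrak P_n$ iff its section belongs to $\mathfrak D(\mathbb S^{n-1})$; (2) for $M=\mathbb R^n$ or $\mathbb S^n$, a bounded connected open $\Omega\subset M$ belongs to $\mathfrak D(M)$ iff for every $x\in\overline\Omega$ there are a cone $\Pi_x\in\mathfrak P_n$ (the tangent cone at $x$) and a $C^\infty$ diffeomorphism $\mathrm U^x$ from a neighborhood $\mathcal U_x$ of $x$ in $M$ onto a neighborhood $\mathcal V_x$ of $0$ in $\mathbb R^n$ with $\mathrm U^x(\mathcal U_x\cap\Omega)=\mathcal V_x\cap\Pi_x$ and $\mathrm U^x(\mathcal U_x\cap\partial\Omega)=\mathcal V_x\cap\partial\Pi_x$, whose differential at $x$ is the identity (the tangent space of $M$ at $x$ being identified with $\mathbb R^n$). A cone in $\mathfrak P_n$ is polyhedral, written $\Pi\in\overline{\mathfrak P}_n$, if its boundary is contained in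 a finite union of hyperplanes; $\Omega\in\mathfrak D(M)$ is a polyhedral domain, written $\Omega\in\overline{\mathfrak D}(M)$, if all its tangent cones are polyhedral. **Strata.** If $\Pi\in\mathfrak P_3$ is the image under an orthogonal transformation of $\mathbb R^{3-d}\times\Gamma$ with $\Gamma\in\mathfrak P_d$ and $d$ minimal, $d$ is the dimension of the minimal reduced cone of $\Pi$ ($d=0$: full space; $d=1$: half-space; $d=2$: wedge; $d=3$: all others). The strata of $\overline\Omega$ are the connected components of the sets $\{x\in\overline\Omega:\ \Pi_x\text{ has reduced dimension }d\}$, $d=0,1,2,3$: the interior $\Omega$, the faces, the edges and the vertices. Strata of a cone $\Pi_x$, and tangent cones to $\Pi_x$ at points of $\overline{\Pi_x}$, are defined in the same way. **Energies.** $\mathbf B_x=\mathbf B(x)$ is the constant field frozen at $x$. For a constant field $\mathbf B$ and a cone $\Pi\in\overline{\mathfrak P}_3$, $E(\mathbf B,\Pi)$ is the bottom of the spectrum of the Neumann realization $H(\mathbf A,\Pi)$ of $(-i\nabla+\mathbf A)^2$ on $\Pi$ (the self-adjoint operator of the form $\int_\Pi|(-i\nabla+\mathbf A)f|^2$ with domain $\{f\in L^2(\Pi):(-i\nabla+\mathbf A)f\in L^2(\Pi)\}$), where $\mathbf A$ is any linear potential with $\operatorname{curl}\mathbf A=\mathbf B$ (the value does not depend on the choice).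
   Formalization: It is assumed that at each x in ∂t a single stratum t~ of Π_x with U^x(t∩U_x)=t~∩V_x exists; this fails for strata that meet a boundary point from several sides (e.g. the face of a revolved teardrop), where the formula is undefined and no continuous extension need exist. *)

theory Defs
  imports "HOL-Analysis.Analysis"
begin

section \<open>Smooth maps and diffeomorphisms\<close>

text \<open>\<open>Ck_on k f S\<close> is meant for open \<open>S\<close>: all iterated directional derivatives of \<open>f\<close> up to
  order \<open>k\<close> exist and are continuous on \<open>S\<close>.\<close>

primrec Ck_on :: "nat \<Rightarrow> ('a::real_normed_vector \<Rightarrow> 'b::real_normed_vector) \<Rightarrow> 'a set \<Rightarrow> bool" where
  "Ck_on 0 f S \<longleftrightarrow> continuous_on S f"
| "Ck_on (Suc k) f S \<longleftrightarrow>
     (\<forall>x\<in>S. f differentiable (at x)) \<and> (\<forall>v. Ck_on k (\<lambda>x. frechet_derivative f (at x) v) S)"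

definition smooth_on :: "('a::real_normed_vector \<Rightarrow> 'b::real_normed_vector) \<Rightarrow> 'a set \<Rightarrow> bool" where
  "smooth_on f S \<longleftrightarrow> (\<forall>k. Ck_on k f S)"

text \<open>For a subset \<open>S\<close> that need not be open (here: a relatively open piece of a sphere or of a
  linear subspace), smoothness means that \<open>f\<close> locally extends to a smooth map of the ambient space.\<close>

definition smooth_map :: "'a::real_normed_vector set \<Rightarrow> ('a \<Rightarrow> 'b::real_normed_vector) \<Rightarrow> bool" where
  "smooth_map S f \<longleftrightarrow>
     (\<forall>x\<in>S. \<exists>W g. open W \<and> x \<in> W \<and> smooth_on g W \<and> (\<forall>y\<in>S \<inter> W. g y = f y))"

definition diffeo :: "'a::real_normed_vector set \<Rightarrow> 'b::real_normed_vector set \<Rightarrow> ('a \<Rightarrow> 'b) \<Rightarrow> bool" where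
  "diffeo S T f \<longleftrightarrow> bij_betw f S T \<and> smooth_map S f \<and> smooth_map T (inv_into S f)"


section \<open>Corner cones and corner domains\<close>

text \<open>The copy of $\mathbb R^n$ is an \<open>n\<close>-dimensional linear subspace \<open>L\<close> of an ambient Euclidean
  space, and $\mathbb S^{n-1}$ is the unit sphere of \<open>L\<close>. The tangent space of that sphere at \<open>x\<close>
  is then the \<open>(n-1)\<close>-dimensional subspace of \<open>L\<close> orthogonal to \<open>x\<close>, so that no coordinates have
  to be chosen on it.\<close>

definition unit_sphere :: "'a::euclidean_space set \<Rightarrow> 'a set" where
  "unit_sphere L = L \<inter> sphere 0 1"

definition sphere_tangent :: "'a::euclidean_space set \<Rightarrow> 'a \<Rightarrow> 'a set" where
  "sphere_tangent L x = {v \<in> L. orthogonal x v}"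

text \<open>The boundary, relative to a closed set \<open>M\<close>, of a relatively open subset \<open>S\<close> of \<open>M\<close>.\<close>

definition bd :: "'a::topological_space set \<Rightarrow> 'a set" where
  "bd S = closure S - S"

text \<open>The last conjunct is the convention that the cone whose section is the whole sphere is
  \<open>L\<close> itself and not \<open>L - {0}\<close>.\<close>

definition open_cone :: "'a::euclidean_space set \<Rightarrow> 'a set \<Rightarrow> bool" where
  "open_cone L C \<longleftrightarrow> openin (top_of_set L) C \<and> (\<forall>\<rho>>0. \<forall>x\<in>C. \<rho> *\<^sub>R x \<in> C) \<and>
     (C \<inter> unit_sphere L = unit_sphere L \<longrightarrow> C = L)"

text \<open>\<open>tangent_chart M T \<Omega> x C U V \<phi>\<close>: the map \<open>\<phi>\<close> is a diffeomorphism from the neighbourhood \<open>U\<close>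
  of \<open>x\<close> in \<open>M\<close> onto the neighbourhood \<open>V\<close> of \<open>0\<close> in the tangent space \<open>T\<close> of \<open>M\<close> at \<open>x\<close>, which
  straightens \<open>\<Omega>\<close> to the cone \<open>C\<close>. Vectors \<open>y - x\<close> with \<open>y \<in> M\<close> are tangent to \<open>M\<close> at \<open>x\<close> up to
  \<open>o(|y - x|)\<close>, so the derivative within \<open>M\<close> being \<open>\<lambda>h. h\<close> says exactly that the differential
  of \<open>\<phi>\<close> at \<open>x\<close> is the identity of \<open>T\<close>.\<close>

definition tangent_chart ::
  "'a::euclidean_space set \<Rightarrow> 'a set \<Rightarrow> 'a set \<Rightarrow> 'a \<Rightarrow> 'a set \<Rightarrow> 'a set \<Rightarrow> 'a set \<Rightarrow> ('a \<Rightarrow> 'a) \<Rightarrow> bool"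
where
  "tangent_chart M T \<Omega> x C U V \<phi> \<longleftrightarrow>
     openin (top_of_set M) U \<and> x \<in> U \<and> openin (top_of_set T) V \<and> 0 \<in> V \<and>
     diffeo U V \<phi> \<and> \<phi> x = 0 \<and> (\<phi> has_derivative (\<lambda>h. h)) (at x within M) \<and>
     \<phi> ` (U \<inter> \<Omega>) = V \<inter> C \<and> \<phi> ` (U \<inter> bd \<Omega>) = V \<inter> bd C"

text \<open>The domains of \<open>M\<close> whose tangent cone at each \<open>x\<close> can be taken in the class \<open>\<C> (T x)\<close> of
  cones of the tangent space \<open>T x\<close>.\<close>

definition corner_domains_in ::
  "'a::euclidean_space set \<Rightarrow> ('a \<Rightarrow> 'a set) \<Rightarrow> ('a set \<Rightarrow> 'a set set) \<Rightarrow> 'a set set"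
where
  "corner_domains_in M T \<C> = {\<Omega>. \<Omega> \<noteq> {} \<and> bounded \<Omega> \<and> connected \<Omega> \<and> openin (top_of_set M) \<Omega> \<and>
     (\<forall>x\<in>closure \<Omega>. \<exists>C\<in>\<C> (T x). \<exists>U V \<phi>. tangent_chart M (T x) \<Omega> x C U V \<phi>)}"

text \<open>For \<open>dim L = n\<close>, \<open>corner_cones n L\<close> is the class $\mathfrak P_n$ on \<open>L\<close>; for
  \<open>dim L = n + 1\<close>, \<open>sphere_domains n L\<close> is $\mathfrak D(\mathbb S^n)$ on the unit sphere of \<open>L\<close>.\<close>

function corner_cones :: "nat \<Rightarrow> 'a::euclidean_space set \<Rightarrow> 'a set set"
  and sphere_domains :: "nat \<Rightarrow> 'a::euclidean_space set \<Rightarrow> 'a set set"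
where
  "corner_cones 0 L = {{0}}"
| "corner_cones (Suc n) L = {C. open_cone L C \<and> C \<inter> unit_sphere L \<in> sphere_domains n L}"
| "sphere_domains 0 L = {S. S \<subseteq> unit_sphere L \<and> S \<noteq> {}}"
| "sphere_domains (Suc n) L =
     corner_domains_in (unit_sphere L) (sphere_tangent L) (\<lambda>K. corner_cones (Suc n) K)"
  by pat_completeness auto
termination
  by (relation "Wellfounded.measure (\<lambda>s. case s of Inl (n, _) \<Rightarrow> 2 * n | Inr (n, _) \<Rightarrow> 2 * n + 1)") auto

text \<open>From here on $M$ is the whole space.\<close>

definition corner_domain :: "'a::euclidean_space set \<Rightarrow> bool" where
  "corner_domain \<Omega> \<longleftrightarrow> \<Omega> \<in> corner_domains_in UNIV (\<lambda>_. UNIV) (corner_cones DIM('a))"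

definition is_tangent_cone :: "'a::euclidean_space set \<Rightarrow> 'a \<Rightarrow> 'a set \<Rightarrow> bool" where
  "is_tangent_cone \<Omega> x C \<longleftrightarrow>
     C \<in> corner_cones DIM('a) UNIV \<and> (\<exists>U V \<phi>. tangent_chart UNIV UNIV \<Omega> x C U V \<phi>)"

text \<open>The set \<open>\<Omega>\<close> is a corner domain or itself a cone. Tangent cones are unique, see
  \<open>is_tangent_cone_unique\<close> below.\<close>

definition tangent_cone :: "'a::euclidean_space set \<Rightarrow> 'a \<Rightarrow> 'a set" where
  "tangent_cone \<Omega> x = (THE C. is_tangent_cone \<Omega> x C)"

lemma smooth_map_continuous_at:
  assumes "smooth_map S f" "open S" "x \<in> S"
  shows "continuous (at x) f"
proof -
  obtain W g where W: "open W" "x \<in> W" "smooth_on g W" "\<forall>y\<in>S \<inter> W. g y = f y"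
    using assms unfolding smooth_map_def by blast
  have "Ck_on 0 g W" using W(3) unfolding smooth_on_def by blast
  then have "continuous_on (S \<inter> W) g" by (auto intro: continuous_on_subset)
  then have "continuous_on (S \<inter> W) f" using W(4) continuous_on_cong by (metis (no_types, lifting))
  then show ?thesis
    using assms W continuous_on_eq_continuous_at[of "S \<inter> W" f] by (auto simp: open_Int)
qed

lemma tangent_cone_subset_closure:
  fixes \<phi> \<psi> :: "'a::euclidean_space \<Rightarrow> 'a"
  assumes U: "open U" "x \<in> U" and V: "open V" "0 \<in> V" and d: "diffeo U V \<phi>" "\<phi> x = 0"
    and der: "(\<phi> has_derivative (\<lambda>h. h)) (at x)"
    and im: "\<phi> ` (U \<inter> Z) = V \<inter> S"
    and U': "open U'" "x \<in> U'" and d': "\<psi> x = 0"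
    and der': "(\<psi> has_derivative (\<lambda>h. h)) (at x)"
    and im': "\<psi> ` (U' \<inter> Z) = V' \<inter> S'"
    and cone: "\<forall>\<rho>>0. \<forall>y\<in>S. \<rho> *\<^sub>R y \<in> S"
    and cone': "\<forall>\<rho>>0. \<forall>y\<in>S'. \<rho> *\<^sub>R y \<in> S'"
  shows "S \<subseteq> closure S'"
proof
  fix v assume v: "v \<in> S"
  define g where "g = inv_into U \<phi>"
  have bij: "bij_betw \<phi> U V" and sg: "smooth_map V g"
    using d unfolding diffeo_def g_def by auto
  have g0: "g 0 = x"
    using bij U(2) d(2) unfolding g_def bij_betw_def by (metis inv_into_f_f)
  have fg: "\<phi> (g z) = z" if "z \<in> V" for z
    using bij that unfolding g_def by (simp add: bij_betw_inv_into_right)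
  have cg: "continuous (at 0) g" by (rule smooth_map_continuous_at[OF sg V])
  have dg: "(g has_derivative (\<lambda>h. h)) (at 0)"
    by (rule has_derivative_inverse_basic[where f = \<phi> and f' = "\<lambda>h. h" and T = V])
      (use der g0 cg V fg in \<open>auto simp: bounded_linear_ident comp_def id_def\<close>)
  have "(\<psi> has_derivative (\<lambda>h. h)) (at (g 0))" using der' g0 by simp
  from diff_chain_at[OF dg this] have dc: "((\<psi> \<circ> g) has_derivative (\<lambda>h. h)) (at 0)"
    by (simp add: comp_def)
  have dray: "((\<lambda>t::real. t *\<^sub>R v) has_derivative (\<lambda>t. t *\<^sub>R v)) (at 0)"
    by (auto intro!: derivative_eq_intros)
  have "((\<psi> \<circ> g) has_derivative (\<lambda>h. h)) (at ((\<lambda>t::real. t *\<^sub>R v) 0))" using dc by simp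
  from diff_chain_at[OF dray this]
  have "((\<lambda>t. \<psi> (g (t *\<^sub>R v))) has_vector_derivative v) (at 0)"
    by (simp add: comp_def has_vector_derivative_def)
  then have "((\<lambda>t. \<psi> (g (t *\<^sub>R v))) has_derivative (\<lambda>t. t *\<^sub>R v)) (at_right 0)"
    unfolding has_vector_derivative_def by (rule has_derivative_at_withinI)
  then have "((\<lambda>t::real. (1 / norm (t - 0)) *\<^sub>R
      (\<psi> (g (t *\<^sub>R v)) - (\<psi> (g (0 *\<^sub>R v)) + (t - 0) *\<^sub>R v))) \<longlongrightarrow> 0) (at_right 0)"
    unfolding has_derivative_within by (rule conjunct2)
  moreover have "\<forall>\<^sub>F t::real in at_right 0. (1 / norm (t - 0)) *\<^sub>R
      (\<psi> (g (t *\<^sub>R v)) - (\<psi> (g (0 *\<^sub>R v)) + (t - 0) *\<^sub>R v)) = (1 / t) *\<^sub>R \<psi> (g (t *\<^sub>R v)) - v"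
    using eventually_at_right_less[of "0::real"]
    by eventually_elim (simp add: g0 d' scaleR_diff_right)
  ultimately have "((\<lambda>t. (1 / t) *\<^sub>R \<psi> (g (t *\<^sub>R v)) - v) \<longlongrightarrow> 0) (at_right 0)"
    by (rule Lim_transform_eventually)
  then have lim: "((\<lambda>t. (1 / t) *\<^sub>R \<psi> (g (t *\<^sub>R v))) \<longlongrightarrow> v) (at_right 0)"
    by (rule LIM_zero_cancel)
  have "((\<lambda>t::real. t *\<^sub>R v) \<longlongrightarrow> 0) (at_right 0)"
    by (auto intro!: tendsto_eq_intros)
  then have inV: "\<forall>\<^sub>F t in at_right 0. t *\<^sub>R v \<in> V" using V by (rule topological_tendstoD)
  have "((\<lambda>t::real. g (t *\<^sub>R v)) \<longlongrightarrow> x) (at_right 0)"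
    using isCont_tendsto_compose[OF cg \<open>((\<lambda>t::real. t *\<^sub>R v) \<longlongrightarrow> 0) (at_right 0)\<close>] g0 by simp
  then have inU': "\<forall>\<^sub>F t in at_right 0. g (t *\<^sub>R v) \<in> U'" using U' by (rule topological_tendstoD)
  have pos: "\<forall>\<^sub>F t::real in at_right 0. t > 0" by (simp add: eventually_at_right_less)
  have "\<forall>\<^sub>F t in at_right 0. (1 / t) *\<^sub>R \<psi> (g (t *\<^sub>R v)) \<in> closure S'"
    using inV inU' pos
  proof eventually_elim
    case (elim t)
    then have "t *\<^sub>R v \<in> V \<inter> S" using cone v by auto
    then obtain y where y: "y \<in> U \<inter> Z" "\<phi> y = t *\<^sub>R v" using im by (metis (no_types) imageE)
    then have "g (t *\<^sub>R v) = y"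
      using bij unfolding g_def bij_betw_def by (metis IntD1 inv_into_f_f)
    then have "\<psi> (g (t *\<^sub>R v)) \<in> S'" using im' y elim by auto
    then show ?case using cone' elim closure_subset by (metis subsetD zero_less_divide_1_iff)
  qed
  then show "v \<in> closure S'"
    using Lim_in_closed_set[OF closed_closure _ _ lim] trivial_limit_at_right_real by blast
qed

lemma closure_scale:
  fixes S :: "'a::real_normed_vector set"
  assumes "\<forall>\<rho>>0. \<forall>y\<in>S. \<rho> *\<^sub>R y \<in> S" "\<rho> > 0" "y \<in> closure S"
  shows "\<rho> *\<^sub>R y \<in> closure S"
proof -
  have "(\<lambda>y. \<rho> *\<^sub>R y) ` closure S = closure ((\<lambda>y. \<rho> *\<^sub>R y) ` S)"
    by (rule closure_scaleR)
  also have "\<dots> \<subseteq> closure S" using assms(1,2) by (intro closure_mono) auto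
  finally have "(\<lambda>y. \<rho> *\<^sub>R y) ` closure S \<subseteq> closure S" .
  then show ?thesis using assms(3) by blast
qed

lemma bd_cone:
  fixes D :: "'a::real_normed_vector set"
  assumes s: "\<forall>\<rho>>0. \<forall>y\<in>D. \<rho> *\<^sub>R y \<in> D"
  shows "\<forall>\<rho>>0. \<forall>y\<in>bd D. \<rho> *\<^sub>R y \<in> bd D"
proof (intro allI impI ballI)
  fix \<rho> :: real and y assume \<rho>: "\<rho> > 0" and "y \<in> bd D"
  then have y: "y \<in> closure D" "y \<notin> D" unfolding bd_def by blast+
  have "\<rho> *\<^sub>R y \<in> closure D" by (rule closure_scale[OF s \<rho> y(1)])
  moreover have "\<rho> *\<^sub>R y \<notin> D"
  proof
    assume "\<rho> *\<^sub>R y \<in> D"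
    then have "(1 / \<rho>) *\<^sub>R \<rho> *\<^sub>R y \<in> D" using s \<rho> by (metis zero_less_divide_1_iff)
    then show False using y(2) \<rho> by simp
  qed
  ultimately show "\<rho> *\<^sub>R y \<in> bd D" unfolding bd_def by blast
qed

lemma is_tangent_cone_cone:
  fixes C :: "'a::euclidean_space set"
  assumes "is_tangent_cone \<Omega> x C"
  shows "open C" "\<forall>\<rho>>0. \<forall>y\<in>C. \<rho> *\<^sub>R y \<in> C"
proof -
  obtain n where n: "DIM('a) = Suc n" using DIM_positive gr0_implies_Suc by blast
  have "C \<in> corner_cones (Suc n) UNIV"
    using assms unfolding is_tangent_cone_def n by (rule conjunct1)
  then have "open_cone UNIV C" by simp
  then show "open C" "\<forall>\<rho>>0. \<forall>y\<in>C. \<rho> *\<^sub>R y \<in> C"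
    unfolding open_cone_def by auto
qed

lemma is_tangent_cone_subset:
  assumes t: "is_tangent_cone \<Omega> x D" and t': "is_tangent_cone \<Omega> x D'"
  shows "D \<subseteq> D'"
proof -
  obtain U V \<phi> where "tangent_chart UNIV UNIV \<Omega> x D U V \<phi>"
    using t unfolding is_tangent_cone_def by blast
  then have c: "open U" "x \<in> U" "open V" "0 \<in> V" "diffeo U V \<phi>" "\<phi> x = 0"
    "(\<phi> has_derivative (\<lambda>h. h)) (at x)" "\<phi> ` (U \<inter> \<Omega>) = V \<inter> D" "\<phi> ` (U \<inter> bd \<Omega>) = V \<inter> bd D"
    unfolding tangent_chart_def by simp_all
  obtain U' V' \<psi> where "tangent_chart UNIV UNIV \<Omega> x D' U' V' \<psi>"
    using t' unfolding is_tangent_cone_def by blast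
  then have c': "open U'" "x \<in> U'" "open V'" "0 \<in> V'" "diffeo U' V' \<psi>" "\<psi> x = 0"
    "(\<psi> has_derivative (\<lambda>h. h)) (at x)" "\<psi> ` (U' \<inter> \<Omega>) = V' \<inter> D'" "\<psi> ` (U' \<inter> bd \<Omega>) = V' \<inter> bd D'"
    unfolding tangent_chart_def by simp_all
  note s = is_tangent_cone_cone(2)[OF t] and s' = is_tangent_cone_cone(2)[OF t']
  have "D \<subseteq> closure D'"
    by (rule tangent_cone_subset_closure[OF c(1-8) c'(1,2,6,7,8) s s'])
  moreover have "bd D' \<subseteq> closure (bd D)"
    by (rule tangent_cone_subset_closure[OF c'(1-7,9) c(1,2,6,7,9) bd_cone[OF s'] bd_cone[OF s]])
  moreover have "closed (bd D)"
    unfolding bd_def using is_tangent_cone_cone(1)[OF t] by (intro closed_Diff closed_closure)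
  ultimately show ?thesis unfolding bd_def[of D'] by (auto simp: bd_def)
qed

lemma is_tangent_cone_unique:
  "is_tangent_cone \<Omega> x C \<Longrightarrow> is_tangent_cone \<Omega> x C' \<Longrightarrow> C = C'"
  by (intro equalityI is_tangent_cone_subset)

lemma tangent_cone_eqI: "is_tangent_cone \<Omega> x C \<Longrightarrow> tangent_cone \<Omega> x = C"
  unfolding tangent_cone_def by (rule the_equality) (assumption, erule is_tangent_cone_unique)

definition polyhedral_cone :: "'a::euclidean_space set \<Rightarrow> bool" where
  "polyhedral_cone C \<longleftrightarrow> C \<in> corner_cones DIM('a) UNIV \<and>
     (\<exists>\<H>. finite \<H> \<and> (\<forall>H\<in>\<H>. \<exists>a b. a \<noteq> 0 \<and> H = {y. a \<bullet> y = b}) \<and> bd C \<subseteq> \<Union>\<H>)"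

definition polyhedral_domain :: "'a::euclidean_space set \<Rightarrow> bool" where
  "polyhedral_domain \<Omega> \<longleftrightarrow> corner_domain \<Omega> \<and>
     (\<forall>x\<in>closure \<Omega>. \<forall>C. is_tangent_cone \<Omega> x C \<longrightarrow> polyhedral_cone C)"


section \<open>Strata\<close>

text \<open>The product of \<open>\<Gamma> \<subseteq> L\<close> with the orthogonal complement of \<open>L\<close> is written as a sum set.\<close>

definition reduced_dim :: "'a::euclidean_space set \<Rightarrow> nat" where
  "reduced_dim C = (LEAST d. \<exists>(L :: 'a set) \<Gamma> (Q :: 'a \<Rightarrow> 'a). subspace L \<and> dim L = d \<and> \<Gamma> \<in> corner_cones d L \<and>
     orthogonal_transformation Q \<and>
     C = Q ` {y + z | y z. y \<in> orthogonal_comp L \<and> z \<in> \<Gamma>})"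

definition strata_of_dim :: "nat \<Rightarrow> 'a::euclidean_space set \<Rightarrow> 'a set set" where
  "strata_of_dim d \<Omega> = components {x \<in> closure \<Omega>. reduced_dim (tangent_cone \<Omega> x) = d}"

definition strata :: "'a::euclidean_space set \<Rightarrow> 'a set set" where
  "strata \<Omega> = (\<Union>d. strata_of_dim d \<Omega>)"

definition vertices :: "'a::euclidean_space set \<Rightarrow> 'a set set" where
  "vertices \<Omega> = strata_of_dim DIM('a) \<Omega>"


section \<open>The Neumann magnetic Laplacian\<close>

text \<open>Elements of $L^2(\Omega)$ are represented by functions; equality is equality almost everywhere
  on \<open>\<Omega>\<close>.\<close>

definition L2 :: "'a::euclidean_space set \<Rightarrow> ('a \<Rightarrow> 'b::euclidean_space) set" where
  "L2 \<Omega> = {f \<in> borel_measurable (lebesgue_on \<Omega>). integrable (lebesgue_on \<Omega>) (\<lambda>x. (norm (f x))\<^sup>2)}"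

definition test_functions :: "(real^3) set \<Rightarrow> (real^3 \<Rightarrow> complex) set" where
  "test_functions \<Omega> = {\<psi>. smooth_on \<psi> UNIV \<and>
     compact (closure {x. \<psi> x \<noteq> 0}) \<and> closure {x. \<psi> x \<noteq> 0} \<subseteq> \<Omega>}"

definition partial_deriv :: "3 \<Rightarrow> (real^3 \<Rightarrow> 'b::real_normed_vector) \<Rightarrow> real^3 \<Rightarrow> 'b" where
  "partial_deriv j f x = frechet_derivative f (at x) (axis j 1)"

text \<open>\<open>g\<close> is $(-i\nabla + A) f$ in the sense of distributions on \<open>\<Omega>\<close>.\<close>

definition magnetic_gradient ::
  "(real^3 \<Rightarrow> real^3) \<Rightarrow> (real^3) set \<Rightarrow> (real^3 \<Rightarrow> complex) \<Rightarrow> (real^3 \<Rightarrow> complex^3) \<Rightarrow> bool"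
where
  "magnetic_gradient A \<Omega> f g \<longleftrightarrow> (\<forall>\<psi>\<in>test_functions \<Omega>. \<forall>j.
     (LINT x|lebesgue_on \<Omega>. g x $ j * \<psi> x) =
     (LINT x|lebesgue_on \<Omega>. f x * (\<i> * partial_deriv j \<psi> x + of_real (A x $ j) * \<psi> x)))"

text \<open>\<open>neumann_laplacian A \<Omega> f w\<close>: \<open>f\<close> belongs to the domain of the self-adjoint operator
  associated with the form $\int_\Omega |(-i\nabla + A) f|^2$, and this operator maps \<open>f\<close> to \<open>w\<close>.\<close>

definition neumann_laplacian ::
  "(real^3 \<Rightarrow> real^3) \<Rightarrow> (real^3) set \<Rightarrow> (real^3 \<Rightarrow> complex) \<Rightarrow> (real^3 \<Rightarrow> complex) \<Rightarrow> bool"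
where
  "neumann_laplacian A \<Omega> f w \<longleftrightarrow> f \<in> L2 \<Omega> \<and> w \<in> L2 \<Omega> \<and>
     (\<exists>g\<in>L2 \<Omega>. magnetic_gradient A \<Omega> f g \<and>
       (\<forall>v\<in>L2 \<Omega>. \<forall>h\<in>L2 \<Omega>. magnetic_gradient A \<Omega> v h \<longrightarrow>
         (LINT x|lebesgue_on \<Omega>. (\<Sum>j\<in>UNIV. g x $ j * cnj (h x $ j))) =
         (LINT x|lebesgue_on \<Omega>. w x * cnj (v x))))"

text \<open>The two conjuncts below say that \<open>H - z\<close> is onto $L^2(\Omega)$, and that it is injective with
  bounded inverse; both are expressed through \<open>H f = w + z f\<close>.\<close>

definition neumann_resolvent_set :: "(real^3 \<Rightarrow> real^3) \<Rightarrow> (real^3) set \<Rightarrow> complex set" where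
  "neumann_resolvent_set A \<Omega> = {z.
     (\<forall>w\<in>L2 \<Omega>. \<exists>f. neumann_laplacian A \<Omega> f (\<lambda>x. w x + z * f x)) \<and>
     (\<exists>c. \<forall>f w. neumann_laplacian A \<Omega> f (\<lambda>x. w x + z * f x) \<longrightarrow>
        (LINT x|lebesgue_on \<Omega>. (norm (f x))\<^sup>2) \<le> c * (LINT x|lebesgue_on \<Omega>. (norm (w x))\<^sup>2))}"

definition neumann_spectrum :: "(real^3 \<Rightarrow> real^3) \<Rightarrow> (real^3) set \<Rightarrow> complex set" where
  "neumann_spectrum A \<Omega> = - neumann_resolvent_set A \<Omega>"

definition curl :: "(real^3 \<Rightarrow> real^3) \<Rightarrow> real^3 \<Rightarrow> real^3" where
  "curl A x = vector
     [partial_deriv 2 A x $ 3 - partial_deriv 3 A x $ 2,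
      partial_deriv 3 A x $ 1 - partial_deriv 1 A x $ 3,
      partial_deriv 1 A x $ 2 - partial_deriv 2 A x $ 1]"

text \<open>Any choice of linear potential gives the same value, by gauge invariance.\<close>

definition linear_potential :: "real^3 \<Rightarrow> real^3 \<Rightarrow> real^3" where
  "linear_potential B = (SOME A. linear A \<and> (\<forall>x. curl A x = B))"

definition energy :: "real^3 \<Rightarrow> (real^3) set \<Rightarrow> real" where
  "energy B \<Omega> = Inf {l. complex_of_real l \<in> neumann_spectrum (linear_potential B) \<Omega>}"

end

theory Submission
  imports Defs "HOL-Probability.Distributions"
begin

text \<open>
The energy is the infimum of the Rayleigh quotient of the form, and it depends continuously on the
field and on the domain when the domain is moved by linear maps close to the identity. Indeed, after
the change of variables only the potential and the metric are perturbed. The difference of the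
potentials grows linearly, but Gaussian windows of width \<open>\<epsilon>\<close> to the power \<open>-1/2\<close> together with a constant
gauge in each window bound its effect by a multiple of \<open>\<epsilon>\<close>, where \<open>\<epsilon>\<close> is the size of the perturbation of
the field. This works for every open set and needs no information on the cone.

Let \<open>x\<close> be in the closure of the stratum \<open>t\<close>, with tangent cone \<open>P\<close> and chart \<open>\<phi>\<close>. For \<open>y\<close> near \<open>x\<close> the tangent cone
of \<open>\<Omega>\<close> at \<open>y\<close> is the image of the tangent cone of \<open>P\<close> at \<open>\<phi> y\<close> under the inverse of the differential of \<open>\<phi>\<close> at \<open>y\<close>,
which tends to the identity. A polyhedral cone \<open>P\<close> coincides near each point \<open>X\<close> with a translate of a cone, and
moving \<open>X\<close> transversally to the lineality space of that cone lowers the reduced dimension. So the tangent cone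
of \<open>P\<close> at \<open>\<phi> y\<close> does not depend on \<open>y \<in> t\<close>, and the energy converges along \<open>t\<close> to the asserted value.
\<close>

section \<open>Iterated derivatives\<close>

text \<open>The energy is defined through resolvent sets. So two facts precede any estimate: below
  the best lower bound of the form the shifted equation is solved by minimisation, and at that bound
  a bounded inverse would contradict Cauchy-Schwarz. A Gaussian lies in the form domain for every
  linear potential, so the best lower bound is finite.

  The error is of order \<epsilon> because the window gradient and the remaining potential are both
  of size \<epsilon> |x - c|, while |x - c| is about \<epsilon>^(-1/2) inside a window.

  Corner cones are defined recursively through charts of spherical sections. To evaluate
  \<open>tangent_cone\<close> on a cone, its germ at a point must be shown to be a corner cone
  again; central projection of the sphere onto a tangent plane reduces this to flat slices.

  Reduced dimensions are compared only for lineality spaces of dimension at least 2, where the cone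
  is a half-space or the whole space: the cone already contains one line, and a transversal
  displacement adds another. At points of \<open>t\<close> that first line exists because
  \<open>t\<close> is not a vertex.\<close>

lemma Ck_on_SucD: "Ck_on (Suc k) f S \<Longrightarrow> Ck_on k f S"
proof (induction k arbitrary: f)
  case 0
  then have "\<forall>x\<in>S. f differentiable (at x)" by simp
  then have "continuous_on S f"
    by (intro continuous_at_imp_continuous_on ballI differentiable_imp_continuous_within) blast
  then show ?case by simp
next
  case (Suc k)
  have d: "\<forall>x\<in>S. f differentiable (at x)" and D: "\<And>v. Ck_on (Suc k) (\<lambda>x. frechet_derivative f (at x) v) S"
    using Suc.prems unfolding Ck_on.simps(2)[of "Suc k"] by blast+
  show ?case unfolding Ck_on.simps(2)[of k] using d Suc.IH[OF D] by blast
qed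

lemma Ck_on_SucI:
  assumes "\<And>x. x \<in> S \<Longrightarrow> (f has_derivative D x) (at x)" "\<And>v. Ck_on k (\<lambda>x. frechet_derivative f (at x) v) S"
  shows "Ck_on (Suc k) f S"
  using assms by (auto simp: differentiable_def)

text \<open>Openness of \<open>S\<close> makes the values on \<open>S\<close> determine the
  derivatives there, so the exchange of \<open>f\<close> and \<open>g\<close> survives every
  order.\<close>

lemma Ck_on_cong:
  assumes "open S" "\<And>x. x \<in> S \<Longrightarrow> f x = g x" "Ck_on k f S"
  shows "Ck_on k g S"
  using assms(2,3)
proof (induction k arbitrary: f g)
  case 0
  then show ?case using continuous_on_cong[of S S f g] by simp
next
  case (Suc k)
  have d: "(f has_derivative frechet_derivative f (at x)) (at x)" if "x \<in> S" for x
    using Suc.prems(2) that by (simp add: frechet_derivative_works)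
  have dg: "(g has_derivative frechet_derivative f (at x)) (at x)" if "x \<in> S" for x
    by (rule has_derivative_transform_within_open[OF d[OF that] assms(1) that]) (rule Suc.prems(1))
  have e: "frechet_derivative f (at x) = frechet_derivative g (at x)" if "x \<in> S" for x
    by (rule frechet_derivative_at[OF dg[OF that]])
  show ?case
  proof (rule Ck_on_SucI[OF dg])
    fix v show "Ck_on k (\<lambda>x. frechet_derivative g (at x) v) S"
      by (rule Suc.IH[where f = "\<lambda>x. frechet_derivative f (at x) v"]) (use Suc.prems(2) e in auto)
  qed
qed

text \<open>Uniqueness of the derivative lets an explicit formula \<open>D\<close> stand for
  \<open>frechet_derivative\<close>. The closure properties below take \<open>D\<close> from the
  usual differentiation rule and recurse on it.\<close>

lemma Ck_on_SucI':
  assumes "open S" "\<And>x. x \<in> S \<Longrightarrow> (f has_derivative D x) (at x)" "\<And>v. Ck_on k (\<lambda>x. D x v) S"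
  shows "Ck_on (Suc k) f S"
proof (rule Ck_on_SucI[OF assms(2)])
  fix v show "Ck_on k (\<lambda>x. frechet_derivative f (at x) v) S"
    by (rule Ck_on_cong[OF assms(1) _ assms(3)[of v]]) (metis assms(2) frechet_derivative_at)
qed

lemma Ck_on_SucE:
  assumes "Ck_on (Suc k) f S"
  obtains D where "\<And>x. x \<in> S \<Longrightarrow> (f has_derivative D x) (at x)" "\<And>v. Ck_on k (\<lambda>x. D x v) S"
  by (rule that[of "\<lambda>x. frechet_derivative f (at x)"]) (use assms in \<open>auto simp: frechet_derivative_works\<close>)

lemma Ck_on_const: "open S \<Longrightarrow> Ck_on k (\<lambda>x. c) S"
proof (induction k arbitrary: c)
  case (Suc k)
  show ?case by (rule Ck_on_SucI'[OF Suc.prems has_derivative_const Suc.IH[OF Suc.prems]])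
qed (simp add: continuous_on_const)

lemma Ck_on_bounded_linear:
  assumes "bounded_linear T" "open S"
  shows "Ck_on k T S"
proof (cases k)
  case (Suc n)
  show ?thesis unfolding Suc
    by (rule Ck_on_SucI'[OF assms(2) bounded_linear_imp_has_derivative[OF assms(1)] Ck_on_const[OF assms(2)]])
qed (use assms in \<open>simp add: linear_continuous_on\<close>)

lemma Ck_on_add:
  assumes S: "open S"
  shows "Ck_on k f S \<Longrightarrow> Ck_on k g S \<Longrightarrow> Ck_on k (\<lambda>x. f x + g x) S"
proof (induction k arbitrary: f g)
  case 0
  then show ?case by (simp add: continuous_on_add)
next
  case (Suc k)
  from Suc.prems(1) obtain D where D: "\<And>x. x \<in> S \<Longrightarrow> (f has_derivative D x) (at x)" "\<And>v. Ck_on k (\<lambda>x. D x v) S"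
    by (rule Ck_on_SucE) blast
  from Suc.prems(2) obtain D' where D': "\<And>x. x \<in> S \<Longrightarrow> (g has_derivative D' x) (at x)" "\<And>v. Ck_on k (\<lambda>x. D' x v) S"
    by (rule Ck_on_SucE) blast
  show ?case by (rule Ck_on_SucI'[OF S has_derivative_add[OF D(1) D'(1)] Suc.IH[OF D(2) D'(2)]])
qed

lemma Ck_on_bilinear:
  assumes p: "bounded_bilinear p" and S: "open S"
  shows "Ck_on k f S \<Longrightarrow> Ck_on k g S \<Longrightarrow> Ck_on k (\<lambda>x. p (f x) (g x)) S"
proof (induction k arbitrary: f g)
  case 0
  then show ?case by (simp add: bounded_bilinear.continuous_on[OF p])
next
  case (Suc k)
  from Suc.prems(1) obtain D where D: "\<And>x. x \<in> S \<Longrightarrow> (f has_derivative D x) (at x)" "\<And>v. Ck_on k (\<lambda>x. D x v) S"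
    by (rule Ck_on_SucE) blast
  from Suc.prems(2) obtain D' where D': "\<And>x. x \<in> S \<Longrightarrow> (g has_derivative D' x) (at x)" "\<And>v. Ck_on k (\<lambda>x. D' x v) S"
    by (rule Ck_on_SucE) blast
  note f = Ck_on_SucD[OF Suc.prems(1)] and g = Ck_on_SucD[OF Suc.prems(2)]
  show ?case
    by (rule Ck_on_SucI'[OF S bounded_bilinear.FDERIV[OF p D(1) D'(1)]
        Ck_on_add[OF S Suc.IH[OF f D'(2)] Suc.IH[OF D(2) g]]])
qed

lemmas Ck_on_mult = Ck_on_bilinear[OF bounded_bilinear_mult]
lemmas Ck_on_scaleR = Ck_on_bilinear[OF bounded_bilinear_scaleR]
lemmas Ck_on_inner = Ck_on_bilinear[OF bounded_bilinear_inner]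

lemma Ck_on_linear_comp:
  assumes T: "bounded_linear T" and S: "open S"
  shows "Ck_on k f S \<Longrightarrow> Ck_on k (\<lambda>x. T (f x)) S"
proof (induction k arbitrary: f)
  case 0
  then show ?case by (simp add: bounded_linear.continuous_on[OF T])
next
  case (Suc k)
  from Suc.prems(1) obtain D where D: "\<And>x. x \<in> S \<Longrightarrow> (f has_derivative D x) (at x)" "\<And>v. Ck_on k (\<lambda>x. D x v) S"
    by (rule Ck_on_SucE) blast
  show ?case by (rule Ck_on_SucI'[OF S bounded_linear.has_derivative[OF T D(1)] Suc.IH[OF D(2)]])
qed

lemma Ck_on_comp_affine:
  assumes T: "bounded_linear T" and S: "open S" and "open R" and sub: "\<And>x. x \<in> S \<Longrightarrow> c + T x \<in> R"
  shows "Ck_on k f R \<Longrightarrow> Ck_on k (\<lambda>x. f (c + T x)) S"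
proof (induction k arbitrary: f)
  case 0
  have "continuous_on S (\<lambda>x. c + T x)" using T by (intro continuous_intros linear_continuous_on)
  then show ?case using 0 sub by (auto intro: continuous_on_compose2)
next
  case (Suc k)
  from Suc.prems(1) obtain D where D: "\<And>x. x \<in> R \<Longrightarrow> (f has_derivative D x) (at x)" "\<And>v. Ck_on k (\<lambda>x. D x v) R"
    by (rule Ck_on_SucE) blast
  have d: "((\<lambda>x. f (c + T x)) has_derivative (\<lambda>h. D (c + T x) (T h))) (at x)" if "x \<in> S" for x
  proof -
    have "((\<lambda>x. c + T x) has_derivative T) (at x)"
      using has_derivative_add[OF has_derivative_const[of c] bounded_linear_imp_has_derivative[OF T]] by simp
    from diff_chain_at[OF this D(1)[OF sub[OF that]]] show ?thesis by (simp add: o_def)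
  qed
  show ?case by (rule Ck_on_SucI'[OF S d Suc.IH[OF D(2)]])
qed

lemma Ck_on_exp:
  fixes f :: "'a::real_normed_vector \<Rightarrow> complex"
  assumes S: "open S"
  shows "Ck_on k f S \<Longrightarrow> Ck_on k (\<lambda>x. exp (f x)) S"
proof (induction k)
  case 0
  then show ?case by (simp add: continuous_on_exp)
next
  case (Suc k)
  from Suc.prems(1) obtain D where D: "\<And>x. x \<in> S \<Longrightarrow> (f has_derivative D x) (at x)" "\<And>v. Ck_on k (\<lambda>x. D x v) S"
    by (rule Ck_on_SucE) blast
  have d: "((\<lambda>x. exp (f x)) has_derivative (\<lambda>h. exp (f x) * D x h)) (at x)" if "x \<in> S" for x
    using diff_chain_at[OF D(1)[OF that], of exp "\<lambda>h. exp (f x) * h"] DERIV_exp[of "f x"]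
    by (simp add: o_def has_field_derivative_def)
  show ?case by (rule Ck_on_SucI'[OF S d Ck_on_mult[OF S Suc.IH[OF Ck_on_SucD[OF Suc.prems]] D(2)]])
qed

text \<open>The exponent is arbitrary in the induction because differentiation lowers it by one. The
  exponents -1 and -1/2 later express the inverse of an inner product and of a norm.\<close>

lemma Ck_on_powr:
  fixes f :: "'a::real_normed_vector \<Rightarrow> real"
  assumes S: "open S" and pos: "\<And>x. x \<in> S \<Longrightarrow> f x > 0"
  shows "Ck_on k f S \<Longrightarrow> Ck_on k (\<lambda>x. f x powr a) S"
proof (induction k arbitrary: a)
  case 0
  then show ?case using pos by (auto intro!: continuous_on_powr continuous_intros simp: order_less_le)
next
  case (Suc k)
  from Suc.prems(1) obtain D where D: "\<And>x. x \<in> S \<Longrightarrow> (f has_derivative D x) (at x)" "\<And>v. Ck_on k (\<lambda>x. D x v) S"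
    by (rule Ck_on_SucE) blast
  have d: "((\<lambda>x. f x powr a) has_derivative (\<lambda>h. a * (f x powr (a - 1) * D x h))) (at x)" if "x \<in> S" for x
  proof -
    have "((\<lambda>y. y powr a) has_derivative (\<lambda>h. a * f x powr (a - 1) * h)) (at (f x))"
      using has_real_derivative_powr[OF pos[OF that], of a] by (simp add: has_field_derivative_def)
    from diff_chain_at[OF D(1)[OF that] this] show ?thesis by (simp add: o_def mult.assoc)
  qed
  show ?case
    by (rule Ck_on_SucI'[OF S d Ck_on_mult[OF S Ck_on_const[OF S]
          Ck_on_mult[OF S Suc.IH[OF Ck_on_SucD[OF Suc.prems]] D(2)]]])
qed

section \<open>Square integrable functions\<close>

definition l2sq :: "'a::euclidean_space set \<Rightarrow> ('a \<Rightarrow> 'b::euclidean_space) \<Rightarrow> real" where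
  "l2sq \<Omega> f = (LINT x|lebesgue_on \<Omega>. (norm (f x))\<^sup>2)"

lemma L2_measurable: "f \<in> L2 \<Omega> \<Longrightarrow> f \<in> borel_measurable (lebesgue_on \<Omega>)"
  by (simp add: L2_def)

lemma L2_integrable: "f \<in> L2 \<Omega> \<Longrightarrow> integrable (lebesgue_on \<Omega>) (\<lambda>x. (norm (f x))\<^sup>2)"
  by (simp add: L2_def)

text \<open>A product of norms is dominated by the sum of their squares. A general \<open>p\<close>
  covers real inner products and complex products at once.\<close>

lemma L2_bilinear_integrable:
  fixes f :: "'a::euclidean_space \<Rightarrow> 'b::euclidean_space" and g :: "'a \<Rightarrow> 'c::euclidean_space"
    and p :: "'b \<Rightarrow> 'c \<Rightarrow> 'd::euclidean_space"
  assumes p: "bounded_bilinear p" and f: "f \<in> L2 \<Omega>" and g: "g \<in> L2 \<Omega>"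
  shows "integrable (lebesgue_on \<Omega>) (\<lambda>x. p (f x) (g x))"
proof -
  interpret bounded_bilinear p by fact
  obtain K where K: "\<And>a b. norm (p a b) \<le> norm a * norm b * K" "K > 0" using pos_bounded by blast
  have m: "(\<lambda>x. p (f x) (g x)) \<in> borel_measurable (lebesgue_on \<Omega>)"
    by (rule borel_measurable_continuous_Pair[OF L2_measurable[OF f] L2_measurable[OF g]])
      (auto intro!: continuous_on continuous_intros)
  have b: "norm (p (f x) (g x)) \<le> norm (K * ((norm (f x))\<^sup>2 + (norm (g x))\<^sup>2))" for x
  proof -
    have "norm (f x) * norm (g x) \<le> (norm (f x))\<^sup>2 + (norm (g x))\<^sup>2"
      using sum_squares_bound[of "norm (f x)" "norm (g x)"] mult_nonneg_nonneg[OF norm_ge_zero norm_ge_zero, of "f x" "g x"]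
      unfolding mult.assoc by linarith
    then have "norm (f x) * norm (g x) * K \<le> K * ((norm (f x))\<^sup>2 + (norm (g x))\<^sup>2)"
      using K(2) by (simp add: mult.commute)
    with K(1)[of "f x" "g x"] have "norm (p (f x) (g x)) \<le> K * ((norm (f x))\<^sup>2 + (norm (g x))\<^sup>2)"
      by linarith
    then show ?thesis by simp
  qed
  have i: "integrable (lebesgue_on \<Omega>) (\<lambda>x. K * ((norm (f x))\<^sup>2 + (norm (g x))\<^sup>2))"
    by (intro integrable_mult_right Bochner_Integration.integrable_add L2_integrable f g)
  show ?thesis
    by (rule Bochner_Integration.integrable_bound[OF i m AE_I2]) (rule b)
qed

lemmas L2_inner_integrable = L2_bilinear_integrable[OF bounded_bilinear_inner]
lemmas L2_mult_integrable = L2_bilinear_integrable[OF bounded_bilinear_mult]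

lemma L2_zero: "(\<lambda>x. 0) \<in> L2 \<Omega>"
  by (simp add: L2_def)

lemma L2_bound:
  fixes f :: "'a::euclidean_space \<Rightarrow> 'b::euclidean_space"
  assumes "f \<in> L2 \<Omega>" and "g \<in> borel_measurable (lebesgue_on \<Omega>)"
    and "\<And>x. x \<in> \<Omega> \<Longrightarrow> norm (g x) \<le> c * norm (f x)"
  shows "g \<in> L2 \<Omega>"
proof -
  have "integrable (lebesgue_on \<Omega>) (\<lambda>x. (norm (g x))\<^sup>2)"
  proof (rule Bochner_Integration.integrable_bound)
    show "integrable (lebesgue_on \<Omega>) (\<lambda>x. c\<^sup>2 * (norm (f x))\<^sup>2)"
      using L2_integrable[OF assms(1)] by simp
    show "AE x in lebesgue_on \<Omega>. norm ((norm (g x))\<^sup>2) \<le> norm (c\<^sup>2 * (norm (f x))\<^sup>2)"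
    proof (rule AE_I2)
      fix x assume "x \<in> space (lebesgue_on \<Omega>)"
      then have "norm (g x) \<le> c * norm (f x)" using assms(3) by (simp add: space_restrict_space)
      then have "(norm (g x))\<^sup>2 \<le> (c * norm (f x))\<^sup>2" by (intro power_mono) auto
      then show "norm ((norm (g x))\<^sup>2) \<le> norm (c\<^sup>2 * (norm (f x))\<^sup>2)" by (simp add: power_mult_distrib)
    qed
  qed (use assms(2) in measurable)
  then show ?thesis using assms(2) by (simp add: L2_def)
qed

lemma L2_cong:
  assumes "f \<in> L2 \<Omega>" "\<And>x. x \<in> \<Omega> \<Longrightarrow> f x = g x"
  shows "g \<in> L2 \<Omega>"
proof -
  have "f \<in> borel_measurable (lebesgue_on \<Omega>) \<longleftrightarrow> g \<in> borel_measurable (lebesgue_on \<Omega>)"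
    by (rule measurable_cong) (simp add: assms(2) space_restrict_space)
  moreover have "integrable (lebesgue_on \<Omega>) (\<lambda>x. (norm (f x))\<^sup>2) \<longleftrightarrow> integrable (lebesgue_on \<Omega>) (\<lambda>x. (norm (g x))\<^sup>2)"
    by (rule Bochner_Integration.integrable_cong) (simp_all add: assms(2) space_restrict_space)
  ultimately show ?thesis using assms(1) by (simp add: L2_def)
qed

lemma L2_linear:
  fixes f :: "'a::euclidean_space \<Rightarrow> 'b::euclidean_space" and T :: "'b \<Rightarrow> 'c::euclidean_space"
  assumes "bounded_linear T" and f: "f \<in> L2 \<Omega>"
  shows "(\<lambda>x. T (f x)) \<in> L2 \<Omega>"
proof -
  obtain K where K: "\<And>a. norm (T a) \<le> norm a * K" using bounded_linear.bounded[OF assms(1)] by blast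
  have [measurable]: "T \<in> borel_measurable borel"
    using assms(1) by (intro borel_measurable_continuous_onI linear_continuous_on)
  note [measurable] = L2_measurable[OF f]
  show ?thesis
    by (rule L2_bound[OF f, of _ K]) (use K in \<open>auto simp: mult.commute\<close>)
qed

lemma L2_add:
  fixes f g :: "'a::euclidean_space \<Rightarrow> 'b::euclidean_space"
  assumes f: "f \<in> L2 \<Omega>" and g: "g \<in> L2 \<Omega>"
  shows "(\<lambda>x. f x + g x) \<in> L2 \<Omega>"
proof -
  have "integrable (lebesgue_on \<Omega>) (\<lambda>x. (norm (f x))\<^sup>2 + (norm (g x))\<^sup>2 + 2 * (f x \<bullet> g x))"
    by (intro Bochner_Integration.integrable_add integrable_mult_right L2_integrable f g L2_inner_integrable)
  then show ?thesis
    using L2_measurable[OF f] L2_measurable[OF g] unfolding L2_def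
    by (simp add: power2_norm_eq_inner inner_add_left inner_add_right inner_commute algebra_simps)
qed

lemma L2_scaleR: "f \<in> L2 \<Omega> \<Longrightarrow> (\<lambda>x. c *\<^sub>R f x) \<in> L2 \<Omega>"
  by (rule L2_linear[OF bounded_linear_scaleR_right])

lemma L2_cmult: "f \<in> L2 \<Omega> \<Longrightarrow> (\<lambda>x. c * f x :: complex) \<in> L2 \<Omega>"
  by (rule L2_linear[OF bounded_linear_mult_right])

lemma L2_diff: "f \<in> L2 \<Omega> \<Longrightarrow> g \<in> L2 \<Omega> \<Longrightarrow> (\<lambda>x. f x - g x) \<in> L2 \<Omega>"
  using L2_add[of f \<Omega> "\<lambda>x. (-1) *\<^sub>R g x"] L2_scaleR[of g \<Omega> "-1"] by simp

lemma L2_component: "g \<in> L2 \<Omega> \<Longrightarrow> (\<lambda>x. g x $ j) \<in> L2 \<Omega>"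
  for g :: "'a::euclidean_space \<Rightarrow> 'b::euclidean_space ^ 'n"
  by (rule L2_linear[OF bounded_linear_vec_nth])

lemma l2sq_nonneg: "0 \<le> l2sq \<Omega> f"
  unfolding l2sq_def by simp

lemma l2sq_scaleR: "l2sq \<Omega> (\<lambda>x. c *\<^sub>R f x) = c\<^sup>2 * l2sq \<Omega> f"
  unfolding l2sq_def by (simp add: power_mult_distrib)

lemma l2sq_mono:
  assumes "f \<in> L2 \<Omega>" "g \<in> L2 \<Omega>" "\<And>x. x \<in> \<Omega> \<Longrightarrow> norm (f x) \<le> norm (g x)"
  shows "l2sq \<Omega> f \<le> l2sq \<Omega> g"
  unfolding l2sq_def
  by (rule integral_mono[OF L2_integrable[OF assms(1)] L2_integrable[OF assms(2)]])
    (use assms(3) in \<open>auto simp: space_restrict_space intro: power_mono\<close>)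

lemma l2sq_add:
  assumes "f \<in> L2 \<Omega>" "g \<in> L2 \<Omega>"
  shows "l2sq \<Omega> (\<lambda>x. f x + t *\<^sub>R g x) = l2sq \<Omega> f + 2 * t * (LINT x|lebesgue_on \<Omega>. f x \<bullet> g x) + t\<^sup>2 * l2sq \<Omega> g"
proof -
  note i = L2_integrable[OF assms(1)] L2_integrable[OF assms(2)] L2_inner_integrable[OF assms]
  have "(norm (f x + t *\<^sub>R g x))\<^sup>2 = (norm (f x))\<^sup>2 + 2 * t * (f x \<bullet> g x) + t\<^sup>2 * (norm (g x))\<^sup>2" for x
    unfolding power2_norm_eq_inner
    by (simp add: inner_add_left inner_add_right inner_commute power2_eq_square algebra_simps)
  then show ?thesis using i unfolding l2sq_def by (simp add: mult.assoc)
qed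

text \<open>The Cauchy-Schwarz bounds below and the estimate of the first variation along a
  minimising sequence come from this. The case \<open>c = 0\<close> is included because the forms
  are only semidefinite.\<close>

lemma discriminant_nonpos:
  fixes a b c :: real
  assumes "\<And>t. a + 2 * t * b + t\<^sup>2 * c \<ge> 0" "c \<ge> 0"
  shows "b\<^sup>2 \<le> a * c"
proof (cases "c = 0")
  case True
  have "b = 0"
  proof (rule ccontr)
    assume b: "b \<noteq> 0"
    have "a + 2 * (- (a + 1) / (2 * b)) * b + 0 \<ge> 0"
      using assms(1)[of "- (a + 1) / (2 * b)"] True by simp
    moreover have "a + 2 * (- (a + 1) / (2 * b)) * b = -1" using b by (simp add: field_simps)
    ultimately show False by linarith
  qed
  then show ?thesis using True by simp
next
  case False
  then have c: "c > 0" using assms(2) by simp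
  have "a + 2 * (- b / c) * b + (- b / c)\<^sup>2 * c = a - b\<^sup>2 / c"
    using c by (simp add: field_simps power2_eq_square)
  then have "b\<^sup>2 / c \<le> a" using assms(1)[of "- b / c"] by simp
  then show ?thesis using c by (simp add: field_simps)
qed

lemma L2_Cauchy_Schwarz:
  assumes "f \<in> L2 \<Omega>" "g \<in> L2 \<Omega>"
  shows "(LINT x|lebesgue_on \<Omega>. f x \<bullet> g x)\<^sup>2 \<le> l2sq \<Omega> f * l2sq \<Omega> g"
  by (rule discriminant_nonpos) (use l2sq_nonneg l2sq_add[OF assms] in metis)+

text \<open>The Riesz-Fischer argument for functions instead of classes: a rapidly convergent
  subsequence converges almost everywhere, and Fatou's lemma compares the whole sequence with the
  limit.\<close>

lemma L2_complete:
  fixes u :: "nat \<Rightarrow> 'a::euclidean_space \<Rightarrow> 'b::euclidean_space"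
  assumes u: "\<And>n. u n \<in> L2 \<Omega>"
    and Cauchy: "\<And>e. e > 0 \<Longrightarrow> \<exists>N. \<forall>m\<ge>N. \<forall>n\<ge>N. l2sq \<Omega> (\<lambda>x. u m x - u n x) < e"
  shows "\<exists>v\<in>L2 \<Omega>. (\<lambda>n. l2sq \<Omega> (\<lambda>x. u n x - v x)) \<longlonglongrightarrow> 0"
proof -
  let ?M = "lebesgue_on \<Omega>"
  have "\<forall>k. \<exists>N. \<forall>m\<ge>N. \<forall>n\<ge>N. l2sq \<Omega> (\<lambda>x. u m x - u n x) < (1/4) ^ k"
    using Cauchy by simp
  then obtain N where N: "\<And>k m n. m \<ge> N k \<Longrightarrow> n \<ge> N k \<Longrightarrow> l2sq \<Omega> (\<lambda>x. u m x - u n x) < (1/4) ^ k"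
    by metis
  \<comment> \<open>The sum makes \<open>r\<close> monotone and \<open>r k\<close> at least
    \<open>N k\<close>; the summand \<open>k\<close> makes it tend to infinity.\<close>
  define r where "r k = (\<Sum>i\<le>k. N i) + k" for k
  have rN: "r k \<ge> N k" for k
    unfolding r_def by (metis (no_types, lifting) add_increasing2 atMost_iff finite_atMost le0 le_refl member_le_sum)
  have rk: "r k \<ge> k" for k by (simp add: r_def)
  have rS: "r (Suc k) \<ge> N k" for k
  proof -
    have "r (Suc k) \<ge> r k" by (simp add: r_def)
    then show ?thesis using rN[of k] by linarith
  qed
  define d where "d k x = u (r (Suc k)) x - u (r k) x" for k x
  have dL: "d k \<in> L2 \<Omega>" for k unfolding d_def by (intro L2_diff u)
  have d: "l2sq \<Omega> (d k) \<le> (1/4) ^ k" for k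
    using N[OF rS rN, of k] unfolding d_def by (simp add: less_imp_le)
  note [measurable] = L2_measurable[OF u] L2_measurable[OF dL]
  have nn: "(\<integral>\<^sup>+x. ennreal ((norm (f x))\<^sup>2) \<partial>?M) = ennreal (l2sq \<Omega> f)" if "f \<in> L2 \<Omega>" for f :: "'a \<Rightarrow> 'b"
    unfolding l2sq_def using L2_integrable[OF that] by (simp add: nn_integral_eq_integral)
  have "(\<integral>\<^sup>+x. (\<Sum>k. ennreal (2 ^ k * (norm (d k x))\<^sup>2)) \<partial>?M) =
      (\<Sum>k. \<integral>\<^sup>+x. ennreal (2 ^ k * (norm (d k x))\<^sup>2) \<partial>?M)"
    by (rule nn_integral_suminf) measurable
  also have "\<dots> = (\<Sum>k. ennreal (2 ^ k * l2sq \<Omega> (d k)))"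
    by (rule suminf_cong) (simp add: ennreal_mult nn_integral_cmult nn[OF dL] l2sq_nonneg)
  also have "\<dots> \<le> (\<Sum>k. ennreal ((1/2) ^ k))"
  proof (intro suminf_le ennreal_leI)
    fix k
    have "2 ^ k * l2sq \<Omega> (d k) \<le> 2 ^ k * (1/4) ^ k" using d[of k] by simp
    also have "\<dots> = (1/2 :: real) ^ k" by (simp add: power_mult_distrib[symmetric])
    finally show "2 ^ k * l2sq \<Omega> (d k) \<le> (1/2) ^ k" .
  qed auto
  also have "\<dots> = ennreal (\<Sum>k. (1/2) ^ k)"
    by (rule suminf_ennreal2) (auto intro: summable_geometric)
  also have "\<dots> < \<infinity>" by simp
  finally have "AE x in ?M. (\<Sum>k. ennreal (2 ^ k * (norm (d k x))\<^sup>2)) \<noteq> \<infinity>"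
    by (intro nn_integral_PInf_AE) auto
  then have conv: "AE x in ?M. convergent (\<lambda>k. u (r k) x)"
  proof eventually_elim
    case (elim x)
    then have s: "summable (\<lambda>k. 2 ^ k * (norm (d k x))\<^sup>2)"
      by (intro summable_suminf_not_top) auto
    \<comment> \<open>The weight \<open>2 ^ k\<close> against the bound \<open>(1/4) ^ k\<close>
      left a finite total integral. Pointwise, 2 |d| is at most \<open>(1/2) ^ k\<close> plus the
      weighted square, by completing a square.\<close>
    have "summable (\<lambda>k. norm (d k x))"
    proof (rule summable_comparison_test'[where N = 0])
      show "summable (\<lambda>k. (1/2) ^ k + 2 ^ k * (norm (d k x))\<^sup>2)"
        by (intro summable_add s summable_geometric) simp
      fix k :: nat
      have "0 \<le> ((1/2) ^ k - norm (d k x))\<^sup>2 * 2 ^ k" by simp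
      also have "\<dots> = (1/2) ^ k - 2 * norm (d k x) + 2 ^ k * (norm (d k x))\<^sup>2"
        by (simp add: power2_eq_square algebra_simps power_divide power_one_over)
      finally have "2 * norm (d k x) \<le> (1/2) ^ k + 2 ^ k * (norm (d k x))\<^sup>2" by simp
      moreover have "0 \<le> norm (d k x)" by simp
      ultimately show "norm (norm (d k x)) \<le> (1/2) ^ k + 2 ^ k * (norm (d k x))\<^sup>2" unfolding real_norm_def by linarith
    qed
    then have "summable (\<lambda>k. d k x)" by (rule summable_norm_cancel)
    then have "convergent (\<lambda>n. \<Sum>k<n. d k x)" by (simp add: summable_iff_convergent)
    moreover have "(\<Sum>k<n. d k x) = u (r n) x - u (r 0) x" for n
      unfolding d_def by (rule sum_lessThan_telescope)
    ultimately have "convergent (\<lambda>n. u (r n) x - u (r 0) x)" by simp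
    then show ?case by (simp add: convergent_diff_const_right_iff)
  qed
  \<comment> \<open>Where the subsequence diverges, on a null set, \<open>lim\<close> has an
    unspecified value; \<open>v\<close> is measurable all the same.\<close>
  define v where "v x = lim (\<lambda>k. u (r k) x)" for x
  have [measurable]: "v \<in> borel_measurable ?M" unfolding v_def by (rule borel_measurable_lim_metric) measurable
  have fatou: "(\<integral>\<^sup>+x. ennreal ((norm (u n x - v x))\<^sup>2) \<partial>?M) \<le> ennreal ((1/4) ^ k)" if "n \<ge> N k" for n k
  proof -
    have "(\<integral>\<^sup>+x. ennreal ((norm (u n x - v x))\<^sup>2) \<partial>?M)
      = (\<integral>\<^sup>+x. liminf (\<lambda>j. ennreal ((norm (u n x - u (r j) x))\<^sup>2)) \<partial>?M)"
    proof (rule nn_integral_cong_AE, use conv in eventually_elim)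
      case (elim x)
      then have "(\<lambda>j. u (r j) x) \<longlonglongrightarrow> v x" by (simp add: v_def convergent_LIMSEQ_iff)
      then have "(\<lambda>j. ennreal ((norm (u n x - u (r j) x))\<^sup>2)) \<longlonglongrightarrow> ennreal ((norm (u n x - v x))\<^sup>2)"
        by (intro tendsto_intros)
      then show ?case by (rule lim_imp_Liminf[OF trivial_limit_sequentially, symmetric])
    qed
    also have "\<dots> \<le> liminf (\<lambda>j. \<integral>\<^sup>+x. ennreal ((norm (u n x - u (r j) x))\<^sup>2) \<partial>?M)"
      by (rule nn_integral_liminf) measurable
    also have "\<dots> \<le> liminf (\<lambda>j. ennreal ((1/4) ^ k))"
    proof (rule Liminf_mono, rule eventually_sequentiallyI[of "N k"])
      fix j assume "N k \<le> j"
      then have "r j \<ge> N k" using rk[of j] by linarith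
      then have "l2sq \<Omega> (\<lambda>x. u n x - u (r j) x) < (1/4) ^ k" using N that by blast
      then show "(\<integral>\<^sup>+x. ennreal ((norm (u n x - u (r j) x))\<^sup>2) \<partial>?M) \<le> ennreal ((1/4) ^ k)"
        by (subst nn[OF L2_diff[OF u u]]) (simp add: ennreal_leI)
    qed
    also have "\<dots> = ennreal ((1/4) ^ k)" by (simp add: Liminf_const)
    finally show ?thesis .
  qed
  have dv: "(\<lambda>x. u n x - v x) \<in> L2 \<Omega>" if "n \<ge> N k" for n k
  proof -
    have "integrable ?M (\<lambda>x. (norm (u n x - v x))\<^sup>2)"
      by (rule integrableI_bounded, measurable) (use le_less_trans[OF fatou[OF that] ennreal_less_top] in simp)
    then show ?thesis unfolding L2_def by simp
  qed
  have vL: "v \<in> L2 \<Omega>"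
    using L2_diff[OF u[of "N 0"] dv[of 0 "N 0"]] by simp
  have "(\<lambda>n. l2sq \<Omega> (\<lambda>x. u n x - v x)) \<longlonglongrightarrow> 0"
  proof (rule LIMSEQ_I)
    fix e :: real assume "e > 0"
    then obtain k where k: "(1/4) ^ k < e" using real_arch_pow_inv[of e "1/4"] by auto
    have "norm (l2sq \<Omega> (\<lambda>x. u n x - v x) - 0) < e" if "n \<ge> N k" for n
    proof -
      have "ennreal (l2sq \<Omega> (\<lambda>x. u n x - v x)) \<le> ennreal ((1/4) ^ k)"
        using fatou[OF that] nn[OF dv[OF that]] by simp
      then have "l2sq \<Omega> (\<lambda>x. u n x - v x) \<le> (1/4) ^ k" by (simp add: ennreal_le_iff)
      then show ?thesis using k l2sq_nonneg[of \<Omega> "\<lambda>x. u n x - v x"] by simp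
    qed
    then show "\<exists>no. \<forall>n\<ge>no. norm (l2sq \<Omega> (\<lambda>x. u n x - v x) - 0) < e" by blast
  qed
  with vL show ?thesis by blast
qed

section \<open>The form domain and the bottom of the spectrum\<close>

lemma L2_norm: "f \<in> L2 \<Omega> \<Longrightarrow> (\<lambda>x. norm (f x)) \<in> L2 \<Omega>"
  unfolding L2_def by (auto intro: borel_measurable_norm)

lemma L2_bilinear_bound:
  fixes F :: "'a::euclidean_space \<Rightarrow> 'b::euclidean_space" and H :: "'a \<Rightarrow> 'c::euclidean_space"
    and p :: "'b \<Rightarrow> 'c \<Rightarrow> 'd::euclidean_space"
  assumes p: "bounded_bilinear p" "\<And>a b. norm (p a b) \<le> norm a * norm b" and L: "F \<in> L2 \<Omega>" "H \<in> L2 \<Omega>"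
  shows "(norm (LINT x|lebesgue_on \<Omega>. p (F x) (H x)))\<^sup>2 \<le> l2sq \<Omega> F * l2sq \<Omega> H"
proof -
  have "norm (LINT x|lebesgue_on \<Omega>. p (F x) (H x)) \<le> (LINT x|lebesgue_on \<Omega>. norm (F x) \<bullet> norm (H x))"
    by (rule Bochner_Integration.integral_norm_bound_integral[OF L2_bilinear_integrable[OF p(1) L] L2_inner_integrable[OF L2_norm L2_norm]])
      (use p(2) L in auto)
  then have "(norm (LINT x|lebesgue_on \<Omega>. p (F x) (H x)))\<^sup>2 \<le> (LINT x|lebesgue_on \<Omega>. norm (F x) \<bullet> norm (H x))\<^sup>2"
    by (intro power_mono) auto
  also have "\<dots> \<le> l2sq \<Omega> (\<lambda>x. norm (F x)) * l2sq \<Omega> (\<lambda>x. norm (H x))"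
    by (intro L2_Cauchy_Schwarz L2_norm L)
  finally show ?thesis by (simp add: l2sq_def)
qed

text \<open>Pairings with a fixed \<open>H\<close> are continuous in the norm. This yields the
  closedness of the form and, later, the Euler equation of the minimiser.\<close>

lemma L2_bilinear_tendsto:
  fixes F :: "nat \<Rightarrow> 'a::euclidean_space \<Rightarrow> 'b::euclidean_space" and H :: "'a \<Rightarrow> 'c::euclidean_space"
    and p :: "'b \<Rightarrow> 'c \<Rightarrow> 'd::euclidean_space"
  assumes p: "bounded_bilinear p" "\<And>a b. norm (p a b) \<le> norm a * norm b"
    and L: "\<And>n. F n \<in> L2 \<Omega>" "F' \<in> L2 \<Omega>" "H \<in> L2 \<Omega>" and lim: "(\<lambda>n. l2sq \<Omega> (\<lambda>x. F n x - F' x)) \<longlonglongrightarrow> 0"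
  shows "(\<lambda>n. LINT x|lebesgue_on \<Omega>. p (F n x) (H x)) \<longlonglongrightarrow> (LINT x|lebesgue_on \<Omega>. p (F' x) (H x))"
proof -
  let ?d = "\<lambda>n. (LINT x|lebesgue_on \<Omega>. p (F n x) (H x)) - (LINT x|lebesgue_on \<Omega>. p (F' x) (H x))"
  have b: "(norm (?d n))\<^sup>2 \<le> l2sq \<Omega> (\<lambda>x. F n x - F' x) * l2sq \<Omega> H" for n
  proof -
    have "?d n = (LINT x|lebesgue_on \<Omega>. p (F n x - F' x) (H x))"
      using L2_bilinear_integrable[OF p(1) L(1,3)] L2_bilinear_integrable[OF p(1) L(2,3)]
      by (simp add: bounded_bilinear.diff_left[OF p(1)])
    then show ?thesis using L2_bilinear_bound[OF p L2_diff[OF L(1,2)] L(3)] by simp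
  qed
  have l: "(\<lambda>n. l2sq \<Omega> (\<lambda>x. F n x - F' x) * l2sq \<Omega> H) \<longlonglongrightarrow> 0"
    using tendsto_mult[OF lim tendsto_const, of "l2sq \<Omega> H"] by simp
  have "(\<lambda>n. (norm (?d n))\<^sup>2) \<longlonglongrightarrow> 0"
    by (rule tendsto_sandwich[OF _ _ tendsto_const l]) (use b in auto)
  from tendsto_real_sqrt[OF this] show ?thesis by (simp add: tendsto_norm_zero_iff LIM_zero_iff)
qed

lemma L2_compact_support:
  fixes h :: "'a::euclidean_space \<Rightarrow> 'b::euclidean_space"
  assumes h: "continuous_on UNIV h" and K: "compact K" "\<And>x. x \<notin> K \<Longrightarrow> h x = 0" and \<Omega>: "open \<Omega>"
  shows "h \<in> L2 \<Omega>"
proof -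
  obtain r where r: "K \<subseteq> cball 0 r" using compact_imp_bounded[OF K(1)] by (auto simp: bounded_iff subset_iff)
  obtain c where c: "\<And>x. x \<in> K \<Longrightarrow> norm (h x) \<le> c"
    using compact_imp_bounded[OF compact_continuous_image[OF continuous_on_subset[OF h subset_UNIV] K(1)]]
    unfolding bounded_iff by blast
  have hm: "h \<in> borel_measurable borel" using h by (rule borel_measurable_continuous_onI)
  then have hL: "h \<in> borel_measurable (lebesgue_on \<Omega>)"
    by (intro measurable_restrict_space1 measurable_completion) simp
  have i: "integrable lebesgue (\<lambda>x. (norm (h x))\<^sup>2)"
  proof (rule Bochner_Integration.integrable_bound)
    show "integrable lebesgue (\<lambda>x. c\<^sup>2 * indicator (cball (0::'a) r) x :: real)"
      by (intro integrable_mult_right integrable_real_indicator)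
        (simp_all add: emeasure_lborel_cball_finite[unfolded infinity_ennreal_def])
    show "(\<lambda>x. (norm (h x))\<^sup>2) \<in> borel_measurable lebesgue"
      using hm by (intro measurable_completion) simp
    show "AE x in lebesgue. norm ((norm (h x))\<^sup>2) \<le> norm (c\<^sup>2 * indicator (cball 0 r) x :: real)"
    proof (rule AE_I2)
      fix x show "norm ((norm (h x))\<^sup>2) \<le> norm (c\<^sup>2 * indicator (cball 0 r) x :: real)"
      proof (cases "x \<in> K")
        case True
        then have "(norm (h x))\<^sup>2 \<le> c\<^sup>2" using c by (intro power_mono) auto
        then show ?thesis using True r by (auto simp: indicator_def)
      qed (simp add: K)
    qed
  qed
  have "integrable (lebesgue_on \<Omega>) (\<lambda>x. (norm (h x))\<^sup>2)"
    using integrable_mult_indicator[OF _ i, of \<Omega>] \<Omega> by (subst integrable_restrict_space) auto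
  then show ?thesis using hL by (simp add: L2_def)
qed

lemma smooth_on_continuous: "smooth_on f S \<Longrightarrow> continuous_on S f"
  unfolding smooth_on_def by (drule spec[of _ 0]) simp

lemma smooth_on_differentiable: "smooth_on f S \<Longrightarrow> x \<in> S \<Longrightarrow> f differentiable (at x)"
  unfolding smooth_on_def by (drule spec[of _ "Suc 0"]) simp

lemma smooth_on_derivative: "smooth_on f S \<Longrightarrow> smooth_on (\<lambda>x. frechet_derivative f (at x) v) S"
  unfolding smooth_on_def
proof
  fix k assume "\<forall>k. Ck_on k f S"
  then have "Ck_on (Suc k) f S" by blast
  then show "Ck_on k (\<lambda>x. frechet_derivative f (at x) v) S" by simp
qed

lemma frechet_derivative_zero_outside:
  assumes "x \<notin> closure {x. f x \<noteq> 0}"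
  shows "frechet_derivative f (at x) v = 0"
proof -
  have "(f has_derivative (\<lambda>h. 0)) (at x)"
    by (rule has_derivative_transform_within_open[where f = "\<lambda>_. 0" and s = "- closure {x. f x \<noteq> 0}"])
      (use assms closure_subset[of "{x. f x \<noteq> 0}"] in auto)
  from frechet_derivative_at[OF this] show ?thesis by metis
qed

lemma test_functionD:
  assumes "\<psi> \<in> test_functions \<Omega>"
  shows "smooth_on \<psi> UNIV" "compact (closure {x. \<psi> x \<noteq> 0})" "closure {x. \<psi> x \<noteq> 0} \<subseteq> \<Omega>"
  using assms by (auto simp: test_functions_def)

lemma test_function_L2:
  assumes \<psi>: "\<psi> \<in> test_functions \<Omega>" and \<Omega>: "open \<Omega>" and a: "continuous_on UNIV a"
  shows "(\<lambda>x. a x * \<psi> x) \<in> L2 \<Omega>" "(\<lambda>x. a x * partial_deriv j \<psi> x) \<in> L2 \<Omega>"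
proof -
  note D = test_functionD[OF \<psi>]
  show "(\<lambda>x. a x * \<psi> x) \<in> L2 \<Omega>"
    by (rule L2_compact_support[OF _ D(2) _ \<Omega>])
      (use a smooth_on_continuous[OF D(1)] closure_subset[of "{x. \<psi> x \<noteq> 0}"] in \<open>auto intro!: continuous_intros\<close>)
  show "(\<lambda>x. a x * partial_deriv j \<psi> x) \<in> L2 \<Omega>"
    unfolding partial_deriv_def
    by (rule L2_compact_support[OF _ D(2) _ \<Omega>])
      (use a smooth_on_continuous[OF smooth_on_derivative[OF D(1)]] in
        \<open>auto intro!: continuous_intros simp: frechet_derivative_zero_outside\<close>)
qed

lemma magnetic_gradientD:
  assumes "magnetic_gradient A \<Omega> f g" "\<psi> \<in> test_functions \<Omega>"
  shows "(LINT x|lebesgue_on \<Omega>. g x $ j * \<psi> x) =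
     (LINT x|lebesgue_on \<Omega>. f x * (\<i> * partial_deriv j \<psi> x + of_real (A x $ j) * \<psi> x))"
  using assms unfolding magnetic_gradient_def by blast

text \<open>The form is a function on pairs \<open>(f, g)\<close>; this avoids proving that the weak gradient \<open>g\<close> of \<open>f\<close> is unique.\<close>

definition mgraph :: "(real^3 \<Rightarrow> real^3) \<Rightarrow> (real^3) set \<Rightarrow> ((real^3 \<Rightarrow> complex) \<times> (real^3 \<Rightarrow> complex^3)) set" where
  "mgraph A \<Omega> = {(f, g). f \<in> L2 \<Omega> \<and> g \<in> L2 \<Omega> \<and> magnetic_gradient A \<Omega> f g}"

lemma mgraphD:
  assumes "(f, g) \<in> mgraph A \<Omega>"
  shows "f \<in> L2 \<Omega>" "g \<in> L2 \<Omega>" "magnetic_gradient A \<Omega> f g"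
  using assms by (auto simp: mgraph_def)

text \<open>The imaginary part of a complex pairing with \<open>v\<close> is the real pairing with
  \<open>\<i> * v\<close>, so the variational arguments can be carried out over the reals.\<close>

lemma complex_inner_product:
  fixes w v :: "real^3 \<Rightarrow> complex" and g h :: "real^3 \<Rightarrow> complex^3"
  assumes L: "w \<in> L2 \<Omega>" "v \<in> L2 \<Omega>" "g \<in> L2 \<Omega>" "h \<in> L2 \<Omega>"
  shows "(LINT x|lebesgue_on \<Omega>. w x * cnj (v x)) =
      Complex (LINT x|lebesgue_on \<Omega>. w x \<bullet> v x) (LINT x|lebesgue_on \<Omega>. w x \<bullet> (\<i> * v x))" (is ?scalar)
    and "(LINT x|lebesgue_on \<Omega>. (\<Sum>j\<in>UNIV. g x $ j * cnj (h x $ j))) =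
      Complex (LINT x|lebesgue_on \<Omega>. g x \<bullet> h x) (LINT x|lebesgue_on \<Omega>. g x \<bullet> (\<chi> j. \<i> * h x $ j))" (is ?vector)
proof -
  have cnjL: "(\<lambda>x. cnj (f x)) \<in> L2 \<Omega>" if "f \<in> L2 \<Omega>" for f by (rule L2_linear[OF bounded_linear_cnj that])
  have i1: "integrable (lebesgue_on \<Omega>) (\<lambda>x. \<Sum>j\<in>UNIV. g x $ j * cnj (h x $ j))"
    by (intro Bochner_Integration.integrable_sum L2_mult_integrable L2_component cnjL L)
  have i2: "integrable (lebesgue_on \<Omega>) (\<lambda>x. w x * cnj (v x))"
    by (intro L2_mult_integrable cnjL L)
  have "Re (\<Sum>j\<in>UNIV. g x $ j * cnj (h x $ j)) = g x \<bullet> h x"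
    "Im (\<Sum>j\<in>UNIV. g x $ j * cnj (h x $ j)) = g x \<bullet> (\<chi> j. \<i> * h x $ j)" for x
    by (simp_all add: inner_vec_def inner_complex_def algebra_simps)
  then show ?vector using integral_Re[OF i1] integral_Im[OF i1] by (simp add: complex_eq_iff)
  have "Re (w x * cnj (v x)) = w x \<bullet> v x" "Im (w x * cnj (v x)) = w x \<bullet> (\<i> * v x)" for x
    by (simp_all add: inner_complex_def algebra_simps)
  then show ?scalar using integral_Re[OF i2] integral_Im[OF i2] by (simp only: complex_eq_iff complex.sel)
qed

section \<open>Linear structure and closedness of the form domain\<close>

context
  fixes A :: "real^3 \<Rightarrow> real^3" and \<Omega> :: "(real^3) set"
  assumes A: "continuous_on UNIV A" and \<Omega>: "open \<Omega>"
begin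

lemma test_function_form_L2:
  assumes "\<psi> \<in> test_functions \<Omega>"
  shows "\<psi> \<in> L2 \<Omega>" "(\<lambda>x. \<i> * partial_deriv j \<psi> x + of_real (A x $ j) * \<psi> x) \<in> L2 \<Omega>"
  using test_function_L2(1)[OF assms \<Omega>, of "\<lambda>_. 1"]
    L2_add[OF test_function_L2(2)[OF assms \<Omega>, of "\<lambda>_. \<i>" j]
      test_function_L2(1)[OF assms \<Omega>, of "\<lambda>x. of_real (A x $ j)"]] A
  by (auto intro!: continuous_intros)

lemma mgraph_add_scaleR:
  assumes u: "(f, g) \<in> mgraph A \<Omega>" and v: "(f', g') \<in> mgraph A \<Omega>"
  shows "(\<lambda>x. f x + t *\<^sub>R f' x, \<lambda>x. g x + t *\<^sub>R g' x) \<in> mgraph A \<Omega>"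
proof -
  note D = mgraphD[OF u] and D' = mgraphD[OF v]
  have "magnetic_gradient A \<Omega> (\<lambda>x. f x + t *\<^sub>R f' x) (\<lambda>x. g x + t *\<^sub>R g' x)"
    unfolding magnetic_gradient_def
  proof (intro ballI allI)
    fix \<psi> j assume \<psi>: "\<psi> \<in> test_functions \<Omega>"
    note T = test_function_form_L2[OF \<psi>]
    let ?H = "\<lambda>x. \<i> * partial_deriv j \<psi> x + of_real (A x $ j) * \<psi> x"
    have "(LINT x|lebesgue_on \<Omega>. (g x + t *\<^sub>R g' x) $ j * \<psi> x) =
       (LINT x|lebesgue_on \<Omega>. g x $ j * \<psi> x + t *\<^sub>R (g' x $ j * \<psi> x))"
      by (simp add: algebra_simps)
    also have "\<dots> = (LINT x|lebesgue_on \<Omega>. g x $ j * \<psi> x) + t *\<^sub>R (LINT x|lebesgue_on \<Omega>. g' x $ j * \<psi> x)"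
      using L2_mult_integrable[OF L2_component[OF D(2)] T(1)] L2_mult_integrable[OF L2_component[OF D'(2)] T(1)]
      by (subst Bochner_Integration.integral_add) simp_all
    also have "\<dots> = (LINT x|lebesgue_on \<Omega>. f x * ?H x) + t *\<^sub>R (LINT x|lebesgue_on \<Omega>. f' x * ?H x)"
      by (simp only: magnetic_gradientD[OF D(3) \<psi>] magnetic_gradientD[OF D'(3) \<psi>])
    also have "\<dots> = (LINT x|lebesgue_on \<Omega>. f x * ?H x + t *\<^sub>R (f' x * ?H x))"
      using L2_mult_integrable[OF D(1) T(2)] L2_mult_integrable[OF D'(1) T(2)]
      by (subst Bochner_Integration.integral_add) simp_all
    also have "\<dots> = (LINT x|lebesgue_on \<Omega>. (f x + t *\<^sub>R f' x) * ?H x)" by (simp add: algebra_simps)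
    finally show "(LINT x|lebesgue_on \<Omega>. (g x + t *\<^sub>R g' x) $ j * \<psi> x) =
      (LINT x|lebesgue_on \<Omega>. (f x + t *\<^sub>R f' x) * ?H x)" .
  qed
  then show ?thesis using L2_add[OF D(1) L2_scaleR[OF D'(1)]] L2_add[OF D(2) L2_scaleR[OF D'(2)]]
    by (simp add: mgraph_def)
qed

text \<open>Testing a real identity with a pair and with this multiple of it recovers the complex
  identity.\<close>

lemma mgraph_imaginary_multiple:
  assumes u: "(f, g) \<in> mgraph A \<Omega>"
  shows "(\<lambda>x. \<i> * f x, \<lambda>x. \<chi> j. \<i> * g x $ j) \<in> mgraph A \<Omega>"
proof -
  note D = mgraphD[OF u]
  have "magnetic_gradient A \<Omega> (\<lambda>x. \<i> * f x) (\<lambda>x. \<chi> j. \<i> * g x $ j)"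
    unfolding magnetic_gradient_def
  proof (intro ballI allI)
    fix \<psi> j assume \<psi>: "\<psi> \<in> test_functions \<Omega>"
    have "(LINT x|lebesgue_on \<Omega>. g x $ j * \<psi> x) =
        (LINT x|lebesgue_on \<Omega>. f x * (\<i> * partial_deriv j \<psi> x + of_real (A x $ j) * \<psi> x))"
      by (rule magnetic_gradientD[OF D(3) \<psi>])
    then show "(LINT x|lebesgue_on \<Omega>. (\<chi> j. \<i> * g x $ j) $ j * \<psi> x) =
        (LINT x|lebesgue_on \<Omega>. (\<i> * f x) * (\<i> * partial_deriv j \<psi> x + of_real (A x $ j) * \<psi> x))"
      by (simp add: mult.assoc)
  qed
  moreover have "bounded_linear (\<lambda>z :: complex^3. \<chi> j. \<i> * z $ j)"
    by (rule linear_conv_bounded_linear[THEN iffD1], rule linearI) (auto simp: vec_eq_iff algebra_simps)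
  from L2_linear[OF this D(2)] have "(\<lambda>x. \<chi> j. \<i> * g x $ j) \<in> L2 \<Omega>" .
  ultimately show ?thesis using L2_cmult[OF D(1)] by (simp add: mgraph_def)
qed

text \<open>The form is closed: each side of the weak identity is a pairing with a fixed square
  integrable function, since \<open>\<psi>\<close> has compact support and \<open>A\<close> is
  continuous.\<close>

lemma mgraph_closed:
  assumes u: "\<And>n. (f n, g n) \<in> mgraph A \<Omega>" and fg: "f' \<in> L2 \<Omega>" "g' \<in> L2 \<Omega>"
    and lim: "(\<lambda>n. l2sq \<Omega> (\<lambda>x. f n x - f' x)) \<longlonglongrightarrow> 0" "(\<lambda>n. l2sq \<Omega> (\<lambda>x. g n x - g' x)) \<longlonglongrightarrow> 0"
  shows "(f', g') \<in> mgraph A \<Omega>"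
proof -
  have n: "norm (a * b) \<le> norm a * norm b" for a b :: complex by (simp add: norm_mult)
  note * = L2_bilinear_tendsto[OF bounded_bilinear_mult n]
  have "magnetic_gradient A \<Omega> f' g'"
    unfolding magnetic_gradient_def
  proof (intro ballI allI)
    fix \<psi> j assume \<psi>: "\<psi> \<in> test_functions \<Omega>"
    note T = test_function_form_L2[OF \<psi>]
    let ?H = "\<lambda>x. \<i> * partial_deriv j \<psi> x + of_real (A x $ j) * \<psi> x"
    have c: "(\<lambda>n. l2sq \<Omega> (\<lambda>x. g n x $ j - g' x $ j)) \<longlonglongrightarrow> 0"
    proof (rule tendsto_sandwich[OF _ _ tendsto_const lim(2)])
      have "l2sq \<Omega> (\<lambda>x. g n x $ j - g' x $ j) \<le> l2sq \<Omega> (\<lambda>x. g n x - g' x)" for n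
        using L2_diff[OF mgraphD(2)[OF u[of n]] fg(2)] L2_component[of "\<lambda>x. g n x - g' x" \<Omega> j]
        by (intro l2sq_mono) (auto simp: Finite_Cartesian_Product.norm_nth_le simp flip: vector_minus_component)
      then show "\<forall>\<^sub>F n in sequentially. l2sq \<Omega> (\<lambda>x. g n x $ j - g' x $ j) \<le> l2sq \<Omega> (\<lambda>x. g n x - g' x)" by simp
    qed (simp add: l2sq_nonneg)
    have 1: "(\<lambda>n. LINT x|lebesgue_on \<Omega>. g n x $ j * \<psi> x) \<longlonglongrightarrow> (LINT x|lebesgue_on \<Omega>. g' x $ j * \<psi> x)"
      by (rule *[OF L2_component[OF mgraphD(2)[OF u]] L2_component[OF fg(2)] T(1) c])
    have 2: "(\<lambda>n. LINT x|lebesgue_on \<Omega>. f n x * ?H x) \<longlonglongrightarrow> (LINT x|lebesgue_on \<Omega>. f' x * ?H x)"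
      by (rule *[OF mgraphD(1)[OF u] fg(1) T(2) lim(1)])
    show "(LINT x|lebesgue_on \<Omega>. g' x $ j * \<psi> x) = (LINT x|lebesgue_on \<Omega>. f' x * ?H x)"
      by (rule LIMSEQ_unique[OF 1]) (use 2 in \<open>simp only: magnetic_gradientD[OF mgraphD(3)[OF u] \<psi>]\<close>)
  qed
  then show ?thesis using fg by (simp add: mgraph_def)
qed

text \<open>The complex weak equation follows from its real part because the set of test pairs is
  stable under multiplication by the imaginary unit.\<close>

lemma neumann_laplacian_iff:
  "neumann_laplacian A \<Omega> f w \<longleftrightarrow> w \<in> L2 \<Omega> \<and> (\<exists>g. (f, g) \<in> mgraph A \<Omega> \<and>
     (\<forall>(v, h)\<in>mgraph A \<Omega>. (LINT x|lebesgue_on \<Omega>. g x \<bullet> h x) = (LINT x|lebesgue_on \<Omega>. w x \<bullet> v x)))"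
  (is "?L \<longleftrightarrow> ?R")
proof
  assume ?L
  then obtain g where g: "f \<in> L2 \<Omega>" "w \<in> L2 \<Omega>" "g \<in> L2 \<Omega>" "magnetic_gradient A \<Omega> f g"
    and e: "\<And>v h. v \<in> L2 \<Omega> \<Longrightarrow> h \<in> L2 \<Omega> \<Longrightarrow> magnetic_gradient A \<Omega> v h \<Longrightarrow>
         (LINT x|lebesgue_on \<Omega>. (\<Sum>j\<in>UNIV. g x $ j * cnj (h x $ j))) =
         (LINT x|lebesgue_on \<Omega>. w x * cnj (v x))"
    unfolding neumann_laplacian_def by blast
  have "(LINT x|lebesgue_on \<Omega>. g x \<bullet> h x) = (LINT x|lebesgue_on \<Omega>. w x \<bullet> v x)" if "(v, h) \<in> mgraph A \<Omega>" for v h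
    using e[OF mgraphD[OF that]] complex_inner_product[OF g(2) mgraphD(1)[OF that] g(3) mgraphD(2)[OF that]] by simp
  with g show ?R by (auto simp: mgraph_def)
next
  assume ?R
  then obtain g where w: "w \<in> L2 \<Omega>" and g: "(f, g) \<in> mgraph A \<Omega>"
    and e: "\<And>v h. (v, h) \<in> mgraph A \<Omega> \<Longrightarrow> (LINT x|lebesgue_on \<Omega>. g x \<bullet> h x) = (LINT x|lebesgue_on \<Omega>. w x \<bullet> v x)"
    by blast
  note D = mgraphD[OF g]
  have "(LINT x|lebesgue_on \<Omega>. (\<Sum>j\<in>UNIV. g x $ j * cnj (h x $ j))) = (LINT x|lebesgue_on \<Omega>. w x * cnj (v x))"
    if "v \<in> L2 \<Omega>" "h \<in> L2 \<Omega>" "magnetic_gradient A \<Omega> v h" for v h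
  proof -
    have m: "(v, h) \<in> mgraph A \<Omega>" using that by (simp add: mgraph_def)
    show ?thesis using e[OF m] e[OF mgraph_imaginary_multiple[OF m]] complex_inner_product[OF w that(1) D(2) that(2)] by simp
  qed
  with D w show ?L unfolding neumann_laplacian_def by blast
qed

end

text \<open>The lower bounds of the Rayleigh quotient, written without division so that functions
  vanishing almost everywhere need no exception.\<close>

definition low_bounds :: "(real^3 \<Rightarrow> real^3) \<Rightarrow> (real^3) set \<Rightarrow> real set" where
  "low_bounds A \<Omega> = {l. \<forall>(f, g)\<in>mgraph A \<Omega>. l * l2sq \<Omega> f \<le> l2sq \<Omega> g}"

section \<open>The shifted equation and the bottom of the spectrum\<close>

context
  fixes A :: "real^3 \<Rightarrow> real^3" and \<Omega> :: "(real^3) set"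
  assumes A: "continuous_on UNIV A" and \<Omega>: "open \<Omega>"
begin

text \<open>The form shifted by a lower bound is nonnegative on all combinations of the two pairs,
  hence its discriminant is not positive.\<close>

lemma form_Cauchy_Schwarz:
  assumes l: "l \<in> low_bounds A \<Omega>" and u: "(f, g) \<in> mgraph A \<Omega>" and v: "(f', g') \<in> mgraph A \<Omega>"
  shows "((LINT x|lebesgue_on \<Omega>. g x \<bullet> g' x) - l * (LINT x|lebesgue_on \<Omega>. f x \<bullet> f' x))\<^sup>2
    \<le> (l2sq \<Omega> g - l * l2sq \<Omega> f) * (l2sq \<Omega> g' - l * l2sq \<Omega> f')"
proof (rule discriminant_nonpos)
  note D = mgraphD[OF u] and D' = mgraphD[OF v]
  show "0 \<le> l2sq \<Omega> g' - l * l2sq \<Omega> f'" using l v by (auto simp: low_bounds_def)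
  fix t
  have "l * l2sq \<Omega> (\<lambda>x. f x + t *\<^sub>R f' x) \<le> l2sq \<Omega> (\<lambda>x. g x + t *\<^sub>R g' x)"
    using l mgraph_add_scaleR[OF A \<Omega> u v, of t] by (auto simp: low_bounds_def)
  then show "0 \<le> l2sq \<Omega> g - l * l2sq \<Omega> f + 2 * t * ((LINT x|lebesgue_on \<Omega>. g x \<bullet> g' x) -
      l * (LINT x|lebesgue_on \<Omega>. f x \<bullet> f' x)) + t\<^sup>2 * (l2sq \<Omega> g' - l * l2sq \<Omega> f')"
    unfolding l2sq_add[OF D(1) D'(1)] l2sq_add[OF D(2) D'(2)] by (simp add: algebra_simps)
qed

text \<open>The solution is the minimiser of the functional \<open>J\<close>, obtained as the limit of a minimising
  sequence, which is a Cauchy sequence by the parallelogram identity.\<close>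

lemma form_equation_solvable:
  assumes l0: "l0 \<in> low_bounds A \<Omega>" and l: "l < l0" and w: "w \<in> L2 \<Omega>"
  shows "\<exists>f g. (f, g) \<in> mgraph A \<Omega> \<and> (\<forall>(v, h)\<in>mgraph A \<Omega>.
     (LINT x|lebesgue_on \<Omega>. g x \<bullet> h x) - l * (LINT x|lebesgue_on \<Omega>. f x \<bullet> v x) = (LINT x|lebesgue_on \<Omega>. w x \<bullet> v x))"
proof -
  define a where "a f g = l2sq \<Omega> g - l * l2sq \<Omega> f" for f :: "real^3 \<Rightarrow> complex" and g :: "real^3 \<Rightarrow> complex^3"
  define ip where "ip f v = (LINT x|lebesgue_on \<Omega>. f x \<bullet> v x)" for f v :: "real^3 \<Rightarrow> complex"
  define ip3 where "ip3 g h = (LINT x|lebesgue_on \<Omega>. g x \<bullet> h x)" for g h :: "real^3 \<Rightarrow> complex^3"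
  define J where "J f g = a f g - 2 * ip w f" for f g
  define c where "c = l0 - l"
  have c: "c > 0" using l by (simp add: c_def)
  have coercive: "c * l2sq \<Omega> f \<le> a f g" if "(f, g) \<in> mgraph A \<Omega>" for f g
    using l0 that by (auto simp: low_bounds_def a_def c_def algebra_simps)
  have ip_add: "ip w (\<lambda>x. f x + t *\<^sub>R f' x) = ip w f + t * ip w f'" if "f \<in> L2 \<Omega>" "f' \<in> L2 \<Omega>" for f f' t
    using L2_inner_integrable[OF w that(1)] L2_inner_integrable[OF w that(2)]
    unfolding ip_def by (simp add: inner_add_right)
  have a_add: "a (\<lambda>x. f x + t *\<^sub>R f' x) (\<lambda>x. g x + t *\<^sub>R g' x) =
      a f g + 2 * t * (ip3 g g' - l * ip f f') + t\<^sup>2 * a f' g'"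
    if "(f, g) \<in> mgraph A \<Omega>" "(f', g') \<in> mgraph A \<Omega>" for f g f' g' t
    unfolding a_def ip_def ip3_def l2sq_add[OF mgraphD(1)[OF that(1)] mgraphD(1)[OF that(2)]]
      l2sq_add[OF mgraphD(2)[OF that(1)] mgraphD(2)[OF that(2)]] by (simp add: algebra_simps)
  have J_add: "J (\<lambda>x. f x + t *\<^sub>R f' x) (\<lambda>x. g x + t *\<^sub>R g' x) =
      J f g + 2 * t * (ip3 g g' - l * ip f f' - ip w f') + t\<^sup>2 * a f' g'"
    if "(f, g) \<in> mgraph A \<Omega>" "(f', g') \<in> mgraph A \<Omega>" for f g f' g' t
    unfolding J_def a_add[OF that] ip_add[OF mgraphD(1)[OF that(1)] mgraphD(1)[OF that(2)]]
    by (simp add: algebra_simps)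
  \<comment> \<open>Completing the square in the distance of \<open>f\<close> from \<open>w\<close>
    divided by \<open>c\<close>; beyond this only coercivity is used.\<close>
  have J_bound: "J f g \<ge> - (l2sq \<Omega> w / c)" if "(f, g) \<in> mgraph A \<Omega>" for f g
  proof -
    have "0 \<le> l2sq \<Omega> (\<lambda>x. f x + (- 1 / c) *\<^sub>R w x)" by (rule l2sq_nonneg)
    also have "\<dots> = l2sq \<Omega> f - 2 / c * ip w f + l2sq \<Omega> w / c\<^sup>2"
      unfolding l2sq_add[OF mgraphD(1)[OF that] w] ip_def
      by (simp add: power2_eq_square inner_commute)
    finally have "0 \<le> c * (l2sq \<Omega> f - 2 / c * ip w f + l2sq \<Omega> w / c\<^sup>2)" using c by simp
    also have "\<dots> = c * l2sq \<Omega> f - 2 * ip w f + l2sq \<Omega> w / c"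
      using c by (simp add: field_simps power2_eq_square)
    finally show ?thesis using coercive[OF that] unfolding J_def by linarith
  qed
  define X where "X = {J f g | f g. (f, g) \<in> mgraph A \<Omega>}"
  have bdd: "bdd_below X" unfolding X_def bdd_below_def using J_bound by blast
  have "(\<lambda>x. 0, \<lambda>x. 0) \<in> mgraph A \<Omega>"
    by (simp add: mgraph_def L2_zero magnetic_gradient_def)
  then have ne: "X \<noteq> {}" unfolding X_def by blast
  define m where "m = Inf X"
  have m_le: "m \<le> J f g" if "(f, g) \<in> mgraph A \<Omega>" for f g
    unfolding m_def by (rule cInf_lower[OF _ bdd]) (use that X_def in blast)
  have "\<exists>f g. (f, g) \<in> mgraph A \<Omega> \<and> J f g < m + 1 / real (Suc n)" for n
  proof -
    have "Inf X < m + 1 / real (Suc n)" unfolding m_def by simp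
    then obtain y where "y \<in> X" "y < m + 1 / real (Suc n)" using cInf_lessD[OF ne] by blast
    then show ?thesis unfolding X_def by blast
  qed
  then obtain f g where fg: "\<And>n. (f n, g n) \<in> mgraph A \<Omega>" and Jn: "\<And>n. J (f n) (g n) < m + 1 / real (Suc n)"
    by metis
  note fL = mgraphD(1)[OF fg] and gL = mgraphD(2)[OF fg]
  have small: "a (\<lambda>x. f n x - f k x) (\<lambda>x. g n x - g k x) \<le> 2 / real (Suc n) + 2 / real (Suc k)" for n k
  proof -
    let ?b = "ip3 (g n) (g k) - l * ip (f n) (f k)"
    have "(\<lambda>x. f n x + (-1) *\<^sub>R f k x, \<lambda>x. g n x + (-1) *\<^sub>R g k x) \<in> mgraph A \<Omega>"
      by (rule mgraph_add_scaleR[OF A \<Omega> fg fg])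
    then have d: "(\<lambda>x. f k x + (1/2) *\<^sub>R (f n x - f k x), \<lambda>x. g k x + (1/2) *\<^sub>R (g n x - g k x)) \<in> mgraph A \<Omega>"
      using mgraph_add_scaleR[OF A \<Omega> fg[of k], of "\<lambda>x. f n x - f k x" "\<lambda>x. g n x - g k x" "1/2"] by simp
    then have d': "(\<lambda>x. f k x + (1/2) *\<^sub>R (f n x - f k x), \<lambda>x. g k x + (1/2) *\<^sub>R (g n x - g k x))
        = (\<lambda>x. (1/2) *\<^sub>R f n x + (1/2) *\<^sub>R f k x, \<lambda>x. (1/2) *\<^sub>R g n x + (1/2) *\<^sub>R g k x)"
      by (auto simp: fun_eq_iff algebra_simps simp flip: scaleR_add_left)
    have diff: "a (\<lambda>x. f n x - f k x) (\<lambda>x. g n x - g k x) = a (f n) (g n) - 2 * ?b + a (f k) (g k)"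
      using a_add[OF fg[of n] fg[of k], of "-1"] by simp
    \<comment> \<open>Half of a pair arises as the pair plus -1/2 times itself, because closure
      under adding a multiple of a pair is the operation at hand.\<close>
    have hf: "((\<lambda>x. (1/2) *\<^sub>R f n x), (\<lambda>x. (1/2) *\<^sub>R g n x)) \<in> mgraph A \<Omega>" for n
    proof -
      have "(\<lambda>x. f n x + (-1/2) *\<^sub>R f n x, \<lambda>x. g n x + (-1/2) *\<^sub>R g n x) \<in> mgraph A \<Omega>"
        by (rule mgraph_add_scaleR[OF A \<Omega> fg fg])
      moreover have "y + (-1/2) *\<^sub>R y = (1/2) *\<^sub>R y" for y :: complex
        using scaleR_add_left[of 1 "-1/2" y] by simp
      moreover have "y + (-1/2) *\<^sub>R y = (1/2) *\<^sub>R y" for y :: "complex^3"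
        using scaleR_add_left[of 1 "-1/2" y] by simp
      ultimately show ?thesis by (simp only:)
    qed
    \<comment> \<open>The midpoint cannot lie below the infimum. Comparing it with the two nearly
      minimal values isolates the form of the difference.\<close>
    have "m \<le> J (\<lambda>x. (1/2) *\<^sub>R f n x + (1/2) *\<^sub>R f k x) (\<lambda>x. (1/2) *\<^sub>R g n x + (1/2) *\<^sub>R g k x)"
      by (rule m_le[OF mgraph_add_scaleR[OF A \<Omega> hf fg]])
    also have "\<dots> = (a (f n) (g n) + 2 * ?b + a (f k) (g k)) / 4 - (ip w (f n) + ip w (f k))"
    proof -
      have q: "a (\<lambda>x. (1/2) *\<^sub>R f n x) (\<lambda>x. (1/2) *\<^sub>R g n x) = a (f n) (g n) / 4"
        unfolding a_def l2sq_scaleR by (simp add: power2_eq_square)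
      have r: "ip3 (\<lambda>x. (1/2) *\<^sub>R g n x) (g k) = ip3 (g n) (g k) / 2" "ip (\<lambda>x. (1/2) *\<^sub>R f n x) (f k) = ip (f n) (f k) / 2"
        "ip w (\<lambda>x. (1/2) *\<^sub>R f n x) = ip w (f n) / 2"
        unfolding ip_def ip3_def by simp_all
      show ?thesis
        unfolding J_def a_add[OF hf fg] ip_add[OF mgraphD(1)[OF hf] fL] q r
        by (simp add: power2_eq_square algebra_simps add_divide_distrib diff_divide_distrib)
    qed
    finally have "4 * m \<le> a (f n) (g n) + 2 * ?b + a (f k) (g k) - 4 * ip w (f n) - 4 * ip w (f k)"
      by (simp add: field_simps)
    then show ?thesis
      unfolding diff using Jn[of n] Jn[of k] unfolding J_def
      by (simp add: algebra_simps del: of_nat_Suc)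
  qed
  have mdiff: "(\<lambda>x. f n x - f k x, \<lambda>x. g n x - g k x) \<in> mgraph A \<Omega>" for n k
    using mgraph_add_scaleR[OF A \<Omega> fg[of n] fg[of k], of "-1"] by simp
  \<comment> \<open>One constant for both norms: \<open>1 / c\<close> controls \<open>f\<close> by
    coercivity, and \<open>1 + \<bar>l\<bar> / c\<close> controls \<open>g\<close>, whose squared
    norm is the form plus \<open>l\<close> times that of \<open>f\<close>.\<close>
  define d where "d = 1 / c + (1 + \<bar>l\<bar> / c)"
  have d0: "d > 0" using c unfolding d_def by (simp add: add_pos_nonneg)
  have bounds: "l2sq \<Omega> (\<lambda>x. f n x - f k x) \<le> d * a (\<lambda>x. f n x - f k x) (\<lambda>x. g n x - g k x)"
    "l2sq \<Omega> (\<lambda>x. g n x - g k x) \<le> d * a (\<lambda>x. f n x - f k x) (\<lambda>x. g n x - g k x)" for n k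
  proof -
    let ?F = "l2sq \<Omega> (\<lambda>x. f n x - f k x)" and ?G = "l2sq \<Omega> (\<lambda>x. g n x - g k x)"
    let ?a = "a (\<lambda>x. f n x - f k x) (\<lambda>x. g n x - g k x)"
    have F: "?F \<le> ?a / c" using coercive[OF mdiff, of n k] c by (simp add: field_simps)
    have a0: "?a \<ge> 0" 
      by (rule order_trans[OF mult_nonneg_nonneg[OF less_imp_le[OF c] l2sq_nonneg] coercive[OF mdiff]])
    have "d * ?a = ?a / c + ?a + \<bar>l\<bar> * (?a / c)" by (simp add: d_def algebra_simps)
    moreover have "\<bar>l\<bar> * (?a / c) \<ge> \<bar>l\<bar> * ?F" using F by (intro mult_left_mono) auto
    moreover have "\<bar>l\<bar> * ?F \<ge> l * ?F" using l2sq_nonneg by (intro mult_right_mono) auto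
    moreover have "\<bar>l\<bar> * ?F \<ge> 0" by (intro mult_nonneg_nonneg abs_ge_zero l2sq_nonneg)
    moreover have "?G = ?a + l * ?F" by (simp add: a_def)
    moreover have "?a / c \<ge> 0" using a0 c by simp
    ultimately show "?F \<le> d * ?a" "?G \<le> d * ?a" using F a0 by linarith+
  qed
  have Cauchy: "\<exists>N. \<forall>n\<ge>N. \<forall>k\<ge>N. d * a (\<lambda>x. f n x - f k x) (\<lambda>x. g n x - g k x) < e" if "e > 0" for e
  proof -
    obtain N where N: "4 * d / e < real N" using reals_Archimedean2 by blast
    have "d * a (\<lambda>x. f n x - f k x) (\<lambda>x. g n x - g k x) < e" if "n \<ge> N" "k \<ge> N" for n k
    proof -
      have "2 / real (Suc n) \<le> 2 / real (Suc N)" "2 / real (Suc k) \<le> 2 / real (Suc N)"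
        using that by (auto intro!: divide_left_mono)
      then have "a (\<lambda>x. f n x - f k x) (\<lambda>x. g n x - g k x) \<le> 4 / real (Suc N)"
        using small[of n k] by linarith
      then have "d * a (\<lambda>x. f n x - f k x) (\<lambda>x. g n x - g k x) \<le> d * (4 / real (Suc N))"
        using d0 by (intro mult_left_mono) auto
      also have "\<dots> < e" using N \<open>e > 0\<close> by (simp add: field_simps)
      finally show ?thesis .
    qed
    then show ?thesis by blast
  qed
  have "\<exists>N. \<forall>n\<ge>N. \<forall>k\<ge>N. l2sq \<Omega> (\<lambda>x. f n x - f k x) < e" if "e > 0" for e
    using Cauchy[OF that] le_less_trans[OF bounds(1)] by blast
  from L2_complete[of f, OF fL this] obtain f'
    where f': "f' \<in> L2 \<Omega>" "(\<lambda>n. l2sq \<Omega> (\<lambda>x. f n x - f' x)) \<longlonglongrightarrow> 0" by blast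
  have "\<exists>N. \<forall>n\<ge>N. \<forall>k\<ge>N. l2sq \<Omega> (\<lambda>x. g n x - g k x) < e" if "e > 0" for e
    using Cauchy[OF that] le_less_trans[OF bounds(2)] by blast
  from L2_complete[of g, OF gL this] obtain g'
    where g': "g' \<in> L2 \<Omega>" "(\<lambda>n. l2sq \<Omega> (\<lambda>x. g n x - g' x)) \<longlonglongrightarrow> 0" by blast
  have fg': "(f', g') \<in> mgraph A \<Omega>" by (rule mgraph_closed[OF A \<Omega> fg f'(1) g'(1) f'(2) g'(2)])
  have n: "norm (a \<bullet> b) \<le> norm a * norm b" for a b :: "'z::euclidean_space"
    by (simp add: Cauchy_Schwarz_ineq2)
  note lim = L2_bilinear_tendsto[OF bounded_bilinear_inner n]
  have "ip3 g' h - l * ip f' v = ip w v" if vh: "(v, h) \<in> mgraph A \<Omega>" for v h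
  proof -
    define b where "b n = ip3 (g n) h - l * ip (f n) v - ip w v" for n
    \<comment> \<open>The value at the \<open>n\<close>-th pair exceeds the infimum by less than
      \<open>1 / real (Suc n)\<close>. So the parabola of values in direction \<open>(v, h)\<close>,
      raised by this amount, stays nonnegative, and its discriminant bounds the first variation
      \<open>b n\<close>.\<close>
    have b1: "(b n)\<^sup>2 \<le> (1 / real (Suc n)) * a v h" for n
    proof (rule discriminant_nonpos)
      show "0 \<le> a v h" 
        by (rule order_trans[OF mult_nonneg_nonneg[OF less_imp_le[OF c] l2sq_nonneg] coercive[OF vh]])
      fix t
      have "m \<le> J (\<lambda>x. f n x + t *\<^sub>R v x) (\<lambda>x. g n x + t *\<^sub>R h x)"
        by (rule m_le[OF mgraph_add_scaleR[OF A \<Omega> fg vh]])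
      then show "0 \<le> 1 / real (Suc n) + 2 * t * b n + t\<^sup>2 * a v h"
        unfolding J_add[OF fg vh] b_def using Jn[of n] by linarith
    qed
    have b2: "(\<lambda>n. (1 / real (Suc n)) * a v h) \<longlonglongrightarrow> 0"
      using tendsto_mult[OF LIMSEQ_Suc[OF lim_1_over_n] tendsto_const, of "a v h"] by simp
    have 1: "(\<lambda>n. (b n)\<^sup>2) \<longlonglongrightarrow> 0"
      by (rule tendsto_sandwich[OF _ _ tendsto_const b2]) (use b1 in auto)
    have "b \<longlonglongrightarrow> ip3 g' h - l * ip f' v - ip w v"
      unfolding b_def ip_def ip3_def
      by (intro tendsto_intros lim fL gL f' g' mgraphD[OF vh])
    then have "(\<lambda>n. (b n)\<^sup>2) \<longlonglongrightarrow> (ip3 g' h - l * ip f' v - ip w v)\<^sup>2" by (intro tendsto_intros)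
    from LIMSEQ_unique[OF this 1] have "(ip3 g' h - l * ip f' v - ip w v)\<^sup>2 = 0" .
    then show ?thesis by simp
  qed
  with fg' show ?thesis unfolding ip_def ip3_def by blast
qed

text \<open>The variational form of (H - l) f = w for real \<open>l\<close>, in which both existence
  and bounds are proved.\<close>

lemma neumann_shift_iff:
  "neumann_laplacian A \<Omega> f (\<lambda>x. w x + complex_of_real l * f x) \<longleftrightarrow> w \<in> L2 \<Omega> \<and> (\<exists>g. (f, g) \<in> mgraph A \<Omega> \<and>
     (\<forall>(v, h)\<in>mgraph A \<Omega>. (LINT x|lebesgue_on \<Omega>. g x \<bullet> h x) - l * (LINT x|lebesgue_on \<Omega>. f x \<bullet> v x) =
       (LINT x|lebesgue_on \<Omega>. w x \<bullet> v x)))"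
proof -
  have s: "(\<lambda>x. w x + complex_of_real l * f x) = (\<lambda>x. w x + l *\<^sub>R f x)" by (simp add: scaleR_conv_of_real)
  have w: "(\<lambda>x. w x + l *\<^sub>R f x) \<in> L2 \<Omega> \<longleftrightarrow> w \<in> L2 \<Omega>" if "f \<in> L2 \<Omega>"
    using L2_add[OF _ L2_scaleR[OF that], of w l] L2_diff[OF _ L2_scaleR[OF that], of "\<lambda>x. w x + l *\<^sub>R f x" l] by auto
  have e: "(LINT x|lebesgue_on \<Omega>. (w x + l *\<^sub>R f x) \<bullet> v x) =
      (LINT x|lebesgue_on \<Omega>. w x \<bullet> v x) + l * (LINT x|lebesgue_on \<Omega>. f x \<bullet> v x)"
    if "f \<in> L2 \<Omega>" "w \<in> L2 \<Omega>" "v \<in> L2 \<Omega>" for v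
    using L2_inner_integrable[OF that(1,3)] L2_inner_integrable[OF that(2,3)]
    by (simp add: inner_add_left)
  show ?thesis
  proof
    assume "neumann_laplacian A \<Omega> f (\<lambda>x. w x + complex_of_real l * f x)"
    then obtain g where g: "(\<lambda>x. w x + l *\<^sub>R f x) \<in> L2 \<Omega>" "(f, g) \<in> mgraph A \<Omega>"
      "\<And>v h. (v, h)\<in>mgraph A \<Omega> \<Longrightarrow> (LINT x|lebesgue_on \<Omega>. g x \<bullet> h x) = (LINT x|lebesgue_on \<Omega>. (w x + l *\<^sub>R f x) \<bullet> v x)"
      unfolding neumann_laplacian_iff[OF A \<Omega>] s by blast
    have wL: "w \<in> L2 \<Omega>" using w g mgraphD by blast
    have "(LINT x|lebesgue_on \<Omega>. g x \<bullet> h x) - l * (LINT x|lebesgue_on \<Omega>. f x \<bullet> v x) =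
       (LINT x|lebesgue_on \<Omega>. w x \<bullet> v x)" if "(v, h)\<in>mgraph A \<Omega>" for v h
      using g(3)[OF that] e[OF mgraphD(1)[OF g(2)] wL mgraphD(1)[OF that]] by simp
    with wL g(2) show "w \<in> L2 \<Omega> \<and> (\<exists>g. (f, g) \<in> mgraph A \<Omega> \<and>
     (\<forall>(v, h)\<in>mgraph A \<Omega>. (LINT x|lebesgue_on \<Omega>. g x \<bullet> h x) - l * (LINT x|lebesgue_on \<Omega>. f x \<bullet> v x) =
       (LINT x|lebesgue_on \<Omega>. w x \<bullet> v x)))" by blast
  next
    assume "w \<in> L2 \<Omega> \<and> (\<exists>g. (f, g) \<in> mgraph A \<Omega> \<and>
     (\<forall>(v, h)\<in>mgraph A \<Omega>. (LINT x|lebesgue_on \<Omega>. g x \<bullet> h x) - l * (LINT x|lebesgue_on \<Omega>. f x \<bullet> v x) =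
       (LINT x|lebesgue_on \<Omega>. w x \<bullet> v x)))"
    then obtain g where g: "w \<in> L2 \<Omega>" "(f, g) \<in> mgraph A \<Omega>"
      "\<And>v h. (v, h)\<in>mgraph A \<Omega> \<Longrightarrow> (LINT x|lebesgue_on \<Omega>. g x \<bullet> h x) - l * (LINT x|lebesgue_on \<Omega>. f x \<bullet> v x) =
       (LINT x|lebesgue_on \<Omega>. w x \<bullet> v x)" by blast
    have "(LINT x|lebesgue_on \<Omega>. g x \<bullet> h x) = (LINT x|lebesgue_on \<Omega>. (w x + l *\<^sub>R f x) \<bullet> v x)"
      if "(v, h)\<in>mgraph A \<Omega>" for v h
      using g(3)[OF that] e[OF mgraphD(1)[OF g(2)] g(1) mgraphD(1)[OF that]] by simp
    then show "neumann_laplacian A \<Omega> f (\<lambda>x. w x + complex_of_real l * f x)"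
      unfolding neumann_laplacian_iff[OF A \<Omega>] s using w[OF mgraphD(1)[OF g(2)]] g(1,2) by blast
  qed
qed

text \<open>Surjectivity is the minimisation. The bounded inverse comes from testing the equation
  with \<open>f\<close> itself: (l0 - l) |f|^2 is at most the pairing of \<open>w\<close> with
  \<open>f\<close>, hence at most |w| |f|.\<close>

lemma resolvent_below:
  assumes l0: "l0 \<in> low_bounds A \<Omega>" and l: "l < l0"
  shows "complex_of_real l \<in> neumann_resolvent_set A \<Omega>"
  unfolding neumann_resolvent_set_def mem_Collect_eq
proof (intro conjI ballI)
  fix w :: "real^3 \<Rightarrow> complex" assume w: "w \<in> L2 \<Omega>"
  then show "\<exists>f. neumann_laplacian A \<Omega> f (\<lambda>x. w x + complex_of_real l * f x)"
    unfolding neumann_shift_iff using form_equation_solvable[OF l0 l w] by blast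
next
  show "\<exists>c. \<forall>f w. neumann_laplacian A \<Omega> f (\<lambda>x. w x + complex_of_real l * f x) \<longrightarrow>
        (LINT x|lebesgue_on \<Omega>. (norm (f x))\<^sup>2) \<le> c * (LINT x|lebesgue_on \<Omega>. (norm (w x))\<^sup>2)"
  proof (intro exI allI impI)
    fix f w assume "neumann_laplacian A \<Omega> f (\<lambda>x. w x + complex_of_real l * f x)"
    then obtain g where w: "w \<in> L2 \<Omega>" and fg: "(f, g) \<in> mgraph A \<Omega>"
      and e: "(LINT x|lebesgue_on \<Omega>. g x \<bullet> g x) - l * (LINT x|lebesgue_on \<Omega>. f x \<bullet> f x) =
         (LINT x|lebesgue_on \<Omega>. w x \<bullet> f x)"
      unfolding neumann_shift_iff by blast
    have "(l0 - l) * l2sq \<Omega> f \<le> (LINT x|lebesgue_on \<Omega>. w x \<bullet> f x)"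
      using l0 fg e by (auto simp: low_bounds_def l2sq_def power2_norm_eq_inner algebra_simps)
    then have "((l0 - l) * l2sq \<Omega> f)\<^sup>2 \<le> (LINT x|lebesgue_on \<Omega>. w x \<bullet> f x)\<^sup>2"
      using l l2sq_nonneg[of \<Omega> f] by (intro power_mono) auto
    also have "\<dots> \<le> l2sq \<Omega> w * l2sq \<Omega> f" by (rule L2_Cauchy_Schwarz[OF w mgraphD(1)[OF fg]])
    finally have b: "((l0 - l)\<^sup>2 * l2sq \<Omega> f) * l2sq \<Omega> f \<le> l2sq \<Omega> w * l2sq \<Omega> f"
      by (simp add: power2_eq_square algebra_simps)
    have "(l0 - l)\<^sup>2 * l2sq \<Omega> f \<le> l2sq \<Omega> w"
    proof (cases "l2sq \<Omega> f = 0")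
      case False
      then have "l2sq \<Omega> f > 0" using l2sq_nonneg[of \<Omega> f] by linarith
      then show ?thesis using b by simp
    qed (simp add: l2sq_nonneg)
    then show "(LINT x|lebesgue_on \<Omega>. (norm (f x))\<^sup>2) \<le> (1 / (l0 - l)\<^sup>2) * (LINT x|lebesgue_on \<Omega>. (norm (w x))\<^sup>2)"
      using l unfolding l2sq_def by (simp add: field_simps)
  qed
qed

text \<open>If (H - l0) had a bounded inverse, solve (H - l0) v = f for a nearly minimising
  \<open>f\<close>. Cauchy-Schwarz for the shifted form, whose value at \<open>f\<close> is at most
  \<open>e\<close> times |f|^2, then bounds |f|^2 by \<open>e\<close> times the pairing of
  \<open>f\<close> with \<open>v\<close>, and the bound on \<open>v\<close> makes this impossible
  for small \<open>e\<close>.\<close>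

lemma not_resolvent_bottom:
  assumes l0: "l0 \<in> low_bounds A \<Omega>" and max: "\<And>l. l \<in> low_bounds A \<Omega> \<Longrightarrow> l \<le> l0"
  shows "complex_of_real l0 \<notin> neumann_resolvent_set A \<Omega>"
proof
  assume "complex_of_real l0 \<in> neumann_resolvent_set A \<Omega>"
  then obtain c where onto: "\<And>w. w \<in> L2 \<Omega> \<Longrightarrow> \<exists>f. neumann_laplacian A \<Omega> f (\<lambda>x. w x + complex_of_real l0 * f x)"
    and c: "\<And>f w. neumann_laplacian A \<Omega> f (\<lambda>x. w x + complex_of_real l0 * f x) \<Longrightarrow> l2sq \<Omega> f \<le> c * l2sq \<Omega> w"
    unfolding neumann_resolvent_set_def l2sq_def by blast
  \<comment> \<open>Small enough for e^2 |c| < 1, which refutes the inequality 1 <= e^2 |c| reached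
    at the end.\<close>
  define e where "e = 1 / (\<bar>c\<bar> + 1)"
  have e: "e > 0" by (simp add: e_def)
  have "\<not> l0 + e \<in> low_bounds A \<Omega>" using max[of "l0 + e"] e by linarith
  then obtain f g where fg: "(f, g) \<in> mgraph A \<Omega>" and small: "l2sq \<Omega> g < (l0 + e) * l2sq \<Omega> f"
    by (auto simp: low_bounds_def not_le)
  note fL = mgraphD(1)[OF fg]
  obtain v where v: "neumann_laplacian A \<Omega> v (\<lambda>x. f x + complex_of_real l0 * v x)" using onto[OF fL] by blast
  then obtain h where vh: "(v, h) \<in> mgraph A \<Omega>"
    and eq: "\<And>v' h'. (v', h')\<in>mgraph A \<Omega> \<Longrightarrow> (LINT x|lebesgue_on \<Omega>. h x \<bullet> h' x) - l0 * (LINT x|lebesgue_on \<Omega>. v x \<bullet> v' x) =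
       (LINT x|lebesgue_on \<Omega>. f x \<bullet> v' x)"
    unfolding neumann_shift_iff by blast
  let ?p = "LINT x|lebesgue_on \<Omega>. f x \<bullet> v x"
  have sq: "l2sq \<Omega> f = (LINT x|lebesgue_on \<Omega>. f x \<bullet> f x)" for f :: "real^3 \<Rightarrow> 'z::euclidean_space"
    by (simp add: l2sq_def power2_norm_eq_inner)
  have p: "l2sq \<Omega> h - l0 * l2sq \<Omega> v = ?p" using eq[OF vh] by (simp add: sq)
  have "(l2sq \<Omega> f)\<^sup>2 \<le> (l2sq \<Omega> h - l0 * l2sq \<Omega> v) * (l2sq \<Omega> g - l0 * l2sq \<Omega> f)"
    using form_Cauchy_Schwarz[OF l0 vh fg] unfolding eq[OF fg] by (simp add: sq)
  also have "\<dots> \<le> ?p * (e * l2sq \<Omega> f)"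
  proof -
    have "l2sq \<Omega> g - l0 * l2sq \<Omega> f \<le> e * l2sq \<Omega> f" using small by (simp add: algebra_simps)
    moreover have "0 \<le> ?p" using l0 vh unfolding p[symmetric] by (auto simp: low_bounds_def)
    ultimately show ?thesis unfolding p by (intro mult_left_mono) auto
  qed
  finally have 1: "(l2sq \<Omega> f)\<^sup>2 \<le> e * ?p * l2sq \<Omega> f" by (simp add: algebra_simps)
  have F: "l2sq \<Omega> f > 0"
  proof (rule ccontr)
    assume "\<not> l2sq \<Omega> f > 0"
    then have "l2sq \<Omega> f = 0" using l2sq_nonneg[of \<Omega> f] by linarith
    then show False using small l2sq_nonneg[of \<Omega> g] by simp
  qed
  then have "l2sq \<Omega> f \<le> e * ?p" using 1 by (simp add: power2_eq_square)
  then have "(l2sq \<Omega> f)\<^sup>2 \<le> (e * ?p)\<^sup>2" using F by (intro power_mono) auto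
  also have "\<dots> = e\<^sup>2 * ?p\<^sup>2" by (simp add: power_mult_distrib)
  also have "\<dots> \<le> e\<^sup>2 * (l2sq \<Omega> f * l2sq \<Omega> v)"
    by (intro mult_left_mono L2_Cauchy_Schwarz[OF fL mgraphD(1)[OF vh]]) simp
  also have "\<dots> \<le> e\<^sup>2 * (l2sq \<Omega> f * (\<bar>c\<bar> * l2sq \<Omega> f))"
  proof -
    have "l2sq \<Omega> v \<le> c * l2sq \<Omega> f" by (rule c[OF v])
    also have "\<dots> \<le> \<bar>c\<bar> * l2sq \<Omega> f" using F by (intro mult_right_mono) auto
    finally show ?thesis using F by (intro mult_left_mono) auto
  qed
  also have "\<dots> = (e\<^sup>2 * \<bar>c\<bar>) * (l2sq \<Omega> f)\<^sup>2" by (simp add: power2_eq_square algebra_simps)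
  finally have "1 \<le> e\<^sup>2 * \<bar>c\<bar>" using F by simp
  moreover have "e\<^sup>2 * \<bar>c\<bar> < 1"
  proof -
    have "\<bar>c\<bar> < (\<bar>c\<bar> + 1)\<^sup>2" by (simp add: power2_eq_square algebra_simps add_pos_nonneg)
    then show ?thesis by (simp add: e_def power_divide divide_less_eq)
  qed
  ultimately show False by linarith
qed

text \<open>One pair with nonzero \<open>f\<close> bounds the lower bounds from above. Their
  supremum is itself a lower bound, belongs to the spectrum, and every smaller real number is in the
  resolvent set.\<close>

lemma spectrum_bottom:
  assumes "(f, g) \<in> mgraph A \<Omega>" "l2sq \<Omega> f > 0"
  defines "E \<equiv> Inf {l. complex_of_real l \<in> neumann_spectrum A \<Omega>}"
  shows "E \<in> low_bounds A \<Omega>" "l \<in> low_bounds A \<Omega> \<Longrightarrow> l \<le> E"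
proof -
  let ?L = "low_bounds A \<Omega>"
  have 0: "0 \<in> ?L" by (auto simp: low_bounds_def l2sq_nonneg)
  have ub: "l \<le> l2sq \<Omega> g / l2sq \<Omega> f" if "l \<in> ?L" for l
    using that assms by (auto simp: low_bounds_def field_simps)
  then have bdd: "bdd_above ?L" by (auto simp: bdd_above_def)
  have S: "Sup ?L \<in> ?L"
  proof -
    have "Sup ?L * l2sq \<Omega> f' \<le> l2sq \<Omega> g'" if u: "(f', g') \<in> mgraph A \<Omega>" for f' g'
    proof (cases "l2sq \<Omega> f' = 0")
      case False
      then have F: "l2sq \<Omega> f' > 0" using l2sq_nonneg[of \<Omega> f'] by linarith
      have "Sup ?L \<le> l2sq \<Omega> g' / l2sq \<Omega> f'"
      proof (rule cSup_least)
        show "?L \<noteq> {}" using 0 by blast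
        fix l assume "l \<in> ?L"
        then have "l * l2sq \<Omega> f' \<le> l2sq \<Omega> g'" using u by (auto simp: low_bounds_def)
        then show "l \<le> l2sq \<Omega> g' / l2sq \<Omega> f'" using F by (simp add: field_simps)
      qed
      then show ?thesis using F by (simp add: field_simps)
    qed (simp add: l2sq_nonneg)
    then show ?thesis by (auto simp: low_bounds_def)
  qed
  have max: "l \<le> Sup ?L" if "l \<in> ?L" for l by (rule cSup_upper[OF that bdd])
  have "E = Sup ?L" unfolding E_def
  proof (rule cInf_eq_minimum)
    show "Sup ?L \<in> {l. complex_of_real l \<in> neumann_spectrum A \<Omega>}"
      using not_resolvent_bottom[OF S max] by (simp add: neumann_spectrum_def)
    fix l assume "l \<in> {l. complex_of_real l \<in> neumann_spectrum A \<Omega>}"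
    then show "Sup ?L \<le> l"
      using resolvent_below[OF S, of l] by (auto simp: neumann_spectrum_def not_le[symmetric])
  qed
  then show "E \<in> ?L" "l \<in> ?L \<Longrightarrow> l \<le> E" using S max by auto
qed

end

section \<open>Gaussian functions and localisation\<close>

text \<open>The exponent 1/2 is that of the standard normal density; the Gaussian factorises over an
  orthonormal basis.\<close>

lemma gauss_integrable: "integrable lborel (\<lambda>x::'a::euclidean_space. exp (- (norm x)\<^sup>2 / 2))"
proof (rule integrableI_nonneg)
  have 1: "(\<integral>\<^sup>+s. ennreal (exp (- s\<^sup>2 / 2)) \<partial>lborel) < \<infinity>"
  proof -
    have "integrable lborel (\<lambda>s::real. sqrt (2 * pi) * std_normal_density s)" by simp
    then have "integrable lborel (\<lambda>s::real. exp (- s\<^sup>2 / 2))" by (simp add: std_normal_density_def)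
    then show ?thesis by (simp add: integrable_iff_bounded)
  qed
  have "exp (- (norm x)\<^sup>2 / 2) = (\<Prod>b\<in>Basis. exp (- (x \<bullet> b)\<^sup>2 / 2))" for x :: 'a
  proof -
    have "(norm x)\<^sup>2 = (\<Sum>b\<in>Basis. (x \<bullet> b)\<^sup>2)"
      unfolding power2_norm_eq_inner euclidean_inner[of x x] by (simp add: power2_eq_square)
    then have "- (norm x)\<^sup>2 / 2 = (\<Sum>b\<in>Basis. - (x \<bullet> b)\<^sup>2 / 2)"
      by (simp add: sum_divide_distrib sum_negf)
    then show ?thesis by (simp only: exp_sum[OF finite_Basis])
  qed
  then have "(\<integral>\<^sup>+(x::'a). ennreal (exp (- (norm x)\<^sup>2 / 2)) \<partial>lborel) =
      (\<integral>\<^sup>+(x::'a). (\<Prod>b\<in>Basis. ennreal (exp (- (x \<bullet> b)\<^sup>2 / 2))) \<partial>lborel)"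
    by (simp add: prod_ennreal)
  also have "\<dots> = (\<Prod>b\<in>(Basis::'a set). (\<integral>\<^sup>+s. ennreal (exp (- s\<^sup>2 / 2)) \<partial>lborel))"
    by (rule nn_integral_lborel_prod) auto
  also have "\<dots> < \<infinity>" using 1 by (simp add: power_less_top_ennreal)
  finally show "(\<integral>\<^sup>+(x::'a). ennreal (exp (- (norm x)\<^sup>2 / 2)) \<partial>lborel) < \<infinity>" .
qed auto

text \<open>Giving up half of the exponent pays for a linear factor, so both Gaussian moments reduce
  to one integrable function.\<close>

lemma gauss_moment_bound: "exp (- t) \<le> exp (- t / 2)" "t * exp (- t) \<le> 2 * exp (- t / 2)" if "t \<ge> 0" for t :: real
proof -
  show "exp (- t) \<le> exp (- t / 2)" using that by simp
  have "t / 2 \<le> exp (t / 2)" using exp_ge_add_one_self[of "t / 2"] by linarith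
  then have "t * exp (- t) \<le> (2 * exp (t / 2)) * exp (- t)" by (intro mult_right_mono) auto
  also have "\<dots> = 2 * exp (- t / 2)" by (simp add: mult_exp_exp)
  finally show "t * exp (- t) \<le> 2 * exp (- t / 2)" .
qed

lemma gauss_moments_integrable:
  "integrable lborel (\<lambda>x::'a::euclidean_space. exp (- (norm x)\<^sup>2))"
  "integrable lborel (\<lambda>x::'a::euclidean_space. (norm x)\<^sup>2 * exp (- (norm x)\<^sup>2))"
proof -
  show "integrable lborel (\<lambda>x::'a. exp (- (norm x)\<^sup>2))"
    by (rule Bochner_Integration.integrable_bound[OF gauss_integrable])
      (use gauss_moment_bound(1) in auto)
  show "integrable lborel (\<lambda>x::'a. (norm x)\<^sup>2 * exp (- (norm x)\<^sup>2))"
    by (rule Bochner_Integration.integrable_bound[OF integrable_mult_right[OF gauss_integrable, of 2]])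
      (use gauss_moment_bound(2) in auto)
qed

lemma sigma_finite_lebesgue_on:
  assumes "S \<in> sets lebesgue"
  shows "sigma_finite_measure (lebesgue_on S)"
proof (rule sigma_finite_measure_restrict_space[OF _ assms])
  show "sigma_finite_measure (lebesgue :: 'a measure)"
  proof
    show "\<exists>A. countable A \<and> A \<subseteq> sets (lebesgue :: 'a measure) \<and> \<Union> A = space lebesgue \<and> (\<forall>a\<in>A. emeasure lebesgue a \<noteq> \<infinity>)"
    proof (rule exI, intro conjI)
      show "countable (range (\<lambda>n::nat. cball (0::'a) (real n)))" by simp
      have "\<exists>n. norm x \<le> real n" for x :: 'a by (rule real_arch_simple)
      then show "\<Union> (range (\<lambda>n::nat. cball (0::'a) (real n))) = space lebesgue" by (simp add: set_eq_iff)
      show "range (\<lambda>n::nat. cball (0::'a) (real n)) \<subseteq> sets lebesgue" by auto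
      show "\<forall>a\<in>range (\<lambda>n::nat. cball (0::'a) (real n)). emeasure lebesgue a \<noteq> \<infinity>"
      proof
        fix a :: "'a set" assume "a \<in> range (\<lambda>n::nat. cball (0::'a) (real n))"
        then obtain n :: nat where a: "a = cball 0 (real n)" by blast
        show "emeasure lebesgue a \<noteq> \<infinity>"
          using emeasure_lborel_cball_finite[of "0::'a" "real n"] unfolding a by simp
      qed
    qed
  qed
qed

text \<open>The parameter \<open>s\<close> absorbs the scaling of the window, so that its mass does not depend on it.\<close>

lemma window_average:
  fixes h F :: "'a::euclidean_space \<Rightarrow> real"
  assumes h: "integrable lborel h" "\<And>x. h x \<ge> 0" "continuous_on UNIV h"
    and F: "integrable (lebesgue_on S) F" "\<And>x. F x \<ge> 0" and S: "S \<in> sets lebesgue"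
  shows "(\<integral>\<^sup>+c. (\<integral>\<^sup>+x. ennreal (h (s *\<^sub>R x - c) * F x) \<partial>lebesgue_on S) \<partial>lborel) =
     ennreal ((LINT x|lborel. h x) * (LINT x|lebesgue_on S. F x))"
    and "(\<lambda>c. \<integral>\<^sup>+x. ennreal (h (s *\<^sub>R x - c) * F x) \<partial>lebesgue_on S) \<in> borel_measurable lborel"
proof -
  interpret M: sigma_finite_measure "lebesgue_on S" by (rule sigma_finite_lebesgue_on[OF S])
  interpret P: pair_sigma_finite "lborel :: 'a measure" "lebesgue_on S" ..
  have [measurable]: "(\<lambda>x. x) \<in> lebesgue_on S \<rightarrow>\<^sub>M borel"
    by (intro measurable_restrict_space1 measurable_completion) simp
  have [measurable]: "h \<in> borel_measurable borel" by (rule borel_measurable_continuous_onI[OF h(3)])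
  have [measurable]: "F \<in> borel_measurable (lebesgue_on S)" using F(1) by auto
  have sub[measurable]: "(\<lambda>(c, x). s *\<^sub>R x - c) \<in> lborel \<Otimes>\<^sub>M lebesgue_on S \<rightarrow>\<^sub>M borel"
    by measurable
  have m: "(\<lambda>(c, x). ennreal (h (s *\<^sub>R x - c) * F x)) \<in> borel_measurable (lborel \<Otimes>\<^sub>M lebesgue_on S)"
    using measurable_compose[OF sub, of h borel] by measurable
  show "(\<lambda>c. \<integral>\<^sup>+x. ennreal (h (s *\<^sub>R x - c) * F x) \<partial>lebesgue_on S) \<in> borel_measurable lborel"
    using M.borel_measurable_nn_integral_fst[OF m] by simp
  have "(\<integral>\<^sup>+c. (\<integral>\<^sup>+x. ennreal (h (s *\<^sub>R x - c) * F x) \<partial>lebesgue_on S) \<partial>lborel) =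
      (\<integral>\<^sup>+x. (\<integral>\<^sup>+c. ennreal (h (s *\<^sub>R x - c) * F x) \<partial>lborel) \<partial>lebesgue_on S)"
    using P.Fubini'[OF m] by simp
  also have "\<dots> = (\<integral>\<^sup>+x. ennreal (LINT x|lborel. h x) * ennreal (F x) \<partial>lebesgue_on S)"
  proof (rule nn_integral_cong)
    fix x
    have "(\<integral>\<^sup>+c. ennreal (h (s *\<^sub>R x - c) * F x) \<partial>lborel) = (\<integral>\<^sup>+c. ennreal (h (s *\<^sub>R x - c)) \<partial>lborel) * ennreal (F x)"
      by (subst nn_integral_multc[symmetric]) (auto simp: ennreal_mult h F)
    \<comment> \<open>Reflection and translation preserve Lebesgue measure, so the total weight of
      all windows at \<open>x\<close> is the same for every \<open>x\<close>.\<close>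
    also have "(\<integral>\<^sup>+c. ennreal (h (s *\<^sub>R x - c)) \<partial>lborel) = (\<integral>\<^sup>+c. ennreal (h c) \<partial>lborel)"
      by (subst (2) lborel_affine[of "-1" "s *\<^sub>R x"]) (simp_all add: nn_integral_density nn_integral_distr)
    also have "\<dots> = ennreal (LINT x|lborel. h x)" using h by (intro nn_integral_eq_integral) auto
    finally show "(\<integral>\<^sup>+c. ennreal (h (s *\<^sub>R x - c) * F x) \<partial>lborel) = ennreal (LINT x|lborel. h x) * ennreal (F x)" .
  qed
  also have "\<dots> = ennreal (LINT x|lborel. h x) * ennreal (LINT x|lebesgue_on S. F x)"
    using F by (simp add: nn_integral_cmult nn_integral_eq_integral)
  also have "\<dots> = ennreal ((LINT x|lborel. h x) * (LINT x|lebesgue_on S. F x))"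
    using h(2) F(2) by (simp add: ennreal_mult)
  finally show "(\<integral>\<^sup>+c. (\<integral>\<^sup>+x. ennreal (h (s *\<^sub>R x - c) * F x) \<partial>lebesgue_on S) \<partial>lborel) =
     ennreal ((LINT x|lborel. h x) * (LINT x|lebesgue_on S. F x))" .
qed

section \<open>Multiplication of weak gradients by smooth functions\<close>

lemma test_function_mult:
  assumes m: "smooth_on m UNIV" and \<psi>: "\<psi> \<in> test_functions \<Omega>"
  shows "(\<lambda>x. m x * \<psi> x) \<in> test_functions \<Omega>"
proof -
  note D = test_functionD[OF \<psi>]
  have sub: "closure {x. m x * \<psi> x \<noteq> 0} \<subseteq> closure {x. \<psi> x \<noteq> 0}" by (rule closure_mono) auto
  have "compact (closure {x. m x * \<psi> x \<noteq> 0})"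
    using compact_Int_closed[OF D(2) closed_closure, of "{x. m x * \<psi> x \<noteq> 0}"] sub by (simp add: Int_absorb1)
  moreover have "smooth_on (\<lambda>x. m x * \<psi> x) UNIV"
    using m D(1) Ck_on_mult[OF open_UNIV] unfolding smooth_on_def by blast
  ultimately show ?thesis using sub D(3) by (auto simp: test_functions_def)
qed

lemma partial_deriv_mult:
  fixes m \<psi> :: "real^3 \<Rightarrow> complex"
  assumes "m differentiable (at x)" "\<psi> differentiable (at x)"
  shows "partial_deriv j (\<lambda>x. m x * \<psi> x) x = partial_deriv j m x * \<psi> x + m x * partial_deriv j \<psi> x"
proof -
  have "((\<lambda>x. m x * \<psi> x) has_derivative (\<lambda>h. m x * frechet_derivative \<psi> (at x) h + frechet_derivative m (at x) h * \<psi> x)) (at x)"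
    by (rule has_derivative_mult) (use assms frechet_derivative_works in blast)+
  from frechet_derivative_at[OF this, symmetric] show ?thesis by (simp add: partial_deriv_def)
qed

text \<open>The multiplier is moved onto the test function, which gives the product rule without
  differentiating \<open>f\<close>. The change of potential enters as a multiplication term, so one
  \<open>m\<close> can carry both a window and a gauge.\<close>

lemma magnetic_gradient_mult:
  fixes m :: "real^3 \<Rightarrow> complex"
  assumes m: "smooth_on m UNIV" and A: "continuous_on UNIV A" and A': "continuous_on UNIV A'" and \<Omega>: "open \<Omega>"
    and fg: "(f, g) \<in> mgraph A' \<Omega>"
  shows "magnetic_gradient A \<Omega> (\<lambda>x. m x * f x)
    (\<lambda>x. \<chi> j. m x * g x $ j - \<i> * partial_deriv j m x * f x + of_real ((A x - A' x) $ j) * m x * f x)"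
  unfolding magnetic_gradient_def
proof (intro ballI allI)
  fix \<psi> j assume \<psi>: "\<psi> \<in> test_functions \<Omega>"
  note D = mgraphD[OF fg]
  have m\<psi>: "(\<lambda>x. m x * \<psi> x) \<in> test_functions \<Omega>" by (rule test_function_mult[OF m \<psi>])
  have mc: "continuous_on UNIV m" "continuous_on UNIV (\<lambda>x. partial_deriv j m x)"
    using smooth_on_continuous[OF m] smooth_on_continuous[OF smooth_on_derivative[OF m]]
    unfolding partial_deriv_def by auto
  let ?H1 = "\<lambda>x. \<i> * partial_deriv j (\<lambda>x. m x * \<psi> x) x + of_real (A' x $ j) * (m x * \<psi> x)"
  let ?K = "\<lambda>x. (- \<i> * partial_deriv j m x + of_real ((A x - A' x) $ j) * m x) * \<psi> x"
  have K: "?K \<in> L2 \<Omega>"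
    by (rule test_function_L2(1)[OF \<psi> \<Omega>]) (use mc A A' in \<open>auto intro!: continuous_intros\<close>)
  note H = test_function_form_L2[OF A' \<Omega> m\<psi>]
  have i1: "integrable (lebesgue_on \<Omega>) (\<lambda>x. g x $ j * (m x * \<psi> x))"
    by (rule L2_mult_integrable[OF L2_component[OF D(2)] H(1)])
  have i2: "integrable (lebesgue_on \<Omega>) (\<lambda>x. f x * ?K x)" by (rule L2_mult_integrable[OF D(1) K])
  have i3: "integrable (lebesgue_on \<Omega>) (\<lambda>x. f x * ?H1 x)" by (rule L2_mult_integrable[OF D(1) H(2)])
  have "(LINT x|lebesgue_on \<Omega>. (\<chi> j. m x * g x $ j - \<i> * partial_deriv j m x * f x + of_real ((A x - A' x) $ j) * m x * f x) $ j * \<psi> x)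
      = (LINT x|lebesgue_on \<Omega>. g x $ j * (m x * \<psi> x) + f x * ?K x)"
    by (simp add: algebra_simps)
  also have "\<dots> = (LINT x|lebesgue_on \<Omega>. g x $ j * (m x * \<psi> x)) + (LINT x|lebesgue_on \<Omega>. f x * ?K x)"
    by (rule Bochner_Integration.integral_add[OF i1 i2])
  also have "\<dots> = (LINT x|lebesgue_on \<Omega>. f x * ?H1 x) + (LINT x|lebesgue_on \<Omega>. f x * ?K x)"
    by (simp only: magnetic_gradientD[OF D(3) m\<psi>])
  also have "\<dots> = (LINT x|lebesgue_on \<Omega>. f x * ?H1 x + f x * ?K x)"
    by (rule Bochner_Integration.integral_add[OF i3 i2, symmetric])
  also have "\<dots> = (LINT x|lebesgue_on \<Omega>. (m x * f x) * (\<i> * partial_deriv j \<psi> x + of_real (A x $ j) * \<psi> x))"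
  proof (rule Bochner_Integration.integral_cong[OF refl])
    fix x
    have "partial_deriv j (\<lambda>x. m x * \<psi> x) x = partial_deriv j m x * \<psi> x + m x * partial_deriv j \<psi> x"
      using smooth_on_differentiable[OF m] smooth_on_differentiable[OF test_functionD(1)[OF \<psi>]]
      by (intro partial_deriv_mult) auto
    then show "f x * ?H1 x + f x * ?K x = (m x * f x) * (\<i> * partial_deriv j \<psi> x + of_real (A x $ j) * \<psi> x)"
      by (simp add: algebra_simps)
  qed
  finally show "(LINT x|lebesgue_on \<Omega>. (\<chi> j. m x * g x $ j - \<i> * partial_deriv j m x * f x + of_real ((A x - A' x) $ j) * m x * f x) $ j * \<psi> x)
      = (LINT x|lebesgue_on \<Omega>. (m x * f x) * (\<i> * partial_deriv j \<psi> x + of_real (A x $ j) * \<psi> x))" .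
qed

section \<open>Integration by parts and a Gaussian in the form domain\<close>

lemma test_function_differentiable:
  assumes "\<psi> \<in> test_functions \<Omega>"
  shows "(\<psi> has_derivative frechet_derivative \<psi> (at x)) (at x)"
  using smooth_on_differentiable[OF test_functionD(1)[OF assms]] frechet_derivative_works by blast

text \<open>Difference quotients have integral zero by translation invariance. They converge to the
  derivative and are dominated by a Lipschitz constant on a bounded set.\<close>

lemma integral_partial_deriv_zero:
  assumes \<psi>: "\<psi> \<in> test_functions \<Omega>" and \<Omega>: "open \<Omega>"
  shows "(LINT x|lebesgue_on \<Omega>. partial_deriv j \<psi> x) = 0"
proof -
  note D = test_functionD[OF \<psi>]
  note dd = test_function_differentiable[OF \<psi>]
  let ?e = "axis j 1 :: real^3"
  let ?p = "partial_deriv j \<psi>"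
  define K where "K = closure {x. \<psi> x \<noteq> 0}"
  note D = D[folded K_def]
  have pc: "continuous_on UNIV ?p"
    using smooth_on_continuous[OF smooth_on_derivative[OF D(1)]] unfolding partial_deriv_def by auto
  have \<psi>c: "continuous_on UNIV \<psi>" by (rule smooth_on_continuous[OF D(1)])
  have \<psi>0: "\<psi> x = 0" if "x \<notin> K" for x
    using that closure_subset[of "{x. \<psi> x \<noteq> 0}"] by (auto simp: K_def)
  have p0: "?p x = 0" if "x \<notin> K" for x
    unfolding partial_deriv_def by (rule frechet_derivative_zero_outside[OF that[unfolded K_def]])
  obtain r where r: "\<And>x. x \<in> K \<Longrightarrow> norm x \<le> r"
    using compact_imp_bounded[OF D(2)] unfolding bounded_iff by blast
  obtain C0 where C0: "\<And>x. x \<in> K \<Longrightarrow> norm (?p x) \<le> C0"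
    using compact_imp_bounded[OF compact_continuous_image[OF continuous_on_subset[OF pc subset_UNIV] D(2)]]
    unfolding bounded_iff by blast
  define C where "C = max C0 0"
  have C: "norm (?p x) \<le> C" for x
    using C0[of x] p0[of x] by (cases "x \<in> K") (auto simp: C_def)
  have lip: "norm (\<psi> (x + h *\<^sub>R ?e) - \<psi> x) \<le> C * norm h" for x and h :: real
  proof -
    have der: "((\<lambda>t. \<psi> (x + t *\<^sub>R ?e)) has_derivative (\<lambda>s. s *\<^sub>R ?p (x + t *\<^sub>R ?e))) (at t)" for t :: real
    proof -
      have "((\<lambda>t::real. x + t *\<^sub>R ?e) has_derivative (\<lambda>s. s *\<^sub>R ?e)) (at t)"
        by (auto intro!: derivative_eq_intros)
      from diff_chain_at[OF this dd]
      have "((\<lambda>t. \<psi> (x + t *\<^sub>R ?e)) has_derivative (\<lambda>s. frechet_derivative \<psi> (at (x + t *\<^sub>R ?e)) (s *\<^sub>R ?e))) (at t)"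
        by (simp add: o_def)
      then show ?thesis
        unfolding partial_deriv_def linear_scale[OF has_derivative_linear[OF dd]] .
    qed
    have "norm (\<psi> (x + h *\<^sub>R ?e) - \<psi> (x + 0 *\<^sub>R ?e)) \<le> C * norm (h - 0)"
    proof (rule differentiable_bound[OF convex_UNIV, where f = "\<lambda>t. \<psi> (x + t *\<^sub>R ?e)"])
      fix t :: real
      show "((\<lambda>t. \<psi> (x + t *\<^sub>R ?e)) has_derivative (\<lambda>s. s *\<^sub>R ?p (x + t *\<^sub>R ?e))) (at t within UNIV)"
        using der by simp
      have "\<bar>s\<bar> * norm (?p (x + t *\<^sub>R ?e)) \<le> C * \<bar>s\<bar>" for s :: real
        using mult_right_mono[OF C abs_ge_zero, of "x + t *\<^sub>R ?e" s] by (simp add: mult.commute)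
      then show "onorm (\<lambda>s. s *\<^sub>R ?p (x + t *\<^sub>R ?e)) \<le> C"
        by (intro onorm_bound) (auto simp: C_def)
    qed auto
    then show ?thesis by simp
  qed
  define F where "F n x = real (Suc n) *\<^sub>R (\<psi> (x + (1 / real (Suc n)) *\<^sub>R ?e) - \<psi> x)" for n x
  have int\<psi>: "integrable lborel (\<lambda>x. \<psi> (x + c))" for c
  proof -
    have "integrable lborel (\<lambda>x. indicator (K) x *\<^sub>R \<psi> x)"
      by (rule borel_integrable_compact[OF D(2) continuous_on_subset[OF \<psi>c subset_UNIV]])
    moreover have "(\<lambda>x. indicator (K) x *\<^sub>R \<psi> x) = \<psi>"
      by (rule ext) (simp add: \<psi>0 indicator_def)
    ultimately have i: "integrable lborel \<psi>" by simp
    then have "integrable (distr lborel borel ((+) c)) \<psi>" by (simp only: lborel_distr_plus)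
    then show ?thesis by (subst (asm) integrable_distr_eq) (auto simp: add.commute borel_measurable_continuous_onI[OF \<psi>c])
  qed
  have shift: "(LINT x|lborel. \<psi> (x + c)) = (LINT x|lborel. \<psi> x)" for c
  proof -
    have "(LINT x|lborel. \<psi> x) = (LINT x|distr lborel borel ((+) c). \<psi> x)" by (simp only: lborel_distr_plus)
    also have "\<dots> = (LINT x|lborel. \<psi> (c + x))"
      by (rule integral_distr) (auto simp: borel_measurable_continuous_onI[OF \<psi>c])
    finally show ?thesis by (simp add: add.commute)
  qed
  have F0: "(LINT x|lborel. F n x) = 0" for n
    unfolding F_def using int\<psi>[of "(1 / real (Suc n)) *\<^sub>R ?e"] int\<psi>[of 0] shift
    by (simp del: of_nat_Suc)
  have [measurable]: "\<psi> \<in> borel_measurable borel" by (rule borel_measurable_continuous_onI[OF \<psi>c])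
  have lim: "(\<lambda>n. LINT x|lborel. F n x) \<longlonglongrightarrow> (LINT x|lborel. ?p x)"
  proof (rule integral_dominated_convergence)
    show "?p \<in> borel_measurable lborel" using borel_measurable_continuous_onI[OF pc] by simp
    show "F n \<in> borel_measurable lborel" for n unfolding F_def by measurable
    \<comment> \<open>Shifts by at most 1 keep all difference quotients supported in this ball of
      radius \<open>r + 1\<close>.\<close>
    show "integrable lborel (\<lambda>x. C * indicator (cball (0::real^3) (r + 1)) x)"
      by (intro integrable_mult_right integrable_real_indicator)
        (simp_all add: emeasure_lborel_cball_finite[unfolded infinity_ennreal_def])
    show "AE x in lborel. (\<lambda>n. F n x) \<longlonglongrightarrow> ?p x"
    proof (rule AE_I2)
      fix x
      have "((\<lambda>h. (1 / norm (h - 0)) *\<^sub>R (\<psi> (x + h *\<^sub>R ?e) - (\<psi> (x + 0 *\<^sub>R ?e) + (h - 0) *\<^sub>R ?p x))) \<longlongrightarrow> 0) (at (0::real))"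
      proof -
        have "((\<lambda>t::real. x + t *\<^sub>R ?e) has_derivative (\<lambda>s. s *\<^sub>R ?e)) (at 0)"
          by (auto intro!: derivative_eq_intros)
        from diff_chain_at[OF this] dd[of x]
        have "((\<lambda>t. \<psi> (x + t *\<^sub>R ?e)) has_derivative (\<lambda>s. frechet_derivative \<psi> (at x) (s *\<^sub>R ?e))) (at (0::real))"
          by (simp add: o_def)
        then have "((\<lambda>t. \<psi> (x + t *\<^sub>R ?e)) has_derivative (\<lambda>s. s *\<^sub>R ?p x)) (at (0::real))"
          unfolding partial_deriv_def linear_scale[OF has_derivative_linear[OF dd]] .
        then show ?thesis unfolding has_derivative_within by blast
      qed
      moreover have "filterlim (\<lambda>n. 1 / real (Suc n)) (at (0::real)) sequentially"
        unfolding filterlim_at using LIMSEQ_Suc[OF lim_1_over_n] by auto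
      ultimately have "(\<lambda>n. (1 / norm (1 / real (Suc n) - 0)) *\<^sub>R (\<psi> (x + (1 / real (Suc n)) *\<^sub>R ?e) - (\<psi> (x + 0 *\<^sub>R ?e) + (1 / real (Suc n) - 0) *\<^sub>R ?p x))) \<longlonglongrightarrow> 0"
        by (rule filterlim_compose)
      moreover have "(1 / norm (1 / real (Suc n) - 0)) *\<^sub>R (\<psi> (x + (1 / real (Suc n)) *\<^sub>R ?e) - (\<psi> (x + 0 *\<^sub>R ?e) + (1 / real (Suc n) - 0) *\<^sub>R ?p x))
        = F n x - ?p x" for n
        unfolding F_def by (simp add: scaleR_diff_right scaleR_add_right del: of_nat_Suc)
      ultimately show "(\<lambda>n. F n x) \<longlonglongrightarrow> ?p x" by (simp add: LIM_zero_iff)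
    qed
    show "AE x in lborel. norm (F n x) \<le> C * indicator (cball 0 (r + 1)) x" for n
    proof (rule AE_I2)
      fix x
      show "norm (F n x) \<le> C * indicator (cball 0 (r + 1)) x"
      proof (cases "x \<in> cball 0 (r + 1)")
        case True
        have "norm (F n x) = real (Suc n) * norm (\<psi> (x + (1 / real (Suc n)) *\<^sub>R ?e) - \<psi> x)"
          unfolding F_def by simp
        also have "\<dots> \<le> real (Suc n) * (C * norm (1 / real (Suc n)))"
          by (intro mult_left_mono lip) simp
        also have "\<dots> = C" by simp
        finally show ?thesis using True by simp
      next
        case False
        let ?y = "x + (1 / real (Suc n)) *\<^sub>R ?e"
        have nx: "norm x > r + 1" using False by simp
        have 1: "norm ((1 / real (Suc n)) *\<^sub>R ?e) \<le> 1" by simp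
        have "norm (?y - (1 / real (Suc n)) *\<^sub>R ?e) \<le> norm ?y + norm ((1 / real (Suc n)) *\<^sub>R ?e)"
          by (rule norm_triangle_ineq4)
        then have "norm ?y > r" using nx 1 unfolding add_diff_cancel_right' by linarith
        then have "?y \<notin> K" "x \<notin> K" using r nx by force+
        then show ?thesis using \<psi>0 False unfolding F_def by simp
      qed
    qed
  qed
  have "(LINT x|lebesgue_on \<Omega>. ?p x) = (LINT x|lebesgue. indicator \<Omega> x *\<^sub>R ?p x)"
    by (rule integral_restrict_space) (use \<Omega> in auto)
  also have "\<dots> = (LINT x|lebesgue. ?p x)"
    using p0 D(3) by (intro Bochner_Integration.integral_cong) (auto simp: indicator_def)
  also have "\<dots> = (LINT x|lborel. ?p x)"
    by (rule integral_completion) (use borel_measurable_continuous_onI[OF pc] in simp)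
  also have "\<dots> = 0" using LIMSEQ_unique[OF lim] F0 by simp
  finally show ?thesis .
qed

lemma lebesgue_on_measurable_continuous:
  fixes h :: "'a::euclidean_space \<Rightarrow> 'b::euclidean_space"
  assumes "continuous_on UNIV h"
  shows "h \<in> borel_measurable (lebesgue_on \<Omega>)"
  using borel_measurable_continuous_onI[OF assms]
  by (intro measurable_restrict_space1 measurable_completion) simp

lemma L2_gauss_bound:
  fixes h :: "'a::euclidean_space \<Rightarrow> 'b::euclidean_space"
  assumes h: "continuous_on UNIV h" and b: "\<And>x. (norm (h x))\<^sup>2 \<le> K * exp (- (norm x)\<^sup>2 / 2)" and \<Omega>: "open \<Omega>"
  shows "h \<in> L2 \<Omega>"
proof -
  have i: "integrable lebesgue (\<lambda>x. (norm (h x))\<^sup>2)"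
  proof (rule Bochner_Integration.integrable_bound)
    show "integrable lebesgue (\<lambda>x::'a. K * exp (- (norm x)\<^sup>2 / 2))"
      using gauss_integrable by (intro integrable_mult_right integrable_completion[THEN iffD2]) auto
    show "(\<lambda>x. (norm (h x))\<^sup>2) \<in> borel_measurable lebesgue"
      using borel_measurable_continuous_onI[OF h] by (intro measurable_completion) simp
    show "AE x in lebesgue. norm ((norm (h x))\<^sup>2) \<le> norm (K * exp (- (norm x)\<^sup>2 / 2))"
      using b by (intro AE_I2) (simp add: order_trans[OF _ abs_ge_self])
  qed
  have "integrable (lebesgue_on \<Omega>) (\<lambda>x. (norm (h x))\<^sup>2)"
    using integrable_mult_indicator[OF _ i, of \<Omega>] \<Omega> by (subst integrable_restrict_space) auto
  then show ?thesis using lebesgue_on_measurable_continuous[OF h] by (simp add: L2_def)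
qed

lemma partial_deriv_exp:
  fixes p :: "real^3 \<Rightarrow> complex"
  assumes "(p has_derivative dp) (at x)"
  shows "partial_deriv j (\<lambda>x. exp (p x)) x = exp (p x) * dp (axis j 1)"
proof -
  have "((exp :: complex \<Rightarrow> complex) has_derivative (\<lambda>h. exp (p x) * h)) (at (p x))"
    using DERIV_exp[of "p x"] by (simp add: has_field_derivative_def)
  from diff_chain_at[OF assms this] have "((\<lambda>x. exp (p x)) has_derivative (\<lambda>h. exp (p x) * dp h)) (at x)"
    by (simp add: o_def)
  from frechet_derivative_at[OF this, symmetric] show ?thesis by (simp add: partial_deriv_def)
qed

lemma norm_complex_vector: "norm (\<chi> j. z * complex_of_real (v $ j)) = norm z * norm v"
  by (simp add: norm_vec_def norm_mult L2_set_right_distrib)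

lemma norm_complex_cmult: "norm (\<chi> j. z * w $ j) = norm z * norm w" for w :: "complex ^ 'n"
  by (simp add: norm_vec_def norm_mult L2_set_right_distrib)

lemma linear_bound:
  fixes A :: "'a::euclidean_space \<Rightarrow> 'b::real_normed_vector"
  assumes "linear A"
  obtains a where "a \<ge> 0" "\<And>x. norm (A x) \<le> a * norm x"
  using linear_bounded[OF assms] by (metis abs_ge_zero abs_ge_self mult_right_mono norm_ge_zero order_trans)

lemma smooth_on_exp:
  fixes p :: "'a::real_normed_vector \<Rightarrow> complex"
  shows "open S \<Longrightarrow> smooth_on p S \<Longrightarrow> smooth_on (\<lambda>x. exp (p x)) S"
  unfolding smooth_on_def using Ck_on_exp by blast

text \<open>Gaussian decay beats the linear growth of \<open>A\<close> on every open set. In the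
  weak identity the two sides differ by the integral of a derivative of the compactly supported
  function \<open>m \<psi>\<close>, which vanishes.\<close>

lemma gauss_mgraph:
  assumes A: "linear A" and \<Omega>: "open \<Omega>" "\<Omega> \<noteq> {}"
  shows "\<exists>f g. (f, g) \<in> mgraph A \<Omega> \<and> l2sq \<Omega> f > 0"
proof -
  define p where "p x = complex_of_real (- (1/2) * (x \<bullet> x))" for x :: "real^3"
  define m where "m x = exp (p x)" for x
  define g where "g x = (\<chi> j. m x * (\<i> * complex_of_real (x $ j))) + (\<chi> j. m x * complex_of_real (A x $ j))" for x :: "real^3"
  have Ac: "continuous_on UNIV A" using A by (simp add: linear_continuous_on linear_conv_bounded_linear)
  have dp: "(p has_derivative (\<lambda>h. complex_of_real (- (x \<bullet> h)))) (at x)" for x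
    unfolding p_def by (auto intro!: derivative_eq_intros simp: inner_commute)
  have "smooth_on p UNIV"
    unfolding smooth_on_def p_def
    by (intro allI Ck_on_linear_comp[OF bounded_linear_of_real] Ck_on_linear_comp[OF bounded_linear_mult_right]
        Ck_on_inner Ck_on_bounded_linear[OF bounded_linear_ident] open_UNIV)
  then have ms: "smooth_on m UNIV" unfolding m_def by (intro smooth_on_exp) auto
  have dm: "partial_deriv j m x = - (complex_of_real (x $ j)) * m x" for j x
    unfolding m_def[abs_def] partial_deriv_exp[OF dp] by (simp add: inner_axis)
  have nm: "norm (m x) = exp (- (norm x)\<^sup>2 / 2)" for x
    by (simp add: m_def p_def power2_norm_eq_inner)
  have nm2: "(norm (m x))\<^sup>2 = exp (- (norm x)\<^sup>2)" for x
    unfolding nm by (simp add: power2_eq_square mult_exp_exp)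
  have mc: "continuous_on UNIV m" by (rule smooth_on_continuous[OF ms])
  have mL: "m \<in> L2 \<Omega>"
    by (rule L2_gauss_bound[OF mc, of 1]) (use nm2 gauss_moment_bound(1) \<Omega> in auto)
  obtain a where a: "a \<ge> 0" "\<And>x. norm (A x) \<le> a * norm x" using linear_bound[OF A] by blast
  have gc: "continuous_on UNIV g" unfolding g_def
    by (intro continuous_intros mc Ac continuous_on_vec_lambda)
  have gb: "(norm (g x))\<^sup>2 \<le> ((1 + a)\<^sup>2 * 2) * exp (- (norm x)\<^sup>2 / 2)" for x
  proof -
    have "g x = (\<chi> j. (m x * \<i>) * complex_of_real (x $ j)) + (\<chi> j. m x * complex_of_real (A x $ j))"
      by (simp add: g_def mult.assoc)
    then have "norm (g x) \<le> norm (m x * \<i>) * norm x + norm (m x) * norm (A x)"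
      using norm_triangle_ineq by (metis norm_complex_vector)
    also have "\<dots> \<le> norm (m x) * ((1 + a) * norm x)"
      using mult_left_mono[OF a(2)[of x] norm_ge_zero[of "m x"]] by (simp add: norm_mult algebra_simps)
    finally have "(norm (g x))\<^sup>2 \<le> (norm (m x) * ((1 + a) * norm x))\<^sup>2" by (intro power_mono) auto
    also have "\<dots> = (1 + a)\<^sup>2 * ((norm x)\<^sup>2 * exp (- (norm x)\<^sup>2))" by (simp add: power_mult_distrib nm2 mult_ac)
    also have "\<dots> \<le> (1 + a)\<^sup>2 * (2 * exp (- (norm x)\<^sup>2 / 2))"
      by (intro mult_left_mono gauss_moment_bound(2)) auto
    finally show ?thesis by simp
  qed
  have gL: "g \<in> L2 \<Omega>" by (rule L2_gauss_bound[OF gc gb \<Omega>(1)])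
  have "magnetic_gradient A \<Omega> m g"
    unfolding magnetic_gradient_def
  proof (intro ballI allI)
    fix \<psi> j assume \<psi>: "\<psi> \<in> test_functions \<Omega>"
    let ?H = "\<lambda>x. \<i> * partial_deriv j \<psi> x + of_real (A x $ j) * \<psi> x"
    note T = test_function_form_L2[OF Ac \<Omega>(1) \<psi>]
    have "(LINT x|lebesgue_on \<Omega>. g x $ j * \<psi> x) - (LINT x|lebesgue_on \<Omega>. m x * ?H x)
      = (LINT x|lebesgue_on \<Omega>. g x $ j * \<psi> x - m x * ?H x)"
      by (rule Bochner_Integration.integral_diff[symmetric])
        (intro L2_mult_integrable[OF L2_component[OF gL] T(1)] L2_mult_integrable[OF mL T(2)])+
    also have "\<dots> = (LINT x|lebesgue_on \<Omega>. - \<i> * partial_deriv j (\<lambda>x. m x * \<psi> x) x)"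
    proof (rule Bochner_Integration.integral_cong[OF refl])
      fix x
      have e: "partial_deriv j (\<lambda>x. m x * \<psi> x) x = partial_deriv j m x * \<psi> x + m x * partial_deriv j \<psi> x"
        using smooth_on_differentiable[OF ms] smooth_on_differentiable[OF test_functionD(1)[OF \<psi>]]
        by (intro partial_deriv_mult) auto
      show "g x $ j * \<psi> x - m x * ?H x = - \<i> * partial_deriv j (\<lambda>x. m x * \<psi> x) x"
        unfolding e dm by (simp add: g_def algebra_simps)
    qed
    also have "\<dots> = - \<i> * (LINT x|lebesgue_on \<Omega>. partial_deriv j (\<lambda>x. m x * \<psi> x) x)"
      by (rule integral_mult_right_zero)
    also have "\<dots> = 0"
      using integral_partial_deriv_zero[OF test_function_mult[OF ms \<psi>] \<Omega>(1)] by simp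
    finally show "(LINT x|lebesgue_on \<Omega>. g x $ j * \<psi> x) = (LINT x|lebesgue_on \<Omega>. m x * ?H x)" by simp
  qed
  then have "(m, g) \<in> mgraph A \<Omega>" using mL gL by (simp add: mgraph_def)
  moreover have "l2sq \<Omega> m > 0"
  proof (rule ccontr)
    assume "\<not> l2sq \<Omega> m > 0"
    then have "l2sq \<Omega> m = 0" using l2sq_nonneg[of \<Omega> m] by linarith
    then have "AE x in lebesgue_on \<Omega>. (norm (m x))\<^sup>2 = 0"
      unfolding l2sq_def using integral_nonneg_eq_0_iff_AE[OF L2_integrable[OF mL]] by simp
    then have "AE x in lebesgue_on \<Omega>. False" by (simp add: nm)
    then have "AE x in lebesgue. x \<notin> \<Omega>" using \<Omega>(1) by (subst (asm) AE_restrict_space_iff) auto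
    then have "negligible \<Omega>" using \<Omega>(1) by (simp add: negligible_iff_null_sets AE_iff_null_sets[symmetric])
    then show False using open_not_negligible[OF \<Omega>] by blast
  qed
  ultimately show ?thesis by blast
qed

text \<open>Keeps the coefficient of the main term near 1; the price \<open>1 / d\<close> falls on
  the error term.\<close>

lemma real_weighted_square: "(a + b)\<^sup>2 \<le> (1 + d) * a\<^sup>2 + (1 + 1 / d) * b\<^sup>2" if "d > 0" for a b d :: real
proof -
  have "0 \<le> (d * a - b)\<^sup>2 / d" using that by simp
  also have "\<dots> = d * a\<^sup>2 - 2 * a * b + b\<^sup>2 / d" using that by (simp add: power2_eq_square field_simps)
  finally show ?thesis by (simp add: power2_eq_square algebra_simps)
qed

text \<open>Localisation by Gaussian windows centred at \<open>c\<close>: in each window the constant gauge \<open>N c\<close>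
  reduces the difference of the potentials to \<open>N (x - c)\<close>, up to the gradient of \<open>x \<bullet> S x / 2\<close>.
  Averaging over \<open>c\<close> removes the windows.\<close>

lemma localisation_inequality:
  fixes A A' S N :: "real^3 \<Rightarrow> real^3"
  assumes A: "linear A" and A': "linear A'" and S: "linear S" and N: "linear N"
    and sym: "\<And>x y. S x \<bullet> y = x \<bullet> S y" and diff: "\<And>x. A' x - A x = S x + N x"
    and Nb: "\<And>x. norm (N x) \<le> \<epsilon> * norm x" and \<epsilon>: "\<epsilon> > 0" and \<delta>: "\<delta> > 0"
    and \<Omega>: "open \<Omega>" and l: "l \<in> low_bounds A \<Omega>" "l \<ge> 0" and fg: "(f, g) \<in> mgraph A' \<Omega>"
  defines "a \<equiv> LINT y|lborel. exp (- (norm (y :: real^3))\<^sup>2)"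
    and "b \<equiv> LINT y|lborel. (norm (y :: real^3))\<^sup>2 * exp (- (norm y)\<^sup>2)"
  shows "l * (a * l2sq \<Omega> f) \<le> (1 + \<delta>) * (a * l2sq \<Omega> g) + (1 + 1 / \<delta>) * (4 * \<epsilon>) * (b * l2sq \<Omega> f)"
proof -
  let ?M = "lebesgue_on \<Omega>"
  note D = mgraphD[OF fg]
  \<comment> \<open>In the variable \<open>s *\<^sub>R x\<close> the windows have a width
    independent of \<open>\<epsilon>\<close>; in \<open>x\<close> their width is of order
    \<open>1 / s\<close>.\<close>
  define s where "s = sqrt \<epsilon>"
  have s: "s > 0" "s\<^sup>2 = \<epsilon>" using \<epsilon> by (auto simp: s_def)
  define P where "P y = exp (- (norm y)\<^sup>2)" for y :: "real^3"
  define Q where "Q y = (norm y)\<^sup>2 * exp (- (norm y)\<^sup>2)" for y :: "real^3"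
  define K where "K = (1 + 1 / \<delta>) * (4 * \<epsilon>)"
  have K: "K \<ge> 0" using \<epsilon> \<delta> by (simp add: K_def)
  have Ac: "continuous_on UNIV A" "continuous_on UNIV A'" "continuous_on UNIV S" "continuous_on UNIV N"
    using A A' S N by (simp_all add: linear_continuous_on linear_conv_bounded_linear)
  have main: "ennreal l * (\<integral>\<^sup>+x. ennreal (P (s *\<^sub>R x - c') * (norm (f x))\<^sup>2) \<partial>?M) \<le>
      ennreal (1 + \<delta>) * (\<integral>\<^sup>+x. ennreal (P (s *\<^sub>R x - c') * (norm (g x))\<^sup>2) \<partial>?M) +
      ennreal K * (\<integral>\<^sup>+x. ennreal (Q (s *\<^sub>R x - c') * (norm (f x))\<^sup>2) \<partial>?M)" for c'
  proof -
    define c where "c = (1 / s) *\<^sub>R c'"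
    have sc: "s *\<^sub>R x - c' = s *\<^sub>R (x - c)" for x using s by (simp add: c_def scaleR_diff_right)
    have nsc: "(norm (s *\<^sub>R x - c'))\<^sup>2 = \<epsilon> * (norm (x - c))\<^sup>2" for x
      unfolding sc norm_scaleR power_mult_distrib by (simp add: s(2))
    \<comment> \<open>The real part of \<open>p\<close> is the window. The imaginary part is the
      gauge, with gradient \<open>S x + N c\<close>: it removes the symmetric part of the potential
      difference entirely and freezes the other part at the centre.\<close>
    define p where "p x = complex_of_real (- (\<epsilon> / 2) * ((x - c) \<bullet> (x - c))) + \<i> * complex_of_real ((1/2) * (x \<bullet> S x) + N c \<bullet> x)" for x
    define m where "m x = exp (p x)" for x
    have dp: "(p has_derivative (\<lambda>h. complex_of_real (- \<epsilon> * ((x - c) \<bullet> h)) + \<i> * complex_of_real (S x \<bullet> h + N c \<bullet> h))) (at x)" for x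
    proof -
      have 1: "((\<lambda>x. - (\<epsilon> / 2) * ((x - c) \<bullet> (x - c))) has_derivative (\<lambda>h. - \<epsilon> * ((x - c) \<bullet> h))) (at x)"
        by (auto intro!: derivative_eq_intros simp: inner_commute algebra_simps)
      have 2: "((\<lambda>x. (1/2) * (x \<bullet> S x) + N c \<bullet> x) has_derivative (\<lambda>h. S x \<bullet> h + N c \<bullet> h)) (at x)"
        by (rule has_derivative_eq_rhs[OF has_derivative_add[OF has_derivative_mult_right[OF
                has_derivative_inner[OF has_derivative_ident linear_imp_has_derivative[OF S]]]
              has_derivative_inner_right[OF has_derivative_ident]]])
          (simp add: fun_eq_iff inner_commute[of _ "S x"] sym[of x, symmetric])
      show ?thesis unfolding p_def
        by (intro has_derivative_add has_derivative_mult_right has_derivative_of_real 1 2)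
    qed
    have "smooth_on p UNIV"
      unfolding smooth_on_def p_def diff_conv_add_uminus
      by (intro allI Ck_on_add Ck_on_linear_comp[OF bounded_linear_of_real] Ck_on_linear_comp[OF bounded_linear_mult_right]
          Ck_on_linear_comp[OF bounded_linear_inner_right] Ck_on_const
          Ck_on_inner Ck_on_bounded_linear[OF bounded_linear_ident]
          Ck_on_bounded_linear[OF linear_conv_bounded_linear[THEN iffD1, OF S]] open_UNIV)
    then have ms: "smooth_on m UNIV" unfolding m_def by (intro smooth_on_exp) auto
    have mc: "continuous_on UNIV m" by (rule smooth_on_continuous[OF ms])
    have dm: "partial_deriv j m x = m x * (complex_of_real (- \<epsilon> * (x - c) $ j) + \<i> * complex_of_real (S x $ j + N c $ j))" for j x
      unfolding m_def[abs_def] partial_deriv_exp[OF dp] by (simp add: inner_axis)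
    have nm: "norm (m x) = exp (- (\<epsilon> / 2) * (norm (x - c))\<^sup>2)" for x
      by (simp add: m_def p_def power2_norm_eq_inner)
    have nm2: "(norm (m x))\<^sup>2 = P (s *\<^sub>R x - c')" for x
      unfolding nm nsc P_def by (simp add: power2_eq_square mult_exp_exp)
    define G where "G x = (\<chi> j. m x * g x $ j - \<i> * partial_deriv j m x * f x + of_real ((A x - A' x) $ j) * m x * f x)" for x
    have NA: "A x = A' x - (S x + N x)" for x using diff[of x] by (simp add: algebra_simps)
    \<comment> \<open>The three terms are the localised gradient, the derivative of the window, and
      the potential left after the gauge: \<open>S x + N c\<close> from the phase against
      \<open>- (S x + N x)\<close> leaves \<open>- N (x - c)\<close>.\<close>
    have G: "G x = (\<chi> j. m x * g x $ j) + (\<chi> j. (\<i> * \<epsilon> * m x * f x) * complex_of_real ((x - c) $ j))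
        - (\<chi> j. (m x * f x) * complex_of_real (N (x - c) $ j))" for x
      by (simp add: G_def vec_eq_iff dm NA linear_diff[OF N] algebra_simps)
    have nG: "norm (G x) \<le> norm (m x) * (norm (g x) + 2 * \<epsilon> * norm (x - c) * norm (f x))" for x
    proof -
      have "norm (G x) \<le> norm (m x) * norm (g x) + norm (\<i> * \<epsilon> * m x * f x) * norm (x - c) + norm (m x * f x) * norm (N (x - c))"
        unfolding G norm_complex_vector[symmetric] norm_complex_cmult[symmetric]
        by (rule order_trans[OF norm_triangle_ineq4 add_right_mono[OF norm_triangle_ineq]])
      also have "\<dots> \<le> norm (m x) * norm (g x) + (\<epsilon> * norm (m x * f x)) * norm (x - c) + norm (m x * f x) * (\<epsilon> * norm (x - c))"
        using \<epsilon> by (intro add_mono mult_left_mono Nb) (auto simp: norm_mult)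
      also have "\<dots> = norm (m x) * (norm (g x) + 2 * \<epsilon> * norm (x - c) * norm (f x))"
        by (simp add: norm_mult algebra_simps)
      finally show ?thesis .
    qed
    \<comment> \<open>One of the two powers of \<open>\<epsilon>\<close> is spent on turning the
      squared distance into the scaled variable; hence the error is linear in
      \<open>\<epsilon>\<close>.\<close>
    have Q': "4 * \<epsilon>\<^sup>2 * (norm (x - c))\<^sup>2 * (norm (m x))\<^sup>2 = 4 * \<epsilon> * Q (s *\<^sub>R x - c')" for x
      unfolding nm2 Q_def P_def nsc by (simp add: power2_eq_square[of \<epsilon>])
    have nG2: "(norm (G x))\<^sup>2 \<le> (1 + \<delta>) * (P (s *\<^sub>R x - c') * (norm (g x))\<^sup>2) + K * (Q (s *\<^sub>R x - c') * (norm (f x))\<^sup>2)" for x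
    proof -
      have "(norm (G x))\<^sup>2 \<le> (norm (m x) * (norm (g x) + 2 * \<epsilon> * norm (x - c) * norm (f x)))\<^sup>2"
        by (intro power_mono nG) auto
      also have "\<dots> = (norm (m x))\<^sup>2 * (norm (g x) + 2 * \<epsilon> * norm (x - c) * norm (f x))\<^sup>2"
        by (rule power_mult_distrib)
      also have "\<dots> \<le> (norm (m x))\<^sup>2 * ((1 + \<delta>) * (norm (g x))\<^sup>2 + (1 + 1 / \<delta>) * (2 * \<epsilon> * norm (x - c) * norm (f x))\<^sup>2)"
        by (intro mult_left_mono real_weighted_square \<delta>) auto
      also have "\<dots> = (1 + \<delta>) * ((norm (m x))\<^sup>2 * (norm (g x))\<^sup>2) +
          (1 + 1 / \<delta>) * ((4 * \<epsilon>\<^sup>2 * (norm (x - c))\<^sup>2 * (norm (m x))\<^sup>2) * (norm (f x))\<^sup>2)"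
        by (simp add: power_mult_distrib distrib_left mult_ac)
      also have "\<dots> = (1 + \<delta>) * (P (s *\<^sub>R x - c') * (norm (g x))\<^sup>2) + K * (Q (s *\<^sub>R x - c') * (norm (f x))\<^sup>2)"
        unfolding Q' unfolding nm2 K_def by (simp add: mult_ac)
      finally show ?thesis .
    qed
    have [measurable]: "f \<in> borel_measurable ?M" "g \<in> borel_measurable ?M"
      using D by (auto simp: L2_measurable)
    have mm[measurable]: "m \<in> borel_measurable ?M" by (rule lebesgue_on_measurable_continuous[OF mc])
    have m1: "norm (m x) \<le> 1" for x using \<epsilon> by (simp add: nm)
    have mfL: "(\<lambda>x. m x * f x) \<in> L2 \<Omega>"
    proof (rule L2_bound[OF D(1), of _ 1])
      show "norm (m x * f x) \<le> 1 * norm (f x)" for x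
        unfolding norm_mult using m1 by (intro mult_right_mono) auto
    qed measurable
    have GL: "G \<in> L2 \<Omega>"
    proof -
      \<comment> \<open>The factor \<open>x - c\<close> is unbounded, but times the window it is at
        most \<open>2 / s\<close>, by the Gaussian moment bound; this gives square integrability for
        each fixed centre.\<close>
      have wL: "(\<lambda>x. m x * (of_real (z \<bullet> (x - c)) * f x)) \<in> L2 \<Omega>" for z :: "real^3"
      proof (rule L2_bound[OF D(1), of _ "norm z * (2 / s)"])
        have "(\<lambda>x. m x * of_real (z \<bullet> (x - c))) \<in> borel_measurable ?M"
          by (rule lebesgue_on_measurable_continuous) (intro continuous_intros mc)
        then show "(\<lambda>x. m x * (of_real (z \<bullet> (x - c)) * f x)) \<in> borel_measurable ?M"
          unfolding mult.assoc[symmetric] by measurable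
        fix x
        have "(norm (m x) * (s * norm (x - c)))\<^sup>2 = Q (s *\<^sub>R x - c')"
          unfolding power_mult_distrib nm2 P_def Q_def nsc by (simp add: s(2))
        also have "\<dots> \<le> 2\<^sup>2"
        proof -
          have "Q (s *\<^sub>R x - c') \<le> 2 * exp (- (norm (s *\<^sub>R x - c'))\<^sup>2 / 2)"
            unfolding Q_def by (rule gauss_moment_bound(2)) simp
          also have "\<dots> \<le> 2 * 1" by (intro mult_left_mono) auto
          finally show ?thesis by simp
        qed
        finally have "norm (m x) * (s * norm (x - c)) \<le> 2" by (rule power2_le_imp_le) simp
        then have 1: "norm (m x) * norm (x - c) \<le> 2 / s" using s(1) by (simp add: field_simps)
        have "norm (m x * (of_real (z \<bullet> (x - c)) * f x)) = (norm (m x) * \<bar>z \<bullet> (x - c)\<bar>) * norm (f x)"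
          by (simp add: norm_mult)
        also have "\<dots> \<le> (norm (m x) * (norm z * norm (x - c))) * norm (f x)"
          by (intro mult_right_mono mult_left_mono Cauchy_Schwarz_ineq2) auto
        also have "\<dots> = (norm z * (norm (m x) * norm (x - c))) * norm (f x)" by simp
        also have "\<dots> \<le> (norm z * (2 / s)) * norm (f x)"
          by (intro mult_right_mono mult_left_mono 1) auto
        finally show "norm (m x * (of_real (z \<bullet> (x - c)) * f x)) \<le> (norm z * (2 / s)) * norm (f x)" .
      qed
      have L2_vec: "h \<in> L2 \<Omega>" if "\<And>j. (\<lambda>x. h x $ j) \<in> L2 \<Omega>" for h :: "real^3 \<Rightarrow> complex^3"
      proof -
        have "(\<lambda>x. axis j (h x $ j)) \<in> L2 \<Omega>" for j
          by (rule L2_linear[OF _ that, of "axis j"])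
            (auto intro!: linear_conv_bounded_linear[THEN iffD1] linearI simp: vec_eq_iff axis_def)
        from L2_add[OF L2_add[OF this[of 1] this[of 2]] this[of 3]]
        have "(\<lambda>x. axis 1 (h x $ 1) + axis 2 (h x $ 2) + axis 3 (h x $ 3) :: complex^3) \<in> L2 \<Omega>" .
        then show ?thesis by (rule L2_cong) (simp add: vec_eq_iff forall_3 axis_def)
      qed
      show ?thesis
      proof (rule L2_vec)
        fix j
        have mgL: "(\<lambda>x. m x * g x $ j) \<in> L2 \<Omega>"
        proof (rule L2_bound[OF L2_component[OF D(2), of j], of _ 1])
          have [measurable]: "(\<lambda>x. g x $ j) \<in> borel_measurable ?M" by (rule L2_measurable[OF L2_component[OF D(2)]])
          show "(\<lambda>x. m x * g x $ j) \<in> borel_measurable ?M" by measurable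
          show "norm (m x * g x $ j) \<le> 1 * norm (g x $ j)" for x
            unfolding norm_mult using m1 by (intro mult_right_mono) auto
        qed
        have Nj: "N y $ j = adjoint N (axis j 1) \<bullet> y" for y
          using adjoint_works[OF N, of y "axis j 1"] by (simp add: inner_axis inner_commute)
        have "(\<lambda>x. (m x * g x $ j + (\<i> * \<epsilon>) * (m x * (of_real (axis j 1 \<bullet> (x - c)) * f x)))
            - m x * (of_real (adjoint N (axis j 1) \<bullet> (x - c)) * f x)) \<in> L2 \<Omega>"
          by (intro L2_diff L2_add L2_cmult wL mgL)
        moreover have "G x $ j = m x * g x $ j + (\<i> * \<epsilon>) * (m x * (of_real (axis j 1 \<bullet> (x - c)) * f x))
            - m x * (of_real (adjoint N (axis j 1) \<bullet> (x - c)) * f x)" for x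
          unfolding G Nj[symmetric] inner_axis' by (simp add: algebra_simps)
        ultimately show "(\<lambda>x. G x $ j) \<in> L2 \<Omega>" by simp
      qed
    qed
    have mG: "(\<lambda>x. m x * f x, G) \<in> mgraph A \<Omega>"
      using magnetic_gradient_mult[OF ms Ac(1,2) \<Omega> fg] mfL GL unfolding mgraph_def G_def by simp
    have nn: "(\<integral>\<^sup>+x. ennreal ((norm (h x))\<^sup>2) \<partial>?M) = ennreal (l2sq \<Omega> h)" if "h \<in> L2 \<Omega>" for h :: "real^3 \<Rightarrow> 'z::euclidean_space"
      unfolding l2sq_def using L2_integrable[OF that] by (simp add: nn_integral_eq_integral)
    have "ennreal l * (\<integral>\<^sup>+x. ennreal (P (s *\<^sub>R x - c') * (norm (f x))\<^sup>2) \<partial>?M) = ennreal l * ennreal (l2sq \<Omega> (\<lambda>x. m x * f x))"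
      unfolding nn[OF mfL, symmetric] by (simp add: nm2 norm_mult power_mult_distrib)
    also have "\<dots> = ennreal (l * l2sq \<Omega> (\<lambda>x. m x * f x))" using l(2) by (simp add: ennreal_mult l2sq_nonneg)
    also have "\<dots> \<le> ennreal (l2sq \<Omega> G)" using l(1) mG by (intro ennreal_leI) (auto simp: low_bounds_def)
    also have "\<dots> = (\<integral>\<^sup>+x. ennreal ((norm (G x))\<^sup>2) \<partial>?M)" by (rule nn[OF GL, symmetric])
    also have "\<dots> \<le> (\<integral>\<^sup>+x. ennreal (1 + \<delta>) * ennreal (P (s *\<^sub>R x - c') * (norm (g x))\<^sup>2) + ennreal K * ennreal (Q (s *\<^sub>R x - c') * (norm (f x))\<^sup>2) \<partial>?M)"
    proof (rule nn_integral_mono)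
      fix x
      have "ennreal ((norm (G x))\<^sup>2) \<le> ennreal ((1 + \<delta>) * (P (s *\<^sub>R x - c') * (norm (g x))\<^sup>2) + K * (Q (s *\<^sub>R x - c') * (norm (f x))\<^sup>2))"
        by (rule ennreal_leI[OF nG2])
      also have "\<dots> = ennreal (1 + \<delta>) * ennreal (P (s *\<^sub>R x - c') * (norm (g x))\<^sup>2) + ennreal K * ennreal (Q (s *\<^sub>R x - c') * (norm (f x))\<^sup>2)"
        using \<delta> K by (simp add: ennreal_plus ennreal_mult P_def Q_def del: ennreal_plus[symmetric])
      finally show "ennreal ((norm (G x))\<^sup>2) \<le> ennreal (1 + \<delta>) * ennreal (P (s *\<^sub>R x - c') * (norm (g x))\<^sup>2) + ennreal K * ennreal (Q (s *\<^sub>R x - c') * (norm (f x))\<^sup>2)" .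
    qed
    also have "\<dots> = ennreal (1 + \<delta>) * (\<integral>\<^sup>+x. ennreal (P (s *\<^sub>R x - c') * (norm (g x))\<^sup>2) \<partial>?M) +
      ennreal K * (\<integral>\<^sup>+x. ennreal (Q (s *\<^sub>R x - c') * (norm (f x))\<^sup>2) \<partial>?M)"
    proof -
      have [measurable]: "(\<lambda>x. P (s *\<^sub>R x - c')) \<in> borel_measurable ?M" "(\<lambda>x. Q (s *\<^sub>R x - c')) \<in> borel_measurable ?M"
        unfolding P_def Q_def by (intro lebesgue_on_measurable_continuous continuous_intros)+
      show ?thesis by (simp add: nn_integral_add nn_integral_cmult)
    qed
    finally show ?thesis .
  qed
  have Pc: "continuous_on UNIV P" "continuous_on UNIV Q" unfolding P_def Q_def by (intro continuous_intros)+
  have Pi: "integrable lborel P" "integrable lborel Q"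
    using gauss_moments_integrable unfolding P_def Q_def by auto
  have pos: "P y \<ge> 0" "Q y \<ge> 0" for y by (auto simp: P_def Q_def)
  have \<Omega>s: "\<Omega> \<in> sets lebesgue" using \<Omega> by auto
  note W1 = window_average[OF Pi(1) pos(1) Pc(1) L2_integrable[OF D(1)] zero_le_power2 \<Omega>s]
    and W2 = window_average[OF Pi(1) pos(1) Pc(1) L2_integrable[OF D(2)] zero_le_power2 \<Omega>s]
    and W3 = window_average[OF Pi(2) pos(2) Pc(2) L2_integrable[OF D(1)] zero_le_power2 \<Omega>s]
  note [measurable] = W1(2) W2(2) W3(2)
  have ab: "a = (LINT x|lborel. P x)" "b = (LINT x|lborel. Q x)" by (simp_all add: a_def b_def P_def Q_def)
  have ab0: "a \<ge> 0" "b \<ge> 0" unfolding ab using pos by simp_all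
  have "(\<integral>\<^sup>+c. ennreal l * (\<integral>\<^sup>+x. ennreal (P (s *\<^sub>R x - c) * (norm (f x))\<^sup>2) \<partial>?M) \<partial>lborel) \<le>
      (\<integral>\<^sup>+c. ennreal (1 + \<delta>) * (\<integral>\<^sup>+x. ennreal (P (s *\<^sub>R x - c) * (norm (g x))\<^sup>2) \<partial>?M) +
      ennreal K * (\<integral>\<^sup>+x. ennreal (Q (s *\<^sub>R x - c) * (norm (f x))\<^sup>2) \<partial>?M) \<partial>lborel)"
    by (rule nn_integral_mono[OF main])
  then have "ennreal l * ennreal (a * l2sq \<Omega> f) \<le> ennreal (1 + \<delta>) * ennreal (a * l2sq \<Omega> g) + ennreal K * ennreal (b * l2sq \<Omega> f)"
    by (simp add: nn_integral_add nn_integral_cmult W1(1) W2(1) W3(1) ab l2sq_def)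
  then have "ennreal (l * (a * l2sq \<Omega> f)) \<le> ennreal ((1 + \<delta>) * (a * l2sq \<Omega> g) + K * (b * l2sq \<Omega> f))"
    using l(2) \<delta> K ab0 l2sq_nonneg[of \<Omega> f] l2sq_nonneg[of \<Omega> g] by (simp add: ennreal_mult ennreal_plus)
  then have "l * (a * l2sq \<Omega> f) \<le> (1 + \<delta>) * (a * l2sq \<Omega> g) + K * (b * l2sq \<Omega> f)"
    using \<delta> K ab0 l2sq_nonneg[of \<Omega> f] l2sq_nonneg[of \<Omega> g] by (subst (asm) ennreal_le_iff) auto
  then show ?thesis by (simp add: K_def)
qed

section \<open>Linear changes of variables\<close>

text \<open>Boxes determine the measure. The preimage of a box is its image under the inverse map,
  and \<open>K\<close> takes it back to the box with the determinant as volume factor.\<close>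

lemma lborel_linear:
  fixes K :: "real^'n::{finite,wellorder} \<Rightarrow> real^'n::_"
  assumes K: "linear K" "inj K"
  shows "lborel = density (distr lborel borel K) (\<lambda>_. ennreal \<bar>det (matrix K)\<bar>)"
proof (rule lborel_eqI)
  fix l u :: "(real, 'n) vec" assume lu: "\<And>b. b \<in> Basis \<Longrightarrow> l \<bullet> b \<le> u \<bullet> b"
  have Km[measurable]: "K \<in> borel_measurable borel"
    using K(1) by (intro borel_measurable_continuous_onI linear_continuous_on) (simp add: linear_conv_bounded_linear)
  obtain K' where K': "linear K'" "\<And>x. K' (K x) = x" "\<And>x. K (K' x) = x"
    using linear_injective_isomorphism[OF K] by auto
  have v: "K -` box l u = K' ` box l u" using K'(2,3) by (auto simp: image_iff) metis
  have m: "K' ` box l u \<in> lmeasurable" by (rule measurable_linear_image[OF K'(1)]) simp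
  have b: "K ` (K' ` box l u) = box l u" using K'(3) by (simp add: image_comp o_def)
  have "measure lebesgue (box l u) = \<bar>det (matrix K)\<bar> * measure lebesgue (K' ` box l u)"
    using measure_linear_image[OF K(1) m] unfolding b by simp
  moreover have "emeasure lborel (K -` box l u) = ennreal (measure lebesgue (K' ` box l u))"
  proof -
    have "emeasure lborel (K -` box l u) = emeasure lebesgue (K' ` box l u)"
      unfolding v[symmetric] using measurable_sets_borel[OF Km, of "box l u"] by simp
    also have "\<dots> = ennreal (measure lebesgue (K' ` box l u))"
      using m by (simp add: emeasure_eq_measure2 fmeasurableD2)
    finally show ?thesis .
  qed
  ultimately show "emeasure (density (distr lborel borel K) (\<lambda>_. ennreal \<bar>det (matrix K)\<bar>)) (box l u) =
      ennreal (\<Prod>b\<in>Basis. (u - l) \<bullet> b)"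
    using lu by (simp add: emeasure_density nn_integral_cmult emeasure_distr ennreal_mult[symmetric] measure_lborel_box_eq inner_diff_left)
qed simp

text \<open>Passing to the completion requires that \<open>K\<close> respects null sets in both
  directions, which holds because the determinant is nonzero.\<close>

lemma lebesgue_linear:
  fixes K :: "real^'n::{finite,wellorder} \<Rightarrow> real^'n::_"
  assumes K: "linear K" "inj K"
  shows "lebesgue = density (distr lebesgue lebesgue K) (\<lambda>_. ennreal \<bar>det (matrix K)\<bar>)"
    and "K \<in> lebesgue \<rightarrow>\<^sub>M lebesgue"
proof -
  let ?d = "\<bar>det (matrix K)\<bar>"
  have d: "?d > 0" using det_nz_iff_inj[OF K(1)] K(2) by simp
  have Km[measurable]: "K \<in> borel \<rightarrow>\<^sub>M borel"
    using K(1) by (intro borel_measurable_continuous_onI linear_continuous_on) (simp add: linear_conv_bounded_linear)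
  { fix A :: "(real, 'n) vec set" assume A: "A \<in> sets borel"
    then have "emeasure lborel A = 0 \<longleftrightarrow> emeasure (density (distr lborel borel K) (\<lambda>_. ennreal ?d)) A = 0"
      by (subst lborel_linear[OF K, symmetric]) auto
    also have "\<dots> \<longleftrightarrow> emeasure (distr lebesgue lborel K) A = 0"
      using A d by (simp add: distr_completion emeasure_density nn_integral_cmult cong: distr_cong)
    finally have "emeasure lborel A = 0 \<longleftrightarrow> emeasure (distr lebesgue lborel K) A = 0" . }
  then have eq: "null_sets lborel = null_sets (distr lebesgue lborel K)"
    by (auto simp: null_sets_def)
  show "K \<in> lebesgue \<rightarrow>\<^sub>M lebesgue"
    by (simp add: completion.measurable_completion2 eq measurable_completion)
  have "lebesgue = completion (density (distr lborel borel K) (\<lambda>_. ennreal ?d))"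
    by (subst lborel_linear[OF K]) simp
  also have "\<dots> = density (completion (distr lebesgue lborel K)) (\<lambda>_. ennreal ?d)"
    using d by (auto intro!: always_eventually completion_density_eq simp: distr_completion cong: distr_cong)
  also have "\<dots> = density (distr lebesgue lebesgue K) (\<lambda>_. ennreal ?d)"
    by (subst completion.completion_distr_eq) (auto simp: eq measurable_completion)
  finally show "lebesgue = density (distr lebesgue lebesgue K) (\<lambda>_. ennreal ?d)" .
qed

section \<open>Square integrable functions under linear maps\<close>

context
  fixes K :: "real^'n::{finite,wellorder} \<Rightarrow> real^'n::_" and T :: "(real, 'n) vec set"
  assumes K: "linear K" "inj K" and T: "T \<in> sets lebesgue" "K ` T \<in> sets lebesgue"
begin

lemma measurable_lebesgue_on_linear: "K \<in> lebesgue_on T \<rightarrow>\<^sub>M lebesgue_on (K ` T)"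
  by (rule measurable_restrict_space3[OF lebesgue_linear(2)[OF K]]) auto

lemma lebesgue_on_linear_image:
  "lebesgue_on (K ` T) = density (distr (lebesgue_on T) (lebesgue_on (K ` T)) K) (\<lambda>_. ennreal \<bar>det (matrix K)\<bar>)"
proof (rule measure_eqI)
  note [measurable] = measurable_lebesgue_on_linear
  fix X assume X: "X \<in> sets (lebesgue_on (K ` T))"
  then have Xs: "X \<subseteq> K ` T" "X \<in> sets lebesgue" using T by (auto simp: sets_restrict_space_iff)
  have v: "K -` X \<inter> T = K -` X" using Xs(1) K(2) by (auto simp: inj_def)
  have vm: "K -` X \<in> sets lebesgue" using measurable_sets[OF lebesgue_linear(2)[OF K] Xs(2)] by simp
  have "emeasure (lebesgue_on (K ` T)) X = emeasure lebesgue X"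
    using Xs T by (simp add: emeasure_restrict_space)
  also have "\<dots> = emeasure (density (distr lebesgue lebesgue K) (\<lambda>_. ennreal \<bar>det (matrix K)\<bar>)) X"
    by (subst lebesgue_linear(1)[OF K]) simp
  also have "\<dots> = ennreal \<bar>det (matrix K)\<bar> * emeasure lebesgue (K -` X)"
    using Xs(2) lebesgue_linear(2)[OF K] by (simp add: emeasure_density nn_integral_cmult emeasure_distr)
  also have "emeasure lebesgue (K -` X) = emeasure (lebesgue_on T) (K -` X \<inter> T)"
    using v T vm by (subst emeasure_restrict_space) auto
  also have "ennreal \<bar>det (matrix K)\<bar> * \<dots> = emeasure (density (distr (lebesgue_on T) (lebesgue_on (K ` T)) K) (\<lambda>_. ennreal \<bar>det (matrix K)\<bar>)) X"
    using X by (simp add: emeasure_density nn_integral_cmult emeasure_distr measurable_lebesgue_on_linear space_restrict_space)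
  finally show "emeasure (lebesgue_on (K ` T)) X = emeasure (density (distr (lebesgue_on T) (lebesgue_on (K ` T)) K) (\<lambda>_. ennreal \<bar>det (matrix K)\<bar>)) X" .
qed simp

lemma integral_linear_image:
  fixes h :: "real^'n::{finite,wellorder} \<Rightarrow> 'c::euclidean_space"
  assumes h: "h \<in> borel_measurable (lebesgue_on (K ` T))"
  shows "(LINT x|lebesgue_on (K ` T). h x) = \<bar>det (matrix K)\<bar> *\<^sub>R (LINT x|lebesgue_on T. h (K x))"
    and "integrable (lebesgue_on (K ` T)) h \<Longrightarrow> integrable (lebesgue_on T) (\<lambda>x. h (K x))"
    and "(\<lambda>x. h (K x)) \<in> borel_measurable (lebesgue_on T)"
proof -
  note [measurable] = measurable_lebesgue_on_linear
  let ?D = "distr (lebesgue_on T) (lebesgue_on (K ` T)) K"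
  have h': "h \<in> borel_measurable ?D" using h by simp
  show "(\<lambda>x. h (K x)) \<in> borel_measurable (lebesgue_on T)"
    by (rule measurable_compose[OF measurable_lebesgue_on_linear h])
  have "(LINT x|lebesgue_on (K ` T). h x) = (LINT x|density ?D (\<lambda>_. ennreal \<bar>det (matrix K)\<bar>). h x)"
    by (simp flip: lebesgue_on_linear_image)
  also have "\<dots> = (LINT x|?D. \<bar>det (matrix K)\<bar> *\<^sub>R h x)"
    by (rule integral_density) (use h' in auto)
  also have "\<dots> = \<bar>det (matrix K)\<bar> *\<^sub>R (LINT x|lebesgue_on T. h (K x))"
    using integral_distr[OF measurable_lebesgue_on_linear h] by simp
  finally show "(LINT x|lebesgue_on (K ` T). h x) = \<bar>det (matrix K)\<bar> *\<^sub>R (LINT x|lebesgue_on T. h (K x))" .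
  assume "integrable (lebesgue_on (K ` T)) h"
  then have "integrable (density ?D (\<lambda>_. ennreal \<bar>det (matrix K)\<bar>)) h" by (simp flip: lebesgue_on_linear_image)
  then have "integrable ?D (\<lambda>x. \<bar>det (matrix K)\<bar> *\<^sub>R h x)"
    by (subst (asm) integrable_density) (use h' in auto)
  from integrable_scaleR_right[OF this, of "1 / \<bar>det (matrix K)\<bar>"]
  have "integrable ?D h" using det_nz_iff_inj[OF K(1)] K(2) by simp
  then show "integrable (lebesgue_on T) (\<lambda>x. h (K x))"
    using integrable_distr_eq[OF measurable_lebesgue_on_linear h] by simp
qed

lemma L2_linear_image:
  fixes h :: "real^'n::{finite,wellorder} \<Rightarrow> 'c::euclidean_space"
  assumes h: "h \<in> L2 (K ` T)"
  shows "(\<lambda>x. h (K x)) \<in> L2 T" "l2sq (K ` T) h = \<bar>det (matrix K)\<bar> * l2sq T (\<lambda>x. h (K x))"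
proof -
  have m: "(\<lambda>x. (norm (h x))\<^sup>2) \<in> borel_measurable (lebesgue_on (K ` T))"
    using L2_measurable[OF h] by measurable
  show "(\<lambda>x. h (K x)) \<in> L2 T"
    using integral_linear_image(2)[OF m L2_integrable[OF h]] integral_linear_image(3)[OF L2_measurable[OF h]]
    by (simp add: L2_def)
  show "l2sq (K ` T) h = \<bar>det (matrix K)\<bar> * l2sq T (\<lambda>x. h (K x))"
    unfolding l2sq_def integral_linear_image(1)[OF m] by simp
qed

end

lemma smooth_on_comp_linear:
  fixes L :: "'a::euclidean_space \<Rightarrow> 'b::euclidean_space"
  assumes "linear L" "smooth_on f UNIV"
  shows "smooth_on (\<lambda>x. f (L x)) UNIV"
  using Ck_on_comp_affine[of L UNIV UNIV 0 _ f] assms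
  by (auto simp: smooth_on_def linear_conv_bounded_linear)

lemma test_function_linear:
  assumes K: "linear K" "linear K'" "\<And>x. K' (K x) = x" "\<And>x. K (K' x) = x" and \<psi>: "\<psi> \<in> test_functions T"
  shows "(\<lambda>y. \<psi> (K' y)) \<in> test_functions (K ` T)"
proof -
  note D = test_functionD[OF \<psi>]
  have "{y. \<psi> (K' y) \<noteq> 0} = K ` {x. \<psi> x \<noteq> 0}" using K(3,4) by (auto simp: image_iff) metis
  moreover have "inj K" using K(3) by (metis injI)
  ultimately have c: "closure {y. \<psi> (K' y) \<noteq> 0} = K ` closure {x. \<psi> x \<noteq> 0}"
    using closure_injective_linear_image[OF K(1)] by simp
  have "compact (K ` closure {x. \<psi> x \<noteq> 0})"
    using D(2) K(1) by (intro compact_continuous_image linear_continuous_on) (simp add: linear_conv_bounded_linear)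
  then show ?thesis
    unfolding test_functions_def mem_Collect_eq c
    using smooth_on_comp_linear[OF K(2) D(1)] image_mono[OF D(3)] by simp
qed

text \<open>The real transpose of \<open>K\<close> acting on complex vectors, as the chain rule for
  gradients demands.\<close>

definition pullback :: "(real^3 \<Rightarrow> real^3) \<Rightarrow> complex^3 \<Rightarrow> complex^3" where
  "pullback K z = (\<chi> j. \<Sum>i\<in>UNIV. of_real (K (axis j 1) $ i) * z $ i)"

lemma linear_pullback: "bounded_linear (pullback K)"
  by (rule linear_conv_bounded_linear[THEN iffD1], rule linearI)
    (auto simp: pullback_def vec_eq_iff sum.distrib algebra_simps scaleR_sum_right)

lemma adjoint_component:
  fixes K :: "real^3 \<Rightarrow> real^3"
  assumes "linear K"
  shows "adjoint K v $ j = (\<Sum>i\<in>UNIV. K (axis j 1) $ i * v $ i)"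
  using adjoint_works[OF assms, of "axis j 1" v] unfolding inner_axis' by (simp add: inner_vec_def)

text \<open>A real matrix acts separately on real and imaginary parts, and the adjoint of
  \<open>K\<close> satisfies the same norm bound as \<open>K\<close>.\<close>

lemma norm_pullback:
  assumes K: "linear K" and b: "\<And>v. norm (K v) \<le> \<kappa> * norm v"
  shows "norm (pullback K z) \<le> \<kappa> * norm z"
proof -
  have \<kappa>: "\<kappa> \<ge> 0"
    using order_trans[OF norm_ge_zero b[of "axis 1 1"]] by simp
  define re where "re w = (\<chi> i. Re (w $ i))" for w :: "complex^3"
  define im where "im w = (\<chi> i. Im (w $ i))" for w :: "complex^3"
  have n: "(norm w)\<^sup>2 = (norm (re w))\<^sup>2 + (norm (im w))\<^sup>2" for w :: "complex^3"
    unfolding power2_norm_eq_inner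
    by (simp add: inner_vec_def re_def im_def inner_complex_def sum.distrib)
  have ad: "norm (adjoint K v) \<le> \<kappa> * norm v" for v
  proof (cases "adjoint K v = 0")
    case False
    have "norm (adjoint K v) * norm (adjoint K v) = adjoint K v \<bullet> adjoint K v"
      by (simp add: power2_norm_eq_inner[symmetric] power2_eq_square)
    also have "\<dots> = K (adjoint K v) \<bullet> v" by (rule adjoint_works[OF K])
    also have "\<dots> \<le> norm (K (adjoint K v)) * norm v" by (rule norm_cauchy_schwarz)
    also have "\<dots> \<le> (\<kappa> * norm (adjoint K v)) * norm v" by (intro mult_right_mono b) simp
    finally have "norm (adjoint K v) * norm (adjoint K v) \<le> (\<kappa> * norm v) * norm (adjoint K v)" by (simp add: mult_ac)
    then show ?thesis using False by simp
  qed (use \<kappa> in simp)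
  have "re (pullback K z) = adjoint K (re z)" "im (pullback K z) = adjoint K (im z)"
    by (simp_all add: vec_eq_iff re_def im_def pullback_def adjoint_component[OF K])
  then have "(norm (pullback K z))\<^sup>2 = (norm (adjoint K (re z)))\<^sup>2 + (norm (adjoint K (im z)))\<^sup>2"
    using n[of "pullback K z"] by simp
  also have "\<dots> \<le> (\<kappa> * norm (re z))\<^sup>2 + (\<kappa> * norm (im z))\<^sup>2"
    by (intro add_mono power_mono ad) auto
  also have "\<dots> = (\<kappa> * norm z)\<^sup>2" by (simp add: power_mult_distrib n[of z] algebra_simps)
  finally show ?thesis by (rule power2_le_imp_le) (use \<kappa> in simp)
qed

lemma mgraph_linear_image:
  assumes K: "linear K" "inj K" and T: "open T" and A: "linear A" and fg: "(f, g) \<in> mgraph A (K ` T)"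
  shows "(\<lambda>x. f (K x), \<lambda>x. pullback K (g (K x))) \<in> mgraph (\<lambda>x. adjoint K (A (K x))) T"
proof -
  obtain K' where K': "linear K'" "\<And>x. K' (K x) = x" "\<And>x. K (K' x) = x"
    using linear_injective_isomorphism[OF K] by auto
  have KT: "open (K ` T)"
    using open_surjective_linear_image[OF T K(1)] K'(3) by (metis surjI)
  have Ts: "T \<in> sets lebesgue" "K ` T \<in> sets lebesgue" using T KT by auto
  note D = mgraphD[OF fg]
  have Ac: "continuous_on UNIV A" using A by (simp add: linear_continuous_on linear_conv_bounded_linear)
  define d where "d = \<bar>det (matrix K)\<bar>"
  have d: "d > 0" using det_nz_iff_inj[OF K(1)] K(2) by (simp add: d_def)
  have "magnetic_gradient (\<lambda>x. adjoint K (A (K x))) T (\<lambda>x. f (K x)) (\<lambda>x. pullback K (g (K x)))"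
    unfolding magnetic_gradient_def
  proof (intro ballI allI)
    fix \<psi> j assume \<psi>: "\<psi> \<in> test_functions T"
    define \<psi>' where "\<psi>' y = \<psi> (K' y)" for y
    have t: "\<psi>' \<in> test_functions (K ` T)"
      unfolding \<psi>'_def by (rule test_function_linear[OF K(1) K' \<psi>])
    note H = test_function_form_L2[OF Ac KT t]
    define k where "k i = complex_of_real (K (axis j 1) $ i)" for i
    let ?H = "\<lambda>i y. \<i> * partial_deriv i \<psi>' y + of_real (A y $ i) * \<psi>' y"
    have i1: "integrable (lebesgue_on (K ` T)) (\<lambda>y. g y $ i * \<psi>' y)" for i
      by (rule L2_mult_integrable[OF L2_component[OF D(2)] H(1)])
    have i2: "integrable (lebesgue_on (K ` T)) (\<lambda>y. f y * ?H i y)" for i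
      by (rule L2_mult_integrable[OF D(1) H(2)])
    have m1: "(\<lambda>y. \<Sum>i\<in>UNIV. k i * (g y $ i * \<psi>' y)) \<in> borel_measurable (lebesgue_on (K ` T))"
      using i1 by (intro borel_measurable_integrable Bochner_Integration.integrable_sum integrable_mult_right)
    have m2: "(\<lambda>y. \<Sum>i\<in>UNIV. k i * (f y * ?H i y)) \<in> borel_measurable (lebesgue_on (K ` T))"
      using i2 by (intro borel_measurable_integrable Bochner_Integration.integrable_sum integrable_mult_right)
    have "d *\<^sub>R (LINT x|lebesgue_on T. pullback K (g (K x)) $ j * \<psi> x) =
        d *\<^sub>R (LINT x|lebesgue_on T. (\<Sum>i\<in>UNIV. k i * (g (K x) $ i * \<psi>' (K x))))"
      by (simp add: pullback_def k_def \<psi>'_def K'(2) sum_distrib_right mult.assoc)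
    also have "\<dots> = (LINT y|lebesgue_on (K ` T). (\<Sum>i\<in>UNIV. k i * (g y $ i * \<psi>' y)))"
      unfolding d_def by (rule integral_linear_image(1)[OF K Ts m1, symmetric])
    also have "\<dots> = (\<Sum>i\<in>UNIV. k i * (LINT y|lebesgue_on (K ` T). g y $ i * \<psi>' y))"
      by (subst Bochner_Integration.integral_sum) (simp_all add: i1)
    also have "\<dots> = (\<Sum>i\<in>UNIV. k i * (LINT y|lebesgue_on (K ` T). f y * ?H i y))"
      by (simp only: magnetic_gradientD[OF D(3) t])
    also have "\<dots> = (LINT y|lebesgue_on (K ` T). (\<Sum>i\<in>UNIV. k i * (f y * ?H i y)))"
      by (subst Bochner_Integration.integral_sum) (simp_all only: integrable_mult_right[OF i2] integral_mult_right_zero)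
    also have "\<dots> = d *\<^sub>R (LINT x|lebesgue_on T. (\<Sum>i\<in>UNIV. k i * (f (K x) * ?H i (K x))))"
      unfolding d_def by (rule integral_linear_image(1)[OF K Ts m2])
    also have "(LINT x|lebesgue_on T. (\<Sum>i\<in>UNIV. k i * (f (K x) * ?H i (K x)))) =
      (LINT x|lebesgue_on T. f (K x) * (\<i> * partial_deriv j \<psi> x + of_real (adjoint K (A (K x)) $ j) * \<psi> x))"
    proof (rule Bochner_Integration.integral_cong[OF refl])
      fix x
      have dK: "(K' has_derivative K') (at y)" for y by (rule linear_imp_has_derivative[OF K'(1)])
      have p: "frechet_derivative \<psi>' (at (K x)) = (\<lambda>h. frechet_derivative \<psi> (at x) (K' h))"
        using frechet_derivative_at[OF diff_chain_at[OF dK[of "K x"] test_function_differentiable[OF \<psi>]]]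
        by (simp add: o_def \<psi>'_def[abs_def] K'(2))
      have lin: "linear (frechet_derivative \<psi>' (at (K x)))"
        by (rule has_derivative_linear[OF test_function_differentiable[OF t]])
      have "(\<Sum>i\<in>UNIV. k i * partial_deriv i \<psi>' (K x)) = (\<Sum>i\<in>UNIV. frechet_derivative \<psi>' (at (K x)) (K (axis j 1) $ i *\<^sub>R axis i 1))"
        unfolding linear_scale[OF lin] by (simp add: k_def partial_deriv_def scaleR_conv_of_real)
      also have "\<dots> = frechet_derivative \<psi>' (at (K x)) (\<Sum>i\<in>UNIV. K (axis j 1) $ i *\<^sub>R axis i 1)"
        by (rule linear_sum[OF lin, symmetric])
      also have "(\<Sum>i\<in>UNIV. K (axis j 1) $ i *\<^sub>R axis i 1) = K (axis j 1)"
        by (simp add: basis_expansion flip: scalar_mult_eq_scaleR)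
      finally have P: "(\<Sum>i\<in>UNIV. k i * partial_deriv i \<psi>' (K x)) = partial_deriv j \<psi> x"
        unfolding p by (simp add: K'(2) partial_deriv_def)
      have Q: "(\<Sum>i\<in>UNIV. k i * of_real (A (K x) $ i)) = of_real (adjoint K (A (K x)) $ j)"
        unfolding adjoint_component[OF K(1)] k_def by simp
      have "(\<Sum>i\<in>UNIV. k i * (f (K x) * ?H i (K x))) =
        f (K x) * (\<i> * (\<Sum>i\<in>UNIV. k i * partial_deriv i \<psi>' (K x)) + (\<Sum>i\<in>UNIV. k i * of_real (A (K x) $ i)) * \<psi>' (K x))"
        by (simp add: sum_distrib_left sum_distrib_right sum.distrib[symmetric] algebra_simps)
      then show "(\<Sum>i\<in>UNIV. k i * (f (K x) * ?H i (K x))) =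
        f (K x) * (\<i> * partial_deriv j \<psi> x + of_real (adjoint K (A (K x)) $ j) * \<psi> x)"
        unfolding P Q by (simp add: \<psi>'_def K'(2))
    qed
    finally show "(LINT x|lebesgue_on T. pullback K (g (K x)) $ j * \<psi> x) =
      (LINT x|lebesgue_on T. f (K x) * (\<i> * partial_deriv j \<psi> x + of_real (adjoint K (A (K x)) $ j) * \<psi> x))"
      using d by simp
  qed
  then show ?thesis
    using L2_linear_image(1)[OF K Ts D(1)] L2_linear[OF linear_pullback L2_linear_image(1)[OF K Ts D(2)]]
    by (simp add: mgraph_def)
qed

section \<open>Continuity of the energy\<close>

lemma axis_expansion_3: "v = (v $ 1) *\<^sub>R axis 1 1 + (v $ 2) *\<^sub>R axis 2 1 + (v $ 3) *\<^sub>R axis 3 1" for v :: "real^3"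
  by (simp add: vec_eq_iff forall_3 axis_def)

lemma linear_partial_deriv:
  assumes "linear A"
  shows "partial_deriv j A x = A (axis j 1)"
  using frechet_derivative_at[OF linear_imp_has_derivative[OF assms], of x] by (simp add: partial_deriv_def)

text \<open>The field fixes exactly the antisymmetric part of a linear potential. Bounds on this
  part therefore do not depend on which potential was chosen.\<close>

lemma curl_antisymmetric_part:
  assumes A: "linear A" and c: "curl A x = B"
  shows "A v \<bullet> w - A w \<bullet> v = cross3 B v \<bullet> w"
proof -
  have e: "A v = (v $ 1) *\<^sub>R A (axis 1 1) + (v $ 2) *\<^sub>R A (axis 2 1) + (v $ 3) *\<^sub>R A (axis 3 1)" for v
    by (subst axis_expansion_3[of v]) (simp add: linear_add[OF A] linear_scale[OF A])
  have B: "B = vector [A (axis 2 1) $ 3 - A (axis 3 1) $ 2, A (axis 3 1) $ 1 - A (axis 1 1) $ 3, A (axis 1 1) $ 2 - A (axis 2 1) $ 1]"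
    using c unfolding curl_def linear_partial_deriv[OF A] by simp
  show ?thesis
    unfolding e[of v] e[of w] B by (simp add: cross3_def inner_vec_def sum_3 algebra_simps)
qed

text \<open>The symmetric gauge, half the cross product of \<open>B\<close> with \<open>x\<close>,
  shows that the choice operator in the definition has something to choose.\<close>

lemma linear_potential: "linear (linear_potential B)" "curl (linear_potential B) x = B"
proof -
  let ?A = "\<lambda>x. (1/2) *\<^sub>R cross3 B x"
  have lin: "linear ?A" by (rule linearI) (simp_all add: cross_add_right cross_mult_right scaleR_add_right)
  have "curl ?A x = B" for x
    unfolding curl_def linear_partial_deriv[OF lin]
    by (simp add: vec_eq_iff forall_3 cross3_def axis_def)
  then have "\<exists>A. linear A \<and> (\<forall>x. curl A x = B)" using lin by blast
  from someI_ex[OF this] show "linear (linear_potential B)" "curl (linear_potential B) x = B"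
    unfolding linear_potential_def by auto
qed

text \<open>The Gaussian pair provides the nonzero element of the form domain that makes the energy
  the largest lower bound; 0 is always a lower bound.\<close>

lemma energy_bottom:
  assumes "open T" "T \<noteq> {}"
  shows "energy B T \<in> low_bounds (linear_potential B) T"
    "l \<in> low_bounds (linear_potential B) T \<Longrightarrow> l \<le> energy B T"
    "energy B T \<ge> 0"
proof -
  note A = linear_potential(1)[of B]
  have Ac: "continuous_on UNIV (linear_potential B)" using A by (simp add: linear_continuous_on linear_conv_bounded_linear)
  obtain f g where fg: "(f, g) \<in> mgraph (linear_potential B) T" "l2sq T f > 0"
    using gauss_mgraph[OF A assms] by blast
  note b = spectrum_bottom[OF Ac assms(1) fg, folded energy_def]
  show "energy B T \<in> low_bounds (linear_potential B) T" by (rule b(1))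
  show "l \<in> low_bounds (linear_potential B) T \<Longrightarrow> l \<le> energy B T" by (rule b(2))
  show "energy B T \<ge> 0" by (rule b(2)) (auto simp: low_bounds_def l2sq_nonneg)
qed

text \<open>The mean of |y|^2 under the normalised weight exp (- |y|^2), that is, the averaged error
  of a window relative to its mass.\<close>

definition gauss_ratio :: real where
  "gauss_ratio = (LINT y|lborel. (norm (y :: real^3))\<^sup>2 * exp (- (norm y)\<^sup>2)) / (LINT y|lborel. exp (- (norm (y :: real^3))\<^sup>2))"

lemma gauss_mass_pos: "(LINT y|lborel. exp (- (norm (y :: real^3))\<^sup>2)) > 0"
proof -
  have "(LINT y|lborel. exp (- (norm (y :: real^3))\<^sup>2)) \<noteq> 0"
  proof
    assume "(LINT y|lborel. exp (- (norm (y :: real^3))\<^sup>2)) = 0"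
    then have "AE y :: real^3 in lborel. exp (- (norm y)\<^sup>2) = 0"
      using integral_nonneg_eq_0_iff_AE[OF gauss_moments_integrable(1)[where 'a = "real^3"]] by simp
    then have "AE y :: real^3 in lborel. False" by simp
    then have "emeasure lborel (UNIV :: (real^3) set) = 0" by (subst (asm) AE_iff_measurable[OF _ refl]) auto
    then show False by simp
  qed
  moreover have "(LINT y|lborel. exp (- (norm (y :: real^3))\<^sup>2)) \<ge> 0" by simp
  ultimately show ?thesis by linarith
qed

lemma gauss_ratio_nonneg: "gauss_ratio \<ge> 0"
  unfolding gauss_ratio_def using gauss_mass_pos by (intro divide_nonneg_nonneg) (auto intro!: Bochner_Integration.integral_nonneg)

lemma energy_compare:
  assumes T: "open T" "T \<noteq> {}" and K: "linear K" "inj K" and \<kappa>: "\<kappa> > 0" "\<And>v. norm (K v) \<le> \<kappa> * norm v"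
    and \<epsilon>: "\<epsilon> > 0" and \<delta>: "\<delta> > 0"
    and skew: "\<And>v w. \<bar>cross3 B' (K v) \<bullet> K w - cross3 B v \<bullet> w\<bar> \<le> 2 * \<epsilon> * norm v * norm w"
  shows "energy B T \<le> (1 + \<delta>) * \<kappa>\<^sup>2 * energy B' (K ` T) + (1 + 1 / \<delta>) * (4 * \<epsilon>) * gauss_ratio"
proof -
  define A where "A = linear_potential B"
  define A' where "A' = linear_potential B'"
  define A'' where "A'' x = adjoint K (A' (K x))" for x
  define E where "E = energy B T"
  define X where "X = (1 + 1 / \<delta>) * (4 * \<epsilon>)"
  note lin = linear_potential(1)[of B, folded A_def] linear_potential(1)[of B', folded A'_def]
  have lin'': "linear A''"
    unfolding A''_def[abs_def]
    using linear_compose[OF linear_compose[OF K(1) lin(2)] adjoint_linear[OF K(1)]] by (simp add: o_def)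
  define D where "D x = A'' x - A x" for x
  have D: "linear D" unfolding D_def[abs_def] by (rule linear_compose_sub[OF lin'' lin(1)])
  \<comment> \<open>The symmetric part of the difference is a gradient and can be gauged away on the
    whole space; the antisymmetric part \<open>N\<close> carries the difference of the
    fields.\<close>
  define S where "S x = (1/2) *\<^sub>R (D x + adjoint D x)" for x
  define N where "N x = (1/2) *\<^sub>R (D x - adjoint D x)" for x
  note aw = adjoint_works[OF D]
  have S: "linear S" unfolding S_def[abs_def]
    by (intro linear_compose_scale_right linear_compose_add D adjoint_linear)
  have N: "linear N" unfolding N_def[abs_def]
    by (intro linear_compose_scale_right linear_compose_sub D adjoint_linear)
  have sym: "S x \<bullet> y = x \<bullet> S y" for x y
    using aw[of x y] aw[of y x] by (simp add: S_def inner_add_left inner_add_right inner_commute)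
  have diff: "A'' x - A x = S x + N x" for x
    by (simp add: S_def N_def D_def[symmetric] algebra_simps flip: scaleR_add_left)
  have Nvw: "N v \<bullet> w = (1/2) * (cross3 B' (K v) \<bullet> K w - cross3 B v \<bullet> w)" for v w
  proof -
    have "N v \<bullet> w = (1/2) * (D v \<bullet> w - D w \<bullet> v)"
      using aw[of w v] by (simp add: N_def inner_diff_left inner_diff_right inner_commute)
    also have "D v \<bullet> w - D w \<bullet> v = (A'' v \<bullet> w - A'' w \<bullet> v) - (A v \<bullet> w - A w \<bullet> v)"
      by (simp add: D_def inner_diff_left)
    also have "A'' v \<bullet> w - A'' w \<bullet> v = A' (K v) \<bullet> K w - A' (K w) \<bullet> K v"
      using adjoint_works[OF K(1), of w "A' (K v)"] adjoint_works[OF K(1), of v "A' (K w)"]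
      by (simp add: A''_def inner_commute)
    finally show ?thesis
      using curl_antisymmetric_part[OF lin(1) linear_potential(2)[of B, folded A_def]]
        curl_antisymmetric_part[OF lin(2) linear_potential(2)[of B', folded A'_def]] by simp
  qed
  have Nb: "norm (N v) \<le> \<epsilon> * norm v" for v
  proof (cases "N v = 0")
    case False
    have "norm (N v) * norm (N v) = N v \<bullet> N v" by (simp add: power2_norm_eq_inner[symmetric] power2_eq_square)
    also have "\<dots> \<le> (\<epsilon> * norm v) * norm (N v)" using skew[of v "N v"] unfolding Nvw[of v "N v"] by (simp add: abs_le_iff)
    finally show ?thesis using False by simp
  qed (use \<epsilon> in simp)
  have KT: "open (K ` T)" "K ` T \<noteq> {}"
    using open_surjective_linear_image[OF T(1) K(1)] linear_injective_imp_surjective[OF K] T(2) by auto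
  have sets: "T \<in> sets lebesgue" "K ` T \<in> sets lebesgue" using T(1) KT(1) by auto
  note EB = energy_bottom[OF T, where B = B, folded A_def E_def]
  let ?a = "LINT y|lborel. exp (- (norm (y :: real^3))\<^sup>2)"
  let ?b = "LINT y|lborel. (norm (y :: real^3))\<^sup>2 * exp (- (norm y)\<^sup>2)"
  have ba: "?b = gauss_ratio * ?a" using gauss_mass_pos by (simp add: gauss_ratio_def)
  have *: "(E - X * gauss_ratio) * l2sq (K ` T) f \<le> ((1 + \<delta>) * \<kappa>\<^sup>2) * l2sq (K ` T) g"
    if fg: "(f, g) \<in> mgraph A' (K ` T)" for f g
  proof -
    let ?F = "\<lambda>x. f (K x)" and ?G = "\<lambda>x. pullback K (g (K x))"
    define d where "d = \<bar>det (matrix K)\<bar>"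
    have d: "d \<ge> 0" by (simp add: d_def)
    have FG: "(?F, ?G) \<in> mgraph A'' T"
      unfolding A''_def[abs_def] by (rule mgraph_linear_image[OF K T(1) lin(2) fg])
    have "E * (?a * l2sq T ?F) \<le> (1 + \<delta>) * (?a * l2sq T ?G) + (1 + 1 / \<delta>) * (4 * \<epsilon>) * (?b * l2sq T ?F)"
      by (rule localisation_inequality[OF lin(1) lin'' S N sym diff Nb \<epsilon> \<delta> T(1) EB(1) EB(3) FG])
    then have "?a * (E * l2sq T ?F) \<le> ?a * ((1 + \<delta>) * l2sq T ?G + X * (gauss_ratio * l2sq T ?F))"
      unfolding ba X_def by (simp add: algebra_simps)
    then have 1: "E * l2sq T ?F \<le> (1 + \<delta>) * l2sq T ?G + X * (gauss_ratio * l2sq T ?F)"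
      using gauss_mass_pos by simp
    have gK: "(\<lambda>x. g (K x)) \<in> L2 T" by (rule L2_linear_image(1)[OF K sets mgraphD(2)[OF fg]])
    have "l2sq T ?G \<le> l2sq T (\<lambda>x. \<kappa> *\<^sub>R g (K x))"
      using \<kappa> norm_pullback[OF K(1) \<kappa>(2)] by (intro l2sq_mono mgraphD(2)[OF FG] L2_scaleR gK) auto
    then have "(1 + \<delta>) * l2sq T ?G \<le> (1 + \<delta>) * (\<kappa>\<^sup>2 * l2sq T (\<lambda>x. g (K x)))"
      unfolding l2sq_scaleR using \<delta> by (intro mult_left_mono) auto
    then have "(E - X * gauss_ratio) * l2sq T ?F \<le> ((1 + \<delta>) * \<kappa>\<^sup>2) * l2sq T (\<lambda>x. g (K x))"
      using 1 by (simp add: algebra_simps)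
    then have "d * ((E - X * gauss_ratio) * l2sq T ?F) \<le> d * (((1 + \<delta>) * \<kappa>\<^sup>2) * l2sq T (\<lambda>x. g (K x)))"
      using d by (rule mult_left_mono)
    then show ?thesis
      unfolding L2_linear_image(2)[OF K sets mgraphD(1)[OF fg]] L2_linear_image(2)[OF K sets mgraphD(2)[OF fg]] d_def
      by (simp add: algebra_simps)
  qed
  define c where "c = (1 + \<delta>) * \<kappa>\<^sup>2"
  have c: "c > 0" using \<delta> \<kappa>(1) by (simp add: c_def)
  have "(E - X * gauss_ratio) / c \<in> low_bounds A' (K ` T)"
    unfolding low_bounds_def mem_Collect_eq
  proof clarify
    fix f g assume fg: "(f, g) \<in> mgraph A' (K ` T)"
    show "(E - X * gauss_ratio) / c * l2sq (K ` T) f \<le> l2sq (K ` T) g"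
      using *[OF fg, folded c_def] c by (simp add: field_simps)
  qed
  then have "(E - X * gauss_ratio) / c \<le> energy B' (K ` T)"
    by (rule energy_bottom(2)[OF KT, where B = B', folded A'_def])
  then have "E - X * gauss_ratio \<le> c * energy B' (K ` T)" using c by (simp add: field_simps)
  then show ?thesis unfolding E_def X_def c_def by simp
qed

lemma norm_cross3_le: "norm (cross3 x y) \<le> norm x * norm y"
proof (rule power2_le_imp_le)
  have "(norm (cross3 x y))\<^sup>2 = (norm x)\<^sup>2 * (norm y)\<^sup>2 - (x \<bullet> y)\<^sup>2"
    using norm_and_cross_eq_0 norm_cross_dot[of x y] by (simp add: algebra_simps power_mult_distrib)
  also have "\<dots> \<le> (norm x * norm y)\<^sup>2" by (simp add: power_mult_distrib)
  finally show "(norm (cross3 x y))\<^sup>2 \<le> (norm x * norm y)\<^sup>2" .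
qed simp

text \<open>The three arguments are exchanged one at a time. Since |K u| is at most 2 |u|, the
  exchange of the field costs 2 * 2 and the other two cost (2 + 1) |B|.\<close>

lemma cross3_skew_bound:
  assumes K: "linear K" "\<And>v. norm (K v - v) \<le> \<theta> * norm v" and B: "norm (B' - B) \<le> \<theta>" and \<theta>: "0 \<le> \<theta>" "\<theta> \<le> 1"
  shows "\<bar>cross3 B' (K v) \<bullet> K w - cross3 B v \<bullet> w\<bar> \<le> \<theta> * (4 + 3 * norm B) * norm v * norm w"
proof -
  have K2: "norm (K u) \<le> 2 * norm u" for u
  proof -
    have "norm (K u) \<le> norm (K u - u) + norm u" using norm_triangle_ineq[of "K u - u" u] by simp
    also have "\<dots> \<le> \<theta> * norm u + norm u" using K(2) by simp
    also have "\<dots> \<le> 1 * norm u + norm u" using \<theta> by (intro add_right_mono mult_right_mono) auto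
    finally show ?thesis by simp
  qed
  have "cross3 B' (K v) \<bullet> K w - cross3 B v \<bullet> w =
      cross3 (B' - B) (K v) \<bullet> K w + cross3 B (K v - v) \<bullet> K w + cross3 B v \<bullet> (K w - w)"
    by (simp add: cross3_def inner_vec_def sum_3 algebra_simps)
  also have "\<bar>\<dots>\<bar> \<le> \<bar>cross3 (B' - B) (K v) \<bullet> K w\<bar> + \<bar>cross3 B (K v - v) \<bullet> K w\<bar> + \<bar>cross3 B v \<bullet> (K w - w)\<bar>"
    by linarith
  also have "\<dots> \<le> \<theta> * (2 * norm v) * (2 * norm w) + norm B * (\<theta> * norm v) * (2 * norm w) + norm B * norm v * (\<theta> * norm w)"
  proof (intro add_mono)
    have t: "\<bar>cross3 x y \<bullet> z\<bar> \<le> norm x * norm y * norm z" for x y z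
      by (rule order_trans[OF Cauchy_Schwarz_ineq2 mult_right_mono[OF norm_cross3_le norm_ge_zero]])
    show "\<bar>cross3 (B' - B) (K v) \<bullet> K w\<bar> \<le> \<theta> * (2 * norm v) * (2 * norm w)"
      by (rule order_trans[OF t]) (use \<theta> in \<open>intro mult_mono B K2 mult_nonneg_nonneg; simp\<close>)
    show "\<bar>cross3 B (K v - v) \<bullet> K w\<bar> \<le> norm B * (\<theta> * norm v) * (2 * norm w)"
      by (rule order_trans[OF t]) (use \<theta> in \<open>intro mult_mono K(2) K2 mult_nonneg_nonneg; simp\<close>)
    show "\<bar>cross3 B v \<bullet> (K w - w)\<bar> \<le> norm B * norm v * (\<theta> * norm w)"
      by (rule order_trans[OF t]) (use \<theta> in \<open>intro mult_mono K(2) mult_nonneg_nonneg; simp\<close>)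
  qed
  also have "\<dots> = \<theta> * (4 + 3 * norm B) * norm v * norm w" by (simp add: algebra_simps)
  finally show ?thesis .
qed

text \<open>From \<eta> at most 1/2 follows |v| <= 2 |J v|. Hence \<open>J\<close> is injective, and
  |K v - v| = |J (K v) - K v| is at most \<eta> |K v|, so at most 2 \<eta> |v|.\<close>

lemma near_identity_inverse:
  fixes J :: "'a::euclidean_space \<Rightarrow> 'a"
  assumes J: "linear J" "\<And>v. norm (J v - v) \<le> \<eta> * norm v" and \<eta>: "0 \<le> \<eta>" "\<eta> \<le> 1/2"
  shows "\<exists>K. linear K \<and> (\<forall>x. K (J x) = x) \<and> (\<forall>x. J (K x) = x) \<and> (\<forall>v. norm (K v - v) \<le> (2 * \<eta>) * norm v)"
proof -
  have half: "norm v \<le> 2 * norm (J v)" for v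
  proof -
    have "norm v \<le> norm (J v) + norm (J v - v)" using norm_triangle_ineq4[of "J v" "J v - v"] by simp
    also have "norm (J v - v) \<le> (1/2) * norm v"
      by (rule order_trans[OF J(2) mult_right_mono]) (use \<eta> in auto)
    finally show ?thesis by simp
  qed
  have inj: "inj J"
  proof (rule linear_injective_0[OF J(1), THEN iffD2], intro allI impI)
    fix v assume "J v = 0" then show "v = 0" using half[of v] by simp
  qed
  obtain K where K: "linear K" "\<And>x. K (J x) = x" "\<And>x. J (K x) = x"
    using linear_injective_isomorphism[OF J(1) inj] by auto
  have "norm (K v - v) \<le> (2 * \<eta>) * norm v" for v
  proof -
    have "norm (K v - v) = norm (J (K v) - K v)" by (simp add: K(3) norm_minus_commute)
    also have "\<dots> \<le> \<eta> * norm (K v)" by (rule J(2))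
    also have "\<dots> \<le> \<eta> * (2 * norm (J (K v)))" using \<eta>(1) by (intro mult_left_mono half) auto
    finally show ?thesis by (simp add: K(3))
  qed
  with K show ?thesis by blast
qed

text \<open>The one-sided comparison is applied to \<open>K\<close> and to its inverse, with the
  fields exchanged. The number \<open>\<delta>\<close> is fixed before \<open>\<eta>\<close>,
  because the error in the comparison carries the factor \<open>1 / \<delta>\<close>.\<close>

lemma energy_continuous:
  assumes T: "open T" "T \<noteq> {}" and e: "e > 0"
  shows "\<exists>\<eta>>0. \<forall>K B'. linear K \<longrightarrow> (\<forall>v. norm (K v - v) \<le> \<eta> * norm v) \<longrightarrow> norm (B' - B) \<le> \<eta> \<longrightarrow>
     \<bar>energy B' (K ` T) - energy B T\<bar> < e"
proof -
  define E where "E = energy B T"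
  have E: "E \<ge> 0" unfolding E_def by (rule energy_bottom(3)[OF T])
  \<comment> \<open>The final difference is at most \<open>\<delta> * (12 * E + 4)\<close>, where 12
    E + 4 = 3 (4 E + 1) + 1 and 4 E + 1 bounds the perturbed energy. The number 5 makes the
    inequality strict.\<close>
  define \<delta> where "\<delta> = min 1 (e / (12 * E + 5))"
  have \<delta>: "\<delta> > 0" "\<delta> \<le> 1" using e E by (auto simp: \<delta>_def)
  have \<delta>e: "\<delta> * (12 * E + 4) < e"
  proof -
    have "\<delta> * (12 * E + 4) < \<delta> * (12 * E + 5)" using \<delta> by simp
    also have "\<dots> \<le> e / (12 * E + 5) * (12 * E + 5)" using E by (intro mult_right_mono) (auto simp: \<delta>_def)
    also have "\<dots> = e" using E by simp
    finally show ?thesis .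
  qed
  \<comment> \<open>In the reverse comparison the field is \<open>B'\<close>, of norm at most |B| +
    1, so the 4 + 3 |B| of the skew bound becomes 7 + 3 |B|.\<close>
  define M where "M = (1 + 1 / \<delta>) * (4 * (7 + 3 * norm B)) * gauss_ratio"
  have M: "M \<ge> 0" unfolding M_def using \<delta> gauss_ratio_nonneg by (intro mult_nonneg_nonneg) auto
  define \<eta> where "\<eta> = min (\<delta> / 8) (\<delta> / (M + 1))"
  have \<eta>: "\<eta> > 0" "\<eta> \<le> \<delta> / 8" "\<eta> * M \<le> \<delta>"
  proof -
    show "\<eta> > 0" using \<delta> M by (simp add: \<eta>_def)
    show "\<eta> \<le> \<delta> / 8" unfolding \<eta>_def by (rule min.cobounded1)
    have "\<eta> * M \<le> \<delta> / (M + 1) * M" using M by (intro mult_right_mono) (auto simp: \<eta>_def)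
    also have "\<dots> \<le> \<delta>" using M \<delta> by (simp add: field_simps)
    finally show "\<eta> * M \<le> \<delta>" .
  qed
  have \<kappa>: "(1 + \<delta>) * (1 + 2 * \<eta>)\<^sup>2 \<le> 1 + 3 * \<delta>"
  proof -
    have "\<eta> * \<eta> \<le> \<eta> * (1/8)" using \<eta> \<delta> by (intro mult_left_mono) auto
    then have "(1 + 2 * \<eta>)\<^sup>2 \<le> 1 + 8 * \<eta>" using \<eta>(1) by (simp add: power2_eq_square algebra_simps)
    also have "\<dots> \<le> 1 + \<delta>" using \<eta> by simp
    finally have "(1 + \<delta>) * (1 + 2 * \<eta>)\<^sup>2 \<le> (1 + \<delta>) * (1 + \<delta>)" using \<delta> by (intro mult_left_mono) auto
    also have "\<dots> \<le> 1 + 3 * \<delta>" using \<delta> by (simp add: algebra_simps mult_left_le)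
    finally show ?thesis .
  qed
  have X: "(1 + 1 / \<delta>) * (4 * (\<eta> * (7 + 3 * norm B))) * gauss_ratio \<le> \<delta>"
    using \<eta>(3) by (simp add: M_def mult_ac)
  have \<epsilon>: "\<eta> * (7 + 3 * norm B) > 0" using \<eta>(1) by (intro mult_pos_pos add_pos_nonneg) auto
  have "\<bar>energy B' (K ` T) - E\<bar> < e"
    if K: "linear K" "\<And>v. norm (K v - v) \<le> \<eta> * norm v" and B: "norm (B' - B) \<le> \<eta>" for K B'
  proof -
    have \<eta>2: "0 \<le> \<eta>" "\<eta> \<le> 1/2" using \<eta> \<delta> by auto
    obtain J where J: "linear J" "\<And>x. J (K x) = x" "\<And>x. K (J x) = x"
      and J2: "\<And>v. norm (J v - v) \<le> (2 * \<eta>) * norm v"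
      using near_identity_inverse[OF K \<eta>2] by blast
    have inj: "inj K" using J(2) by (metis injI)
    have injJ: "inj J" using J(3) by (metis injI)
    have JT: "J ` K ` T = T" by (simp add: image_comp o_def J(2))
    have KT: "open (K ` T)" "K ` T \<noteq> {}"
      using open_surjective_linear_image[OF T(1) K(1)] linear_injective_imp_surjective[OF K(1) inj] T(2) by auto
    let ?E' = "energy B' (K ` T)"
    have E': "?E' \<ge> 0" by (rule energy_bottom(3)[OF KT])
    have 1: "E \<le> (1 + \<delta>) * (1 + 2 * \<eta>)\<^sup>2 * ?E' + (1 + 1 / \<delta>) * (4 * (\<eta> * (7 + 3 * norm B))) * gauss_ratio"
      unfolding E_def
    proof (rule energy_compare[OF T K(1) inj _ _ \<epsilon> \<delta>(1)])
      show "1 + 2 * \<eta> > 0" using \<eta> by simp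
      show "norm (K v) \<le> (1 + 2 * \<eta>) * norm v" for v
      proof -
        have "norm (K v) \<le> norm (K v - v) + norm v" using norm_triangle_ineq[of "K v - v" v] by simp
        also have "\<dots> \<le> \<eta> * norm v + norm v" using K(2) by simp
        also have "\<dots> \<le> (1 + 2 * \<eta>) * norm v" using \<eta>(1) by (simp add: algebra_simps)
        finally show ?thesis .
      qed
      show "\<bar>cross3 B' (K v) \<bullet> K w - cross3 B v \<bullet> w\<bar> \<le> 2 * (\<eta> * (7 + 3 * norm B)) * norm v * norm w" for v w
      proof -
        have "\<bar>cross3 B' (K v) \<bullet> K w - cross3 B v \<bullet> w\<bar> \<le> \<eta> * (4 + 3 * norm B) * norm v * norm w"
          by (rule cross3_skew_bound[OF K B]) (use \<eta> \<delta> in auto)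
        also have "\<dots> \<le> (2 * (\<eta> * (7 + 3 * norm B))) * norm v * norm w"
          using \<eta>(1) by (intro mult_right_mono) (auto simp: algebra_simps add_nonneg_nonneg)
        finally show ?thesis .
      qed
    qed
    have 2: "?E' \<le> (1 + \<delta>) * (1 + 2 * \<eta>)\<^sup>2 * energy B (J ` K ` T) + (1 + 1 / \<delta>) * (4 * (\<eta> * (7 + 3 * norm B))) * gauss_ratio"
    proof (rule energy_compare[OF KT J(1) injJ _ _ \<epsilon> \<delta>(1)])
      show "1 + 2 * \<eta> > 0" using \<eta> by simp
      show "norm (J v) \<le> (1 + 2 * \<eta>) * norm v" for v
      proof -
        have "norm (J v) \<le> norm (J v - v) + norm v" using norm_triangle_ineq[of "J v - v" v] by simp
        also have "\<dots> \<le> (2 * \<eta>) * norm v + norm v" using J2 by simp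
        finally show ?thesis by (simp add: algebra_simps)
      qed
      have B1: "norm (B - B') \<le> 2 * \<eta>" using B \<eta>(1) by (simp add: norm_minus_commute)
      have B2: "norm B' \<le> norm B + 1"
        using B \<eta> \<delta> norm_triangle_ineq[of B "B' - B"] by simp
      show "\<bar>cross3 B (J v) \<bullet> J w - cross3 B' v \<bullet> w\<bar> \<le> 2 * (\<eta> * (7 + 3 * norm B)) * norm v * norm w" for v w
      proof -
        have "\<bar>cross3 B (J v) \<bullet> J w - cross3 B' v \<bullet> w\<bar> \<le> (2 * \<eta>) * (4 + 3 * norm B') * norm v * norm w"
          by (rule cross3_skew_bound[OF J(1) J2 B1]) (use \<eta> \<delta> in auto)
        also have "\<dots> \<le> (2 * \<eta>) * (7 + 3 * norm B) * norm v * norm w"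
          using \<eta>(1) B2 by (intro mult_right_mono mult_left_mono) auto
        finally show ?thesis by (simp add: mult_ac)
      qed
    qed
    have "E \<le> (1 + 3 * \<delta>) * ?E' + \<delta>"
      using 1 X mult_right_mono[OF \<kappa> E'] by linarith
    moreover have b2: "?E' \<le> (1 + 3 * \<delta>) * E + \<delta>"
      using 2 X mult_right_mono[OF \<kappa> E] unfolding JT E_def[symmetric] by linarith
    moreover have "3 * \<delta> * ?E' \<le> 3 * \<delta> * (4 * E + 1)"
    proof -
      have "3 * \<delta> * E \<le> 3 * 1 * E" using \<delta> E by (intro mult_right_mono) auto
      then have "?E' \<le> 4 * E + 1" using b2 \<delta> by (simp add: algebra_simps)
      then show ?thesis using \<delta> by (intro mult_left_mono) auto
    qed
    moreover have "3 * \<delta> * E \<le> 12 * \<delta> * E" using \<delta> E by (intro mult_right_mono) auto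
    ultimately have "\<bar>?E' - E\<bar> \<le> \<delta> * (12 * E + 4)" using \<delta>(1) by (simp add: abs_le_iff algebra_simps)
    then show ?thesis using \<delta>e by linarith
  qed
  then show ?thesis using \<eta>(1) unfolding E_def by blast
qed

section \<open>Charts and contingent cones\<close>

lemma smooth_map_continuous_on:
  assumes "smooth_map S f"
  shows "continuous_on S f"
  unfolding continuous_on_eq_continuous_within
proof
  fix x assume x: "x \<in> S"
  then obtain W g where W: "open W" "x \<in> W" "smooth_on g W" "\<forall>y\<in>S \<inter> W. g y = f y"
    using assms unfolding smooth_map_def by blast
  have "continuous_on (S \<inter> W) g" by (rule continuous_on_subset[OF smooth_on_continuous[OF W(3)]]) simp
  then have "continuous_on (S \<inter> W) f" using W(4) continuous_on_cong[of "S \<inter> W" "S \<inter> W" g f] by auto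
  then have "continuous (at x within (S \<inter> W)) f" using x W(2) by (simp add: continuous_on_eq_continuous_within)
  moreover have "at x within (S \<inter> W) = at x within S"
    by (rule at_within_nhd[OF W(2,1)]) blast
  ultimately show "continuous (at x within S) f" by simp
qed

text \<open>Bouligand's contingent cone. It refers to no chart, so it can identify the cones
  produced by different charts.\<close>

definition contingent :: "'a::real_normed_vector set \<Rightarrow> 'a \<Rightarrow> 'a set" where
  "contingent Z x = {v. \<exists>y t. (\<forall>n::nat. y n \<in> Z \<and> t n > (0::real)) \<and> y \<longlonglongrightarrow> x \<and>
     (\<lambda>n. (y n - x) /\<^sub>R t n) \<longlonglongrightarrow> v}"

text \<open>The remainder is small relative to the distance from \<open>x\<close>, and that distance
  is at most a multiple of \<open>t n\<close>.\<close>

lemma derivative_identity_sequence: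
  assumes der: "(\<phi> has_derivative (\<lambda>h. h)) (at x within M)" and y: "\<And>n::nat. y n \<in> M" "y \<longlonglongrightarrow> x"
    and t: "\<And>n. t n > (0::real)" and b: "\<And>n. norm (y n - x) \<le> c * t n"
  shows "(\<lambda>n. (\<phi> (y n) - \<phi> x - (y n - x)) /\<^sub>R t n) \<longlonglongrightarrow> 0"
proof (rule LIMSEQ_I)
  fix e :: real assume e: "e > 0"
  define e' where "e' = e / (\<bar>c\<bar> + 1)"
  have e': "e' > 0" using e by (simp add: e'_def add_nonneg_pos)
  obtain d where d: "d > 0" "\<And>z. z \<in> M \<Longrightarrow> norm (z - x) < d \<Longrightarrow> norm (\<phi> z - \<phi> x - (z - x)) \<le> e' * norm (z - x)"
    using der e' unfolding has_derivative_within_alt by blast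
  obtain N where N: "\<And>n. n \<ge> N \<Longrightarrow> norm (y n - x) < d" using LIMSEQ_D[OF y(2) d(1)] by blast
  have "norm ((\<phi> (y n) - \<phi> x - (y n - x)) /\<^sub>R t n - 0) < e" if "n \<ge> N" for n
  proof -
    have "norm (\<phi> (y n) - \<phi> x - (y n - x)) \<le> e' * norm (y n - x)" by (rule d(2)[OF y(1) N[OF that]])
    also have "\<dots> \<le> e' * (\<bar>c\<bar> * t n)"
    proof -
      have "c * t n \<le> \<bar>c\<bar> * t n" using t[of n] by (intro mult_right_mono) auto
      then show ?thesis using b[of n] e' by (intro mult_left_mono) auto
    qed
    also have "\<dots> < e * t n"
      using e t[of n] by (simp add: e'_def field_simps)
    finally show ?thesis using t[of n] by (simp add: divide_simps mult.commute)
  qed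
  then show "\<exists>no. \<forall>n\<ge>no. norm ((\<phi> (y n) - \<phi> x - (y n - x)) /\<^sub>R t n - 0) < e" by blast
qed

lemma contingentI_eventually:
  assumes "\<And>n::nat. n \<ge> N \<Longrightarrow> y n \<in> Z" "\<And>n. t n > (0::real)" "y \<longlonglongrightarrow> x" "(\<lambda>n. (y n - x) /\<^sub>R t n) \<longlonglongrightarrow> v"
  shows "v \<in> contingent Z x"
  unfolding contingent_def mem_Collect_eq
  by (rule exI[of _ "\<lambda>n. y (n + N)"], rule exI[of _ "\<lambda>n. t (n + N)"])
    (use assms LIMSEQ_ignore_initial_segment[OF assms(3), of N] LIMSEQ_ignore_initial_segment[OF assms(4), of N] in auto)

text \<open>A chart whose differential is the identity does not change limits of rescaled
  displacements. Stated inside \<open>M\<close> and for an arbitrary piece \<open>Z\<close>, this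
  serves the space and the sphere, the domain and its boundary.\<close>

lemma contingent_chart:
  fixes \<phi> :: "'a::euclidean_space \<Rightarrow> 'a"
  assumes U: "openin (top_of_set M) U" "x \<in> U" and V: "openin (top_of_set T) V" "0 \<in> V"
    and bij: "bij_betw \<phi> U V" and cont: "continuous_on V (inv_into U \<phi>)" and \<phi>0: "\<phi> x = 0"
    and der: "(\<phi> has_derivative (\<lambda>h. h)) (at x within M)" and im: "\<phi> ` (U \<inter> Z) = V \<inter> S"
    and Z: "Z \<subseteq> M" and S: "S \<subseteq> T" "\<forall>\<rho>>0. \<forall>y\<in>S. \<rho> *\<^sub>R y \<in> S"
  shows "contingent Z x = closure S"
proof (intro equalityI subsetI)
  fix v assume "v \<in> contingent Z x"
  then obtain y t where y: "\<And>n::nat. y n \<in> Z" "\<And>n. t n > (0::real)" "y \<longlonglongrightarrow> x"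
    and lim: "(\<lambda>n. (y n - x) /\<^sub>R t n) \<longlonglongrightarrow> v"
    unfolding contingent_def by blast
  obtain c where c: "\<And>n. norm ((y n - x) /\<^sub>R t n) \<le> c"
    using convergent_imp_Bseq[OF convergentI[OF lim]] unfolding Bseq_def by blast
  have b: "norm (y n - x) \<le> c * t n" for n
    using c[of n] y(2)[of n] by (simp add: divide_simps mult.commute)
  have "(\<lambda>n. (\<phi> (y n) - \<phi> x - (y n - x)) /\<^sub>R t n) \<longlonglongrightarrow> 0"
    by (rule derivative_identity_sequence[OF der _ y(3) y(2) b]) (use y(1) Z in blast)
  from tendsto_add[OF this lim] have l: "(\<lambda>n. \<phi> (y n) /\<^sub>R t n) \<longlonglongrightarrow> v"
    by (simp add: \<phi>0 scaleR_diff_right)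
  obtain U' where U': "open U'" "U = M \<inter> U'" using U(1) unfolding openin_open by blast
  then have "\<forall>\<^sub>F n in sequentially. y n \<in> U'" using topological_tendstoD[OF y(3) U'(1)] U(2) by blast
  then have "\<forall>\<^sub>F n in sequentially. \<phi> (y n) /\<^sub>R t n \<in> S"
  proof eventually_elim
    case (elim n)
    then have "y n \<in> U \<inter> Z" using y(1)[of n] Z U'(2) by blast
    then have "\<phi> (y n) \<in> S" using im by blast
    then show ?case using S(2) y(2)[of n] by (metis positive_imp_inverse_positive)
  qed
  then have "\<forall>\<^sub>F n in sequentially. \<phi> (y n) /\<^sub>R t n \<in> closure S"
    by (rule eventually_mono) (use closure_subset in blast)
  then show "v \<in> closure S" using Lim_in_closed_set[OF closed_closure _ _ l] by simp
next
  fix v assume "v \<in> closure S"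
  then obtain s where s: "\<And>n::nat. s n \<in> S" "s \<longlonglongrightarrow> v" unfolding closure_sequential by blast
  define g where "g = inv_into U \<phi>"
  \<comment> \<open>Shrinking the approximating points \<open>s n\<close> by \<open>t n\<close>
    brings them into the range of the chart while keeping them in the cone.\<close>
  define t where "t n = 1 / real (Suc n)" for n
  have t: "t n > 0" for n by (simp add: t_def)
  have t0: "t \<longlonglongrightarrow> 0" unfolding t_def by (rule LIMSEQ_Suc[OF lim_1_over_n])
  define z where "z n = t n *\<^sub>R s n" for n
  have zS: "z n \<in> S" for n unfolding z_def using S(2) s(1) t by blast
  have z0: "z \<longlonglongrightarrow> 0" using tendsto_scaleR[OF t0 s(2)] by (simp add: z_def[abs_def])
  obtain V' where V': "open V'" "V = T \<inter> V'" using V(1) unfolding openin_open by blast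
  then have "\<forall>\<^sub>F n in sequentially. z n \<in> V'" using topological_tendstoD[OF z0 V'(1)] V(2) by blast
  then obtain N0 where N0: "\<And>n. n \<ge> N0 \<Longrightarrow> z n \<in> V"
    unfolding eventually_sequentially using V'(2) zS S(1) by blast
  define y where "y n = g (z (n + N0))" for n
  have fg: "\<phi> (g w) = w" if "w \<in> V" for w
    unfolding g_def using bij_betw_inv_into_right[OF bij that] .
  have gU: "g w \<in> U" if "w \<in> V" for w
    unfolding g_def using bij_betwE[OF bij_betw_inv_into[OF bij]] that by blast
  have g0: "g 0 = x" unfolding g_def using bij_betw_inv_into_left[OF bij U(2)] \<phi>0 by simp
  have yU: "y n \<in> U" and \<phi>y: "\<phi> (y n) = z (n + N0)" for n
    using gU fg N0 by (auto simp: y_def)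
  have UM: "U \<subseteq> M" using U(1) openin_subset by fastforce
  have yM: "y n \<in> M" for n using yU UM by blast
  have yZ: "y n \<in> Z" for n
  proof -
    have "z (n + N0) \<in> \<phi> ` (U \<inter> Z)" using im N0[of "n + N0"] zS by auto
    then obtain w where w: "w \<in> U" "w \<in> Z" "\<phi> w = \<phi> (y n)" unfolding \<phi>y by auto
    then have "w = y n" using bij yU[of n] unfolding bij_betw_def inj_on_def by blast
    then show ?thesis using w by simp
  qed
  have z0': "(\<lambda>n. z (n + N0)) \<longlonglongrightarrow> 0" by (rule LIMSEQ_ignore_initial_segment[OF z0])
  have "y \<longlonglongrightarrow> g 0"
    unfolding y_def
    by (rule continuous_on_tendsto_compose[OF cont[folded g_def] z0' V(2)]) (use N0 in simp)
  then have yx: "y \<longlonglongrightarrow> x" by (simp add: g0)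
  obtain c where c: "\<And>n. norm (s n) \<le> c" 
    using convergent_imp_Bseq[OF convergentI[OF s(2)]] unfolding Bseq_def by blast
  obtain d where d: "d > 0" "\<And>z. z \<in> M \<Longrightarrow> norm (z - x) < d \<Longrightarrow> norm (\<phi> z - \<phi> x - (z - x)) \<le> (1/2) * norm (z - x)"
    using der unfolding has_derivative_within_alt by (metis half_gt_zero zero_less_one)
  obtain N where N: "\<And>n. n \<ge> N \<Longrightarrow> norm (y n - x) < d" using LIMSEQ_D[OF yx d(1)] by blast
  define y' where "y' n = y (n + N)" for n
  define t' where "t' n = t (n + N + N0)" for n
  have t': "t' n > 0" for n using t by (simp add: t'_def)
  have \<phi>y': "\<phi> (y' n) = t' n *\<^sub>R s (n + N + N0)" for n by (simp add: y'_def \<phi>y z_def t'_def)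
  have y'x: "y' \<longlonglongrightarrow> x" unfolding y'_def by (rule LIMSEQ_ignore_initial_segment[OF yx])
  \<comment> \<open>Near \<open>x\<close> the chart is the identity up to half of the displacement,
    so its inverse at most doubles distances.\<close>
  have b: "norm (y' n - x) \<le> (2 * c) * t' n" for n
  proof -
    have "norm (\<phi> (y' n) - \<phi> x - (y' n - x)) \<le> (1/2) * norm (y' n - x)"
      using d(2)[OF yM N, of "n + N"] by (simp add: y'_def)
    moreover have "norm (y' n - x) \<le> norm (\<phi> (y' n)) + norm (\<phi> (y' n) - (y' n - x))"
      using norm_triangle_ineq4[of "\<phi> (y' n)" "\<phi> (y' n) - (y' n - x)"] by simp
    ultimately have "norm (y' n - x) \<le> 2 * norm (\<phi> (y' n))" by (simp add: \<phi>0)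
    also have "\<dots> = 2 * (t' n * norm (s (n + N + N0)))" using t'[of n] by (simp add: \<phi>y')
    also have "\<dots> \<le> 2 * (t' n * c)" using c t'[of n] by (intro mult_left_mono) auto
    finally show ?thesis by (simp add: mult_ac)
  qed
  have "(\<lambda>n. (\<phi> (y' n) - \<phi> x - (y' n - x)) /\<^sub>R t' n) \<longlonglongrightarrow> 0"
    by (rule derivative_identity_sequence[OF der _ y'x t' b]) (simp add: y'_def yM)
  moreover have "(\<lambda>n. s (n + N + N0)) \<longlonglongrightarrow> v"
    using LIMSEQ_ignore_initial_segment[OF s(2), of "N + N0"] by (simp add: add.assoc)
  ultimately have "(\<lambda>n. s (n + N + N0) - (\<phi> (y' n) - \<phi> x - (y' n - x)) /\<^sub>R t' n) \<longlonglongrightarrow> v - 0"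
    by (intro tendsto_diff)
  moreover have "s (n + N + N0) - (\<phi> (y' n) - \<phi> x - (y' n - x)) /\<^sub>R t' n = (y' n - x) /\<^sub>R t' n" for n
    using t'[of n] by (simp add: \<phi>y' \<phi>0 scaleR_diff_right)
  ultimately have "(\<lambda>n. (y' n - x) /\<^sub>R t' n) \<longlonglongrightarrow> v" by simp
  then show "v \<in> contingent Z x"
    by (intro contingentI_eventually[of 0 y' Z t']) (use t' y'x yZ in \<open>auto simp: y'_def\<close>)
qed

lemma image_closure_subset_local:
  fixes \<phi> :: "'a::euclidean_space \<Rightarrow> 'b::euclidean_space"
  assumes U: "openin (top_of_set M) U" and cont: "continuous_on U \<phi>" and im: "\<phi> ` (U \<inter> Z) \<subseteq> S" and Z: "Z \<subseteq> M"
  shows "\<phi> ` (U \<inter> closure Z) \<subseteq> closure S"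
proof
  fix w assume "w \<in> \<phi> ` (U \<inter> closure Z)"
  then obtain y where y: "y \<in> U" "y \<in> closure Z" "w = \<phi> y" by blast
  then obtain s where s: "\<And>n::nat. s n \<in> Z" "s \<longlonglongrightarrow> y" unfolding closure_sequential by blast
  obtain U' where U': "open U'" "U = M \<inter> U'" using U(1) unfolding openin_open by blast
  then have "\<forall>\<^sub>F n in sequentially. s n \<in> U'" using topological_tendstoD[OF s(2) U'(1)] y(1) by blast
  then have ev: "\<forall>\<^sub>F n in sequentially. s n \<in> U" by (rule eventually_mono) (use U'(2) s(1) Z in blast)
  have l: "(\<lambda>n. \<phi> (s n)) \<longlonglongrightarrow> \<phi> y" by (rule continuous_on_tendsto_compose[OF cont s(2) y(1) ev])
  have "\<forall>\<^sub>F n in sequentially. \<phi> (s n) \<in> closure S"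
    using ev by (rule eventually_mono) (use im s(1) closure_subset in blast)
  then show "w \<in> closure S" using Lim_in_closed_set[OF closed_closure _ _ l] y(3) by simp
qed

text \<open>Homeomorphisms transport relative closures. The charts constructed below obtain their
  boundary clause from this, once the sets themselves are matched.\<close>

lemma chart_boundary:
  fixes \<phi> :: "'a::euclidean_space \<Rightarrow> 'b::euclidean_space"
  assumes U: "openin (top_of_set M) U" and V: "openin (top_of_set T) V"
    and bij: "bij_betw \<phi> U V" and cont: "continuous_on U \<phi>" "continuous_on V (inv_into U \<phi>)"
    and im: "\<phi> ` (U \<inter> Z) = V \<inter> S" and Z: "Z \<subseteq> M" and S: "S \<subseteq> T"
  shows "\<phi> ` (U \<inter> bd Z) = V \<inter> bd S"
proof -
  define g where "g = inv_into U \<phi>"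
  have gf: "g (\<phi> y) = y" if "y \<in> U" for y unfolding g_def using bij_betw_inv_into_left[OF bij that] .
  have fg: "\<phi> (g w) = w" "g w \<in> U" if "w \<in> V" for w
    unfolding g_def using bij_betw_inv_into_right[OF bij that] bij_betwE[OF bij_betw_inv_into[OF bij]] that by auto
  have fV: "\<phi> y \<in> V" if "y \<in> U" for y using bij_betwE[OF bij] that by blast
  have gim: "g ` (V \<inter> S) = U \<inter> Z"
    unfolding im[symmetric] using gf by (auto simp: image_iff)
  have 1: "\<phi> ` (U \<inter> closure Z) \<subseteq> closure S"
    by (rule image_closure_subset_local[OF U cont(1) _ Z]) (use im in blast)
  have 2: "g ` (V \<inter> closure S) \<subseteq> closure Z"
    by (rule image_closure_subset_local[OF V cont(2)[folded g_def] _ S]) (use gim in blast)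
  show ?thesis
  proof (intro equalityI subsetI)
    fix w assume "w \<in> \<phi> ` (U \<inter> bd Z)"
    then obtain y where y: "y \<in> U" "y \<in> closure Z" "y \<notin> Z" "w = \<phi> y" unfolding bd_def by blast
    have "w \<notin> S"
    proof
      assume "w \<in> S"
      then have "g w \<in> g ` (V \<inter> S)" using y fV by blast
      then show False using y gf gim by auto
    qed
    then show "w \<in> V \<inter> bd S" using 1 y fV unfolding bd_def by blast
  next
    fix w assume w: "w \<in> V \<inter> bd S"
    then have "g w \<in> closure Z" using 2 unfolding bd_def by blast
    moreover have "g w \<notin> Z"
    proof
      assume "g w \<in> Z"
      then have "\<phi> (g w) \<in> \<phi> ` (U \<inter> Z)" using fg w by blast
      then show False using fg w im unfolding bd_def by auto
    qed
    ultimately have "g w \<in> U \<inter> bd Z" using fg w unfolding bd_def by blast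
    then show "w \<in> \<phi> ` (U \<inter> bd Z)" using fg w by (metis IntD1 image_eqI)
  qed
qed

text \<open>The boundary of a relatively open set is closed. Thus knowledge of two closures, which
  contingent cones supply, gives back the open cone itself.\<close>

lemma openin_subspace_recover:
  assumes "closed L" "openin (top_of_set L) C"
  shows "C = closure C - closure (bd C)"
proof -
  obtain C' where C': "open C'" "C = L \<inter> C'" using assms(2) unfolding openin_open by blast
  have "closure C \<subseteq> L" using C' assms(1) by (metis closure_minimal inf_le1)
  then have "bd C = closure C - C'" using C' unfolding bd_def by blast
  then have "closed (bd C)" using C'(1) by (simp add: closed_Diff)
  then have "closure (bd C) = bd C" by (rule closure_closed)
  then show ?thesis using closure_subset[of C] unfolding bd_def by blast
qed

lemma tangent_chartD:
  assumes "tangent_chart M T \<Omega> x C U V \<phi>"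
  shows "openin (top_of_set M) U" "x \<in> U" "openin (top_of_set T) V" "0 \<in> V" "bij_betw \<phi> U V"
    "continuous_on U \<phi>" "continuous_on V (inv_into U \<phi>)" "\<phi> x = 0" "(\<phi> has_derivative (\<lambda>h. h)) (at x within M)"
    "\<phi> ` (U \<inter> \<Omega>) = V \<inter> C" "\<phi> ` (U \<inter> bd \<Omega>) = V \<inter> bd C"
  using assms by (auto simp: tangent_chart_def diffeo_def smooth_map_continuous_on)

lemma bd_subset: "closed L \<Longrightarrow> C \<subseteq> L \<Longrightarrow> bd C \<subseteq> L"
  unfolding bd_def using closure_minimal by blast

text \<open>The cone is the contingent cone of the domain minus that of its boundary, an expression
  free of the chart. Unlike uniqueness in the whole space, this applies on spheres too.\<close>

lemma tangent_chart_cone_unique: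
  fixes C C' :: "'a::euclidean_space set"
  assumes M: "closed M" "\<Omega> \<subseteq> M" and T: "closed T"
    and c: "tangent_chart M T \<Omega> x C U V \<phi>" "openin (top_of_set T) C" "\<forall>\<rho>>0. \<forall>y\<in>C. \<rho> *\<^sub>R y \<in> C"
    and c': "tangent_chart M T \<Omega> x C' U' V' \<phi>'" "openin (top_of_set T) C'" "\<forall>\<rho>>0. \<forall>y\<in>C'. \<rho> *\<^sub>R y \<in> C'"
  shows "C = C'"
proof -
  have *: "closure C = contingent \<Omega> x \<and> closure (bd C) = contingent (bd \<Omega>) x"
    if c: "tangent_chart M T \<Omega> x C U V \<phi>" and o: "openin (top_of_set T) C" "\<forall>\<rho>>0. \<forall>y\<in>C. \<rho> *\<^sub>R y \<in> C" for C U V \<phi>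
  proof -
    note d = tangent_chartD[OF c]
    have CT: "C \<subseteq> T" using o(1) openin_subset by fastforce
    show ?thesis
      using contingent_chart[OF d(1-5,7-10) M(2) CT o(2)]
        contingent_chart[OF d(1-5,7-9,11) bd_subset[OF M] bd_subset[OF T CT] bd_cone[OF o(2)]] by simp
  qed
  have "C = contingent \<Omega> x - contingent (bd \<Omega>) x"
    using openin_subspace_recover[OF T c(2)] *[OF c] by simp
  moreover have "C' = contingent \<Omega> x - contingent (bd \<Omega>) x"
    using openin_subspace_recover[OF T c'(2)] *[OF c'] by simp
  ultimately show ?thesis by simp
qed

section \<open>Corner cones are regular\<close>

lemma closed_unit_sphere: "subspace L \<Longrightarrow> closed (unit_sphere L)"
  unfolding unit_sphere_def by (intro closed_Int closed_subspace closed_sphere)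

lemma subspace_sphere_tangent: "subspace L \<Longrightarrow> subspace (sphere_tangent L x)"
  unfolding sphere_tangent_def subspace_def by (auto simp: orthogonal_def inner_add_right)

lemma dim_sphere_tangent:
  assumes "subspace L" "x \<in> L" "x \<noteq> 0"
  shows "Suc (dim (sphere_tangent L x)) = dim L"
proof -
  have "{v \<in> L. \<forall>y\<in>span {x}. orthogonal y v} = sphere_tangent L x"
    unfolding sphere_tangent_def by (auto simp: span_singleton orthogonal_def)
  moreover have "span {x} \<subseteq> L" using assms by (intro span_minimal) auto
  ultimately show ?thesis
    using dim_subspace_orthogonal_to_vectors[of "span {x}" L] assms by (simp add: dim_span)
qed

lemma open_coneD:
  assumes "open_cone L C"
  shows "openin (top_of_set L) C" "C \<subseteq> L" "\<forall>\<rho>>0. \<forall>x\<in>C. \<rho> *\<^sub>R x \<in> C"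
    "C \<inter> unit_sphere L = unit_sphere L \<Longrightarrow> C = L"
  using assms openin_subset[of "top_of_set L" C] by (auto simp: open_cone_def)

lemma scaled_cone_mem:
  fixes C :: "'a::real_vector set"
  assumes "\<forall>\<rho>>0. \<forall>x\<in>C. \<rho> *\<^sub>R x \<in> C" "\<rho> > 0"
  shows "\<rho> *\<^sub>R x \<in> C \<longleftrightarrow> x \<in> C"
proof
  assume c: "\<rho> *\<^sub>R x \<in> C"
  have "inverse \<rho> *\<^sub>R (\<rho> *\<^sub>R x) \<in> C"
    by (rule assms(1)[rule_format, OF positive_imp_inverse_positive[OF assms(2)] c])
  moreover have "inverse \<rho> *\<^sub>R (\<rho> *\<^sub>R x) = x"
    using assms(2) by simp
  ultimately show "x \<in> C" by simp
qed (use assms in blast)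

text \<open>Radial projection is continuous off the origin and maps the cone without its apex into
  the section.\<close>

lemma closure_section:
  fixes C :: "'a::euclidean_space set"
  assumes C: "C \<subseteq> L" "\<forall>\<rho>>0. \<forall>x\<in>C. \<rho> *\<^sub>R x \<in> C" and x: "x \<in> closure C" "norm x = 1" and L: "subspace L"
  shows "x \<in> closure (C \<inter> unit_sphere L)"
proof -
  let ?f = "\<lambda>v::'a. inverse (norm v) *\<^sub>R v"
  have "?f ` (- {0} \<inter> closure C) \<subseteq> closure (C \<inter> unit_sphere L)"
  proof (rule image_closure_subset_local[of UNIV])
    show "openin (top_of_set UNIV) (- {0::'a})" by (simp add: open_Compl)
    show "continuous_on (- {0}) ?f" by (intro continuous_intros) auto
    show "?f ` (- {0} \<inter> C) \<subseteq> C \<inter> unit_sphere L"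
      using C by (auto simp: unit_sphere_def subspace_scale[OF L] subset_iff)
  qed simp
  moreover have "?f x \<in> ?f ` (- {0} \<inter> closure C)" using x by (intro imageI) auto
  ultimately show ?thesis using x(2) by (simp add: subset_iff)
qed

lemma openin_scale:
  fixes W :: "'a::euclidean_space set"
  assumes "openin (top_of_set L) W" "subspace L" "c \<noteq> 0"
  shows "openin (top_of_set L) ((*\<^sub>R) c ` W)"
proof -
  have h: "homeomorphism L L ((*\<^sub>R) c) ((*\<^sub>R) (inverse c))"
    unfolding homeomorphism_def using assms(2,3)
    by (auto intro!: continuous_intros simp: subspace_scale image_iff)
       (metis assms(2,3) scaleR_one scaleR_scaleR subspace_scale left_inverse right_inverse)+
  show ?thesis using homeomorphism_imp_open_map[OF h assms(1)] .
qed

text \<open>This excludes cracks. It rests on the convention that a cone whose section is the whole sphere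
  is \<open>L\<close> and not \<open>L - {0}\<close>.\<close>

lemma corner_cone_regular:
  fixes L :: "'a::euclidean_space set"
  shows "C \<in> corner_cones n L \<Longrightarrow> subspace L \<Longrightarrow> dim L = n \<Longrightarrow> openin (top_of_set L) W \<Longrightarrow> W \<subseteq> closure C \<Longrightarrow> W \<subseteq> C"
proof (induction n arbitrary: L C W)
  case 0
  then have "L = {0}" using dim_eq_0[of L] subspace_0 by blast
  then show ?case using 0 openin_subset[of "top_of_set L" W] by auto
next
  case (Suc n)
  note L = Suc.prems(2)
  have oc: "open_cone L C" and sec: "C \<inter> unit_sphere L \<in> sphere_domains n L" using Suc.prems(1) by auto
  note C = open_coneD[OF oc]
  have WL: "W \<subseteq> L" using Suc.prems(4) openin_subset by fastforce
  have unit: "x \<in> C" if W': "openin (top_of_set L) W'" "W' \<subseteq> closure C" and x: "x \<in> W'" "norm x = 1" for W' x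
  proof (cases n)
    case 0
    have xL: "x \<in> L" using W' x openin_subset[of "top_of_set L" W'] by auto
    have "openin (top_of_set L) (W' \<inter> (L \<inter> {y. x \<bullet> y > 0}))"
      by (intro openin_Int W'(1) openin_open_Int open_halfspace_gt)
    moreover have "x \<in> W' \<inter> (L \<inter> {y. x \<bullet> y > 0})" using x xL by (auto simp: power2_norm_eq_inner[symmetric])
    ultimately obtain O' where O': "open O'" "W' \<inter> (L \<inter> {y. x \<bullet> y > 0}) = L \<inter> O'" "x \<in> O'"
      unfolding openin_open by blast
    then obtain c where c: "c \<in> C" "c \<in> O'" using W'(2) x(1) closure_iff_nhds_not_empty[of x C] by blast
    then have cp: "x \<bullet> c > 0" "c \<in> L" using O'(2) C(2) by blast+
    have "span {x} = L"
    proof (rule subspace_dim_equal[OF subspace_span L])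
      show "span {x} \<subseteq> L" using xL L by (intro span_minimal) auto
      show "dim L \<le> dim (span {x})" using x(2) Suc.prems(3) 0 by (simp add: dim_span dim_singleton) auto
    qed
    then obtain k where k: "c = k *\<^sub>R x" using cp(2) by (auto simp: span_singleton)
    then have "k > 0" using cp(1) x(2) by (simp add: power2_norm_eq_inner[symmetric])
    then show "x \<in> C" using c(1) scaled_cone_mem[OF C(3)] k by simp
  next
    case (Suc m)
    have xL: "x \<in> L" using W' x openin_subset[of "top_of_set L" W'] by auto
    let ?S = "unit_sphere L" and ?T = "sphere_tangent L x"
    let ?Z = "C \<inter> ?S"
    have xc: "x \<in> closure ?Z" by (rule closure_section[OF C(2,3) _ x(2) L]) (use W' x in blast)
    have "?Z \<in> corner_domains_in ?S (sphere_tangent L) (\<lambda>K. corner_cones (Suc m) K)"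
      using sec unfolding Suc by (simp only: sphere_domains.simps)
    then obtain C' U V \<phi> where C': "C' \<in> corner_cones n ?T" and ch: "tangent_chart ?S ?T ?Z x C' U V \<phi>"
      using xc unfolding corner_domains_in_def Suc by blast
    note d = tangent_chartD[OF ch]
    have T: "subspace ?T" by (rule subspace_sphere_tangent[OF L])
    have "x \<noteq> 0" using x(2) by auto
    then have dT: "dim ?T = n" using dim_sphere_tangent[OF L xL] Suc.prems(3) by simp
    define W'' where "W'' = ?S \<inter> W'"
    have SL: "?S \<subseteq> L" by (auto simp: unit_sphere_def)
    obtain O' where O': "open O'" "W' = L \<inter> O'" using W'(1) unfolding openin_open by blast
    then have W''O: "W'' = ?S \<inter> O'" using SL unfolding W''_def by blast
    have W''c: "W'' \<subseteq> closure ?Z"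
    proof
      fix y assume "y \<in> W''"
      then have "y \<in> closure C" "norm y = 1" using W' by (auto simp: W''_def unit_sphere_def)
      then show "y \<in> closure ?Z" by (rule closure_section[OF C(2,3) _ _ L])
    qed
    have hom: "homeomorphism U V \<phi> (inv_into U \<phi>)"
      using d(5-7) unfolding homeomorphism_def bij_betw_def by (auto simp: inv_into_image_cancel f_inv_into_f)
    have "openin (top_of_set U) (U \<inter> W'')"
      unfolding openin_open W''O using openin_subset[OF d(1)] O'(1) by auto
    then have "openin (top_of_set V) (\<phi> ` (U \<inter> W''))" by (rule homeomorphism_imp_open_map[OF hom])
    then have o: "openin (top_of_set ?T) (\<phi> ` (U \<inter> W''))" using d(3) openin_trans by blast
    have "\<phi> ` (U \<inter> closure ?Z) \<subseteq> closure C'"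
      by (rule image_closure_subset_local[OF d(1) d(6)]) (use d(10) in auto)
    then have "\<phi> ` (U \<inter> W'') \<subseteq> closure C'" using W''c by blast
    \<comment> \<open>The chart turns a piece of the sphere into an open part of the closure of
      \<open>C'\<close>, one dimension lower, and sends \<open>x\<close> to the apex 0.\<close>
    then have "\<phi> ` (U \<inter> W'') \<subseteq> C'" by (rule Suc.IH[OF C' T dT o])
    moreover have "x \<in> U \<inter> W''" using d(2) x xL by (auto simp: W''_def unit_sphere_def)
    ultimately have "0 \<in> V \<inter> C'" using d(4,8) by (metis Int_iff image_eqI subsetD)
    then obtain z where z: "z \<in> U" "z \<in> ?Z" "\<phi> z = \<phi> x" unfolding d(10)[symmetric] using d(8) by auto
    then have "z = x" using d(2,5) unfolding bij_betw_def inj_on_def by blast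
    then show "x \<in> C" using z by blast
  qed
  have nonzero: "x \<in> C" if x: "x \<in> W" "x \<noteq> 0" for x
  proof -
    let ?c = "inverse (norm x)"
    have "?c *\<^sub>R x \<in> C"
    proof (rule unit)
      show "openin (top_of_set L) ((*\<^sub>R) ?c ` W)" using openin_scale[OF Suc.prems(4) L] x(2) by simp
      show "(*\<^sub>R) ?c ` W \<subseteq> closure C"
        using Suc.prems(5) closure_scale[OF C(3), of ?c] x(2) by auto
    qed (use x in auto)
    then show ?thesis using scaled_cone_mem[OF C(3), of ?c x] x(2) by simp
  qed
  show ?case
  proof
    fix x assume x: "x \<in> W"
    show "x \<in> C"
    proof (cases "x = 0")
      \<comment> \<open>A ball around the apex forces the whole sphere into \<open>C\<close>, so the
        section is full.\<close>
      case True
      obtain O' where O': "open O'" "W = L \<inter> O'" using Suc.prems(4) unfolding openin_open by blast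
      then obtain r where r: "r > 0" "ball 0 r \<subseteq> O'" using x True by (meson IntD2 openE)
      have "unit_sphere L \<subseteq> C"
      proof
        fix u assume u: "u \<in> unit_sphere L"
        then have uL: "u \<in> L" "norm u = 1" by (auto simp: unit_sphere_def)
        have "(r/2) *\<^sub>R u \<in> W" using O'(2) r uL by (auto simp: subspace_scale[OF L] subset_iff)
        moreover have "(r/2) *\<^sub>R u \<noteq> 0" using r uL by auto
        ultimately have "(r/2) *\<^sub>R u \<in> C" by (rule nonzero)
        then show "u \<in> C" using scaled_cone_mem[OF C(3), of "r/2" u] r by simp
      qed
      then have "C = L" using C(4) by blast
      then show ?thesis using x WL by blast
    qed (rule nonzero[OF x])
  qed
qed

section \<open>Locally conic sets\<close>

text \<open>Inside the ball of radius \<open>r\<close>, membership in \<open>P\<close> is constant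
  along each open ray from \<open>X\<close>; two factors \<open>a\<close> and \<open>b\<close> avoid
  normalising the direction.\<close>

definition conic_at :: "'a::euclidean_space set \<Rightarrow> 'a \<Rightarrow> real \<Rightarrow> bool" where
  "conic_at P X r \<longleftrightarrow> r > 0 \<and> (\<forall>v a b. a > 0 \<longrightarrow> b > 0 \<longrightarrow> norm (a *\<^sub>R v) < r \<longrightarrow> norm (b *\<^sub>R v) < r \<longrightarrow>
     X + a *\<^sub>R v \<in> P \<longrightarrow> X + b *\<^sub>R v \<in> P)"

text \<open>The directions that stay in \<open>P\<close> for a while. For locally conic
  \<open>P\<close> this is the germ of \<open>P\<close> at \<open>X\<close> extended by
  scaling.\<close>

definition tcone :: "'a::euclidean_space set \<Rightarrow> 'a \<Rightarrow> 'a set" where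
  "tcone P X = {v. \<exists>r>0. \<forall>s. 0 < s \<longrightarrow> s < r \<longrightarrow> X + s *\<^sub>R v \<in> P}"

definition regular_open :: "'a::topological_space set \<Rightarrow> bool" where
  "regular_open P \<longleftrightarrow> open P \<and> interior (closure P) \<subseteq> P"

definition conic_everywhere :: "'a::euclidean_space set \<Rightarrow> bool" where
  "conic_everywhere P \<longleftrightarrow> (\<forall>X. \<exists>r. conic_at P X r)"

text \<open>Near \<open>X\<close> only the hyperplanes through \<open>X\<close> matter, and a ray from \<open>X\<close> which lies in none of them
  cannot cross the boundary. Such rays are dense, and regularity deals with the others.\<close>

lemma polyhedral_conic:
  fixes P :: "'a::euclidean_space set"
  assumes P: "regular_open P" and fin: "finite \<H>" and H: "\<And>H. H \<in> \<H> \<Longrightarrow> \<exists>a b. a \<noteq> 0 \<and> H = {y. a \<bullet> y = b}"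
    and bd: "bd P \<subseteq> \<Union>\<H>"
  shows "conic_everywhere P"
  unfolding conic_everywhere_def
proof
  fix X
  have Hc: "closed H" if "H \<in> \<H>" for H
  proof -
    obtain a b where "H = {y. a \<bullet> y = b}" using H[OF \<open>H \<in> \<H>\<close>] by blast
    then show ?thesis by (simp add: closed_hyperplane)
  qed
  have "open (- \<Union>{H\<in>\<H>. X \<notin> H})" using fin Hc by (intro open_Compl closed_Union) auto
  moreover have "X \<in> - \<Union>{H\<in>\<H>. X \<notin> H}" by blast
  ultimately obtain r where r: "r > 0" "ball X r \<subseteq> - \<Union>{H\<in>\<H>. X \<notin> H}" by (meson openE)
  define \<H>' where "\<H>' = {H\<in>\<H>. X \<in> H}"
  have "negligible (\<Union>\<H>')"
  proof (rule negligible_Union)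
    show "finite \<H>'" using fin by (simp add: \<H>'_def)
    fix H assume "H \<in> \<H>'"
    then have "H \<in> \<H>" by (simp add: \<H>'_def)
    from H[OF this] obtain a b where "a \<noteq> 0" "H = {y. a \<bullet> y = b}" by blast
    then show "negligible H" using negligible_hyperplane[of a b] by simp
  qed
  then have dense: "O' \<inter> - \<Union>\<H>' \<noteq> {}" if "open O'" "O' \<noteq> {}" for O'
    using that open_not_negligible negligible_subset by (metis disjoint_eq_subset_Compl double_complement)
  have H': "X + s *\<^sub>R w \<in> H \<longleftrightarrow> X + w \<in> H" if "H \<in> \<H>'" "s > 0" for H s w
  proof -
    have "H \<in> \<H>" using \<open>H \<in> \<H>'\<close> by (simp add: \<H>'_def)
    from H[OF this] obtain a b where ab: "H = {y. a \<bullet> y = b}" by blast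
    have "a \<bullet> X = b" using \<open>H \<in> \<H>'\<close> ab by (auto simp: \<H>'_def)
    then show ?thesis using \<open>s > 0\<close> by (simp add: ab inner_add_right)
  qed
  have oP: "open P" and rP: "\<And>O'. open O' \<Longrightarrow> O' \<subseteq> closure P \<Longrightarrow> O' \<subseteq> P"
    using P interior_maximal unfolding regular_open_def by blast+
  have segment: "X + b *\<^sub>R w \<in> P"
    if ab: "a > 0" "b > 0" and n: "norm (a *\<^sub>R w) < r" "norm (b *\<^sub>R w) < r" and off: "X + w \<notin> \<Union>\<H>'" and aP: "X + a *\<^sub>R w \<in> P" for a b w
  proof (rule ccontr)
    assume nb: "X + b *\<^sub>R w \<notin> P"
    let ?I = "(\<lambda>s. X + s *\<^sub>R w) ` {min a b..max a b}"
    have "connected ?I" by (intro connected_continuous_image continuous_intros) auto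
    moreover have "?I \<inter> P \<noteq> {}" using aP by (auto intro!: image_eqI[of _ _ a])
    moreover have "?I - P \<noteq> {}" using nb by (auto intro!: image_eqI[of _ _ b])
    ultimately have "?I \<inter> frontier P \<noteq> {}" by (rule connected_Int_frontier)
    then obtain s where s: "s \<in> {min a b..max a b}" "X + s *\<^sub>R w \<in> frontier P" by blast
    then have sp: "s > 0" using ab by auto
    have "X + s *\<^sub>R w \<in> bd P" using s(2) oP by (simp add: frontier_def bd_def interior_open)
    then obtain H where H1: "H \<in> \<H>" "X + s *\<^sub>R w \<in> H" using bd by blast
    have "norm (s *\<^sub>R w) < r"
    proof -
      have "s \<le> a \<or> s \<le> b" using s(1) by auto
      then have "s * norm w \<le> a * norm w \<or> s * norm w \<le> b * norm w" by (auto intro: mult_right_mono)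
      then show ?thesis using n ab sp by auto
    qed
    then have "X + s *\<^sub>R w \<in> ball X r" by (simp add: dist_norm)
    then have "X \<in> H" using r(2) H1 by blast
    then have "H \<in> \<H>'" using H1 by (simp add: \<H>'_def)
    then show False using H'[OF _ sp] H1(2) off by blast
  qed
  have "X + b *\<^sub>R v \<in> P"
    if ab: "a > 0" "b > 0" and n: "norm (a *\<^sub>R v) < r" "norm (b *\<^sub>R v) < r" and aP: "X + a *\<^sub>R v \<in> P" for a b v
  proof -
    define O' where "O' = {w. X + a *\<^sub>R w \<in> P} \<inter> {w. norm (a *\<^sub>R w) < r} \<inter> {w. norm (b *\<^sub>R w) < r}"
    have pre: "open {w. X + c *\<^sub>R w \<in> Q}" if "open Q" for c and Q :: "'a set"
    proof -
      have "open ((\<lambda>w. X + c *\<^sub>R w) -` Q)" by (intro open_vimage that continuous_intros)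
      then show ?thesis by (simp add: vimage_def)
    qed
    have oO: "open O'" unfolding O'_def
      by (intro open_Int open_Collect_less continuous_intros pre oP)
    have vO: "v \<in> O'" using n aP by (simp add: O'_def)
    define N where "N = (\<lambda>w. X + b *\<^sub>R w) ` O'"
    have "open ((*\<^sub>R) b ` O')" by (rule open_scaling[OF _ oO]) (use ab in simp)
    then have "open ((+) X ` (*\<^sub>R) b ` O')" by (rule open_translation)
    then have oN: "open N" by (simp add: N_def image_image)
    \<comment> \<open>Every neighbourhood of a point of \<open>N\<close> contains an admissible
      direction off the hyperplanes, to which \<open>segment\<close> applies. So \<open>N\<close> is
      an open subset of the closure, and regularity puts it into \<open>P\<close>.\<close>
    have "N \<subseteq> closure P"
    proof
      fix y assume y: "y \<in> N"
      show "y \<in> closure P"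
        unfolding closure_iff_nhds_not_empty
      proof (intro allI impI)
        fix A V assume V: "V \<subseteq> A" "open V" "y \<in> V"
        define G where "G = O' \<inter> {w. X + b *\<^sub>R w \<in> V}"
        have "open {w. X + b *\<^sub>R w \<in> V}" by (rule pre[OF V(2)])
        then have "open G" unfolding G_def using oO by blast
        then have "open ((+) X ` G)" by (rule open_translation)
        moreover have "G \<noteq> {}" using y V(3) unfolding G_def N_def by blast
        ultimately obtain w where w: "w \<in> G" "X + w \<notin> \<Union>\<H>'" using dense[of "(+) X ` G"] by blast
        then have "X + b *\<^sub>R w \<in> P"
          using segment[OF ab _ _ w(2)] by (auto simp: G_def O'_def)
        then show "P \<inter> A \<noteq> {}" using w V(1) by (auto simp: G_def)
      qed
    qed
    then have "N \<subseteq> P" by (rule rP[OF oN])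
    then show ?thesis using vO by (auto simp: N_def)
  qed
  then show "\<exists>r. conic_at P X r" using r(1) unfolding conic_at_def by blast
qed

section \<open>Germs of locally conic sets\<close>

lemma tcone_iff:
  assumes "conic_at P X r" "norm v < r"
  shows "v \<in> tcone P X \<longleftrightarrow> X + v \<in> P"
proof
  assume "v \<in> tcone P X"
  then obtain q where q: "q > 0" "\<And>s. 0 < s \<Longrightarrow> s < q \<Longrightarrow> X + s *\<^sub>R v \<in> P" unfolding tcone_def by blast
  define s where "s = min (q / 2) 1"
  have s: "s > 0" "s < q" "s \<le> 1" using q(1) by (auto simp: s_def)
  have "norm (s *\<^sub>R v) < r" using assms(2) s mult_right_mono[of s 1 "norm v"] by simp
  then have "X + 1 *\<^sub>R v \<in> P" using assms q(2)[OF s(1,2)] s(1) unfolding conic_at_def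
    by (metis scaleR_one zero_less_one)
  then show "X + v \<in> P" by simp
next
  assume v: "X + v \<in> P"
  have "X + s *\<^sub>R v \<in> P" if "0 < s" "s < 1" for s
  proof -
    have "norm (s *\<^sub>R v) < r" using assms(2) that mult_right_mono[of s 1 "norm v"] by simp
    then show ?thesis using assms v that(1) unfolding conic_at_def by (metis scaleR_one zero_less_one)
  qed
  then show "v \<in> tcone P X" unfolding tcone_def by (auto intro!: exI[of _ 1])
qed

lemma tcone_scale: "\<forall>\<rho>>0. \<forall>y\<in>tcone P X. \<rho> *\<^sub>R y \<in> tcone P X"
proof (intro allI impI ballI)
  fix \<rho> :: real and y assume \<rho>: "\<rho> > 0" and "y \<in> tcone P X"
  then obtain q where q: "q > 0" "\<And>s. 0 < s \<Longrightarrow> s < q \<Longrightarrow> X + s *\<^sub>R y \<in> P" unfolding tcone_def by blast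
  have "X + s *\<^sub>R (\<rho> *\<^sub>R y) \<in> P" if "0 < s" "s < q / \<rho>" for s
    using q(2)[of "s * \<rho>"] that \<rho> by (simp add: field_simps)
  then show "\<rho> *\<^sub>R y \<in> tcone P X" unfolding tcone_def using q(1) \<rho> by (auto intro!: exI[of _ "q / \<rho>"])
qed

lemma shrink_into_ball:
  fixes v :: "'a::real_normed_vector"
  assumes "r > 0"
  obtains s where "s > 0" "norm (s *\<^sub>R v) < r"
proof
  show "r / (norm v + 1) > 0" using assms by (simp add: add_nonneg_pos)
  have "norm v < norm v + 1" by simp
  then have "r * norm v < r * (norm v + 1)" using assms by (intro mult_strict_left_mono)
  then show "norm ((r / (norm v + 1)) *\<^sub>R v) < r" using assms by (simp add: pos_divide_less_eq add_nonneg_pos)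
qed

lemma conic_at_cone_scale:
  assumes C: "\<forall>\<rho>>0. \<forall>y\<in>C. \<rho> *\<^sub>R y \<in> C" and s: "s > 0" and c: "conic_at C (s *\<^sub>R X) r"
  shows "conic_at C X (r / s)"
  unfolding conic_at_def
proof (intro conjI allI impI)
  show "r / s > 0" using c s by (simp add: conic_at_def)
  fix v and a b :: real assume ab: "a > 0" "b > 0" "norm (a *\<^sub>R v) < r / s" "norm (b *\<^sub>R v) < r / s" "X + a *\<^sub>R v \<in> C"
  have n: "norm (a *\<^sub>R (s *\<^sub>R v)) < r" "norm (b *\<^sub>R (s *\<^sub>R v)) < r"
    using ab s by (simp_all add: field_simps)
  have "s *\<^sub>R (X + a *\<^sub>R v) \<in> C" using C s ab(5) by blast
  then have "s *\<^sub>R X + a *\<^sub>R (s *\<^sub>R v) \<in> C" by (simp add: scaleR_add_right mult.commute)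
  then have "s *\<^sub>R X + b *\<^sub>R (s *\<^sub>R v) \<in> C" using c n ab(1,2) unfolding conic_at_def by blast
  then have "s *\<^sub>R (X + b *\<^sub>R v) \<in> C" by (simp add: scaleR_add_right mult.commute)
  then show "X + b *\<^sub>R v \<in> C" using scaled_cone_mem[OF C s] by blast
qed

lemma cone_subset_interior:
  fixes A B :: "'a::euclidean_space set"
  assumes C: "\<And>v. v \<in> A \<Longrightarrow> \<exists>s>0. \<exists>O'. open O' \<and> s *\<^sub>R v \<in> O' \<and> O' \<subseteq> B" and B: "\<forall>\<rho>>0. \<forall>y\<in>B. \<rho> *\<^sub>R y \<in> B"
  shows "A \<subseteq> interior B"
proof
  fix v assume "v \<in> A"
  then obtain s O' where s: "s > 0" "open O'" "s *\<^sub>R v \<in> O'" "O' \<subseteq> B" using C by blast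
  have o: "open ((*\<^sub>R) (inverse s) ` O')" by (rule open_scaling[OF _ s(2)]) (use s(1) in simp)
  have m: "v \<in> (*\<^sub>R) (inverse s) ` O'" using s(1,3) by (intro image_eqI[of _ _ "s *\<^sub>R v"]) auto
  have "(*\<^sub>R) (inverse s) ` O' \<subseteq> B" using s(1,4) B by auto
  then show "v \<in> interior B" using o m by (meson interiorI)
qed

context
  fixes P :: "'a::euclidean_space set" and X r
  assumes P: "regular_open P" "conic_everywhere P" and r: "conic_at P X r"
begin

text \<open>Within radius \<open>r\<close> the cone at \<open>X\<close> is \<open>P\<close>
  translated by \<open>- X\<close>, so both sets have the same germ at the displaced point.\<close>

lemma tcone_tcone:
  assumes h: "norm h < r"
  shows "tcone (tcone P X) h = tcone P (X + h)"
proof -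
  define q where "q = r - norm h"
  have q: "q > 0" using h by (simp add: q_def)
  have e: "h + s *\<^sub>R v \<in> tcone P X \<longleftrightarrow> X + h + s *\<^sub>R v \<in> P" if "norm (s *\<^sub>R v) < q" for s v
  proof -
    have "norm (h + s *\<^sub>R v) < r" using norm_triangle_ineq[of h "s *\<^sub>R v"] that by (simp add: q_def)
    then show ?thesis using tcone_iff[OF r, of "h + s *\<^sub>R v"] by (simp add: add.assoc)
  qed
  have small: "\<exists>q'>0. \<forall>s. 0 < s \<longrightarrow> s < q' \<longrightarrow> norm (s *\<^sub>R v) < q" for v
  proof -
    obtain s0 where s0: "s0 > 0" "norm (s0 *\<^sub>R v) < q" using shrink_into_ball[OF q] by blast
    have "norm (s *\<^sub>R v) < q" if "0 < s" "s < s0" for s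
      using s0 that mult_right_mono[of s s0 "norm v"] by simp
    then show ?thesis using s0(1) by blast
  qed
  show ?thesis
  proof (intro set_eqI iffI)
    fix v assume "v \<in> tcone (tcone P X) h"
    then obtain a where a: "a > 0" "\<And>s. 0 < s \<Longrightarrow> s < a \<Longrightarrow> h + s *\<^sub>R v \<in> tcone P X" unfolding tcone_def[of "tcone P X"] by blast
    obtain q' where q': "q' > 0" "\<And>s. 0 < s \<Longrightarrow> s < q' \<Longrightarrow> norm (s *\<^sub>R v) < q" using small by blast
    have "X + h + s *\<^sub>R v \<in> P" if "0 < s" "s < min a q'" for s
      using e[OF q'(2)[OF that(1)]] a(2)[OF that(1)] that(2) by simp
    then show "v \<in> tcone P (X + h)"
      unfolding tcone_def[of P "X + h"] mem_Collect_eq using a(1) q'(1) by (intro exI[of _ "min a q'"]) simp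
  next
    fix v assume "v \<in> tcone P (X + h)"
    then obtain a where a: "a > 0" "\<And>s. 0 < s \<Longrightarrow> s < a \<Longrightarrow> X + h + s *\<^sub>R v \<in> P" unfolding tcone_def[of P "X + h"] by blast
    obtain q' where q': "q' > 0" "\<And>s. 0 < s \<Longrightarrow> s < q' \<Longrightarrow> norm (s *\<^sub>R v) < q" using small by blast
    have "h + s *\<^sub>R v \<in> tcone P X" if "0 < s" "s < min a q'" for s
      using e[OF q'(2)[OF that(1)]] a(2)[OF that(1)] that(2) by simp
    then show "v \<in> tcone (tcone P X) h"
      unfolding tcone_def[of "tcone P X"] mem_Collect_eq using a(1) q'(1) by (intro exI[of _ "min a q'"]) simp
  qed
qed

lemma tcone_conic: "conic_everywhere (tcone P X)"
  unfolding conic_everywhere_def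
proof
  fix h :: 'a
  have r0: "r > 0" using r by (simp add: conic_at_def)
  obtain s where s: "s > 0" "norm (s *\<^sub>R h) < r" using shrink_into_ball[OF r0] by blast
  obtain \<rho> where \<rho>: "conic_at P (X + s *\<^sub>R h) \<rho>" using P(2) unfolding conic_everywhere_def by blast
  define q where "q = min \<rho> (r - norm (s *\<^sub>R h))"
  have "conic_at (tcone P X) (s *\<^sub>R h) q"
    unfolding conic_at_def
  proof (intro conjI allI impI)
    show "q > 0" using s \<rho> by (simp add: q_def conic_at_def)
    fix v and a b :: real assume ab: "a > 0" "b > 0" "norm (a *\<^sub>R v) < q" "norm (b *\<^sub>R v) < q" "s *\<^sub>R h + a *\<^sub>R v \<in> tcone P X"
    have e: "s *\<^sub>R h + c *\<^sub>R v \<in> tcone P X \<longleftrightarrow> X + s *\<^sub>R h + c *\<^sub>R v \<in> P" if "norm (c *\<^sub>R v) < q" for c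
    proof -
      have "norm (s *\<^sub>R h + c *\<^sub>R v) < r" using norm_triangle_ineq[of "s *\<^sub>R h" "c *\<^sub>R v"] that by (simp add: q_def)
      then show ?thesis using tcone_iff[OF r, of "s *\<^sub>R h + c *\<^sub>R v"] by (simp add: add.assoc)
    qed
    have "X + s *\<^sub>R h + a *\<^sub>R v \<in> P" using e ab by blast
    moreover have "norm (a *\<^sub>R v) < \<rho>" "norm (b *\<^sub>R v) < \<rho>" using ab by (auto simp: q_def)
    ultimately have "X + s *\<^sub>R h + b *\<^sub>R v \<in> P" using \<rho> ab(1,2) unfolding conic_at_def by blast
    then show "s *\<^sub>R h + b *\<^sub>R v \<in> tcone P X" using e ab by blast
  qed
  from conic_at_cone_scale[OF tcone_scale s(1) this] show "\<exists>r. conic_at (tcone P X) h r" by blast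
qed

lemma tcone_ball: "tcone P X \<inter> ball 0 r = (+) (- X) ` (P \<inter> ball X r)"
proof (intro set_eqI iffI)
  fix v assume "v \<in> tcone P X \<inter> ball 0 r"
  then have "X + v \<in> P \<inter> ball X r" using tcone_iff[OF r, of v] by (simp add: dist_norm)
  moreover have "v = - X + (X + v)" by simp
  ultimately show "v \<in> (+) (- X) ` (P \<inter> ball X r)" by blast
next
  fix v assume "v \<in> (+) (- X) ` (P \<inter> ball X r)"
  then have "X + v \<in> P" "norm v < r" by (auto simp: dist_norm norm_minus_commute)
  then show "v \<in> tcone P X \<inter> ball 0 r" using tcone_iff[OF r, of v] by simp
qed

text \<open>Near its apex the cone is a translate of \<open>P\<close>, and scaling moves every point
  into that range.\<close>

lemma tcone_regular: "regular_open (tcone P X)"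
proof -
  let ?T = "tcone P X"
  have r0: "r > 0" using r by (simp add: conic_at_def)
  have oP: "open P" using P(1) by (simp add: regular_open_def)
  have o1: "open (?T \<inter> ball 0 r)" unfolding tcone_ball using oP by (intro open_translation open_Int) auto
  have "?T \<subseteq> interior ?T"
  proof (rule cone_subset_interior[OF _ tcone_scale])
    fix v assume v: "v \<in> ?T"
    obtain s where s: "s > 0" "norm (s *\<^sub>R v) < r" using shrink_into_ball[OF r0] by blast
    have "s *\<^sub>R v \<in> ?T" using tcone_scale v s(1) by blast
    then show "\<exists>s>0. \<exists>O'. open O' \<and> s *\<^sub>R v \<in> O' \<and> O' \<subseteq> ?T"
      using s o1 by (intro exI[of _ s] conjI exI[of _ "?T \<inter> ball 0 r"]) auto
  qed
  then have oT: "open ?T" using interior_subset[of ?T] by (metis open_interior subset_antisym)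
  have "interior (closure ?T) \<subseteq> ?T"
  proof
    fix v :: 'a assume v: "v \<in> interior (closure ?T)"
    obtain s where s: "s > 0" "norm (s *\<^sub>R v) < r" using shrink_into_ball[OF r0] by blast
    define O' where "O' = (*\<^sub>R) s ` interior (closure ?T) \<inter> ball 0 r"
    have oO: "open O'" unfolding O'_def using s(1) by (intro open_Int open_scaling) auto
    have "O' \<subseteq> closure ?T"
    proof
      fix w assume "w \<in> O'"
      then obtain u where u: "u \<in> interior (closure ?T)" "w = s *\<^sub>R u" unfolding O'_def by blast
      then have "u \<in> closure ?T" using interior_subset by blast
      then show "w \<in> closure ?T" unfolding u(2) by (rule closure_scale[OF tcone_scale s(1)])
    qed
    then have "O' \<subseteq> closure (?T \<inter> ball 0 r)"
      using open_Int_closure_subset[of "ball 0 r" ?T] unfolding O'_def by (auto simp: Int_commute)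
    also have "\<dots> = (+) (- X) ` closure (P \<inter> ball X r)" unfolding tcone_ball by (rule closure_translation)
    also have "\<dots> \<subseteq> (+) (- X) ` closure P" by (intro image_mono closure_mono) simp
    finally have "(+) X ` O' \<subseteq> closure P" by auto
    moreover have "open ((+) X ` O')" by (rule open_translation[OF oO])
    ultimately have "(+) X ` O' \<subseteq> P" using P(1) interior_maximal unfolding regular_open_def by blast
    moreover have "s *\<^sub>R v \<in> O'" using v s by (simp add: O'_def)
    ultimately have "X + s *\<^sub>R v \<in> P" by blast
    then have "s *\<^sub>R v \<in> ?T" using tcone_iff[OF r s(2)] by blast
    then show "v \<in> ?T" using scaled_cone_mem[OF tcone_scale s(1)] by blast
  qed
  with oT show ?thesis by (simp add: regular_open_def)
qed

lemma tcone_nonempty: "X \<in> closure P \<Longrightarrow> tcone P X \<noteq> {}"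
proof -
  assume X: "X \<in> closure P"
  have r0: "r > 0" using r by (simp add: conic_at_def)
  then have "P \<inter> ball X r \<noteq> {}" using X by (metis centre_in_ball open_ball open_Int_closure_eq_empty Int_commute disjoint_iff)
  then show "tcone P X \<noteq> {}" using tcone_ball by blast
qed

end

section \<open>Corner cones in dimension three\<close>

text \<open>Central projection of the open hemisphere around \<open>x\<close> onto the tangent
  plane. It keeps rays, so the cone corresponds exactly to its flat slice through \<open>x\<close>,
  and the section on the sphere has the same local model as that slice.\<close>

lemma gnomonic_chart:
  fixes L :: "'a::euclidean_space set"
  assumes L: "subspace L" and C: "C \<subseteq> L" "\<forall>\<rho>>0. \<forall>y\<in>C. \<rho> *\<^sub>R y \<in> C" and x: "x \<in> L" "norm x = 1" and r: "r > 0"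
    and loc: "\<And>v. v \<in> sphere_tangent L x \<Longrightarrow> norm v < r \<Longrightarrow> x + v \<in> C \<longleftrightarrow> v \<in> W"
  shows "\<exists>U V \<phi>. tangent_chart (unit_sphere L) (sphere_tangent L x) (C \<inter> unit_sphere L) x (W \<inter> sphere_tangent L x) U V \<phi>"
proof -
  let ?S = "unit_sphere L" and ?T = "sphere_tangent L x"
  define \<phi> where "\<phi> y = inverse (x \<bullet> y) *\<^sub>R y - x" for y
  define g where "g v = inverse (norm (x + v)) *\<^sub>R (x + v)" for v
  define H where "H = {y. x \<bullet> y > 0}"
  define U where "U = ?S \<inter> (H \<inter> \<phi> -` ball 0 r)"
  define V where "V = ?T \<inter> ball 0 r"
  have xx: "x \<bullet> x = 1" using x(2) by (simp add: power2_norm_eq_inner[symmetric])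
  have H: "open H" unfolding H_def by (rule open_halfspace_gt)
  have cH: "continuous_on H \<phi>" unfolding \<phi>_def H_def by (intro continuous_intros) auto
  have oU: "openin (top_of_set ?S) U" unfolding U_def
    by (intro openin_open_Int continuous_open_preimage[OF cH H open_ball])
  have oV: "openin (top_of_set ?T) V" unfolding V_def by (intro openin_open_Int open_ball)
  have T: "x \<bullet> v = 0" "v \<in> L" if "v \<in> ?T" for v using that by (auto simp: sphere_tangent_def orthogonal_def)
  have nxv: "(x + v) \<bullet> (x + v) > 0" "x + v \<noteq> 0" "x \<bullet> (x + v) = 1" if "v \<in> ?T" for v
  proof -
    show 1: "x \<bullet> (x + v) = 1" using T(1)[OF that] xx by (simp add: inner_add_right)
    then show "x + v \<noteq> 0" by auto
    then show "(x + v) \<bullet> (x + v) > 0" by simp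
  qed
  have \<phi>g: "\<phi> (g v) = v" "g v \<in> U" if v: "v \<in> V" for v
  proof -
    have vT: "v \<in> ?T" "norm v < r" using v by (auto simp: V_def)
    note n = nxv[OF vT(1)]
    have xg: "x \<bullet> g v = inverse (norm (x + v))" using n(3) by (simp add: g_def)
    then show \<phi>: "\<phi> (g v) = v" using n(2) by (simp add: \<phi>_def g_def)
    have "g v \<in> ?S" using n(2) T(2)[OF vT(1)] x L by (simp add: g_def unit_sphere_def subspace_scale subspace_add)
    moreover have "g v \<in> H" using n(2) by (simp add: H_def xg)
    ultimately show "g v \<in> U" using vT(2) by (simp add: U_def \<phi>)
  qed
  have g\<phi>: "g (\<phi> y) = y" "\<phi> y \<in> V" if y: "y \<in> U" for y
  proof -
    have y': "y \<in> L" "norm y = 1" "x \<bullet> y > 0" "norm (\<phi> y) < r" using y by (auto simp: U_def H_def unit_sphere_def)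
    show "g (\<phi> y) = y" using y'(2,3) by (simp add: g_def \<phi>_def)
    have "x \<bullet> \<phi> y = 0" using y'(3) xx by (simp add: \<phi>_def inner_diff_right)
    moreover have "\<phi> y \<in> L" using y'(1) x(1) L by (simp add: \<phi>_def subspace_diff subspace_scale)
    ultimately show "\<phi> y \<in> V" using y'(4) by (simp add: V_def sphere_tangent_def orthogonal_def)
  qed
  have bij: "bij_betw \<phi> U V"
    by (rule bij_betw_byWitness[where f' = g]) (use \<phi>g g\<phi> in auto)
  have inv: "inv_into U \<phi> v = g v" if "v \<in> V" for v
    by (rule inv_into_f_eq) (use bij \<phi>g[OF that] in \<open>auto simp: bij_betw_def\<close>)
  have s1: "smooth_map U \<phi>"
    unfolding smooth_map_def
  proof
    fix y assume y: "y \<in> U"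
    \<comment> \<open>On the half-space \<open>H\<close> the base is positive, so the power -1 is
      the inverse appearing in \<open>\<phi>\<close>.\<close>
    have "smooth_on (\<lambda>y. ((x \<bullet> y) powr (-1)) *\<^sub>R y + (- x)) H"
      unfolding smooth_on_def
      by (intro allI Ck_on_add Ck_on_scaleR Ck_on_powr Ck_on_const H Ck_on_bounded_linear[OF bounded_linear_ident]
          Ck_on_bounded_linear[OF bounded_linear_inner_right]) (simp add: H_def)
    then show "\<exists>W g. open W \<and> y \<in> W \<and> smooth_on g W \<and> (\<forall>y\<in>U \<inter> W. g y = \<phi> y)"
      using H y by (intro exI[of _ H] exI[of _ "\<lambda>y. ((x \<bullet> y) powr (-1)) *\<^sub>R y + (- x)"])
        (auto simp: U_def \<phi>_def powr_minus H_def)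
  qed
  have s2: "smooth_map V (inv_into U \<phi>)"
    unfolding smooth_map_def
  proof
    fix v assume v: "v \<in> V"
    let ?W = "{v. (x + v) \<bullet> (x + v) > 0}"
    have oW: "open ?W" by (intro open_Collect_less continuous_intros)
    have "smooth_on (\<lambda>v. (((x + v) \<bullet> (x + v)) powr (-1/2)) *\<^sub>R (x + v)) ?W"
      unfolding smooth_on_def
      by (intro allI Ck_on_scaleR Ck_on_powr Ck_on_inner Ck_on_add Ck_on_const oW Ck_on_bounded_linear[OF bounded_linear_ident]) simp
    moreover have "(((x + v) \<bullet> (x + v)) powr (-1/2)) *\<^sub>R (x + v) = inv_into U \<phi> v" if "v \<in> V" for v
    proof -
      have "norm (x + v) > 0" using nxv(2)[of v] that by (simp add: V_def)
      then have "((x + v) \<bullet> (x + v)) powr (-1/2) = inverse (norm (x + v))"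
        by (simp add: power2_norm_eq_inner[symmetric] powr_minus powr_half_sqrt)
      then show ?thesis by (simp add: inv[OF that] g_def)
    qed
    moreover have "v \<in> ?W" using nxv(1)[of v] v by (simp add: V_def)
    ultimately show "\<exists>W g. open W \<and> v \<in> W \<and> smooth_on g W \<and> (\<forall>y\<in>V \<inter> W. g y = inv_into U \<phi> y)"
      using oW by blast
  qed
  have \<phi>x: "\<phi> x = 0" by (simp add: \<phi>_def xx)
  have der: "(\<phi> has_derivative (\<lambda>h. h)) (at x within ?S)"
    unfolding has_derivative_within_alt
  proof (intro conjI bounded_linear_ident allI impI)
    fix e :: real assume e: "e > 0"
    have "norm (\<phi> y - \<phi> x - (y - x)) \<le> e * norm (y - x)" if y: "y \<in> ?S" "norm (y - x) < min 1 e" for y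
    proof -
      have ny: "norm y = 1" using y by (simp add: unit_sphere_def)
      \<comment> \<open>On the sphere, 1 minus the inner product is half the squared distance. The
        radial factor therefore differs from 1 only to second order.\<close>
      have "(norm (y - x))\<^sup>2 = 2 - 2 * (x \<bullet> y)"
        unfolding power2_norm_eq_inner using ny xx
        by (simp add: inner_diff_left inner_diff_right inner_commute power2_norm_eq_inner[symmetric, of y])
      then have d: "1 - x \<bullet> y = (norm (y - x))\<^sup>2 / 2" by simp
      have "(norm (y - x))\<^sup>2 \<le> 1" using y(2) by (intro power_le_one) auto
      then have xy: "x \<bullet> y \<ge> 1/2" using d by simp
      have "\<phi> y - \<phi> x - (y - x) = (inverse (x \<bullet> y) - 1) *\<^sub>R y" by (simp add: \<phi>x) (simp add: \<phi>_def scaleR_diff_left)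
      also have "inverse (x \<bullet> y) - 1 = (1 - x \<bullet> y) * inverse (x \<bullet> y)" using xy by (simp add: field_simps)
      finally have "norm (\<phi> y - \<phi> x - (y - x)) = \<bar>(1 - x \<bullet> y) * inverse (x \<bullet> y)\<bar>" using ny by simp
      also have "\<dots> = ((norm (y - x))\<^sup>2 / 2) * inverse (x \<bullet> y)" unfolding d using xy by simp
      also have "\<dots> \<le> ((norm (y - x))\<^sup>2 / 2) * 2"
        using xy by (intro mult_left_mono) (auto simp: field_simps)
      also have "\<dots> = norm (y - x) * norm (y - x)" by (simp add: power2_eq_square)
      also have "\<dots> \<le> e * norm (y - x)" using y(2) by (intro mult_right_mono) auto
      finally show ?thesis .
    qed
    then show "\<exists>d>0. \<forall>y\<in>?S. norm (y - x) < d \<longrightarrow> norm (\<phi> y - \<phi> x - (y - x)) \<le> e * norm (y - x)"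
      using e by (intro exI[of _ "min 1 e"]) auto
  qed
  have CW: "y \<in> C \<longleftrightarrow> \<phi> y \<in> W" if y: "y \<in> U" for y
  proof -
    have xy: "inverse (x \<bullet> y) > 0" using y by (simp add: U_def H_def)
    have v: "\<phi> y \<in> ?T" "norm (\<phi> y) < r" using g\<phi>(2)[OF y] by (auto simp: V_def)
    have "x + \<phi> y = inverse (x \<bullet> y) *\<^sub>R y" by (simp add: \<phi>_def)
    then show ?thesis using loc[OF v] scaled_cone_mem[OF C(2) xy, of y] by simp
  qed
  have im: "\<phi> ` (U \<inter> (C \<inter> ?S)) = V \<inter> (W \<inter> ?T)"
  proof (intro equalityI subsetI)
    fix v assume "v \<in> \<phi> ` (U \<inter> (C \<inter> ?S))"
    then obtain y where y: "y \<in> U" "y \<in> C" "v = \<phi> y" by blast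
    then show "v \<in> V \<inter> (W \<inter> ?T)" using CW[OF y(1)] g\<phi>(2)[OF y(1)] by (auto simp: V_def)
  next
    fix v assume v: "v \<in> V \<inter> (W \<inter> ?T)"
    then have "g v \<in> U" "\<phi> (g v) = v" using \<phi>g by auto
    then show "v \<in> \<phi> ` (U \<inter> (C \<inter> ?S))" using CW[of "g v"] v by (intro image_eqI[of _ _ "g v"]) (auto simp: U_def)
  qed
  have xU: "x \<in> U" using x r by (simp add: U_def H_def unit_sphere_def xx \<phi>x)
  have V0: "0 \<in> V" using r subspace_0[OF L] by (simp add: V_def sphere_tangent_def orthogonal_def)
  have bdim: "\<phi> ` (U \<inter> bd (C \<inter> ?S)) = V \<inter> bd (W \<inter> ?T)"
    by (rule chart_boundary[OF oU oV bij smooth_map_continuous_on[OF s1] smooth_map_continuous_on[OF s2] im]) auto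
  have "tangent_chart ?S ?T (C \<inter> ?S) x (W \<inter> ?T) U V \<phi>"
    unfolding tangent_chart_def diffeo_def using oU xU oV V0 bij s1 s2 \<phi>x der im bdim by blast
  then show ?thesis by blast
qed

lemma connected_section:
  fixes C :: "'a::euclidean_space set"
  assumes C: "C \<subseteq> L" "\<forall>\<rho>>0. \<forall>y\<in>C. \<rho> *\<^sub>R y \<in> C" and c: "connected (C - {0})"
  shows "connected (C \<inter> unit_sphere L)"
proof -
  let ?f = "\<lambda>v::'a. inverse (norm v) *\<^sub>R v"
  have "?f ` (C - {0}) = C \<inter> unit_sphere L"
  proof (intro equalityI subsetI)
    fix v assume "v \<in> ?f ` (C - {0})"
    then obtain u where u: "u \<in> C" "u \<noteq> 0" "v = ?f u" by blast
    then have "v \<in> C" using C(2) by simp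
    moreover have "norm v = 1" using u by simp
    ultimately show "v \<in> C \<inter> unit_sphere L" using C(1) by (auto simp: unit_sphere_def)
  next
    fix v assume "v \<in> C \<inter> unit_sphere L"
    then show "v \<in> ?f ` (C - {0})" by (intro image_eqI[of _ _ v]) (auto simp: unit_sphere_def)
  qed
  moreover have "connected (?f ` (C - {0}))"
    by (rule connected_continuous_image[OF _ c]) (intro continuous_intros, auto)
  ultimately show ?thesis by simp
qed

text \<open>The recursive condition on the section restated through flat slices, so no spherical
  chart has to be built again. The dimension is at least 2 because sections in a line obey a
  different clause, without connectedness.\<close>

lemma corner_cone_SucSucI:
  fixes L :: "'a::euclidean_space set"
  assumes L: "subspace L" and C: "open_cone L C" and ne: "C \<inter> unit_sphere L \<noteq> {}" and conn: "connected (C - {0})"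
    and loc: "\<And>x. x \<in> closure (C \<inter> unit_sphere L) \<Longrightarrow> x \<in> L \<Longrightarrow> norm x = 1 \<Longrightarrow>
      \<exists>r>0. \<exists>W. W \<inter> sphere_tangent L x \<in> corner_cones (Suc m) (sphere_tangent L x) \<and>
        (\<forall>v\<in>sphere_tangent L x. norm v < r \<longrightarrow> (x + v \<in> C \<longleftrightarrow> v \<in> W))"
  shows "C \<in> corner_cones (Suc (Suc m)) L"
proof -
  note Cd = open_coneD[OF C]
  let ?S = "unit_sphere L"
  have "C \<inter> ?S \<in> corner_domains_in ?S (sphere_tangent L) (\<lambda>K. corner_cones (Suc m) K)"
    unfolding corner_domains_in_def mem_Collect_eq
  proof (intro conjI ballI)
    show "C \<inter> ?S \<noteq> {}" by (rule ne)
    have "C \<inter> ?S \<subseteq> cball 0 1" by (auto simp: unit_sphere_def)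
    then show "bounded (C \<inter> ?S)" by (rule bounded_subset[OF bounded_cball])
    show "connected (C \<inter> ?S)" by (rule connected_section[OF Cd(2,3) conn])
    obtain O' where "open O'" "C = L \<inter> O'" using Cd(1) unfolding openin_open by blast
    then show "openin (top_of_set ?S) (C \<inter> ?S)"
      unfolding openin_open by (intro exI[of _ O']) (auto simp: unit_sphere_def)
    fix x assume x: "x \<in> closure (C \<inter> ?S)"
    have "closure (C \<inter> ?S) \<subseteq> ?S" by (rule closure_minimal[OF _ closed_unit_sphere[OF L]]) simp
    then have xL: "x \<in> L" "norm x = 1" using x by (auto simp: unit_sphere_def)
    obtain r W where rW: "r > 0" "W \<inter> sphere_tangent L x \<in> corner_cones (Suc m) (sphere_tangent L x)"
      "\<And>v. v \<in> sphere_tangent L x \<Longrightarrow> norm v < r \<Longrightarrow> (x + v \<in> C \<longleftrightarrow> v \<in> W)"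
      using loc[OF x xL] by blast
    show "\<exists>C'\<in>corner_cones (Suc m) (sphere_tangent L x). \<exists>U V \<phi>. tangent_chart ?S (sphere_tangent L x) (C \<inter> ?S) x C' U V \<phi>"
      using gnomonic_chart[OF L Cd(2,3) xL rW(1,3)] rW(2) by blast
  qed
  then show ?thesis
    unfolding corner_cones.simps(2)[of "Suc m"] sphere_domains.simps(2) using C by blast
qed

lemma half_space_open_cone:
  fixes L :: "'a::euclidean_space set"
  assumes L: "subspace L" and a: "a \<in> L" "a \<noteq> 0"
  shows "open_cone L {v \<in> L. a \<bullet> v > 0}" "{v \<in> L. a \<bullet> v > 0} \<inter> unit_sphere L \<noteq> {}"
proof -
  let ?H = "{v \<in> L. a \<bullet> v > 0}"
  have u: "inverse (norm a) *\<^sub>R a \<in> unit_sphere L" "- (inverse (norm a) *\<^sub>R a) \<in> unit_sphere L"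
    using a L by (auto simp: unit_sphere_def subspace_scale subspace_neg)
  have "?H = L \<inter> {v. a \<bullet> v > 0}" by blast
  then have "openin (top_of_set L) ?H" using open_halfspace_gt openin_open_Int by metis
  moreover have "- (inverse (norm a) *\<^sub>R a) \<notin> ?H" using a(2) by (auto simp: not_less)
  then have "?H \<inter> unit_sphere L \<noteq> unit_sphere L" using u(2) by blast
  ultimately show "open_cone L ?H" using L by (auto simp: open_cone_def subspace_scale)
  have "inverse (norm a) *\<^sub>R a \<in> ?H" using a L by (simp add: subspace_scale)
  then show "?H \<inter> unit_sphere L \<noteq> {}" using u(1) by blast
qed

text \<open>Both classes are treated in one induction: slices of a half-space are half-spaces at
  boundary points and full spaces at interior points. Dimension 1 is separate because its section
  lies in a sphere of two points.\<close>

lemma full_and_half_spaces: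
  fixes L :: "'a::euclidean_space set"
  shows "subspace L \<Longrightarrow> dim L = n \<Longrightarrow> L \<in> corner_cones n L \<and> (\<forall>a\<in>L. a \<noteq> 0 \<longrightarrow> {v \<in> L. a \<bullet> v > 0} \<in> corner_cones n L)"
proof (induction n arbitrary: L)
  case 0
  then have "L = {0}" using dim_eq_0[of L] subspace_0 by blast
  then show ?case by simp
next
  case (Suc n)
  note L = Suc.prems(1)
  have oL: "open_cone L L" using L by (simp add: open_cone_def subspace_scale)
  have "\<not> L \<subseteq> {0}" using Suc.prems(2) dim_eq_0[of L] by auto
  then obtain b where b: "b \<in> L" "b \<noteq> 0" by blast
  have neL: "L \<inter> unit_sphere L \<noteq> {}" using half_space_open_cone(2)[OF L b] by blast
  show ?case
  proof (cases n)
    case 0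
    have "L \<in> corner_cones (Suc n) L" using oL neL by (auto simp: 0 unit_sphere_def)
    moreover have "{v \<in> L. a \<bullet> v > 0} \<in> corner_cones (Suc n) L" if "a \<in> L" "a \<noteq> 0" for a
      using half_space_open_cone[OF L that] by (auto simp: 0 unit_sphere_def)
    ultimately show ?thesis by blast
  next
    case (Suc m)
    have T: "subspace (sphere_tangent L x)" "dim (sphere_tangent L x) = n" if "x \<in> L" "norm x = 1" for x
    proof -
      have "x \<noteq> 0" using that(2) by auto
      then show "dim (sphere_tangent L x) = n" using dim_sphere_tangent[OF L that(1)] Suc.prems(2) by simp
    qed (rule subspace_sphere_tangent[OF L])
    have full: "sphere_tangent L x \<in> corner_cones (Suc m) (sphere_tangent L x)" if "x \<in> L" "norm x = 1" for x
      using Suc.IH[OF T[OF that]] unfolding Suc by blast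
    have LT: "L \<inter> sphere_tangent L x = sphere_tangent L x" for x by (auto simp: sphere_tangent_def)
    have xv: "x + v \<in> L \<longleftrightarrow> True" if "x \<in> L" "v \<in> sphere_tangent L x" for x v
      using that L by (auto simp: sphere_tangent_def subspace_add)
    have "aff_dim L \<noteq> 1" using Suc.prems(2) Suc by (simp add: aff_dim_subspace[OF L])
    then have cL: "connected (L - {0})" by (intro connected_punctured_convex subspace_imp_convex L)
    have "L \<in> corner_cones (Suc (Suc m)) L"
    proof (rule corner_cone_SucSucI[OF L oL neL cL])
      fix x assume x: "x \<in> L" "norm x = 1"
      show "\<exists>r>0. \<exists>W. W \<inter> sphere_tangent L x \<in> corner_cones (Suc m) (sphere_tangent L x) \<and>
        (\<forall>v\<in>sphere_tangent L x. norm v < r \<longrightarrow> (x + v \<in> L \<longleftrightarrow> v \<in> W))"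
        by (rule exI[of _ 1], rule conjI, simp, rule exI[of _ L], unfold LT)
          (use full[OF x] x L in \<open>auto simp: sphere_tangent_def subspace_add\<close>)
    qed
    moreover have "{v \<in> L. a \<bullet> v > 0} \<in> corner_cones (Suc (Suc m)) L" if a: "a \<in> L" "a \<noteq> 0" for a
    proof (rule corner_cone_SucSucI[OF L half_space_open_cone[OF L a]])
      let ?H = "{v \<in> L. a \<bullet> v > 0}"
      have "?H = L \<inter> {v. a \<bullet> v > 0}" by blast
      then have "convex ?H" using subspace_imp_convex[OF L] convex_halfspace_gt by (metis convex_Int)
      moreover have "?H - {0} = ?H" by auto
      ultimately show "connected (?H - {0})" by (simp only: convex_connected)
      fix x assume xc: "x \<in> closure (?H \<inter> unit_sphere L)" and x: "x \<in> L" "norm x = 1"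
      let ?T = "sphere_tangent L x"
      have "closure (?H \<inter> unit_sphere L) \<subseteq> {v. a \<bullet> v \<ge> 0}"
        by (rule closure_minimal[OF _ closed_halfspace_ge]) auto
      then have ax: "a \<bullet> x \<ge> 0" using xc by blast
      show "\<exists>r>0. \<exists>W. W \<inter> ?T \<in> corner_cones (Suc m) ?T \<and> (\<forall>v\<in>?T. norm v < r \<longrightarrow> (x + v \<in> ?H \<longleftrightarrow> v \<in> W))"
      proof (cases "a \<bullet> x = 0")
        case True
        have "?H \<inter> ?T = {v \<in> ?T. a \<bullet> v > 0}" by (auto simp: sphere_tangent_def)
        moreover have "a \<in> ?T" using a True by (simp add: sphere_tangent_def orthogonal_def inner_commute)
        ultimately have "?H \<inter> ?T \<in> corner_cones (Suc m) ?T"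
          using Suc.IH[OF T[OF x]] a(2) unfolding Suc by auto
        moreover have "x + v \<in> ?H \<longleftrightarrow> v \<in> ?H" if "v \<in> ?T" for v
          using True xv[OF x(1) that] that by (auto simp: inner_add_right sphere_tangent_def)
        ultimately show ?thesis by (intro exI[of _ 1] conjI exI[of _ ?H]) auto
      next
        case False
        then have ap: "a \<bullet> x > 0" using ax by simp
        \<comment> \<open>The distance of \<open>x\<close> from the bounding hyperplane.\<close>
        let ?r = "(a \<bullet> x) / norm a"
        have "?r > 0" using ap a(2) by simp
        moreover have "x + v \<in> ?H \<longleftrightarrow> v \<in> L" if v: "v \<in> ?T" "norm v < ?r" for v
        proof -
          have "\<bar>a \<bullet> v\<bar> \<le> norm a * norm v" by (rule Cauchy_Schwarz_ineq2)
          also have "\<dots> < a \<bullet> x" using v(2) a(2) by (simp add: field_simps)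
          finally have "a \<bullet> (x + v) > 0" by (simp add: inner_add_right)
          then show ?thesis using xv[OF x(1) v(1)] v(1) by (auto simp: sphere_tangent_def)
        qed
        ultimately show ?thesis using full[OF x] by (intro exI[of _ ?r] conjI exI[of _ L]) (auto simp only: LT)
      qed
    qed
    ultimately show ?thesis unfolding Suc by blast
  qed
qed

text \<open>Modulo \<open>M\<close> only one coordinate is left, and \<open>W\<close> becomes a
  union of the two open half-lines and possibly 0. Regularity excludes the line without 0, and
  openness excludes an isolated 0.\<close>

lemma half_space_dichotomy:
  fixes W :: "'a::euclidean_space set"
  assumes W: "regular_open W" "\<forall>\<rho>>0. \<forall>y\<in>W. \<rho> *\<^sub>R y \<in> W" "W \<noteq> {}"
    and M: "subspace M" "Suc (dim M) = DIM('a)" and lin: "\<And>w m. w \<in> W \<Longrightarrow> m \<in> M \<Longrightarrow> w + m \<in> W"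
  shows "W = UNIV \<or> (\<exists>a. a \<noteq> 0 \<and> (\<forall>m\<in>M. a \<bullet> m = 0) \<and> W = {v. a \<bullet> v > 0})"
proof -
  have "dim M < DIM('a)" using M(2) by simp
  then obtain n where n: "n \<noteq> 0" "\<And>y. y \<in> span M \<Longrightarrow> orthogonal n y"
    using orthogonal_to_subspace_exists[of M] by blast
  have nM: "n \<bullet> m = 0" if "m \<in> M" for m using n(2)[OF span_base[OF that]] by (simp add: orthogonal_def)
  have "M = {v. n \<bullet> v = 0}"
  proof (rule subspace_dim_equal[OF M(1) subspace_hyperplane])
    show "dim {v. n \<bullet> v = 0} \<le> dim M" using M(2) dim_hyperplane[OF n(1)] by simp
  qed (use nM in auto)
  then have same: "w \<in> W" if "v \<in> W" "n \<bullet> v = n \<bullet> w" for v w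
    using lin[OF that(1), of "w - v"] that(2) by (simp add: inner_diff_right)
  have ray: "w \<in> W" if "v \<in> W" "c > 0" "n \<bullet> w = c * (n \<bullet> v)" for v w c
    using same[of "c *\<^sub>R v" w] W(2) that by simp
  have pos: "{w. n \<bullet> w > 0} \<subseteq> W" if "v \<in> W" "n \<bullet> v > 0" for v
    using ray[OF that(1), of "(n \<bullet> w) / (n \<bullet> v)" w for w] that(2) by auto
  have neg: "{w. n \<bullet> w < 0} \<subseteq> W" if "v \<in> W" "n \<bullet> v < 0" for v
    using ray[OF that(1), of "(n \<bullet> w) / (n \<bullet> v)" w for w] that(2) by (auto simp: divide_neg_neg)
  have oW: "open W" and rW: "interior (closure W) \<subseteq> W" using W(1) by (auto simp: regular_open_def)
  \<comment> \<open>The two open half-spaces together are dense, so regularity fills in the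
    hyperplane between them.\<close>
  have both: "W = UNIV" if pq: "{w. n \<bullet> w > 0} \<subseteq> W" "{w. n \<bullet> w < 0} \<subseteq> W"
  proof -
    have "closure {w. n \<bullet> w > 0} = {w. n \<bullet> w \<ge> 0}" using closure_halfspace_gt[of n 0] n(1) by simp
    moreover have "closure {w. n \<bullet> w < 0} = {w. n \<bullet> w \<le> 0}" using closure_halfspace_lt[of n 0] n(1) by simp
    ultimately have "{w. n \<bullet> w \<ge> 0} \<subseteq> closure W" "{w. n \<bullet> w \<le> 0} \<subseteq> closure W" using closure_mono pq by metis+
    then have "closure W = UNIV" using linear by blast
    then show ?thesis using rW by auto
  qed
  \<comment> \<open>Openness pushes a point of \<open>W\<close> on the hyperplane to either side, so
    \<open>W\<close> cannot touch the hyperplane while staying on one side.\<close>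
  have move: "\<exists>w\<in>W. n \<bullet> w < 0" "\<exists>w\<in>W. n \<bullet> w > 0" if "v \<in> W" "n \<bullet> v = 0" for v
  proof -
    obtain e where e: "e > 0" "ball v e \<subseteq> W" using oW \<open>v \<in> W\<close> by (meson openE)
    define c where "c = e / (2 * norm n)"
    have c: "c > 0" using e n(1) by (simp add: c_def)
    have nn: "norm (c *\<^sub>R n) < e" using e n(1) by (simp add: c_def)
    then have "v + c *\<^sub>R n \<in> W" "v - c *\<^sub>R n \<in> W" using e(2) by (auto simp: dist_norm subset_iff)
    moreover have "n \<bullet> (v + c *\<^sub>R n) > 0" "n \<bullet> (v - c *\<^sub>R n) < 0"
      using c n(1) \<open>n \<bullet> v = 0\<close> by (auto simp: inner_add_right inner_diff_right)
    ultimately show "\<exists>w\<in>W. n \<bullet> w < 0" "\<exists>w\<in>W. n \<bullet> w > 0" by blast+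
  qed
  consider "\<exists>v\<in>W. n \<bullet> v > 0" "\<exists>v\<in>W. n \<bullet> v < 0" | "\<exists>v\<in>W. n \<bullet> v > 0" "\<not> (\<exists>v\<in>W. n \<bullet> v < 0)" |
    "\<exists>v\<in>W. n \<bullet> v < 0" "\<not> (\<exists>v\<in>W. n \<bullet> v > 0)" | "\<not> (\<exists>v\<in>W. n \<bullet> v > 0)" "\<not> (\<exists>v\<in>W. n \<bullet> v < 0)" by blast
  then show ?thesis
  proof cases
    case 1
    then show ?thesis using both pos neg by blast
  next
    case 2
    have "W = {v. n \<bullet> v > 0}"
    proof
      show "W \<subseteq> {v. n \<bullet> v > 0}" using move(1) 2(2) by (metis (mono_tags, lifting) mem_Collect_eq not_less_iff_gr_or_eq subsetI)
      show "{v. n \<bullet> v > 0} \<subseteq> W" using 2(1) pos by blast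
    qed
    then show ?thesis using n(1) nM by blast
  next
    case 3
    have "W = {v. - n \<bullet> v > 0}"
    proof
      show "W \<subseteq> {v. - n \<bullet> v > 0}"
      proof
        fix v assume v: "v \<in> W"
        then have "n \<bullet> v \<noteq> 0" "\<not> n \<bullet> v > 0" using move(2) 3(2) by blast+
        then show "v \<in> {v. - n \<bullet> v > 0}" by simp
      qed
      show "{v. - n \<bullet> v > 0} \<subseteq> W" using 3(1) neg by auto
    qed
    moreover have "- n \<noteq> 0" "\<forall>m\<in>M. - n \<bullet> m = 0" using n(1) nM by auto
    ultimately show ?thesis by blast
  next
    case 4
    obtain v where v: "v \<in> W" using W(3) by blast
    then have "n \<bullet> v = 0" using 4 by (metis linorder_neqE_linordered_idom)
    then show ?thesis using move(1)[OF v] 4 by blast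
  qed
qed

section \<open>Directions of invariance of tangent cones\<close>

lemma open_cone_zero_UNIV:
  fixes C :: "'a::euclidean_space set"
  assumes "open C" "\<forall>\<rho>>0. \<forall>y\<in>C. \<rho> *\<^sub>R y \<in> C" "0 \<in> C"
  shows "C = UNIV"
proof -
  obtain e where e: "e > 0" "ball 0 e \<subseteq> C" using assms(1,3) by (meson openE)
  have "v \<in> C" for v
  proof -
    obtain s where s: "s > 0" "norm (s *\<^sub>R v) < e" using shrink_into_ball[OF e(1)] by blast
    then have "s *\<^sub>R v \<in> C" using e(2) by auto
    then show ?thesis using scaled_cone_mem[OF assms(2) s(1)] by blast
  qed
  then show ?thesis by blast
qed

text \<open>Dilation moves the apex along its own ray: with s' = s / (1 + s c), scaling
  \<open>X + s' *\<^sub>R v\<close> by 1 + s c gives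
  \<open>X + s *\<^sub>R (v + c *\<^sub>R X)\<close>.\<close>

lemma tcone_line:
  assumes C: "\<forall>\<rho>>0. \<forall>y\<in>C. \<rho> *\<^sub>R y \<in> C" and v: "v \<in> tcone C X"
  shows "v + c *\<^sub>R X \<in> tcone C X"
proof -
  obtain r where r: "r > 0" "\<And>s. 0 < s \<Longrightarrow> s < r \<Longrightarrow> X + s *\<^sub>R v \<in> C" using v unfolding tcone_def by blast
  \<comment> \<open>The second term ensures 1 + s c > 1/2, and then the first gives s' < 2 s <
    r.\<close>
  define q where "q = min (r / 2) (1 / (2 * (\<bar>c\<bar> + 1)))"
  have q: "q > 0" using r(1) by (simp add: q_def add_nonneg_pos)
  have "X + s *\<^sub>R (v + c *\<^sub>R X) \<in> C" if s: "0 < s" "s < q" for s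
  proof -
    have "s * (\<bar>c\<bar> + 1) < 1 / 2"
      using s(2) by (simp add: q_def pos_less_divide_eq add_nonneg_pos field_simps)
    moreover have "s * \<bar>c\<bar> \<le> s * (\<bar>c\<bar> + 1)" using s(1) by simp
    moreover have "\<bar>s * c\<bar> = s * \<bar>c\<bar>" using s(1) by (simp add: abs_mult)
    ultimately have k: "1 + s * c > 1 / 2" by linarith
    define s' where "s' = s / (1 + s * c)"
    have "s' > 0" using s k by (simp add: s'_def)
    moreover have "s' < r"
    proof -
      have "s' < s / (1/2)" unfolding s'_def using s(1) k by (intro divide_strict_left_mono) auto
      also have "\<dots> < r" using s(2) by (simp add: q_def)
      finally show ?thesis .
    qed
    ultimately have "X + s' *\<^sub>R v \<in> C" by (rule r(2))
    then have "(1 + s * c) *\<^sub>R (X + s' *\<^sub>R v) \<in> C" using C k by simp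
    moreover have "(1 + s * c) *\<^sub>R (X + s' *\<^sub>R v) = X + s *\<^sub>R (v + c *\<^sub>R X)"
      using k by (simp add: s'_def scaleR_add_left scaleR_add_right)
    ultimately show ?thesis by simp
  qed
  then show ?thesis unfolding tcone_def mem_Collect_eq using q by blast
qed

lemma tcone_lineality:
  assumes M: "subspace M" and lin: "\<And>w m. w \<in> C \<Longrightarrow> m \<in> M \<Longrightarrow> w + m \<in> C" and v: "v \<in> tcone C X" and m: "m \<in> M"
  shows "v + m \<in> tcone C X"
proof -
  obtain r where r: "r > 0" "\<And>s. 0 < s \<Longrightarrow> s < r \<Longrightarrow> X + s *\<^sub>R v \<in> C" using v unfolding tcone_def by blast
  have "X + s *\<^sub>R (v + m) \<in> C" if "0 < s" "s < r" for s
    using lin[OF r(2)[OF that], of "s *\<^sub>R m"] subspace_scale[OF M m] by (simp add: scaleR_add_right add.assoc)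
  then show ?thesis unfolding tcone_def mem_Collect_eq using r(1) by blast
qed

text \<open>Translation by \<open>h\<close> preserves \<open>C\<close>, so its germ at
  \<open>h\<close> is the germ at the apex.\<close>

lemma tcone_at_lineality:
  assumes C: "\<forall>\<rho>>0. \<forall>y\<in>C. \<rho> *\<^sub>R y \<in> C" and M: "subspace M" and lin: "\<And>w m. w \<in> C \<Longrightarrow> m \<in> M \<Longrightarrow> w + m \<in> C" and h: "h \<in> M"
  shows "tcone C h = C"
proof -
  have "h + w \<in> C \<longleftrightarrow> w \<in> C" for w
    using lin[of w h] lin[of "h + w" "- h"] h subspace_neg[OF M h] by (auto simp: add.commute)
  then have "h + s *\<^sub>R v \<in> C \<longleftrightarrow> v \<in> C" if "s > 0" for s v using scaled_cone_mem[OF C that] by blast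
  then show ?thesis unfolding tcone_def by (auto intro: exI[of _ 1]) (metis field_lbound_gt_zero)
qed

lemma corner_cones_regular_open:
  fixes C :: "'a::euclidean_space set"
  assumes "C \<in> corner_cones DIM('a) UNIV"
  shows "regular_open C" "open_cone UNIV C"
proof -
  obtain n where n: "DIM('a) = Suc n" using DIM_positive gr0_implies_Suc by blast
  have "C \<in> corner_cones (Suc n) UNIV" using assms n by simp
  then show oc: "open_cone UNIV C" by simp
  have "interior (closure C) \<subseteq> C"
    by (rule corner_cone_regular[OF assms]) (auto simp: interior_subset)
  then show "regular_open C" using open_coneD(1)[OF oc] by (simp add: regular_open_def)
qed

text \<open>The recursion for \<open>P\<close> provides a two-dimensional corner cone at
  \<open>X\<close>, and the germ at \<open>X\<close> is its product with the line through
  \<open>X\<close>. To verify the recursion for this product, its section is inspected at the poles,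
  where the slice is that two-dimensional cone again, and elsewhere, where a plane of invariance
  leaves only half-spaces and the full space.\<close>

lemma tcone_corner_cone:
  fixes P :: "(real^3) set"
  assumes P: "P \<in> corner_cones 3 UNIV" and conic: "conic_everywhere P" and X: "X \<in> closure P" "norm X = 1"
  shows "tcone P X \<in> corner_cones 3 UNIV"
    "tcone P X \<inter> sphere_tangent UNIV X \<in> corner_cones 2 (sphere_tangent UNIV X)"
proof -
  have three: "(3::nat) = Suc (Suc 1)" and two: "(2::nat) = Suc 1" by simp_all
  have reg: "regular_open P" and oc: "open_cone UNIV P"
    using corner_cones_regular_open[of P] P by simp_all
  note Pd = open_coneD[OF oc]
  let ?S = "unit_sphere (UNIV :: (real^3) set)" and ?T = "sphere_tangent UNIV X"
  define W where "W = tcone P X"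
  obtain r where r: "conic_at P X r" using conic unfolding conic_everywhere_def by blast
  have r0: "r > 0" using r by (simp add: conic_at_def)
  have T: "subspace ?T" by (rule subspace_sphere_tangent) simp
  have Wreg: "regular_open W" unfolding W_def by (rule tcone_regular[OF reg conic r])
  have Wcon: "conic_everywhere W" unfolding W_def by (rule tcone_conic[OF reg conic r])
  have Wsc: "\<forall>\<rho>>0. \<forall>y\<in>W. \<rho> *\<^sub>R y \<in> W" unfolding W_def by (rule tcone_scale)
  have Wne: "W \<noteq> {}" unfolding W_def by (rule tcone_nonempty[OF reg conic r X(1)])
  have oW: "open W" using Wreg by (simp add: regular_open_def)
  have line: "v + c *\<^sub>R X \<in> W" if "v \<in> W" for v c using tcone_line[OF Pd(3)] that unfolding W_def by blast
  show 2: "tcone P X \<inter> ?T \<in> corner_cones 2 ?T"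
  proof -
    have "X \<in> closure (P \<inter> ?S)" by (rule closure_section[OF subset_UNIV Pd(3) X]) simp
    moreover have "P \<inter> ?S \<in> corner_domains_in ?S (sphere_tangent UNIV) (\<lambda>K. corner_cones (Suc 1) K)"
      using P unfolding three corner_cones.simps(2)[of "Suc 1"] sphere_domains.simps(2) by blast
    ultimately obtain C' U V \<phi> where C': "C' \<in> corner_cones (Suc 1) ?T" and ch: "tangent_chart ?S ?T (P \<inter> ?S) X C' U V \<phi>"
      unfolding corner_domains_in_def by blast
    obtain U' V' \<phi>' where ch': "tangent_chart ?S ?T (P \<inter> ?S) X (W \<inter> ?T) U' V' \<phi>'"
      using gnomonic_chart[of UNIV P X r W, OF subspace_UNIV subset_UNIV Pd(3) UNIV_I X(2) r0] tcone_iff[OF r]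
      unfolding W_def by blast
    have "open_cone ?T C'" using C' by simp
    note C'd = open_coneD[OF this]
    \<comment> \<open>The abstract chart of the section and the gnomonic one model the same set, so
      their cones agree.\<close>
    have "C' = W \<inter> ?T"
    proof (rule tangent_chart_cone_unique[OF closed_unit_sphere[OF subspace_UNIV] _ closed_subspace[OF T] ch C'd(1,3) ch'])
      show "openin (top_of_set ?T) (W \<inter> ?T)" using openin_open_Int[OF oW, of ?T] by (simp add: Int_commute)
      show "\<forall>\<rho>>0. \<forall>y\<in>W \<inter> ?T. \<rho> *\<^sub>R y \<in> W \<inter> ?T" using Wsc subspace_scale[OF T] by blast
    qed simp
    then show ?thesis using C' unfolding W_def two by simp
  qed
  have "W \<in> corner_cones (Suc (Suc 1)) UNIV"
  proof (rule corner_cone_SucSucI[OF subspace_UNIV])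
    have full: "W = UNIV" if "?S \<subseteq> W"
    proof -
      have "v \<in> W" if "v \<noteq> 0" for v
      proof -
        have "inverse (norm v) *\<^sub>R v \<in> W" using \<open>?S \<subseteq> W\<close> that by (auto simp: unit_sphere_def subset_iff)
        then show ?thesis using scaled_cone_mem[OF Wsc, of "inverse (norm v)" v] that by simp
      qed
      then have "- {0} \<subseteq> W" by blast
      then have "closure (- {0}) \<subseteq> closure W" by (rule closure_mono)
      moreover have "closure (- {0 :: real^3}) = UNIV" by (simp add: closure_complement)
      ultimately show "W = UNIV" using Wreg by (simp add: regular_open_def top.extremum_unique)
    qed
    then show "open_cone UNIV W" using oW Wsc unfolding open_cone_def by auto
    have nz: "W - {0} \<noteq> {}"
    proof
      assume "W - {0} = {}"
      then have "W = {0}" using Wne by blast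
      then show False using oW not_open_singleton[of "0 :: real^3"] by simp
    qed
    then obtain w where w: "w \<in> W" "w \<noteq> 0" by blast
    then have "inverse (norm w) *\<^sub>R w \<in> W \<inter> ?S" using Wsc by (simp add: unit_sphere_def)
    then show "W \<inter> ?S \<noteq> {}" by blast
    show "connected (W - {0})"
    proof (cases "0 \<in> W")
      case True
      then have "W = UNIV" by (rule open_cone_zero_UNIV[OF oW Wsc])
      then show ?thesis using connected_punctured_convex[of "UNIV :: (real^3) set" 0] by (simp add: aff_dim_UNIV)
    next
      case False
      have "W \<inter> ?T \<inter> unit_sphere ?T \<in> corner_domains_in (unit_sphere ?T) (sphere_tangent ?T) (\<lambda>K. corner_cones (Suc 0) K)"
        using 2 unfolding two One_nat_def corner_cones.simps(2)[of "Suc 0"] sphere_domains.simps(2) W_def by blast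
      then have c: "connected (W \<inter> ?T \<inter> unit_sphere ?T)" unfolding corner_domains_in_def by blast
      \<comment> \<open>Coordinates on the product: a point \<open>u\<close> of the section of the
        slice, its radius \<open>a\<close>, and the position \<open>c\<close> along the line of
        \<open>X\<close>. Connectedness of that section passes to \<open>W - {0}\<close>.\<close>
      let ?f = "\<lambda>((u, a), c). a *\<^sub>R u + c *\<^sub>R X"
      have "connected (((W \<inter> ?T \<inter> unit_sphere ?T) \<times> {0 :: real<..}) \<times> (UNIV :: real set))"
        by (intro connected_Times c) auto
      then have "connected (?f ` (((W \<inter> ?T \<inter> unit_sphere ?T) \<times> {0<..}) \<times> UNIV))"
        by (rule connected_continuous_image[rotated]) (auto intro!: continuous_intros simp: case_prod_beta)
      moreover have "?f ` (((W \<inter> ?T \<inter> unit_sphere ?T) \<times> {0<..}) \<times> UNIV) = W - {0}"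
      proof (intro equalityI subsetI)
        fix v assume "v \<in> ?f ` (((W \<inter> ?T \<inter> unit_sphere ?T) \<times> {0<..}) \<times> UNIV)"
        then obtain u a c where u: "u \<in> W" "a > 0" "v = a *\<^sub>R u + c *\<^sub>R X" by auto
        then have "v \<in> W" using Wsc line by simp
        then show "v \<in> W - {0}" using False by blast
      next
        fix v assume v: "v \<in> W - {0}"
        define c where "c = X \<bullet> v"
        define w where "w = v + (- c) *\<^sub>R X"
        have wW: "w \<in> W" unfolding w_def using line v by blast
        then have w0: "w \<noteq> 0" using False by blast
        have wT: "w \<in> ?T"
          using X(2) by (simp add: sphere_tangent_def orthogonal_def w_def c_def inner_diff_right power2_norm_eq_inner[symmetric])
        have "inverse (norm w) *\<^sub>R w \<in> W \<inter> ?T \<inter> unit_sphere ?T"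
          using wW w0 wT Wsc subspace_scale[OF T wT] by (simp add: unit_sphere_def)
        moreover have "v = norm w *\<^sub>R (inverse (norm w) *\<^sub>R w) + c *\<^sub>R X" using w0 by (simp add: w_def)
        ultimately show "v \<in> ?f ` (((W \<inter> ?T \<inter> unit_sphere ?T) \<times> {0<..}) \<times> UNIV)"
          using w0 by (intro image_eqI[of _ _ "((inverse (norm w) *\<^sub>R w, norm w), c)"]) auto
      qed
      ultimately show ?thesis by simp
    qed
    fix x :: "real^3" assume xc: "x \<in> closure (W \<inter> ?S)" and x: "norm x = 1"
    have xW: "x \<in> closure W" using xc closure_mono[of "W \<inter> ?S" W] by blast
    obtain q where q: "conic_at W x q" using Wcon unfolding conic_everywhere_def by blast
    have q0: "q > 0" using q by (simp add: conic_at_def)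
    let ?W = "tcone W x" and ?Tx = "sphere_tangent UNIV x"
    have "?W \<inter> ?Tx \<in> corner_cones (Suc 1) ?Tx"
    proof (cases "x \<in> span {X}")
      \<comment> \<open>At the poles the displacement lies along the invariant line, so the germ is
        \<open>W\<close> itself.\<close>
      case True
      then obtain \<sigma> where \<sigma>: "x = \<sigma> *\<^sub>R X" by (auto simp: span_singleton)
      then have "\<bar>\<sigma>\<bar> = 1" using x X(2) by simp
      then have Teq: "?Tx = ?T" by (auto simp: \<sigma> sphere_tangent_def orthogonal_def)
      have "?W = W"
        by (rule tcone_at_lineality[OF Wsc subspace_span[of "{X}"] _ True]) (use line in \<open>auto simp: span_singleton\<close>)
      then show ?thesis using 2 unfolding Teq W_def two by simp
    next
      \<comment> \<open>The direction \<open>x\<close> is added to the invariant line of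
        \<open>X\<close>, which makes a plane of invariance.\<close>
      case False
      have X0: "X \<noteq> 0" using X(2) by auto
      have "dim (insert x {X}) = dim {X} + 1" by (subst dim_insert) (simp add: False)
      then have "dim {x, X} = 2" using X0 by (simp add: dim_singleton)
      then have dM: "Suc (dim (span {x, X})) = DIM(real^3)" by (simp add: dim_span)
      have lin: "w + m \<in> ?W" if "w \<in> ?W" "m \<in> span {x, X}" for w m
      proof -
        from that(2) obtain a where "m - a *\<^sub>R x \<in> span {X}" unfolding span_insert by blast
        then obtain b where b: "m - a *\<^sub>R x = b *\<^sub>R X" by (auto simp: span_singleton)
        have "w + a *\<^sub>R x \<in> ?W" by (rule tcone_line[OF Wsc that(1)])
        moreover have "b *\<^sub>R X \<in> span {X}" by (simp add: span_base span_scale)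
        ultimately have "w + a *\<^sub>R x + b *\<^sub>R X \<in> ?W"
          by (rule tcone_lineality[OF subspace_span[of "{X}"], rotated]) (use line in \<open>auto simp: span_singleton\<close>)
        then show ?thesis using b by (simp add: algebra_simps)
      qed
      have "dim ?Tx = 2"
      proof -
        have "x \<noteq> 0" using x by auto
        then show ?thesis using dim_sphere_tangent[of UNIV x] by simp
      qed
      then have dT: "dim ?Tx = Suc 1" by simp
      note fh = full_and_half_spaces[OF subspace_sphere_tangent[OF subspace_UNIV] dT]
      from half_space_dichotomy[OF tcone_regular[OF Wreg Wcon q] tcone_scale tcone_nonempty[OF Wreg Wcon q xW]
          subspace_span dM lin]
      show ?thesis
      proof
        assume "?W = UNIV"
        then show ?thesis using fh by simp
      next
        assume "\<exists>a. a \<noteq> 0 \<and> (\<forall>m\<in>span {x, X}. a \<bullet> m = 0) \<and> ?W = {v. a \<bullet> v > 0}"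
        then obtain a where a: "a \<noteq> 0" "\<And>m. m \<in> span {x, X} \<Longrightarrow> a \<bullet> m = 0" "?W = {v. a \<bullet> v > 0}" by blast
        have "x \<bullet> a = 0" using a(2)[of x] by (simp add: span_base inner_commute)
        then have "a \<in> ?Tx" by (simp add: sphere_tangent_def orthogonal_def)
        moreover have "?W \<inter> ?Tx = {v \<in> ?Tx. a \<bullet> v > 0}" using a(3) by blast
        ultimately show ?thesis using fh a(1) by (simp del: corner_cones.simps)
      qed
    qed
    then show "\<exists>r>0. \<exists>W'. W' \<inter> ?Tx \<in> corner_cones (Suc 1) ?Tx \<and> (\<forall>v\<in>?Tx. norm v < r \<longrightarrow> (x + v \<in> W \<longleftrightarrow> v \<in> W'))"
      using q0 tcone_iff[OF q] by blast
  qed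
  then show "tcone P X \<in> corner_cones 3 UNIV" unfolding W_def three .
qed

section \<open>Reduced dimension and strata\<close>

lemma dim_orthogonal_comp:
  fixes L :: "'a::euclidean_space set"
  assumes "subspace L"
  shows "dim (orthogonal_comp L) + dim L = DIM('a)"
proof -
  have "orthogonal_comp L = {y \<in> UNIV. \<forall>x\<in>L. orthogonal x y}"
    by (auto simp: orthogonal_comp_def orthogonal_commute)
  then show ?thesis using dim_subspace_orthogonal_to_vectors[OF assms subspace_UNIV subset_UNIV] by simp
qed

lemma reduced_dim_le:
  assumes "subspace L" "dim L = d" "\<Gamma> \<in> corner_cones d L" "C = {y + z | y z. y \<in> orthogonal_comp L \<and> z \<in> \<Gamma>}"
  shows "reduced_dim C \<le> d"
  unfolding reduced_dim_def
proof (rule Least_le)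
  show "\<exists>(L :: 'a set) \<Gamma> (Q :: 'a \<Rightarrow> 'a). subspace L \<and> dim L = d \<and> \<Gamma> \<in> corner_cones d L \<and>
     orthogonal_transformation Q \<and> C = Q ` {y + z | y z. y \<in> orthogonal_comp L \<and> z \<in> \<Gamma>}"
    using assms by (intro exI[of _ L] exI[of _ \<Gamma>] exI[of _ id]) (simp add: orthogonal_transformation_def linear_id)
qed

text \<open>\<open>M\<close> is some space of invariant directions, not necessarily the largest
  one.\<close>

definition lineality :: "'a::real_vector set \<Rightarrow> 'a set \<Rightarrow> bool" where
  "lineality C M \<longleftrightarrow> subspace M \<and> (\<forall>w\<in>C. \<forall>m\<in>M. w + m \<in> C)"

text \<open>With L the orthogonal complement of \<open>M\<close>, this is the splitting in the
  definition of \<open>reduced_dim\<close>; hence the double complement.\<close>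

lemma lineality_decomposition:
  fixes C :: "'a::euclidean_space set"
  assumes "lineality C M"
  shows "C = {y + z | y z. y \<in> orthogonal_comp (orthogonal_comp M) \<and> z \<in> C \<inter> orthogonal_comp M}"
proof -
  have M: "subspace M" and lin: "\<And>w m. w \<in> C \<Longrightarrow> m \<in> M \<Longrightarrow> w + m \<in> C" using assms by (auto simp: lineality_def)
  show ?thesis unfolding orthogonal_comp_self[OF M]
  proof (intro equalityI subsetI)
    fix v assume v: "v \<in> C"
    obtain y z where yz: "y \<in> span M" "\<And>w. w \<in> span M \<Longrightarrow> orthogonal z w" "v = y + z"
      using orthogonal_subspace_decomp_exists[of M v] by blast
    have y: "y \<in> M" using yz(1) M by (simp add: span_eq_iff[THEN iffD2])
    have "z \<in> orthogonal_comp M" using yz(2) span_base[of _ M] by (auto simp: orthogonal_comp_def orthogonal_commute)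
    moreover have "z \<in> C" using lin[OF v subspace_neg[OF M y]] yz(3) by simp
    ultimately show "v \<in> {y + z | y z. y \<in> M \<and> z \<in> C \<inter> orthogonal_comp M}" using y yz(3) by blast
  next
    fix v assume "v \<in> {y + z | y z. y \<in> M \<and> z \<in> C \<inter> orthogonal_comp M}"
    then obtain y z where "y \<in> M" "z \<in> C" "v = y + z" by blast
    then show "v \<in> C" using lin[of z y] by (simp add: add.commute)
  qed
qed

text \<open>The bound 2 leaves a cross section of dimension at most 1, which the dichotomy
  classifies completely, so its membership among corner cones is known.\<close>

lemma reduced_dim_le_lineality:
  fixes C :: "(real^3) set"
  assumes C: "C \<in> corner_cones 3 UNIV" "C \<noteq> {}" and M: "lineality C M" "dim M \<ge> 2"
  shows "reduced_dim C + dim M \<le> 3"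
proof -
  have sM: "subspace M" and lin: "\<And>w m. w \<in> C \<Longrightarrow> m \<in> M \<Longrightarrow> w + m \<in> C" using M by (auto simp: lineality_def)
  let ?L = "orthogonal_comp M"
  have L: "subspace ?L" by (rule subspace_orthogonal_comp)
  have dL: "dim ?L + dim M = 3" using dim_orthogonal_comp[OF sM] by simp
  have reg: "regular_open C" "open_cone UNIV C" using corner_cones_regular_open[of C] C by simp_all
  have "C \<inter> ?L \<in> corner_cones (dim ?L) ?L"
  proof (cases "dim M = 2")
    case True
    then have d1: "dim ?L = Suc 0" using dL by simp
    note fh = full_and_half_spaces[OF L d1]
    have "Suc (dim M) = DIM(real^3)" using True by simp
    from half_space_dichotomy[OF reg(1) open_coneD(3)[OF reg(2)] C(2) sM this lin]
    show ?thesis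
    proof
      assume "C = UNIV"
      then show ?thesis using fh unfolding d1 by simp
    next
      assume "\<exists>a. a \<noteq> 0 \<and> (\<forall>m\<in>M. a \<bullet> m = 0) \<and> C = {v. a \<bullet> v > 0}"
      then obtain a where a: "a \<noteq> 0" "\<And>m. m \<in> M \<Longrightarrow> a \<bullet> m = 0" "C = {v. a \<bullet> v > 0}" by blast
      have "a \<in> ?L" using a(2) by (auto simp: orthogonal_comp_def orthogonal_def inner_commute)
      moreover have "C \<inter> ?L = {v \<in> ?L. a \<bullet> v > 0}" using a(3) by blast
      ultimately show ?thesis using fh a(1) unfolding d1 by (simp del: corner_cones.simps)
    qed
  next
    case False
    then have "dim M = DIM(real^3)" using M(2) dL by simp
    then have MU: "M = UNIV" using dim_eq_full[of M] sM by (simp add: span_eq_iff[THEN iffD2])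
    obtain c where c: "c \<in> C" using C(2) by blast
    have "v \<in> C" for v using lin[OF c, of "v - c"] MU by simp
    then have "C = UNIV" by blast
    then show ?thesis using MU by simp
  qed
  then have "reduced_dim C \<le> dim ?L"
    by (rule reduced_dim_le[OF L refl _ lineality_decomposition[OF M(1)]])
  then show ?thesis using dL by simp
qed

text \<open>The minimum is attained, since the full space with \<open>C\<close> itself is a
  candidate. The rotated complement of the minimal factor consists of invariant directions.\<close>

lemma reduced_dim_lineality:
  fixes C :: "'a::euclidean_space set"
  assumes C: "C \<in> corner_cones DIM('a) UNIV"
  shows "\<exists>M. lineality C M \<and> dim M + reduced_dim C = DIM('a)"
proof -
  define R where "R d \<longleftrightarrow> (\<exists>(L :: 'a set) \<Gamma> (Q :: 'a \<Rightarrow> 'a). subspace L \<and> dim L = d \<and> \<Gamma> \<in> corner_cones d L \<and>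
     orthogonal_transformation Q \<and> C = Q ` {y + z | y z. y \<in> orthogonal_comp L \<and> z \<in> \<Gamma>})" for d
  have "R DIM('a)" unfolding R_def
    using C by (intro exI[of _ UNIV] exI[of _ C] exI[of _ id]) (simp add: orthogonal_transformation_def linear_id)
  then have "R (LEAST d. R d)" by (rule LeastI)
  then have "R (reduced_dim C)" unfolding R_def reduced_dim_def .
  then obtain L \<Gamma> and Q :: "'a \<Rightarrow> 'a" where L: "subspace L" "dim L = reduced_dim C" and Q: "orthogonal_transformation Q"
    and CQ: "C = Q ` {y + z | y z. y \<in> orthogonal_comp L \<and> z \<in> \<Gamma>}"
    unfolding R_def by blast
  have lQ: "linear Q" and iQ: "inj Q" using Q by (auto simp: orthogonal_transformation_linear orthogonal_transformation_inj)
  let ?K = "orthogonal_comp L"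
  have K: "subspace ?K" by (rule subspace_orthogonal_comp)
  have "w + m \<in> C" if wm: "w \<in> C" "m \<in> Q ` ?K" for w m
  proof -
    from wm(1) obtain y z where yz: "y \<in> ?K" "z \<in> \<Gamma>" "w = Q (y + z)" unfolding CQ by blast
    from wm(2) obtain k where k: "k \<in> ?K" "m = Q k" by blast
    have "w + m = Q ((y + k) + z)" using yz k by (simp add: linear_add[OF lQ])
    then show ?thesis unfolding CQ using subspace_add[OF K yz(1) k(1)] yz(2) by blast
  qed
  then have "lineality C (Q ` ?K)"
    using linear_subspace_image[OF lQ K] by (simp add: lineality_def)
  moreover have "dim (Q ` ?K) = dim ?K" by (rule dim_image_eq[OF lQ]) (use iQ inj_on_subset in blast)
  ultimately show ?thesis using dim_orthogonal_comp[OF L(1)] L(2) by (intro exI[of _ "Q ` ?K"]) simp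
qed

text \<open>Adjoining \<open>h\<close> to \<open>M\<close> raises the dimension of the invariant
  space to at least 2, the range where the reduced dimension is under control.\<close>

lemma reduced_dim_drop:
  fixes C :: "(real^3) set"
  assumes C: "C \<in> corner_cones 3 UNIV" "C \<noteq> {}" and M: "lineality C M" "dim M \<ge> 1"
    and h: "h \<notin> M" "\<And>w c. w \<in> C \<Longrightarrow> w + c *\<^sub>R h \<in> C"
  shows "reduced_dim C + dim M < 3"
proof -
  have sM: "subspace M" and lin: "\<And>w m. w \<in> C \<Longrightarrow> m \<in> M \<Longrightarrow> w + m \<in> C" using M by (auto simp: lineality_def)
  have sp: "span M = M" using sM by (simp add: span_eq_iff[THEN iffD2])
  let ?N = "span (insert h M)"
  have "w + n \<in> C" if "w \<in> C" "n \<in> ?N" for w n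
  proof -
    from that(2) obtain c where c: "n - c *\<^sub>R h \<in> M" unfolding span_insert sp by blast
    have "w + c *\<^sub>R h + (n - c *\<^sub>R h) \<in> C" by (rule lin[OF h(2)[OF that(1)] c])
    then show ?thesis by simp
  qed
  then have "lineality C ?N" by (simp add: lineality_def)
  moreover have "dim ?N = dim M + 1" using h(1) by (simp add: dim_insert sp)
  ultimately show ?thesis using reduced_dim_le_lineality[OF C, of ?N] M(2) by simp
qed

lemma tcone_scale_point:
  assumes P: "\<forall>\<rho>>0. \<forall>y\<in>P. \<rho> *\<^sub>R y \<in> P" and s: "s > 0"
  shows "tcone P (s *\<^sub>R X) = tcone P X"
proof -
  have sub: "tcone P X \<subseteq> tcone P (s *\<^sub>R X)" if s: "s > 0" for s X
  proof
    fix v assume "v \<in> tcone P X"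
    then obtain r where r: "r > 0" "\<And>q. 0 < q \<Longrightarrow> q < r \<Longrightarrow> X + q *\<^sub>R v \<in> P" unfolding tcone_def by blast
    have "s *\<^sub>R X + q *\<^sub>R v \<in> P" if q: "0 < q" "q < s * r" for q
    proof -
      have "X + (q / s) *\<^sub>R v \<in> P" using q s by (intro r(2)) (auto simp: field_simps)
      then have "s *\<^sub>R (X + (q / s) *\<^sub>R v) \<in> P" using P s by blast
      then show ?thesis using s by (simp add: scaleR_add_right)
    qed
    then show "v \<in> tcone P (s *\<^sub>R X)" unfolding tcone_def mem_Collect_eq using r(1) s by (intro exI[of _ "s * r"]) simp
  qed
  have "tcone P (s *\<^sub>R X) \<subseteq> tcone P (inverse s *\<^sub>R (s *\<^sub>R X))" using s by (intro sub) simp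
  then show ?thesis using sub[OF s, of X] s by auto
qed

lemma smooth_map_affine:
  assumes "bounded_linear T"
  shows "smooth_map S (\<lambda>x. c + T x)"
proof -
  have "smooth_on (\<lambda>x. c + T x) UNIV"
    unfolding smooth_on_def by (intro allI Ck_on_add Ck_on_const Ck_on_bounded_linear assms open_UNIV)
  then show ?thesis unfolding smooth_map_def by blast
qed

context
  fixes P :: "(real^3) set"
  assumes P: "P \<in> corner_cones 3 UNIV" and conic: "conic_everywhere P"
begin

text \<open>Rescaling reduces to a unit vector. The line through the point splits off, leaving the
  two-dimensional slice as cross section.\<close>

lemma tcone_corner_cone':
  assumes X: "X \<in> closure P" "X \<noteq> 0"
  shows "tcone P X \<in> corner_cones 3 UNIV" "reduced_dim (tcone P X) \<le> 2"
proof -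
  have oc: "open_cone UNIV P" using corner_cones_regular_open[of P] P by simp
  note sc = open_coneD(3)[OF oc]
  define Y where "Y = inverse (norm X) *\<^sub>R X"
  have n: "inverse (norm X) > 0" using X(2) by simp
  have Y: "Y \<in> closure P" "norm Y = 1" using closure_scale[OF sc n X(1)] X(2) by (auto simp: Y_def)
  have e: "tcone P X = tcone P Y" unfolding Y_def by (rule tcone_scale_point[OF sc n, symmetric])
  note tc = tcone_corner_cone[OF P conic Y]
  show "tcone P X \<in> corner_cones 3 UNIV" unfolding e by (rule tc(1))
  have lin: "lineality (tcone P Y) (span {Y})"
    unfolding lineality_def
    by (intro conjI subspace_span ballI) (auto simp: span_singleton intro: tcone_line[OF sc])
  have o: "orthogonal_comp (span {Y}) = sphere_tangent UNIV Y"
    by (auto simp: orthogonal_comp_def sphere_tangent_def span_singleton orthogonal_def inner_commute)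
  have Y0: "Y \<noteq> 0" using Y(2) by auto
  show "reduced_dim (tcone P X) \<le> 2"
    unfolding e
  proof (rule reduced_dim_le[OF subspace_sphere_tangent[OF subspace_UNIV] _ tc(2)])
    show "dim (sphere_tangent UNIV Y) = 2" using dim_sphere_tangent[of UNIV Y] Y0 by simp
  qed (rule lineality_decomposition[OF lin, unfolded o])
qed

text \<open>Translation by \<open>- X\<close> is a chart with identity differential, so the germ is
  the tangent cone in the sense of the definitions.\<close>

lemma is_tangent_cone_tcone:
  assumes X: "X \<in> closure P" "X \<noteq> 0"
  shows "is_tangent_cone P X (tcone P X)"
proof -
  obtain r where r: "conic_at P X r" using conic unfolding conic_everywhere_def by blast
  have r0: "r > 0" using r by (simp add: conic_at_def)
  have reg: "regular_open P" using corner_cones_regular_open[of P] P by simp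
  let ?\<phi> = "(+) (- X)" and ?U = "ball X r" and ?V = "ball 0 r"
  have UV: "?\<phi> ` ?U = ?V" using ball_translation[of "- X" X r] by simp
  have bij: "bij_betw ?\<phi> ?U ?V" unfolding bij_betw_def using UV by simp
  have inv: "inv_into ?U ?\<phi> w = X + w" if "w \<in> ?V" for w
    by (rule inv_into_f_eq) (use that in \<open>auto simp: dist_norm\<close>)
  have s1: "smooth_map ?U ?\<phi>" by (rule smooth_map_affine[OF bounded_linear_ident])
  have "smooth_map ?V (\<lambda>w. X + w)" by (rule smooth_map_affine[OF bounded_linear_ident])
  then have s2: "smooth_map ?V (inv_into ?U ?\<phi>)" unfolding smooth_map_def using inv by simp
  have im: "?\<phi> ` (?U \<inter> P) = ?V \<inter> tcone P X"
    using tcone_ball[OF reg conic r] by (simp add: Int_commute)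
  have oU: "openin (top_of_set UNIV) ?U" and oV: "openin (top_of_set UNIV) ?V" by simp_all
  have "?\<phi> ` (?U \<inter> bd P) = ?V \<inter> bd (tcone P X)"
    by (rule chart_boundary[OF oU oV bij smooth_map_continuous_on[OF s1] smooth_map_continuous_on[OF s2] im]) auto
  moreover have "(?\<phi> has_derivative (\<lambda>h. h)) (at X within UNIV)" by (auto intro!: derivative_eq_intros)
  ultimately have "tangent_chart UNIV UNIV P X (tcone P X) ?U ?V ?\<phi>"
    unfolding tangent_chart_def diffeo_def using bij s1 s2 im r0 by simp
  then show ?thesis unfolding is_tangent_cone_def using tcone_corner_cone'(1)[OF X] by auto
qed

text \<open>A displacement transversal to the lineality space of the tangent cone enlarges that space, hence
  lowers the reduced dimension.\<close>

lemma tcone_locally_constant: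
  assumes X: "X \<in> closure P" "X \<noteq> 0"
  shows "\<exists>r>0. \<forall>Y. dist Y X < r \<longrightarrow> Y \<in> closure P \<longrightarrow> Y \<noteq> 0 \<longrightarrow> reduced_dim (tcone P Y) = reduced_dim (tcone P X) \<longrightarrow>
    tcone P Y = tcone P X"
proof -
  obtain r where r: "conic_at P X r" using conic unfolding conic_everywhere_def by blast
  have r0: "r > 0" using r by (simp add: conic_at_def)
  have reg: "regular_open P" using corner_cones_regular_open[of P] P by simp
  let ?T = "tcone P X"
  note tX = tcone_corner_cone'[OF X]
  obtain M where M: "lineality ?T M" "dim M + reduced_dim ?T = 3"
    using reduced_dim_lineality[of ?T] tX(1) by auto
  have sM: "subspace M" and lin: "\<And>w m. w \<in> ?T \<Longrightarrow> m \<in> M \<Longrightarrow> w + m \<in> ?T" using M by (auto simp: lineality_def)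
  have "tcone P Y = ?T" if Y: "dist Y X < r" "Y \<in> closure P" "Y \<noteq> 0" "reduced_dim (tcone P Y) = reduced_dim ?T" for Y
  proof -
    define h where "h = Y - X"
    have h: "norm h < r" using Y(1) by (simp add: h_def dist_norm)
    have TY: "tcone P Y = tcone ?T h" using tcone_tcone[OF reg conic r h] by (simp add: h_def)
    show ?thesis
    proof (cases "h \<in> M")
      case True
      show ?thesis unfolding TY by (rule tcone_at_lineality[OF tcone_scale sM lin True])
    next
      case False
      obtain q where q: "conic_at P Y q" using conic unfolding conic_everywhere_def by blast
      have ne: "tcone P Y \<noteq> {}" by (rule tcone_nonempty[OF reg conic q Y(2)])
      have "lineality (tcone P Y) M"
        unfolding TY lineality_def using sM tcone_lineality[OF sM lin] by blast
      moreover have "w + c *\<^sub>R h \<in> tcone P Y" if "w \<in> tcone P Y" for w c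
        using tcone_line[OF tcone_scale] that unfolding TY by blast
      ultimately have "reduced_dim (tcone P Y) + dim M < 3"
        using False tX(2) M(2) by (intro reduced_dim_drop[OF tcone_corner_cone'(1)[OF Y(2,3)] ne, of M h]) auto
      then show ?thesis using Y(4) M(2) by simp
    qed
  qed
  then show ?thesis using r0 by blast
qed

end

section \<open>Tangent cones along a stratum\<close>

text \<open>The chart at \<open>x\<close> is normalised only at \<open>x\<close>; composing with the
  inverse \<open>K\<close> of its differential at \<open>y\<close> normalises it there. Both this
  map and a chart for \<open>C\<close> determine the contingent cones of the domain and of its
  boundary, hence the same open cone.\<close>

lemma tangent_cone_transfer:
  fixes \<Omega> P :: "'a::euclidean_space set"
  assumes ch: "tangent_chart UNIV UNIV \<Omega> x P U V \<phi>" and y: "y \<in> U"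
    and P: "regular_open P" "conic_everywhere P"
    and J: "(\<phi> has_derivative J) (at y)" and K: "linear K" "\<And>v. K (J v) = v" "\<And>v. J (K v) = v"
    and C: "is_tangent_cone \<Omega> y C"
  shows "C = K ` tcone P (\<phi> y)"
proof -
  note d = tangent_chartD[OF ch]
  define X where "X = \<phi> y"
  obtain r where r: "conic_at P X r" using P(2) unfolding conic_everywhere_def by blast
  have r0: "r > 0" using r by (simp add: conic_at_def)
  define T where "T = tcone P X"
  have lJ: "linear J" by (rule has_derivative_linear[OF J])
  have oU: "open U" and oV: "open V" using d(1,3) by auto
  define U' where "U' = U \<inter> \<phi> -` ball X r"
  \<comment> \<open>Identification by contingent cones asks only for a homeomorphism with identity
    differential at \<open>y\<close>, so continuity and one derivative are what is checked for this
    map.\<close>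
  define \<phi>' where "\<phi>' z = K (\<phi> z - X)" for z
  define g where "g w = inv_into U \<phi> (X + J w)" for w
  define V' where "V' = {w. X + J w \<in> V \<inter> ball X r}"
  have oU': "open U'" unfolding U'_def by (rule continuous_open_preimage[OF d(6) oU open_ball])
  have bK: "bounded_linear K" "bounded_linear J" using K(1) lJ by (simp_all add: linear_conv_bounded_linear)
  have cJ: "continuous_on A (\<lambda>w. X + J w)" for A by (intro continuous_intros linear_continuous_on bK)
  have "V' = (\<lambda>w. X + J w) -` (V \<inter> ball X r)" by (auto simp: V'_def)
  then have oV': "open V'" using oV cJ by (auto intro: open_vimage)
  have inv: "inv_into U \<phi> (\<phi> z) = z" if "z \<in> U" for z by (rule bij_betw_inv_into_left[OF d(5) that])
  have inv': "\<phi> (inv_into U \<phi> w) = w" "inv_into U \<phi> w \<in> U" if "w \<in> V" for w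
    using bij_betw_inv_into_right[OF d(5) that] bij_betwE[OF bij_betw_inv_into[OF d(5)]] that by auto
  have \<phi>V: "\<phi> z \<in> V" if "z \<in> U" for z using bij_betwE[OF d(5)] that by blast
  have JK: "X + J (\<phi>' z) = \<phi> z" for z by (simp add: \<phi>'_def K(3))
  have 1: "\<phi>' z \<in> V'" "g (\<phi>' z) = z" if "z \<in> U'" for z
    using that inv \<phi>V by (auto simp: V'_def g_def JK U'_def)
  have 2: "g w \<in> U'" "\<phi>' (g w) = w" if "w \<in> V'" for w
    using that inv' by (auto simp: V'_def g_def U'_def \<phi>'_def K(2))
  have bij: "bij_betw \<phi>' U' V'" by (rule bij_betw_byWitness[where f' = g]) (use 1 2 in auto)
  have inv_g: "inv_into U' \<phi>' w = g w" if "w \<in> V'" for w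
    by (rule inv_into_f_eq) (use bij 2[OF that] in \<open>auto simp: bij_betw_def\<close>)
  have c1: "continuous_on U' \<phi>'" unfolding \<phi>'_def
    by (intro linear_continuous_on_compose[OF _ K(1)] continuous_intros continuous_on_subset[OF d(6)]) (auto simp: U'_def)
  have "continuous_on V' g" unfolding g_def
    by (rule continuous_on_compose2[OF d(7) cJ]) (auto simp: V'_def)
  then have c2: "continuous_on V' (inv_into U' \<phi>')"
    by (rule continuous_on_eq) (simp add: inv_g)
  have yU': "y \<in> U'" using y r0 by (simp add: U'_def X_def)
  have 0: "\<phi>' y = 0" by (simp add: \<phi>'_def X_def linear_0[OF K(1)])
  have V0: "0 \<in> V'" using 1(1)[OF yU'] 0 by simp
  have der: "(\<phi>' has_derivative (\<lambda>h. h)) (at y within UNIV)"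
  proof -
    have "((\<lambda>z. K (\<phi> z - X)) has_derivative (\<lambda>h. K (J h - 0))) (at y)"
      by (intro bounded_linear.has_derivative[OF bK(1)] has_derivative_diff J has_derivative_const)
    then show ?thesis by (simp add: \<phi>'_def[abs_def] K(2))
  qed
  have KT: "w \<in> K ` T \<longleftrightarrow> J w \<in> T" for w using K(2,3) by (auto simp: image_iff) metis
  have PT: "z \<in> \<Omega> \<longleftrightarrow> \<phi>' z \<in> K ` T" if z: "z \<in> U'" for z
  proof -
    have zU: "z \<in> U" "norm (\<phi> z - X) < r" using z by (auto simp: U'_def dist_norm norm_minus_commute)
    have "z \<in> \<Omega> \<longleftrightarrow> \<phi> z \<in> P"
    proof
      assume "z \<in> \<Omega>" then show "\<phi> z \<in> P" using d(10) zU(1) by blast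
    next
      assume "\<phi> z \<in> P"
      then have "\<phi> z \<in> \<phi> ` (U \<inter> \<Omega>)" using d(10) \<phi>V[OF zU(1)] by blast
      then obtain z' where "z' \<in> U" "z' \<in> \<Omega>" "\<phi> z' = \<phi> z" by auto
      then show "z \<in> \<Omega>" using inv zU(1) by metis
    qed
    also have "\<dots> \<longleftrightarrow> \<phi> z - X \<in> T" using tcone_iff[OF r zU(2)] by (simp add: T_def)
    also have "\<dots> \<longleftrightarrow> \<phi>' z \<in> K ` T" unfolding KT by (simp add: \<phi>'_def K(3))
    finally show ?thesis .
  qed
  have im: "\<phi>' ` (U' \<inter> \<Omega>) = V' \<inter> K ` T"
  proof (intro equalityI subsetI)
    fix w assume "w \<in> \<phi>' ` (U' \<inter> \<Omega>)"
    then show "w \<in> V' \<inter> K ` T" using 1(1) PT by blast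
  next
    fix w assume w: "w \<in> V' \<inter> K ` T"
    then show "w \<in> \<phi>' ` (U' \<inter> \<Omega>)"
      using 2[of w] PT[of "g w"] by (intro image_eqI[of _ _ "g w"]) auto
  qed
  have o: "openin (top_of_set UNIV) U'" "openin (top_of_set UNIV) V'" using oU' oV' by simp_all
  have imb: "\<phi>' ` (U' \<inter> bd \<Omega>) = V' \<inter> bd (K ` T)"
    by (rule chart_boundary[OF o bij c1 c2 im]) auto
  have sc: "\<forall>\<rho>>0. \<forall>w\<in>K ` T. \<rho> *\<^sub>R w \<in> K ` T"
  proof (intro allI impI ballI)
    fix \<rho> :: real and w assume \<rho>: "\<rho> > 0" and w: "w \<in> K ` T"
    have "J w \<in> T" using w unfolding KT .
    then have "\<rho> *\<^sub>R J w \<in> T" by (rule tcone_scale[of P X, folded T_def, rule_format, OF \<rho>])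
    then show "\<rho> *\<^sub>R w \<in> K ` T" unfolding KT linear_scale[OF lJ] .
  qed
  have e1: "contingent \<Omega> y = closure (K ` T)"
    by (rule contingent_chart[OF o(1) yU' o(2) V0 bij c2 0 der im subset_UNIV subset_UNIV sc])
  have e2: "contingent (bd \<Omega>) y = closure (bd (K ` T))"
    by (rule contingent_chart[OF o(1) yU' o(2) V0 bij c2 0 der imb subset_UNIV subset_UNIV bd_cone[OF sc]])
  obtain U2 V2 \<phi>2 where c: "tangent_chart UNIV UNIV \<Omega> y C U2 V2 \<phi>2" using C unfolding is_tangent_cone_def by blast
  note Cc = is_tangent_cone_cone[OF C] and d2 = tangent_chartD[OF c]
  have f1: "contingent \<Omega> y = closure C"
    by (rule contingent_chart[OF d2(1-5,7-10) subset_UNIV subset_UNIV Cc(2)])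
  have f2: "contingent (bd \<Omega>) y = closure (bd C)"
    by (rule contingent_chart[OF d2(1-5,7-9,11) subset_UNIV subset_UNIV bd_cone[OF Cc(2)]])
  have oT: "open T" using tcone_regular[OF P r] by (simp add: T_def regular_open_def)
  have "K ` T = J -` T" using KT by blast
  then have oKT: "open (K ` T)" using open_vimage[OF oT linear_continuous_on[OF bK(2)]] by simp
  \<comment> \<open>Both cones are recovered from the same pair of contingent cones.\<close>
  have "C = closure C - closure (bd C)" by (rule openin_subspace_recover[OF closed_UNIV]) (use Cc in simp)
  also have "\<dots> = closure (K ` T) - closure (bd (K ` T))" using e1 e2 f1 f2 by simp
  also have "\<dots> = K ` T" by (rule openin_subspace_recover[OF closed_UNIV, symmetric]) (use oKT in simp)
  finally show ?thesis by (simp add: T_def X_def)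
qed

text \<open>A local smooth extension has continuous directional derivatives. Control on the finitely
  many basis vectors gives control of the linear map.\<close>

lemma chart_derivative_near_identity:
  fixes \<Omega> P :: "'a::euclidean_space set"
  assumes ch: "tangent_chart UNIV UNIV \<Omega> x P U V \<phi>" and \<eta>: "\<eta> > 0"
  shows "\<exists>e>0. ball x e \<subseteq> U \<and> (\<forall>y\<in>ball x e. \<exists>J. (\<phi> has_derivative J) (at y) \<and> (\<forall>v. norm (J v - v) \<le> \<eta> * norm v))"
proof -
  note d = tangent_chartD[OF ch]
  have oU: "open U" using d(1) by simp
  have "smooth_map U \<phi>" using ch by (simp add: tangent_chart_def diffeo_def)
  then have "\<exists>W g. open W \<and> x \<in> W \<and> smooth_on g W \<and> (\<forall>y\<in>U \<inter> W. g y = \<phi> y)"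
    unfolding smooth_map_def using d(2) by (rule bspec)
  then obtain W g where W: "open W" "x \<in> W" "smooth_on g W" "\<forall>y\<in>U \<inter> W. g y = \<phi> y"
    by (elim exE conjE)
  define D where "D y = frechet_derivative g (at y)" for y
  have gD: "(g has_derivative D y) (at y)" if "y \<in> W" for y
    unfolding D_def frechet_derivative_works[symmetric] by (rule smooth_on_differentiable[OF W(3) that])
  have oUW: "open (U \<inter> W)" using oU W(1) by blast
  have \<phi>D: "(\<phi> has_derivative D y) (at y)" if "y \<in> U \<inter> W" for y
    by (rule has_derivative_transform_within_open[OF gD oUW that]) (use that W(4) in auto)
  have Dx: "D x = (\<lambda>h. h)"
    by (rule has_derivative_unique[OF \<phi>D]) (use d(2,9) W(2) in auto)
  \<comment> \<open>Each basis vector gets an equal share of \<open>\<eta>\<close>; the shares add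
    up in the expansion of a vector.\<close>
  have "\<forall>b\<in>Basis. \<exists>e>0. \<forall>y\<in>ball x e. norm (D y b - b) < \<eta> / DIM('a)"
  proof
    fix b :: 'a assume "b \<in> Basis"
    have "continuous_on W (\<lambda>y. D y b)"
      unfolding D_def by (rule smooth_on_continuous[OF smooth_on_derivative[OF W(3)]])
    then have "isCont (\<lambda>y. D y b) x" using W(1,2) by (simp add: continuous_on_eq_continuous_at)
    then have "\<forall>\<^sub>F y in nhds x. dist (D y b) (D x b) < \<eta> / DIM('a)"
      unfolding continuous_at_eps_delta eventually_nhds_metric using \<eta> by simp
    then obtain e where "e > 0" "\<And>y. dist y x < e \<Longrightarrow> dist (D y b) (D x b) < \<eta> / DIM('a)"
      unfolding eventually_nhds_metric by blast
    then show "\<exists>e>0. \<forall>y\<in>ball x e. norm (D y b - b) < \<eta> / DIM('a)"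
      by (intro exI[of _ e]) (simp add: Dx dist_norm norm_minus_commute)
  qed
  then obtain e where e: "\<And>b. b \<in> Basis \<Longrightarrow> e b > 0 \<and> (\<forall>y\<in>ball x (e b). norm (D y b - b) < \<eta> / DIM('a))"
    by metis
  obtain e0 where e0: "e0 > 0" "ball x e0 \<subseteq> U \<inter> W" using oUW d(2) W(2) by (meson IntI openE)
  define q where "q = Min (insert e0 (e ` Basis))"
  have q: "q > 0" unfolding q_def using e e0(1) by (subst Min_gr_iff) auto
  have qe: "q \<le> e0" "\<And>b. b \<in> Basis \<Longrightarrow> q \<le> e b" unfolding q_def by (rule Min_le; simp)+
  have "\<exists>J. (\<phi> has_derivative J) (at y) \<and> (\<forall>v. norm (J v - v) \<le> \<eta> * norm v)" if y: "y \<in> ball x q" for y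
  proof (intro exI[of _ "D y"] conjI allI)
    show der: "(\<phi> has_derivative D y) (at y)" by (rule \<phi>D) (use y subset_ball[OF qe(1)] e0(2) in blast)
    note lin = has_derivative_linear[OF der]
    fix v
    have "D y v - v = D y (\<Sum>b\<in>Basis. (v \<bullet> b) *\<^sub>R b) - (\<Sum>b\<in>Basis. (v \<bullet> b) *\<^sub>R b)" by (simp add: euclidean_representation)
    also have "\<dots> = (\<Sum>b\<in>Basis. (v \<bullet> b) *\<^sub>R (D y b - b))"
      by (simp only: linear_sum[OF lin] linear_scale[OF lin] sum_subtractf[symmetric] scaleR_diff_right)
    also have "norm \<dots> \<le> (\<Sum>b\<in>(Basis :: 'a set). norm v * (\<eta> / DIM('a)))"
    proof (rule sum_norm_le)
      fix b :: 'a assume b: "b \<in> Basis"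
      have "norm (D y b - b) \<le> \<eta> / DIM('a)" using e[OF b] qe(2)[OF b] y by (auto intro: less_imp_le)
      then show "norm ((v \<bullet> b) *\<^sub>R (D y b - b)) \<le> norm v * (\<eta> / DIM('a))"
        unfolding norm_scaleR using Basis_le_norm[OF b, of v] by (intro mult_mono) auto
    qed
    also have "\<dots> = \<eta> * norm v" by simp
    finally show "norm (D y v - v) \<le> \<eta> * norm v" .
  qed
  moreover have "ball x q \<subseteq> U" using e0(2) subset_ball[OF qe(1)] by blast
  ultimately show ?thesis using q by blast
qed

lemma polyhedral_cone_conic:
  assumes "polyhedral_cone C"
  shows "conic_everywhere C"
proof -
  obtain \<H> where H: "finite \<H>" "\<forall>H\<in>\<H>. \<exists>a b. a \<noteq> 0 \<and> H = {y. a \<bullet> y = b}" "bd C \<subseteq> \<Union>\<H>"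
    using assms unfolding polyhedral_cone_def by blast
  show ?thesis
    by (rule polyhedral_conic[OF _ H(1) _ H(3)])
      (use assms corner_cones_regular_open[of C] H(2) in \<open>auto simp: polyhedral_cone_def\<close>)
qed

text \<open>Existence from the definition of the domain and uniqueness of tangent cones make
  \<open>tangent_cone\<close> meaningful. It is nonempty because \<open>x\<close> is a limit of
  points of the domain.\<close>

lemma polyhedral_domain_tangent_cone:
  fixes \<Omega> :: "(real^3) set"
  assumes "polyhedral_domain \<Omega>" "x \<in> closure \<Omega>"
  shows "is_tangent_cone \<Omega> x (tangent_cone \<Omega> x)" "tangent_cone \<Omega> x \<in> corner_cones 3 UNIV"
    "conic_everywhere (tangent_cone \<Omega> x)" "tangent_cone \<Omega> x \<noteq> {}"
proof -
  have "\<Omega> \<in> corner_domains_in UNIV (\<lambda>_. UNIV) (corner_cones DIM(real^3))"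
    using assms(1) by (simp only: polyhedral_domain_def corner_domain_def)
  then obtain C U V \<phi> where "C \<in> corner_cones DIM(real^3) UNIV" "tangent_chart UNIV UNIV \<Omega> x C U V \<phi>"
    using assms(2) unfolding corner_domains_in_def by blast
  then have "is_tangent_cone \<Omega> x C" unfolding is_tangent_cone_def by blast
  then show t: "is_tangent_cone \<Omega> x (tangent_cone \<Omega> x)" using tangent_cone_eqI by metis
  then show "tangent_cone \<Omega> x \<in> corner_cones 3 UNIV" unfolding is_tangent_cone_def by simp
  have "polyhedral_cone (tangent_cone \<Omega> x)" using assms t unfolding polyhedral_domain_def by blast
  then show "conic_everywhere (tangent_cone \<Omega> x)" by (rule polyhedral_cone_conic)
  obtain U V \<phi> where ch: "tangent_chart UNIV UNIV \<Omega> x (tangent_cone \<Omega> x) U V \<phi>"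
    using t unfolding is_tangent_cone_def by blast
  note d = tangent_chartD[OF ch]
  have "U \<inter> closure \<Omega> \<noteq> {}" using d(2) assms(2) by blast
  then have "U \<inter> \<Omega> \<noteq> {}" using open_Int_closure_eq_empty[of U \<Omega>] d(1) by simp
  then show "tangent_cone \<Omega> x \<noteq> {}" using d(10) by blast
qed

text \<open>\<open>T\<close> is the germ shared by the images of all nearby points of
  \<open>t\<close> in the chart at \<open>x\<close>. For \<open>x\<close> in \<open>t\<close> these
  images lie near the apex, which needs its own argument; for \<open>x\<close> outside
  \<open>t\<close> they lie in \<open>\<tau>\<close>, away from the apex, and connectedness
  applies.\<close>

lemma tangent_cones_along_stratum:
  fixes \<Omega> t :: "(real^3) set"
  assumes \<Omega>: "polyhedral_domain \<Omega>" and t: "t \<in> strata \<Omega>" "t \<notin> vertices \<Omega>"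
    and x: "x \<in> closure t"
    and T: "x \<in> t \<Longrightarrow> T = tangent_cone \<Omega> x"
    and corr: "x \<notin> t \<Longrightarrow> tangent_chart UNIV UNIV \<Omega> x (tangent_cone \<Omega> x) U V \<phi> \<and> \<tau> \<in> strata (tangent_cone \<Omega> x) \<and>
      \<phi> ` (t \<inter> U) = \<tau> \<inter> V \<and> X0 \<in> \<tau> \<and> T = tangent_cone (tangent_cone \<Omega> x) X0"
  shows "open T" "T \<noteq> {}"
    "\<eta> > 0 \<Longrightarrow> \<exists>e>0. \<forall>y\<in>t. dist y x < e \<longrightarrow> (\<exists>K. linear K \<and> (\<forall>v. norm (K v - v) \<le> \<eta> * norm v) \<and> tangent_cone \<Omega> y = K ` T)"
    "x \<notin> t \<Longrightarrow> X \<in> \<tau> \<Longrightarrow> tangent_cone (tangent_cone \<Omega> x) X = T"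
proof -
  obtain d where tc: "t \<in> components {x \<in> closure \<Omega>. reduced_dim (tangent_cone \<Omega> x) = d}"
    using t(1) unfolding strata_def strata_of_dim_def by blast
  have tsub: "y \<in> closure \<Omega>" "reduced_dim (tangent_cone \<Omega> y) = d" if "y \<in> t" for y
    using in_components_subset[OF tc] that by auto
  \<comment> \<open>A stratum of reduced dimension 3 would be a vertex; hence for \<open>x\<close>
    in \<open>t\<close> the cone contains at least one line.\<close>
  have d3: "d \<noteq> 3" using tc t(2) unfolding vertices_def strata_of_dim_def by auto
  have xc: "x \<in> closure \<Omega>"
    using x closure_minimal[of t "closure \<Omega>"] tsub(1) by blast
  define P where "P = tangent_cone \<Omega> x"
  note P = polyhedral_domain_tangent_cone[OF \<Omega> xc, folded P_def]
  have reg: "regular_open P" and oc: "open_cone UNIV P" using corner_cones_regular_open[of P] P(2) by simp_all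
  note sc = open_coneD(3)[OF oc]
  have main: "\<exists>U V \<phi>. tangent_chart UNIV UNIV \<Omega> x P U V \<phi> \<and> (\<exists>e>0. \<forall>y\<in>t. dist y x < e \<longrightarrow> y \<in> U \<longrightarrow>
      tcone P (\<phi> y) = T) \<and> open T \<and> T \<noteq> {} \<and> (x \<notin> t \<longrightarrow> (\<forall>X\<in>\<tau>. tangent_cone P X = T))"
  proof (cases "x \<in> t")
    case True
    obtain U V \<phi> where ch: "tangent_chart UNIV UNIV \<Omega> x P U V \<phi>" using P(1) unfolding is_tangent_cone_def by blast
    note D = tangent_chartD[OF ch]
    have TP: "T = P" using T[OF True] by (simp add: P_def)
    obtain M where M: "lineality P M" "dim M + reduced_dim P = 3" using reduced_dim_lineality[of P] P(2) by auto
    have sM: "subspace M" and lin: "\<And>w m. w \<in> P \<Longrightarrow> m \<in> M \<Longrightarrow> w + m \<in> P" using M by (auto simp: lineality_def)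
    have rP: "reduced_dim P = d" using tsub(2)[OF True] by (simp add: P_def)
    then have dM: "dim M \<ge> 1" using M(2) d3 by linarith
    \<comment> \<open>The value 1/2 only secures the invertibility of the differential here.\<close>
    obtain e where e: "e > 0" "ball x e \<subseteq> U"
      "\<And>y. y \<in> ball x e \<Longrightarrow> \<exists>J. (\<phi> has_derivative J) (at y) \<and> (\<forall>v. norm (J v - v) \<le> (1/2) * norm v)"
      using chart_derivative_near_identity[OF ch, of "1/2"] by auto
    have "tcone P (\<phi> y) = T" if y: "y \<in> t" "dist y x < e" for y
    proof -
      have yb: "y \<in> ball x e" using y(2) by (simp add: dist_commute)
      then have yU: "y \<in> U" using e(2) by blast
      obtain J where J: "(\<phi> has_derivative J) (at y)" "\<And>v. norm (J v - v) \<le> (1/2) * norm v" using e(3)[OF yb] by blast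
      obtain K where K: "linear K" "\<And>v. K (J v) = v" "\<And>v. J (K v) = v"
        using near_identity_inverse[OF has_derivative_linear[OF J(1)] J(2), simplified] by blast
      define h where "h = \<phi> y"
      note Cy = polyhedral_domain_tangent_cone[OF \<Omega> tsub(1)[OF y(1)]]
      have CK: "tangent_cone \<Omega> y = K ` tcone P h"
        unfolding h_def by (rule tangent_cone_transfer[OF ch yU reg P(3) J(1) K Cy(1)])
      show ?thesis
      proof (cases "h \<in> M")
        case True
        show ?thesis unfolding TP using tcone_at_lineality[OF sc sM lin True] by (simp add: h_def)
      next
        case False
        \<comment> \<open>The reduced dimension is known for the tangent cone at \<open>y\<close>,
          the image under \<open>K\<close>, and \<open>K\<close> is not orthogonal. So the invariant
          directions are transported by \<open>K\<close>, and a transversal \<open>h\<close>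
          contradicts the constant dimension on \<open>t\<close>.\<close>
        have KM: "lineality (K ` tcone P h) (K ` M)"
          unfolding lineality_def
        proof (intro conjI ballI)
          show "subspace (K ` M)" by (rule linear_subspace_image[OF K(1) sM])
          fix w m assume "w \<in> K ` tcone P h" "m \<in> K ` M"
          then obtain w' m' where w': "w' \<in> tcone P h" "w = K w'" and m': "m' \<in> M" "m = K m'" by blast
          have "w' + m' \<in> tcone P h" by (rule tcone_lineality[OF sM lin w'(1) m'(1)])
          then show "w + m \<in> K ` tcone P h" unfolding w'(2) m'(2) linear_add[OF K(1), symmetric] by blast
        qed
        have injK: "inj K" using K(3) by (metis injI)
        have dKM: "dim (K ` M) = dim M" by (rule dim_image_eq[OF K(1)]) (use injK inj_on_subset in blast)
        have hK: "K h \<notin> K ` M" using False injK by (auto simp: inj_def)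
        have line: "w + c *\<^sub>R K h \<in> K ` tcone P h" if "w \<in> K ` tcone P h" for w c
        proof -
          from that obtain w' where w': "w' \<in> tcone P h" "w = K w'" by blast
          have "w' + c *\<^sub>R h \<in> tcone P h" by (rule tcone_line[OF sc w'(1)])
          then have "K (w' + c *\<^sub>R h) \<in> K ` tcone P h" by blast
          then show ?thesis unfolding w'(2) by (simp add: linear_add[OF K(1)] linear_scale[OF K(1)])
        qed
        have "reduced_dim (K ` tcone P h) + dim (K ` M) < 3"
          by (rule reduced_dim_drop[OF Cy(2,4)[unfolded CK] KM _ hK line]) (use dKM dM in simp)
        then show ?thesis using tsub(2)[OF y(1)] M(2) rP dKM unfolding CK by simp
      qed
    qed
    moreover have "open T" using reg by (simp add: TP regular_open_def)
    ultimately show ?thesis using ch e(1) P(4) True TP by blast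
  next
    case False
    have ch: "tangent_chart UNIV UNIV \<Omega> x P U V \<phi>" and \<tau>: "\<tau> \<in> strata P" and im: "\<phi> ` (t \<inter> U) = \<tau> \<inter> V"
      and X0: "X0 \<in> \<tau>" and TX0: "T = tangent_cone P X0"
      using corr[OF False] by (auto simp: P_def)
    note D = tangent_chartD[OF ch]
    obtain d' where \<tau>c: "\<tau> \<in> components {X \<in> closure P. reduced_dim (tangent_cone P X) = d'}"
      using \<tau> unfolding strata_def strata_of_dim_def by blast
    have \<tau>sub: "X \<in> closure P" "reduced_dim (tangent_cone P X) = d'" if "X \<in> \<tau>" for X
      using in_components_subset[OF \<tau>c] that by auto
    \<comment> \<open>Otherwise 0 would be the image of a point of \<open>t\<close>, which
      injectivity of the chart identifies with \<open>x\<close>.\<close>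
    have "0 \<notin> \<tau>"
    proof
      assume "0 \<in> \<tau>"
      then have "0 \<in> \<phi> ` (t \<inter> U)" using im D(4) by blast
      then obtain y where y: "y \<in> t" "y \<in> U" "\<phi> y = \<phi> x" using D(8) by auto
      then have "y = x" using D(2,5) unfolding bij_betw_def inj_on_def by blast
      then show False using y(1) False by blast
    qed
    then have nz: "X \<noteq> 0" if "X \<in> \<tau>" for X using that by blast
    have tcX: "tangent_cone P X = tcone P X" if "X \<in> \<tau>" for X
      by (rule tangent_cone_eqI[OF is_tangent_cone_tcone[OF P(2,3) \<tau>sub(1)[OF that] nz[OF that]]])
    have rd: "reduced_dim (tcone P X) = d'" if "X \<in> \<tau>" for X using \<tau>sub(2)[OF that] tcX[OF that] by simp
    \<comment> \<open>On the connected set \<open>\<tau>\<close> the reduced dimension is constant,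
      so the locally constant germ is globally constant.\<close>
    have const: "tcone P X0 = tcone P X" if X: "X \<in> \<tau>" for X
    proof (rule connected_equivalence_relation[OF in_components_connected[OF \<tau>c] X0 X, where R = "\<lambda>X Y. tcone P X = tcone P Y"])
      fix Y assume Y: "Y \<in> \<tau>"
      obtain r where r: "r > 0" "\<And>Z. dist Z Y < r \<Longrightarrow> Z \<in> closure P \<Longrightarrow> Z \<noteq> 0 \<Longrightarrow>
          reduced_dim (tcone P Z) = reduced_dim (tcone P Y) \<Longrightarrow> tcone P Z = tcone P Y"
        using tcone_locally_constant[OF P(2,3) \<tau>sub(1)[OF Y] nz[OF Y]] by blast
      show "\<exists>Q. openin (top_of_set \<tau>) Q \<and> Y \<in> Q \<and> (\<forall>Z\<in>Q. tcone P Y = tcone P Z)"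
      proof (intro exI[of _ "\<tau> \<inter> ball Y r"] conjI ballI)
        fix Z assume Z: "Z \<in> \<tau> \<inter> ball Y r"
        then have "tcone P Z = tcone P Y"
          using rd Y by (intro r(2)) (auto simp: dist_commute \<tau>sub nz)
        then show "tcone P Y = tcone P Z" by simp
      qed (use Y r in auto)
    qed auto
    have TT: "tangent_cone P X = T" if "X \<in> \<tau>" for X
      unfolding TX0 tcX[OF that] tcX[OF X0] using const[OF that] by simp
    obtain r where r: "conic_at P X0 r" using P(3) unfolding conic_everywhere_def by blast
    have "open T" "T \<noteq> {}"
      using tcone_regular[OF reg P(3) r] tcone_nonempty[OF reg P(3) r \<tau>sub(1)[OF X0]]
      unfolding TX0 tcX[OF X0] by (auto simp: regular_open_def)
    moreover have "tcone P (\<phi> y) = T" if "y \<in> t" "y \<in> U" for y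
    proof -
      have "\<phi> y \<in> \<tau>" using im that by blast
      then show ?thesis using TT tcX by metis
    qed
    ultimately show ?thesis using ch TT by (intro exI[of _ U] exI[of _ V] exI[of _ \<phi>]) (auto intro: exI[of _ 1])
  qed
  then obtain U V \<phi> e0 where ch: "tangent_chart UNIV UNIV \<Omega> x P U V \<phi>"
    and e0: "e0 > 0" "\<And>y. y \<in> t \<Longrightarrow> dist y x < e0 \<Longrightarrow> y \<in> U \<Longrightarrow> tcone P (\<phi> y) = T"
    and TT: "open T" "T \<noteq> {}" "\<And>X. x \<notin> t \<Longrightarrow> X \<in> \<tau> \<Longrightarrow> tangent_cone P X = T" by metis
  show "open T" "T \<noteq> {}" by (rule TT)+
  show "x \<notin> t \<Longrightarrow> X \<in> \<tau> \<Longrightarrow> tangent_cone (tangent_cone \<Omega> x) X = T" using TT(3) by (simp add: P_def)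
  assume \<eta>: "\<eta> > 0"
  \<comment> \<open>Inverting the differential doubles its distance from the identity and requires
    at most 1/2.\<close>
  define \<eta>' where "\<eta>' = min (\<eta> / 2) (1 / 2)"
  have \<eta>': "\<eta>' > 0" "\<eta>' \<le> 1/2" "2 * \<eta>' \<le> \<eta>" using \<eta> by (auto simp: \<eta>'_def)
  obtain e where e: "e > 0" "ball x e \<subseteq> U"
    "\<And>y. y \<in> ball x e \<Longrightarrow> \<exists>J. (\<phi> has_derivative J) (at y) \<and> (\<forall>v. norm (J v - v) \<le> \<eta>' * norm v)"
    using chart_derivative_near_identity[OF ch \<eta>'(1)] by auto
  have "\<exists>K. linear K \<and> (\<forall>v. norm (K v - v) \<le> \<eta> * norm v) \<and> tangent_cone \<Omega> y = K ` T"
    if y: "y \<in> t" "dist y x < min e e0" for y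
  proof -
    have yb: "y \<in> ball x e" using y(2) by (simp add: dist_commute)
    then have yU: "y \<in> U" using e(2) by blast
    obtain J where J: "(\<phi> has_derivative J) (at y)" "\<And>v. norm (J v - v) \<le> \<eta>' * norm v" using e(3)[OF yb] by blast
    obtain K where K: "linear K" "\<And>v. K (J v) = v" "\<And>v. J (K v) = v" "\<And>v. norm (K v - v) \<le> (2 * \<eta>') * norm v"
      using near_identity_inverse[OF has_derivative_linear[OF J(1)] J(2) less_imp_le[OF \<eta>'(1)] \<eta>'(2)] by blast
    have "tangent_cone \<Omega> y = K ` tcone P (\<phi> y)"
      by (rule tangent_cone_transfer[OF ch yU reg P(3) J(1) K(1-3) polyhedral_domain_tangent_cone(1)[OF \<Omega> tsub(1)[OF y(1)]]])
    moreover have "tcone P (\<phi> y) = T" using e0(2)[OF y(1) _ yU] y(2) by simp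
    moreover have "norm (K v - v) \<le> \<eta> * norm v" for v
      by (rule order_trans[OF K(4) mult_right_mono[OF \<eta>'(3)]]) simp
    ultimately show ?thesis using K(1) by blast
  qed
  then show "\<exists>e>0. \<forall>y\<in>t. dist y x < e \<longrightarrow> (\<exists>K. linear K \<and> (\<forall>v. norm (K v - v) \<le> \<eta> * norm v) \<and> tangent_cone \<Omega> y = K ` T)"
    using e(1) e0(1) by (intro exI[of _ "min e e0"]) auto
qed

text \<open>Two points of the closure are compared through a third point of \<open>S\<close> close
  to the second one, at cost \<open>e / 2\<close> each. So limits along \<open>S\<close>
  suffice.\<close>

lemma continuous_on_closure_extension:
  fixes f :: "'a::metric_space \<Rightarrow> 'b::metric_space"
  assumes "\<And>x e. x \<in> closure S \<Longrightarrow> e > 0 \<Longrightarrow> \<exists>d>0. \<forall>y\<in>S. dist y x < d \<longrightarrow> dist (f y) (f x) < e"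
  shows "continuous_on (closure S) f"
  unfolding continuous_on_iff
proof (intro ballI allI impI)
  fix x and e :: real assume x: "x \<in> closure S" and e: "e > 0"
  obtain d where d: "d > 0" "\<And>y. y \<in> S \<Longrightarrow> dist y x < d \<Longrightarrow> dist (f y) (f x) < e / 2"
    using assms[OF x, of "e / 2"] e by auto
  have "dist (f z) (f x) < e" if z: "z \<in> closure S" "dist z x < d" for z
  proof -
    obtain q where q: "q > 0" "\<And>y. y \<in> S \<Longrightarrow> dist y z < q \<Longrightarrow> dist (f y) (f z) < e / 2"
      using assms[OF z(1), of "e / 2"] e by auto
    obtain y where y: "y \<in> S" "dist y z < min q (d - dist z x)"
      using z q(1) unfolding closure_approachable by (metis diff_gt_0_iff_gt min_less_iff_conj)
    have "dist y x < d" using y(2) dist_triangle[of y x z] by simp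
    then have "dist (f y) (f x) < e / 2" using d(2) y(1) by blast
    moreover have "dist (f y) (f z) < e / 2" using q(2) y by simp
    ultimately show ?thesis using dist_triangle[of "f z" "f x" "f y"] by (simp add: dist_commute)
  qed
  then show "\<exists>d>0. \<forall>x'\<in>closure S. dist x' x < d \<longrightarrow> dist (f x') (f x) < e" using d(1) by blast
qed

text \<open>Demanding the formula for every \<open>X\<close> in \<open>\<tau> x\<close> includes its
  independence of the chosen point. Continuity on \<open>closure t\<close> also covers the boundary
  values among themselves.\<close>

theorem lemma5p1:
  fixes \<Omega> t :: "(real^3) set"
    and B :: "real^3 \<Rightarrow> real^3"
    and U V \<tau> :: "real^3 \<Rightarrow> (real^3) set"
    and \<phi> :: "real^3 \<Rightarrow> real^3 \<Rightarrow> real^3"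
  assumes "polyhedral_domain \<Omega>"
    and "continuous_on (closure \<Omega>) B"
    and "t \<in> strata \<Omega>" and "t \<notin> vertices \<Omega>"
    and chart: "\<And>x. x \<in> closure t - t \<Longrightarrow>
      tangent_chart UNIV UNIV \<Omega> x (tangent_cone \<Omega> x) (U x) (V x) (\<phi> x)"
    and corresponding: "\<And>x. x \<in> closure t - t \<Longrightarrow>
      \<tau> x \<in> strata (tangent_cone \<Omega> x) \<and> \<phi> x ` (t \<inter> U x) = \<tau> x \<inter> V x"
  shows "\<exists>\<Lambda> :: real^3 \<Rightarrow> real.
    (\<forall>x\<in>t. \<Lambda> x = energy (B x) (tangent_cone \<Omega> x)) \<and>
    (\<forall>x\<in>closure t - t. \<forall>X\<in>\<tau> x.
       \<Lambda> x = energy (B x) (tangent_cone (tangent_cone \<Omega> x) X)) \<and>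
    continuous_on (closure t) \<Lambda>"
proof -
  \<comment> \<open>A representative of the stratum, which is nonempty as a connected component;
    independence of it is shown afterwards.\<close>
  define X0 where "X0 x = (SOME X. X \<in> \<tau> x)" for x
  define T where "T x = (if x \<in> t then tangent_cone \<Omega> x else tangent_cone (tangent_cone \<Omega> x) (X0 x))" for x
  define \<Lambda> where "\<Lambda> x = energy (B x) (T x)" for x
  have X0: "X0 x \<in> \<tau> x" if "x \<in> closure t" "x \<notin> t" for x
  proof -
    have "\<tau> x \<in> strata (tangent_cone \<Omega> x)" using corresponding[of x] that by blast
    then have "\<tau> x \<noteq> {}" unfolding strata_def strata_of_dim_def using in_components_nonempty by blast
    then show ?thesis unfolding X0_def by (simp add: some_in_eq)
  qed
  have along: "open (T x)" "T x \<noteq> {}"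
    "\<eta> > 0 \<Longrightarrow> \<exists>e>0. \<forall>y\<in>t. dist y x < e \<longrightarrow> (\<exists>K. linear K \<and> (\<forall>v. norm (K v - v) \<le> \<eta> * norm v) \<and> tangent_cone \<Omega> y = K ` T x)"
    "x \<notin> t \<Longrightarrow> X \<in> \<tau> x \<Longrightarrow> tangent_cone (tangent_cone \<Omega> x) X = T x"
    if x: "x \<in> closure t" for x X \<eta>
  proof -
    have 1: "x \<in> t \<Longrightarrow> T x = tangent_cone \<Omega> x" by (simp add: T_def)
    have 2: "x \<notin> t \<Longrightarrow> tangent_chart UNIV UNIV \<Omega> x (tangent_cone \<Omega> x) (U x) (V x) (\<phi> x) \<and> \<tau> x \<in> strata (tangent_cone \<Omega> x) \<and>
      \<phi> x ` (t \<inter> U x) = \<tau> x \<inter> V x \<and> X0 x \<in> \<tau> x \<and> T x = tangent_cone (tangent_cone \<Omega> x) (X0 x)"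
      using chart[of x] corresponding[of x] X0[of x] x by (simp add: T_def)
    note l = tangent_cones_along_stratum[OF assms(1,3,4) x 1 2]
    show "open (T x)" "T x \<noteq> {}" by (rule l; assumption)+
    show "\<eta> > 0 \<Longrightarrow> \<exists>e>0. \<forall>y\<in>t. dist y x < e \<longrightarrow> (\<exists>K. linear K \<and> (\<forall>v. norm (K v - v) \<le> \<eta> * norm v) \<and> tangent_cone \<Omega> y = K ` T x)"
      by (rule l; assumption)
    show "x \<notin> t \<Longrightarrow> X \<in> \<tau> x \<Longrightarrow> tangent_cone (tangent_cone \<Omega> x) X = T x" by (rule l; assumption)
  qed
  have "continuous_on (closure t) \<Lambda>"
  proof (rule continuous_on_closure_extension)
    fix x and e :: real assume x: "x \<in> closure t" and e: "e > 0"
    note a = along[OF x]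
    \<comment> \<open>One \<open>\<eta>\<close> bounds both the deformation of the cone and the
      variation of the field; the radii \<open>e1\<close> and \<open>e2\<close> are chosen for
      it.\<close>
    obtain \<eta> where \<eta>: "\<eta> > 0" "\<And>K B'. linear K \<Longrightarrow> (\<forall>v. norm (K v - v) \<le> \<eta> * norm v) \<Longrightarrow> norm (B' - B x) \<le> \<eta> \<Longrightarrow>
        \<bar>energy B' (K ` T x) - energy (B x) (T x)\<bar> < e"
      using energy_continuous[OF a(1,2) e, of "B x"] by blast
    obtain e1 where e1: "e1 > 0" "\<And>y. y \<in> t \<Longrightarrow> dist y x < e1 \<Longrightarrow>
        \<exists>K. linear K \<and> (\<forall>v. norm (K v - v) \<le> \<eta> * norm v) \<and> tangent_cone \<Omega> y = K ` T x"
      using a(3)[OF \<eta>(1)] by blast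
    have tcl: "t \<subseteq> closure \<Omega>"
      using assms(3) in_components_subset unfolding strata_def strata_of_dim_def by blast
    then have xO: "x \<in> closure \<Omega>" using x closure_minimal[of t "closure \<Omega>"] by blast
    obtain e2 where e2: "e2 > 0" "\<And>y. y \<in> closure \<Omega> \<Longrightarrow> dist y x < e2 \<Longrightarrow> dist (B y) (B x) < \<eta>"
      using assms(2) xO \<eta>(1) unfolding continuous_on_iff by blast
    have "dist (\<Lambda> y) (\<Lambda> x) < e" if y: "y \<in> t" "dist y x < min e1 e2" for y
    proof -
      obtain K where K: "linear K" "\<forall>v. norm (K v - v) \<le> \<eta> * norm v" "tangent_cone \<Omega> y = K ` T x"
        using e1(2)[OF y(1)] y(2) by auto
      have "norm (B y - B x) \<le> \<eta>" using e2(2)[of y] y tcl by (auto simp: dist_norm)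
      then show ?thesis using \<eta>(2)[OF K(1,2)] y(1) K(3) by (simp add: \<Lambda>_def T_def dist_real_def)
    qed
    then show "\<exists>d>0. \<forall>y\<in>t. dist y x < d \<longrightarrow> dist (\<Lambda> y) (\<Lambda> x) < e"
      using e1(1) e2(1) by (intro exI[of _ "min e1 e2"]) auto
  qed
  moreover have "\<Lambda> x = energy (B x) (tangent_cone \<Omega> x)" if "x \<in> t" for x using that by (simp add: \<Lambda>_def T_def)
  moreover have "\<Lambda> x = energy (B x) (tangent_cone (tangent_cone \<Omega> x) X)" if "x \<in> closure t - t" "X \<in> \<tau> x" for x X
    using along(4)[of x X] that by (simp add: \<Lambda>_def)
  ultimately show ?thesis by blast
qed

end
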